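(* Let $(\rho_h,\mathbf M_h,\mathbf E_h,\mathbf B_h,(\mathbf X_p,\mathbf U_p)_{p=1}^N)$ be a solution on a time interval of the semi-discrete scheme with fluxes (F) described in the context, with $\rho_h(t)\in DG_{k+1}$, $\mathbf M_h(t)\in RT_k$, $\mathbf E_h(t)\in\mathring N_k$, $\mathbf B_h(t)\in\mathring{RT}_k$, $\mathbf X_p(t)\in\Omega_h$. Then the following quantities are constant in time: 1. the total fluid mass $\int_{\Omega_h}\rho_h\,dx$; 2. the total particle mass $\sum_{p=1}^N w_p$; 3. the total energy $$\int_{\Omega_h}\rho_h\big(\gamma(m\mathbf M_h/\rho_h)-1\big)c^2\,dx+\sum_{p=1}^N w_p\big(\gamma(\mathbf U_p)-1\big)mc^2+\frac1{8\pi}\int_{\Omega_h}\big(|\mathbf E_h|^2+|\mathbf B_h|^2\big)\,dx;$$ 4. the weak Gauss law residual $$\int_{\Omega_h}\Big[\nabla_w\cdot\mathbf E_h-4\pi e\Big(\frac{\rho_h}{m}+\sum_{p=1}^N w_p\,\delta(\mathbf x-\mathbf X_p)\Big)\Big]\phi_h\,dx$$ for every $\phi_h\in\mathring Q_{k+1}$ (where $\int_{\Omega_h}\delta(\mathbf x-\mathbf X_p)\phi_h\,dx=\phi_h(\mathbf X_p)$); 5. the divergence $\nabla\cdot\mathbf B_h$.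
   Context: Let $d=3$, let $\Omega\subset\mathbb R^3$ be a bounded domain with a (finite, conforming, polyhedral) partition $\mathcal T_h$ into cells $K$, $\Omega_h=\bigcup_{K\in\mathcal T_h}K$ (identified with $\Omega$), $\mathcal E_h$ the set of interior faces, and $k\ge0$ an integer. The constants $c>0$ (speed of light), $m>0$ (mass), $e$ (charge, a nonzero real number) and the particle weights $w_p$, $p=1,\dots,N$, are fixed. For $\mathbf u\in\mathbb R^3$, $\gamma(\mathbf u)=\sqrt{1+\frac{\mathbf u\cdot\mathbf u}{m^2c^2}}$; also $\mathbf M^2:=\mathbf M\cdot\mathbf M$. Finite element spaces ($P_k(K)$: polynomials of degree at most $k$ on $K$): $Q_k=\{f\in H^1(\Omega): f|_K\in P_k(K)\ \forall K\}$; $N_k=\{f\in H(\mathrm{curl},\Omega): f|_K\in P_k(K)^d+\mathbf x\times P_k(K)^d\ \forall K\}$; $RT_k=\{f\in H(\mathrm{div},\Omega): f|_K\in P_k(K)^d+\mathbf x P_k(K)\ \forall K\}$; $DG_k=\{f\in L^2(\Omega): f|_K\in P_k(K)\ \forall K\}$. $\mathring Q_k$, $\mathring N_k$, $\mathring{RT}_k$ are the subspaces of functions with, respectively, $f=0$, $\mathbf n\times f=0$, $\mathbf n\cdot f=0$ on $\partial\Omega$. The weak divergence $\nabla_w\cdot:\mathring N_k\to\mathring Q_{k+1}$ is defined by $\int_\Omega(\nabla_w\cdot\mathbf E_h)\phi_h\,dx=-\int_\Omega\mathbf E_h\cdot\nabla\phi_h\,dx$ for all $\phi_h\in\mathring Q_{k+1}$.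 Jumps and fluxes: for a face $e=K_1\cap K_2\in\mathcal E_h$ (in $\int_e$ and $\mathcal E_h$, $e$ denotes a face, elsewhere the charge), let $\mathbf n_1$ be the unit normal pointing from $K_1$ to $K_2$, $\mathbf n_2=-\mathbf n_1$, and let $\mathbf n=\mathbf n_1$ be the normal assigned to $e$. For a scalar $g$ with traces $g_1,g_2$: $[\![g]\!]=g_1\mathbf n_1+g_2\mathbf n_2$. For a vector field $\mathbf a$: $[\![\mathbf a]\!]=\mathbf a_1-\mathbf a_2$, $\{\mathbf a\}=\frac{\mathbf a_1+\mathbf a_2}2$. The upwind flux of a vector quantity is $(\mathbf a)^*=\{\mathbf a\}+\frac12\frac{\mathbf M_h\cdot\mathbf n}{|\mathbf M_h\cdot\mathbf n|}[\![\mathbf a]\!]$ (the quotient is taken to be $0$ where $\mathbf M_h\cdot\mathbf n=0$). Vector-gradient notation: $(\mathbf a\cdot\nabla\mathbf b)\cdot\mathbf c=\sum_{i,j}a_i(\partial_i b_j)c_j$; gradients of discontinuous piecewise polynomials are taken cell by cell. Scheme (F). Let $\mathbf w_h$ be the $L^2(\Omega)$-projection onto $RT_k$ of $\frac{\mathbf M_h}{\rho_h\gamma(m\mathbf M_h/\rho_h)}$, and $G_h$ the $L^2(\Omega)$-projection onto $DG_{k+1}$ of $\gamma(m\mathbf M_h/\rho_h)-1-\frac{\mathbf M_h^2}{c^2\rho_h^2\gamma(m\mathbf M_h/\rho_h)}$. Then: $$\int_\Omega\partial_t\rho_h\,\phi_h\,dx=\int_\Omega\rho_h\mathbf w_h\cdot\nabla\phi_h\,dx-\sum_{e\in\mathcal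 E_h}\int_e(\rho_h\mathbf w_h)^*\cdot[\![\phi_h]\!]\,ds\quad\forall\phi_h\in DG_{k+1},$$ $$\begin{aligned}\int_\Omega\partial_t\mathbf M_h\cdot\boldsymbol\mu_h\,dx&=\int_\Omega(\mathbf w_h\cdot\nabla\boldsymbol\mu_h-\boldsymbol\mu_h\cdot\nabla\mathbf w_h)\cdot\mathbf M_h\,dx-\int_\Omega\rho_h\,\boldsymbol\mu_h\cdot\nabla G_h\,c^2\,dx+\frac em\int_\Omega\rho_h\Big(\mathbf E_h+\mathbf w_h\times\frac{\mathbf B_h}c\Big)\cdot\boldsymbol\mu_h\,dx\\&\quad+\sum_{e\in\mathcal E_h}\int_e(\mathbf n\times\mathbf M_h)^*\cdot[\![\boldsymbol\mu_h\times\mathbf w_h]\!]\,ds+\sum_{e\in\mathcal E_h}\int_e(\rho_h\boldsymbol\mu_h)^*\cdot[\![G_h]\!]\,c^2\,ds\quad\forall\boldsymbol\mu_h\in RT_k,\end{aligned}$$ $$\int_\Omega\partial_t\mathbf E_h\cdot\boldsymbol\nu_h\,dx=c\int_\Omega\mathbf B_h\cdot(\nabla\times\boldsymbol\nu_h)\,dx-\frac{4\pi e}m\int_\Omega\rho_h\mathbf w_h\cdot\boldsymbol\nu_h\,dx-\frac{4\pi e}m\sum_{p=1}^N\frac{w_p\mathbf U_p}{\gamma(\mathbf U_p)}\cdot\boldsymbol\nu_h(\mathbf X_p)\quad\forall\boldsymbol\nu_h\in\mathring N_k,$$ $$\int_\Omega\partial_t\mathbf B_h\cdot\boldsymbol\tau_h\,dx=-c\int_\Omega\boldsymbol\tau_h\cdot(\nabla\times\mathbf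 E_h)\,dx\quad\forall\boldsymbol\tau_h\in\mathring{RT}_k,$$ $$\partial_t\mathbf X_p=\frac{\mathbf U_p}{m\gamma(\mathbf U_p)},\qquad\partial_t\mathbf U_p=e\Big(\mathbf E_h(\mathbf X_p,t)+\frac{\mathbf U_p\times\mathbf B_h(\mathbf X_p,t)}{cm\gamma(\mathbf U_p)}\Big).$$ A solution is understood to have $\rho_h$ nowhere vanishing on each closed cell (so that all expressions are defined) and all particles in $\Omega_h$. The unknowns are absolutely continuous in time and the equations hold for almost every $t$. At a point lying on a mesh face, the value of a discontinuous piecewise polynomial field at a particle is its trace from one fixed adjacent cell (the same cell for all fields). *)

theory Defs
  imports "HOL-Analysis.Analysis"
begin

type_synonym cell = "(real^3) set"

section \<open>Differential operators\<close>

definition partial :: "3 \<Rightarrow> (real^3 \<Rightarrow> 'b::real_normed_vector) \<Rightarrow> real^3 \<Rightarrow> 'b" where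
  "partial i f x = frechet_derivative f (at x) (axis i 1)"

definition grad :: "(real^3 \<Rightarrow> real) \<Rightarrow> real^3 \<Rightarrow> real^3" where
  "grad f x = (\<chi> i. partial i f x)"

definition curl :: "(real^3 \<Rightarrow> real^3) \<Rightarrow> real^3 \<Rightarrow> real^3" where
  "curl f x = vector [partial 2 f x $ 3 - partial 3 f x $ 2,
                      partial 3 f x $ 1 - partial 1 f x $ 3,
                      partial 1 f x $ 2 - partial 2 f x $ 1]"

text \<open>The vector field \<open>a \<cdot> \<nabla>b\<close>, whose \<open>j\<close>-th component is the sum over \<open>i\<close> of \<open>a\<^sub>i \<partial>\<^sub>i b\<^sub>j\<close>.\<close>
definition dir_grad :: "(real^3 \<Rightarrow> real^3) \<Rightarrow> (real^3 \<Rightarrow> real^3) \<Rightarrow> real^3 \<Rightarrow> real^3" where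
  "dir_grad a b x = (\<Sum>i\<in>UNIV. (a x $ i) *\<^sub>R partial i b x)"

section \<open>Square-integrable functions and weak derivatives\<close>

fun C_diff :: "nat \<Rightarrow> (real^3 \<Rightarrow> 'b::real_normed_vector) \<Rightarrow> bool" where
  "C_diff 0 f \<longleftrightarrow> continuous_on UNIV f"
| "C_diff (Suc n) f \<longleftrightarrow> (\<forall>x. f differentiable (at x)) \<and> (\<forall>i. C_diff n (partial i f))"

definition test_functions :: "(real^3) set \<Rightarrow> (real^3 \<Rightarrow> 'b::real_normed_vector) set" where
  "test_functions \<Omega> =
     {\<psi>. (\<forall>n. C_diff n \<psi>) \<and> (\<exists>C. compact C \<and> C \<subseteq> \<Omega> \<and> (\<forall>x. x \<notin> C \<longrightarrow> \<psi> x = 0))}"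

definition L2 :: "(real^3) set \<Rightarrow> (real^3 \<Rightarrow> 'b::euclidean_space) set" where
  "L2 \<Omega> = {f. f \<in> borel_measurable (lebesgue_on \<Omega>) \<and> integrable (lebesgue_on \<Omega>) (\<lambda>x. (norm (f x))\<^sup>2)}"

definition has_weak_grad :: "(real^3) set \<Rightarrow> (real^3 \<Rightarrow> real) \<Rightarrow> (real^3 \<Rightarrow> real^3) \<Rightarrow> bool" where
  "has_weak_grad \<Omega> f g \<longleftrightarrow> f \<in> L2 \<Omega> \<and> g \<in> L2 \<Omega> \<and>
     (\<forall>\<psi> \<in> test_functions \<Omega>. \<forall>i.
        (LINT x|lebesgue_on \<Omega>. (g x $ i) * \<psi> x) = - (LINT x|lebesgue_on \<Omega>. f x * partial i \<psi> x))"

definition has_weak_curl :: "(real^3) set \<Rightarrow> (real^3 \<Rightarrow> real^3) \<Rightarrow> (real^3 \<Rightarrow> real^3) \<Rightarrow> bool" where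
  "has_weak_curl \<Omega> f g \<longleftrightarrow> f \<in> L2 \<Omega> \<and> g \<in> L2 \<Omega> \<and>
     (\<forall>\<psi> \<in> test_functions \<Omega>.
        (LINT x|lebesgue_on \<Omega>. g x \<bullet> \<psi> x) = (LINT x|lebesgue_on \<Omega>. f x \<bullet> curl \<psi> x))"

definition has_weak_divergence :: "(real^3) set \<Rightarrow> (real^3 \<Rightarrow> real^3) \<Rightarrow> (real^3 \<Rightarrow> real) \<Rightarrow> bool" where
  "has_weak_divergence \<Omega> f g \<longleftrightarrow> f \<in> L2 \<Omega> \<and> g \<in> L2 \<Omega> \<and>
     (\<forall>\<psi> \<in> test_functions \<Omega>.
        (LINT x|lebesgue_on \<Omega>. g x * \<psi> x) = - (LINT x|lebesgue_on \<Omega>. f x \<bullet> grad \<psi> x))"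

definition H1 :: "(real^3) set \<Rightarrow> (real^3 \<Rightarrow> real) set" where
  "H1 \<Omega> = {f. \<exists>g. has_weak_grad \<Omega> f g}"

definition Hcurl :: "(real^3) set \<Rightarrow> (real^3 \<Rightarrow> real^3) set" where
  "Hcurl \<Omega> = {f. \<exists>g. has_weak_curl \<Omega> f g}"

definition Hdiv :: "(real^3) set \<Rightarrow> (real^3 \<Rightarrow> real^3) set" where
  "Hdiv \<Omega> = {f. \<exists>g. has_weak_divergence \<Omega> f g}"

section \<open>Meshes\<close>

text \<open>Cells are closed convex polytopes with nonempty interior; the domain is identified with
  the union of the cells by being its interior.\<close>
definition conforming_mesh :: "(real^3) set \<Rightarrow> cell set \<Rightarrow> bool" where
  "conforming_mesh \<Omega> T \<longleftrightarrow>
     open \<Omega> \<and> connected \<Omega> \<and> bounded \<Omega> \<and> \<Omega> \<noteq> {} \<and>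
     finite T \<and> (\<forall>K\<in>T. polytope K \<and> interior K \<noteq> {}) \<and>
     (\<forall>K\<in>T. \<forall>K'\<in>T. K \<noteq> K' \<longrightarrow>
        interior K \<inter> interior K' = {} \<and> (K \<inter> K') face_of K \<and> (K \<inter> K') face_of K') \<and>
     \<Omega> = interior (\<Union>T)"

text \<open>An interior face is represented by the ordered pair \<open>(K\<^sub>1, K\<^sub>2)\<close> of its adjacent cells, the
  normal assigned to it pointing from \<open>K\<^sub>1\<close> to \<open>K\<^sub>2\<close>. Each face occurs in exactly one of the two
  orders, and the choice is arbitrary.\<close>
definition oriented_interior_faces :: "cell set \<Rightarrow> (cell \<times> cell) set \<Rightarrow> bool" where
  "oriented_interior_faces T F \<longleftrightarrow>
     (\<forall>(K1, K2) \<in> F. K1 \<in> T \<and> K2 \<in> T \<and> K1 \<noteq> K2 \<and> aff_dim (K1 \<inter> K2) = 2) \<and>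
     (\<forall>K1\<in>T. \<forall>K2\<in>T. K1 \<noteq> K2 \<and> aff_dim (K1 \<inter> K2) = 2 \<longrightarrow>
        ((K1, K2) \<in> F \<longleftrightarrow> (K2, K1) \<notin> F))"

text \<open>The two cells lie on either side of the plane of their common face, which determines \<open>n\<close>.\<close>
definition face_normal :: "cell \<Rightarrow> cell \<Rightarrow> real^3" where
  "face_normal K1 K2 =
     (THE n. norm n = 1 \<and> (\<exists>b. K1 \<subseteq> {x. n \<bullet> x \<le> b} \<and> K2 \<subseteq> {x. n \<bullet> x \<ge> b}))"

definition boundary_normal :: "cell \<Rightarrow> (real^3) set \<Rightarrow> real^3 \<Rightarrow> bool" where
  "boundary_normal K e n \<longleftrightarrow>
     norm n = 1 \<and> (\<exists>b. K \<subseteq> {x. n \<bullet> x \<le> b} \<and> e = K \<inter> {x. n \<bullet> x = b})"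

section \<open>Broken functions and integrals\<close>

text \<open>A piecewise polynomial is given by one polynomial per cell, \<open>f K\<close> being the polynomial
  function on the whole space that agrees with the field on \<open>K\<close>. Thus \<open>f K x\<close> for \<open>x\<close> on the
  boundary of \<open>K\<close> is the trace from \<open>K\<close>, and derivatives of \<open>f K\<close> are cellwise derivatives.
  Values at indices outside the mesh never matter. The associated function on the domain is
  \<open>broken T f\<close>; it is set to 0 on the mesh skeleton, a null set.\<close>
definition broken :: "cell set \<Rightarrow> (cell \<Rightarrow> real^3 \<Rightarrow> 'b::real_vector) \<Rightarrow> real^3 \<Rightarrow> 'b" where
  "broken T f x = (\<Sum>K\<in>T. indicat_real (interior K) x *\<^sub>R f K x)"

definition mesh_integral :: "cell set \<Rightarrow> (cell \<Rightarrow> real^3 \<Rightarrow> real) \<Rightarrow> real" where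
  "mesh_integral T f = (\<Sum>K\<in>T. LINT x|lebesgue_on K. f K x)"

definition plane_chart :: "(real^3) \<times> (real^3) \<times> (real^3) \<Rightarrow> real \<times> real \<Rightarrow> real^3" where
  "plane_chart = (\<lambda>(p, u, v) (r, s). p + r *\<^sub>R u + s *\<^sub>R v)"

text \<open>Surface integral over a flat two-dimensional set, by an isometric parametrization of its
  plane (the value does not depend on the one chosen).\<close>
definition face_integral :: "(real^3) set \<Rightarrow> (real^3 \<Rightarrow> real) \<Rightarrow> real" where
  "face_integral e f =
     (let \<Phi> = plane_chart (SOME (p, u, v). norm u = 1 \<and> norm v = 1 \<and> u \<bullet> v = 0 \<and>
                                            e \<subseteq> range (plane_chart (p, u, v)))
      in LINT z|lebesgue_on {z. \<Phi> z \<in> e}. f (\<Phi> z))"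

section \<open>Finite element spaces\<close>

definition P_poly :: "nat \<Rightarrow> (real^3 \<Rightarrow> real) set" where
  "P_poly k = {f. \<exists>a. \<forall>x. f x =
     (\<Sum>i\<le>k. \<Sum>j\<le>k - i. \<Sum>l\<le>k - i - j. a i j l * (x $ 1) ^ i * (x $ 2) ^ j * (x $ 3) ^ l)}"

definition P_vec :: "nat \<Rightarrow> (real^3 \<Rightarrow> real^3) set" where
  "P_vec k = {f. \<forall>i. (\<lambda>x. f x $ i) \<in> P_poly k}"

definition Q_space :: "(real^3) set \<Rightarrow> cell set \<Rightarrow> nat \<Rightarrow> (cell \<Rightarrow> real^3 \<Rightarrow> real) set" where
  "Q_space \<Omega> T k = {f. (\<forall>K\<in>T. f K \<in> P_poly k) \<and> broken T f \<in> H1 \<Omega>}"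

definition N_space :: "(real^3) set \<Rightarrow> cell set \<Rightarrow> nat \<Rightarrow> (cell \<Rightarrow> real^3 \<Rightarrow> real^3) set" where
  "N_space \<Omega> T k =
     {f. (\<forall>K\<in>T. \<exists>a\<in>P_vec k. \<exists>b\<in>P_vec k. f K = (\<lambda>x. a x + cross3 x (b x))) \<and> broken T f \<in> Hcurl \<Omega>}"

definition RT_space :: "(real^3) set \<Rightarrow> cell set \<Rightarrow> nat \<Rightarrow> (cell \<Rightarrow> real^3 \<Rightarrow> real^3) set" where
  "RT_space \<Omega> T k =
     {f. (\<forall>K\<in>T. \<exists>a\<in>P_vec k. \<exists>b\<in>P_poly k. f K = (\<lambda>x. a x + b x *\<^sub>R x)) \<and> broken T f \<in> Hdiv \<Omega>}"

definition DG_space :: "(real^3) set \<Rightarrow> cell set \<Rightarrow> nat \<Rightarrow> (cell \<Rightarrow> real^3 \<Rightarrow> real) set" where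
  "DG_space \<Omega> T k = {f. (\<forall>K\<in>T. f K \<in> P_poly k) \<and> broken T f \<in> L2 \<Omega>}"

definition Q0_space :: "(real^3) set \<Rightarrow> cell set \<Rightarrow> nat \<Rightarrow> (cell \<Rightarrow> real^3 \<Rightarrow> real) set" where
  "Q0_space \<Omega> T k = {f \<in> Q_space \<Omega> T k. \<forall>K\<in>T. \<forall>x \<in> K \<inter> frontier \<Omega>. f K x = 0}"

definition N0_space :: "(real^3) set \<Rightarrow> cell set \<Rightarrow> nat \<Rightarrow> (cell \<Rightarrow> real^3 \<Rightarrow> real^3) set" where
  "N0_space \<Omega> T k = {f \<in> N_space \<Omega> T k. \<forall>K\<in>T. \<forall>e n.
     e facet_of K \<and> e \<subseteq> frontier \<Omega> \<and> boundary_normal K e n \<longrightarrow> (\<forall>x\<in>e. cross3 n (f K x) = 0)}"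

definition RT0_space :: "(real^3) set \<Rightarrow> cell set \<Rightarrow> nat \<Rightarrow> (cell \<Rightarrow> real^3 \<Rightarrow> real^3) set" where
  "RT0_space \<Omega> T k = {f \<in> RT_space \<Omega> T k. \<forall>K\<in>T. \<forall>e n.
     e facet_of K \<and> e \<subseteq> frontier \<Omega> \<and> boundary_normal K e n \<longrightarrow> (\<forall>x\<in>e. n \<bullet> f K x = 0)}"

definition is_L2_projection ::
  "cell set \<Rightarrow> (cell \<Rightarrow> real^3 \<Rightarrow> 'b::real_inner) set \<Rightarrow> (cell \<Rightarrow> real^3 \<Rightarrow> 'b) \<Rightarrow> (cell \<Rightarrow> real^3 \<Rightarrow> 'b) \<Rightarrow> bool" where
  "is_L2_projection T V f g \<longleftrightarrow> g \<in> V \<and>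
     (\<forall>v\<in>V. mesh_integral T (\<lambda>K x. g K x \<bullet> v K x) = mesh_integral T (\<lambda>K x. f K x \<bullet> v K x))"

text \<open>The polynomials of the weak divergence on the cells are uniquely determined, so \<open>SOME\<close>
  only chooses the irrelevant values at indices outside the mesh.\<close>
definition weak_div ::
  "(real^3) set \<Rightarrow> cell set \<Rightarrow> nat \<Rightarrow> (cell \<Rightarrow> real^3 \<Rightarrow> real^3) \<Rightarrow> cell \<Rightarrow> real^3 \<Rightarrow> real" where
  "weak_div \<Omega> T k E = (SOME D. D \<in> Q0_space \<Omega> T (k + 1) \<and>
     (\<forall>\<phi> \<in> Q0_space \<Omega> T (k + 1).
        mesh_integral T (\<lambda>K x. D K x * \<phi> K x) = - mesh_integral T (\<lambda>K x. E K x \<bullet> grad (\<phi> K) x)))"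

section \<open>Jumps and fluxes\<close>

definition scalar_jump :: "real^3 \<Rightarrow> real \<Rightarrow> real \<Rightarrow> real^3" where
  "scalar_jump n g1 g2 = g1 *\<^sub>R n + g2 *\<^sub>R (- n)"

definition vector_jump :: "real^3 \<Rightarrow> real^3 \<Rightarrow> real^3" where
  "vector_jump a1 a2 = a1 - a2"

text \<open>Division by zero yields 0, which is the convention for the upwind direction where \<open>M \<cdot> n\<close>
  vanishes.\<close>
definition upwind :: "real^3 \<Rightarrow> real^3 \<Rightarrow> real^3 \<Rightarrow> real^3 \<Rightarrow> real^3" where
  "upwind M n a1 a2 =
     (1 / 2) *\<^sub>R (a1 + a2) + (1 / 2 * ((M \<bullet> n) / \<bar>M \<bullet> n\<bar>)) *\<^sub>R vector_jump a1 a2"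

text \<open>The upwind direction uses the trace of \<open>M\<close> from \<open>K\<^sub>1\<close>; the normal component of an \<open>H(div)\<close>
  field is the same from both sides.\<close>
definition face_flux ::
  "(cell \<Rightarrow> real^3 \<Rightarrow> real^3) \<Rightarrow> (cell \<times> cell) set \<Rightarrow> (real^3 \<Rightarrow> cell \<Rightarrow> real^3 \<Rightarrow> real^3) \<Rightarrow>
   (real^3 \<Rightarrow> cell \<Rightarrow> cell \<Rightarrow> real^3 \<Rightarrow> real^3) \<Rightarrow> real" where
  "face_flux M F a j = (\<Sum>(K1, K2) \<in> F. let n = face_normal K1 K2 in
     face_integral (K1 \<inter> K2) (\<lambda>x. upwind (M K1 x) n (a n K1 x) (a n K2 x) \<bullet> j n K1 K2 x))"

section \<open>The semi-discrete scheme\<close>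

definition lorentz :: "real \<Rightarrow> real \<Rightarrow> real^3 \<Rightarrow> real" where
  "lorentz m c u = sqrt (1 + (u \<bullet> u) / (m\<^sup>2 * c\<^sup>2))"

abbreviation fluid_gamma :: "real \<Rightarrow> real \<Rightarrow> real \<Rightarrow> real^3 \<Rightarrow> real" where
  "fluid_gamma m c \<rho> M \<equiv> lorentz m c ((m / \<rho>) *\<^sub>R M)"

definition velocity_arg ::
  "real \<Rightarrow> real \<Rightarrow> (cell \<Rightarrow> real^3 \<Rightarrow> real) \<Rightarrow> (cell \<Rightarrow> real^3 \<Rightarrow> real^3) \<Rightarrow> cell \<Rightarrow> real^3 \<Rightarrow> real^3" where
  "velocity_arg m c \<rho> M K x = (1 / (\<rho> K x * fluid_gamma m c (\<rho> K x) (M K x))) *\<^sub>R M K x"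

definition potential_arg ::
  "real \<Rightarrow> real \<Rightarrow> (cell \<Rightarrow> real^3 \<Rightarrow> real) \<Rightarrow> (cell \<Rightarrow> real^3 \<Rightarrow> real^3) \<Rightarrow> cell \<Rightarrow> real^3 \<Rightarrow> real" where
  "potential_arg m c \<rho> M K x = fluid_gamma m c (\<rho> K x) (M K x) - 1
     - (M K x \<bullet> M K x) / (c\<^sup>2 * (\<rho> K x)\<^sup>2 * fluid_gamma m c (\<rho> K x) (M K x))"

text \<open>In the following equations \<open>d\<rho>\<close>, \<open>dM\<close>, \<open>dE\<close>, \<open>dB\<close> stand for the time derivatives, \<open>q\<close> is the
  charge, and \<open>X p\<close>, \<open>U p\<close> are the position and momentum of particle \<open>p\<close> at the given time.\<close>

definition density_eq where
  "density_eq \<Omega> T F k \<rho> M w d\<rho> \<longleftrightarrow> (\<forall>\<phi> \<in> DG_space \<Omega> T (k + 1).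
     mesh_integral T (\<lambda>K x. d\<rho> K x * \<phi> K x) =
       mesh_integral T (\<lambda>K x. \<rho> K x *\<^sub>R w K x \<bullet> grad (\<phi> K) x)
     - face_flux M F (\<lambda>n K x. \<rho> K x *\<^sub>R w K x) (\<lambda>n K1 K2 x. scalar_jump n (\<phi> K1 x) (\<phi> K2 x)))"

definition momentum_eq where
  "momentum_eq c m q \<Omega> T F k \<rho> M E B w G dM \<longleftrightarrow> (\<forall>\<mu> \<in> RT_space \<Omega> T k.
     mesh_integral T (\<lambda>K x. dM K x \<bullet> \<mu> K x) =
       mesh_integral T (\<lambda>K x. (dir_grad (w K) (\<mu> K) x - dir_grad (\<mu> K) (w K) x) \<bullet> M K x)
     - mesh_integral T (\<lambda>K x. \<rho> K x * (\<mu> K x \<bullet> grad (G K) x) * c\<^sup>2)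
     + q / m * mesh_integral T (\<lambda>K x.
         \<rho> K x * ((E K x + cross3 (w K x) ((1 / c) *\<^sub>R B K x)) \<bullet> \<mu> K x))
     + face_flux M F (\<lambda>n K x. cross3 n (M K x))
         (\<lambda>n K1 K2 x. vector_jump (cross3 (\<mu> K1 x) (w K1 x)) (cross3 (\<mu> K2 x) (w K2 x)))
     + face_flux M F (\<lambda>n K x. \<rho> K x *\<^sub>R \<mu> K x)
         (\<lambda>n K1 K2 x. c\<^sup>2 *\<^sub>R scalar_jump n (G K1 x) (G K2 x)))"

definition ampere_eq where
  "ampere_eq c m q N wt \<Omega> T k loc \<rho> B w dE X U \<longleftrightarrow> (\<forall>\<nu> \<in> N0_space \<Omega> T k.
     mesh_integral T (\<lambda>K x. dE K x \<bullet> \<nu> K x) =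
       c * mesh_integral T (\<lambda>K x. B K x \<bullet> curl (\<nu> K) x)
     - 4 * pi * q / m * mesh_integral T (\<lambda>K x. \<rho> K x *\<^sub>R w K x \<bullet> \<nu> K x)
     - 4 * pi * q / m * (\<Sum>p\<in>{1..N::nat}.
         (wt p / lorentz m c (U p)) *\<^sub>R U p \<bullet> \<nu> (loc (X p)) (X p)))"

definition faraday_eq where
  "faraday_eq c \<Omega> T k E dB \<longleftrightarrow> (\<forall>\<tau> \<in> RT0_space \<Omega> T k.
     mesh_integral T (\<lambda>K x. dB K x \<bullet> \<tau> K x) =
       - c * mesh_integral T (\<lambda>K x. \<tau> K x \<bullet> curl (E K) x))"

text \<open>Locally absolutely continuous: absolutely continuous on every compact subinterval.\<close>
definition abs_continuous_on_ivl :: "real \<Rightarrow> real \<Rightarrow> (real \<Rightarrow> 'b::real_normed_vector) \<Rightarrow> bool" where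
  "abs_continuous_on_ivl a b f \<longleftrightarrow> (\<forall>\<epsilon>>0. \<exists>\<delta>>0. \<forall>(n::nat) s t.
     (\<forall>i<n. a \<le> s i \<and> s i \<le> t i \<and> t i \<le> b) \<and>
     (\<forall>i<n. \<forall>j<n. i \<noteq> j \<longrightarrow> {s i<..<t i} \<inter> {s j<..<t j} = {}) \<and>
     (\<Sum>i<n. t i - s i) < \<delta> \<longrightarrow>
     (\<Sum>i<n. norm (f (t i) - f (s i))) < \<epsilon>)"

definition loc_abs_continuous_on :: "real set \<Rightarrow> (real \<Rightarrow> 'b::real_normed_vector) \<Rightarrow> bool" where
  "loc_abs_continuous_on I f \<longleftrightarrow> (\<forall>a\<in>I. \<forall>b\<in>I. abs_continuous_on_ivl a b f)"

text \<open>Time regularity and time derivatives of a broken field are taken at each point of each closed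
  cell; as the spaces are finite-dimensional, this is the same as taking them for the coefficients.\<close>
definition field_abs_continuous ::
  "cell set \<Rightarrow> real set \<Rightarrow> (real \<Rightarrow> cell \<Rightarrow> real^3 \<Rightarrow> 'b::real_normed_vector) \<Rightarrow> bool" where
  "field_abs_continuous T I f \<longleftrightarrow> (\<forall>K\<in>T. \<forall>x\<in>K. loc_abs_continuous_on I (\<lambda>t. f t K x))"

definition field_has_time_deriv ::
  "cell set \<Rightarrow> real set \<Rightarrow> (real \<Rightarrow> cell \<Rightarrow> real^3 \<Rightarrow> 'b::real_normed_vector) \<Rightarrow> real \<Rightarrow>
   (cell \<Rightarrow> real^3 \<Rightarrow> 'b) \<Rightarrow> bool" where
  "field_has_time_deriv T I f t df \<longleftrightarrow>
     (\<forall>K\<in>T. \<forall>x\<in>K. ((\<lambda>s. f s K x) has_vector_derivative df K x) (at t within I))"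

text \<open>\<open>loc x\<close> is the adjacent cell from which fields are evaluated at a particle located at \<open>x\<close>; it
  is a genuine choice only if \<open>x\<close> lies on a mesh face.\<close>
definition cell_selection :: "cell set \<Rightarrow> (real^3 \<Rightarrow> cell) \<Rightarrow> bool" where
  "cell_selection T loc \<longleftrightarrow> (\<forall>x\<in>\<Union>T. loc x \<in> T \<and> x \<in> loc x)"

definition scheme_F_solution ::
  "real \<Rightarrow> real \<Rightarrow> real \<Rightarrow> nat \<Rightarrow> (nat \<Rightarrow> real) \<Rightarrow>
   (real^3) set \<Rightarrow> cell set \<Rightarrow> (cell \<times> cell) set \<Rightarrow> nat \<Rightarrow> (real^3 \<Rightarrow> cell) \<Rightarrow> real set \<Rightarrow>
   (real \<Rightarrow> cell \<Rightarrow> real^3 \<Rightarrow> real) \<Rightarrow> (real \<Rightarrow> cell \<Rightarrow> real^3 \<Rightarrow> real^3) \<Rightarrow>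
   (real \<Rightarrow> cell \<Rightarrow> real^3 \<Rightarrow> real^3) \<Rightarrow> (real \<Rightarrow> cell \<Rightarrow> real^3 \<Rightarrow> real^3) \<Rightarrow>
   (nat \<Rightarrow> real \<Rightarrow> real^3) \<Rightarrow> (nat \<Rightarrow> real \<Rightarrow> real^3) \<Rightarrow> bool" where
  "scheme_F_solution c m q N wt \<Omega> T F k loc I \<rho> M E B X U \<longleftrightarrow>
     (\<forall>t\<in>I. \<rho> t \<in> DG_space \<Omega> T (k + 1) \<and> M t \<in> RT_space \<Omega> T k \<and>
            E t \<in> N0_space \<Omega> T k \<and> B t \<in> RT0_space \<Omega> T k \<and>
            (\<forall>K\<in>T. \<forall>x\<in>K. \<rho> t K x \<noteq> 0) \<and> (\<forall>p\<in>{1..N}. X p t \<in> \<Union>T)) \<and>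
     field_abs_continuous T I \<rho> \<and> field_abs_continuous T I M \<and>
     field_abs_continuous T I E \<and> field_abs_continuous T I B \<and>
     (\<forall>p\<in>{1..N}. loc_abs_continuous_on I (X p) \<and> loc_abs_continuous_on I (U p)) \<and>
     (AE t in lebesgue_on I. \<exists>w G d\<rho> dM dE dB.
        is_L2_projection T (RT_space \<Omega> T k) (velocity_arg m c (\<rho> t) (M t)) w \<and>
        is_L2_projection T (DG_space \<Omega> T (k + 1)) (potential_arg m c (\<rho> t) (M t)) G \<and>
        field_has_time_deriv T I \<rho> t d\<rho> \<and> field_has_time_deriv T I M t dM \<and>
        field_has_time_deriv T I E t dE \<and> field_has_time_deriv T I B t dB \<and>
        density_eq \<Omega> T F k (\<rho> t) (M t) w d\<rho> \<and>
        momentum_eq c m q \<Omega> T F k (\<rho> t) (M t) (E t) (B t) w G dM \<and>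
        ampere_eq c m q N wt \<Omega> T k loc (\<rho> t) (B t) w dE (\<lambda>p. X p t) (\<lambda>p. U p t) \<and>
        faraday_eq c \<Omega> T k (E t) dB \<and>
        (\<forall>p\<in>{1..N}.
           (X p has_vector_derivative (1 / (m * lorentz m c (U p t))) *\<^sub>R U p t) (at t within I) \<and>
           (U p has_vector_derivative
              q *\<^sub>R (E t (loc (X p t)) (X p t) +
                    (1 / (c * m * lorentz m c (U p t))) *\<^sub>R cross3 (U p t) (B t (loc (X p t)) (X p t))))
             (at t within I)))"

definition total_energy where
  "total_energy c m N wt T \<rho> M E B U =
     mesh_integral T (\<lambda>K x. \<rho> K x * (fluid_gamma m c (\<rho> K x) (M K x) - 1) * c\<^sup>2)
   + (\<Sum>p\<in>{1..N::nat}. wt p * (lorentz m c (U p) - 1) * m * c\<^sup>2)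
   + 1 / (8 * pi) * mesh_integral T (\<lambda>K x. (norm (E K x))\<^sup>2 + (norm (B K x))\<^sup>2)"

definition gauss_residual where
  "gauss_residual m q N wt \<Omega> T k loc \<rho> E X \<phi> =
     mesh_integral T (\<lambda>K x. (weak_div \<Omega> T k E K x - 4 * pi * q * (\<rho> K x / m)) * \<phi> K x)
   - 4 * pi * q * (\<Sum>p\<in>{1..N::nat}. wt p * \<phi> (loc (X p)) (X p))"

end

theory Submission
  imports Defs
begin

text \<open>
  Each conserved quantity is a function of time that is locally absolutely continuous and whose
  derivative vanishes at almost every time, and such a function is constant on an interval
  (\<open>ac_ae_derivative_zero_constant\<close>, \<open>conserved\<close>). The derivative vanishes because of the test
  functions that the spaces of the scheme admit.

  \<^item> Fluid mass: the constant 1 is an admissible test function; it has no gradient and no jumps.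

  \<^item> Energy: the partial derivatives of the fluid energy density with respect to density and
  momentum are \<open>c\<^sup>2 \<cdot> potential_arg\<close> and \<open>velocity_arg\<close>, the functions whose projections are \<open>G\<close>
  and \<open>w\<close>. The time derivatives of density and momentum lie in the spaces projected onto, so the
  projections may be inserted, and testing the density equation with \<open>G\<close> and the momentum
  equation with \<open>w\<close> makes all transport terms cancel, on the cells as on the faces: the upwind
  flux dissipates nothing, since the same flux occurs in both equations. What remains is the
  work of the electric field on the fluid (\<open>fluid_energy_exchange\<close>). It is balanced, together
  with the work on the particles (\<open>particle_energy_deriv\<close>), by the field energy, by Ampere's law
  tested with the electric and Faraday's law tested with the magnetic field
  (\<open>field_energy_exchange\<close>).

  \<^item> Gauss law: for a conforming scalar field \<open>\<phi>\<close> the gradient is admissible in Ampere's law and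
  has no curl (\<open>grad_Q0_in_N0\<close>), and \<open>\<phi>\<close> itself is admissible in the density equation and has no
  jumps (\<open>Q0_continuous\<close>). The currents then cancel the changes of the charges, provided that
  \<open>\<phi>\<close> at a moving particle changes at the rate \<open>grad \<phi> \<cdot> V\<close>. At a time at which the particle lies on
  a face this requires that the rate does not depend on the cell from which \<open>\<phi>\<close> is evaluated,
  which holds outside a countable set of times (\<open>particle_derivative\<close>).

  \<^item> Divergence: the curl maps the edge elements into the face elements (\<open>curl_N0_in_RT0\<close>), so
  Faraday's law holds pointwise on the cells (\<open>magnetic_field_deriv\<close>), and a curl has no weak
  divergence.

  Two bodies of facts support this. The first concerns space. The conforming spaces are defined
  by weak derivatives of broken functions; cutoffs inside the cells show that these weak
  derivatives are the cellwise ones (\<open>H1_mesh\<close>, \<open>Hcurl_mesh\<close>), and mollification turns this into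
  continuity across faces and a global Lipschitz bound (\<open>H1_values_lipschitz\<close>, \<open>Q0_lipschitz\<close>).
  The second concerns time. Fields are absolutely continuous and differentiable in time at each
  point separately; as the spaces are finite-dimensional, a field is a combination of fixed fields
  with finitely many of its values as coefficients, which makes the estimates uniform in space
  and permits differentiation under the integral (\<open>field_in_time\<close>).
\<close>

section \<open>Partial derivatives\<close>

lemma partial_eqI: "(f has_derivative D) (at x) \<Longrightarrow> partial i f x = D (axis i 1)"
  unfolding partial_def by (metis frechet_derivative_at)

lemma vec_expand3: "(\<Sum>i\<in>UNIV. h $ i *\<^sub>R axis i (1::real)) = (h::real^3)"
  using basis_expansion[of h] by (simp add: scalar_mult_eq_scaleR)

lemma has_derivative_partials:
  fixes f :: "real^3 \<Rightarrow> 'b::real_normed_vector"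
  assumes "f differentiable (at x)"
  shows "(f has_derivative (\<lambda>h. \<Sum>i\<in>UNIV. h $ i *\<^sub>R partial i f x)) (at x)"
proof -
  let ?D = "frechet_derivative f (at x)"
  have D: "(f has_derivative ?D) (at x)" using assms frechet_derivative_works by blast
  then interpret linear ?D by (simp add: has_derivative_linear)
  have "?D h = (\<Sum>i\<in>UNIV. h $ i *\<^sub>R partial i f x)" for h
  proof -
    have "?D h = ?D (\<Sum>i\<in>UNIV. h $ i *\<^sub>R axis i 1)" by (simp only: vec_expand3)
    also have "\<dots> = (\<Sum>i\<in>UNIV. h $ i *\<^sub>R partial i f x)" by (simp add: sum scale partial_def)
    finally show ?thesis .
  qed
  then have "?D = (\<lambda>h. \<Sum>i\<in>UNIV. h $ i *\<^sub>R partial i f x)" by auto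
  then show ?thesis using D by simp
qed

lemma partial_const [simp]: "partial i (\<lambda>x. c) = (\<lambda>x. 0)"
proof
  fix x show "partial i (\<lambda>x. c) x = 0" by (rule partial_eqI[OF has_derivative_const])
qed

lemma partial_add:
  assumes "f differentiable (at x)" "g differentiable (at x)"
  shows "partial i (\<lambda>x. f x + g x) x = partial i f x + partial i g x"
  using assms unfolding partial_def
  by (subst frechet_derivative_at[OF has_derivative_add, symmetric]) (auto simp: frechet_derivative_works[symmetric])

lemma partial_bilinear:
  assumes "bounded_bilinear pr" "f differentiable (at x)" "g differentiable (at x)"
  shows "partial i (\<lambda>x. pr (f x) (g x)) x = pr (f x) (partial i g x) + pr (partial i f x) (g x)"
proof -
  interpret bounded_bilinear pr by fact
  show ?thesis using assms(2,3) unfolding partial_def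
    by (subst frechet_derivative_at[OF FDERIV, symmetric]) (auto simp: frechet_derivative_works[symmetric])
qed

lemma partial_linear:
  assumes "bounded_linear L" "f differentiable (at x)"
  shows "partial i (\<lambda>x. L (f x)) x = L (partial i f x)"
proof -
  interpret bounded_linear L by fact
  show ?thesis using assms(2) unfolding partial_def
    by (subst frechet_derivative_at[OF has_derivative, symmetric]) (auto simp: frechet_derivative_works[symmetric])
qed

lemma partial_nth: "f differentiable (at x) \<Longrightarrow> partial i (\<lambda>x. f x $ j) x = partial i f x $ j"
  by (rule partial_linear[OF bounded_linear_vec_nth])

section \<open>Smooth functions\<close>

lemma C_diff_0_of_Suc: "C_diff (Suc n) f \<Longrightarrow> continuous_on UNIV f"
  by (simp add: continuous_on_eq_continuous_within differentiable_imp_continuous_within)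

lemma C_diff_Suc_D: "C_diff (Suc n) f \<Longrightarrow> C_diff n f"
proof (induction n arbitrary: f)
  case 0 show ?case using C_diff_0_of_Suc[OF 0] by simp
next
  case (Suc n) then show ?case by (metis C_diff.simps(2))
qed

lemma differentiable_bilinear:
  assumes "bounded_bilinear pr" "f differentiable (at x)" "g differentiable (at x)"
  shows "(\<lambda>x. pr (f x) (g x)) differentiable (at x)"
proof -
  interpret bounded_bilinear pr by fact
  show ?thesis using assms(2,3) FDERIV unfolding differentiable_def by blast
qed

lemma differentiable_bounded_linear:
  assumes "bounded_linear L" "f differentiable (at x)"
  shows "(\<lambda>x. L (f x)) differentiable (at x)"
proof -
  interpret bounded_linear L by fact
  show ?thesis using assms(2) has_derivative unfolding differentiable_def by blast
qed

lemma C_diff_const: "C_diff n (\<lambda>x. c)"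
  by (induction n arbitrary: c) auto

lemma C_diff_add: "C_diff n f \<Longrightarrow> C_diff n g \<Longrightarrow> C_diff n (\<lambda>x. f x + g x)"
proof (induction n arbitrary: f g)
  case 0 then show ?case by (auto intro: continuous_intros)
next
  case (Suc n)
  then have "partial i (\<lambda>x. f x + g x) = (\<lambda>x. partial i f x + partial i g x)" for i
    by (auto intro!: ext partial_add)
  with Suc show ?case by (auto intro!: differentiable_add)
qed

lemma C_diff_sum: "(\<And>j. j \<in> J \<Longrightarrow> C_diff n (f j)) \<Longrightarrow> C_diff n (\<lambda>x. \<Sum>j\<in>J. f j x)"
  by (induction J rule: infinite_finite_induct) (auto intro: C_diff_const C_diff_add)

lemma C_diff_bilinear:
  assumes "bounded_bilinear pr"
  shows "C_diff n f \<Longrightarrow> C_diff n g \<Longrightarrow> C_diff n (\<lambda>x. pr (f x) (g x))"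
proof (induction n arbitrary: f g)
  case 0 then show ?case by (auto intro: bounded_bilinear.continuous_on[OF assms])
next
  case (Suc n)
  then have "partial i (\<lambda>x. pr (f x) (g x)) = (\<lambda>x. pr (f x) (partial i g x) + pr (partial i f x) (g x))" for i
    by (auto intro!: ext partial_bilinear[OF assms])
  with Suc C_diff_Suc_D[OF Suc.prems(1)] C_diff_Suc_D[OF Suc.prems(2)] show ?case
    by (auto intro!: C_diff_add differentiable_bilinear[OF assms])
qed

lemma C_diff_linear:
  assumes "bounded_linear L"
  shows "C_diff n f \<Longrightarrow> C_diff n (\<lambda>x. L (f x))"
proof (induction n arbitrary: f)
  case 0 then show ?case by (auto intro: bounded_linear.continuous_on[OF assms])
next
  case (Suc n)
  then have "partial i (\<lambda>x. L (f x)) = (\<lambda>x. L (partial i f x))" for i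
    by (auto intro!: ext partial_linear[OF assms])
  with Suc show ?case by (auto intro!: differentiable_bounded_linear[OF assms])
qed

definition smooth :: "(real^3 \<Rightarrow> 'b::real_normed_vector) \<Rightarrow> bool" where
  "smooth f \<longleftrightarrow> (\<forall>n. C_diff n f)"

lemma smooth_continuous: "smooth f \<Longrightarrow> continuous_on S f"
  unfolding smooth_def by (metis C_diff.simps(1) continuous_on_subset top_greatest)

lemma smooth_differentiable: "smooth f \<Longrightarrow> f differentiable (at x)"
  unfolding smooth_def by (metis C_diff.simps(2))

lemma smooth_partial: "smooth f \<Longrightarrow> smooth (partial i f)"
  unfolding smooth_def by (metis C_diff.simps(2))

lemma smooth_const: "smooth (\<lambda>x. c)" by (simp add: smooth_def C_diff_const)
lemma smooth_add: "smooth f \<Longrightarrow> smooth g \<Longrightarrow> smooth (\<lambda>x. f x + g x)" by (simp add: smooth_def C_diff_add)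
lemma smooth_sum: "(\<And>j. j \<in> J \<Longrightarrow> smooth (f j)) \<Longrightarrow> smooth (\<lambda>x. \<Sum>j\<in>J. f j x)"
  by (simp add: smooth_def C_diff_sum)
lemma smooth_linear: "bounded_linear L \<Longrightarrow> smooth f \<Longrightarrow> smooth (\<lambda>x. L (f x))"
  by (simp add: smooth_def C_diff_linear)
lemma smooth_bilinear: "bounded_bilinear p \<Longrightarrow> smooth f \<Longrightarrow> smooth g \<Longrightarrow> smooth (\<lambda>x. p (f x) (g x))"
  by (simp add: smooth_def C_diff_bilinear)
lemma smooth_mult: "smooth f \<Longrightarrow> smooth g \<Longrightarrow> smooth (\<lambda>x. f x * g x :: real)"
  by (rule smooth_bilinear[OF bounded_bilinear_mult])
lemma smooth_minus: "smooth f \<Longrightarrow> smooth (\<lambda>x. - f x)"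
  by (rule smooth_linear[OF bounded_linear_minus[OF bounded_linear_ident]])
lemma smooth_diff: "smooth f \<Longrightarrow> smooth g \<Longrightarrow> smooth (\<lambda>x. f x - g x)"
  using smooth_add[OF _ smooth_minus] by fastforce
lemma smooth_nth: "smooth f \<Longrightarrow> smooth (\<lambda>x. f x $ i)"
  by (rule smooth_linear[OF bounded_linear_vec_nth])
lemma smooth_prod: "(\<And>j. j \<in> J \<Longrightarrow> smooth (f j)) \<Longrightarrow> smooth (\<lambda>x. \<Prod>j\<in>J. f j x :: real)"
  by (induction J rule: infinite_finite_induct) (auto intro: smooth_const smooth_mult)

lemma smooth_componentwise:
  fixes f :: "real^3 \<Rightarrow> real^3"
  assumes "\<And>i. smooth (\<lambda>x. f x $ i)" shows "smooth f"
proof -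
  have "smooth (\<lambda>x. \<Sum>i\<in>UNIV. f x $ i *\<^sub>R axis i (1::real) :: real^3)"
    using assms by (intro smooth_sum smooth_bilinear[OF bounded_bilinear_scaleR] smooth_const)
  then show ?thesis by (simp add: vec_expand3)
qed

lemma smooth_ident: "smooth (\<lambda>x. x)"
  unfolding smooth_def
proof
  fix n show "C_diff n (\<lambda>x::real^3. x)"
  proof (cases n)
    case (Suc m)
    have "partial i (\<lambda>x. x) = (\<lambda>x. axis i 1)" for i
      by (rule ext, rule partial_eqI) (rule has_derivative_ident)
    then show ?thesis using Suc by (auto simp: C_diff_const)
  qed simp
qed

lemma smooth_line_derivative:
  assumes "smooth f"
  shows "((\<lambda>s. f (x + s *\<^sub>R v)) has_vector_derivative (\<Sum>i\<in>UNIV. v $ i *\<^sub>R partial i f (x + s *\<^sub>R v))) (at s within S)"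
proof -
  have "(f has_derivative (\<lambda>h. \<Sum>i\<in>UNIV. h $ i *\<^sub>R partial i f (x + s *\<^sub>R v))) (at (x + s *\<^sub>R v))"
    by (rule has_derivative_partials[OF smooth_differentiable[OF assms]])
  moreover have "((\<lambda>s. x + s *\<^sub>R v) has_derivative (\<lambda>h. h *\<^sub>R v)) (at s within S)"
    by (auto intro!: derivative_eq_intros)
  ultimately have "((\<lambda>s. f (x + s *\<^sub>R v)) has_derivative
      (\<lambda>h. \<Sum>i\<in>UNIV. (h *\<^sub>R v) $ i *\<^sub>R partial i f (x + s *\<^sub>R v))) (at s within S)"
    using has_derivative_compose by blast
  then show ?thesis by (simp add: has_vector_derivative_def scaleR_sum_right)
qed

lemma smooth_line_derivative_axis:
  assumes "smooth f"
  shows "((\<lambda>s. f (x + s *\<^sub>R axis i 1)) has_vector_derivative partial i f (x + s *\<^sub>R axis i 1)) (at s within S)"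
proof -
  have "(\<Sum>j\<in>UNIV. (axis i (1::real) :: real^3) $ j *\<^sub>R partial j f (x + s *\<^sub>R axis i 1)) = partial i f (x + s *\<^sub>R axis i 1)"
    by (simp add: axis_def if_distrib[of "\<lambda>a. a *\<^sub>R _"] cong: if_cong)
  then show ?thesis using smooth_line_derivative[OF assms, of x "axis i 1" s S] by (simp only:)
qed

section \<open>Mixed partial derivatives and vector identities\<close>

definition second_difference :: "(real^3 \<Rightarrow> real) \<Rightarrow> real^3 \<Rightarrow> 3 \<Rightarrow> 3 \<Rightarrow> real \<Rightarrow> real" where
  "second_difference f x i j h =
     f (x + h *\<^sub>R axis i 1 + h *\<^sub>R axis j 1) - f (x + h *\<^sub>R axis i 1) - f (x + h *\<^sub>R axis j 1) + f x"

text \<open>The mean value theorem is applied first in direction \<open>i\<close> to the difference in direction \<open>j\<close>, and then in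
  direction \<open>j\<close> to the derivative.\<close>
lemma second_difference_mvt:
  assumes f: "smooth f" and h: "h > 0"
  obtains z where "norm (z - x) \<le> 2 * h"
    "second_difference f x i j h = h * h * partial j (partial i f) z"
proof -
  let ?u = "axis i 1 :: real^3" and ?v = "axis j 1 :: real^3"
  let ?g = "\<lambda>s. f (x + h *\<^sub>R ?v + s *\<^sub>R ?u) - f (x + s *\<^sub>R ?u)"
  have g: "(?g has_real_derivative (partial i f (x + h *\<^sub>R ?v + s *\<^sub>R ?u) - partial i f (x + s *\<^sub>R ?u))) (at s)" for s
    unfolding has_real_derivative_iff_has_vector_derivative
    by (intro has_vector_derivative_diff smooth_line_derivative_axis f)
  obtain \<xi> where \<xi>: "0 < \<xi>" "\<xi> < h" 
    "?g h - ?g 0 = (h - 0) * (partial i f (x + h *\<^sub>R ?v + \<xi> *\<^sub>R ?u) - partial i f (x + \<xi> *\<^sub>R ?u))"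
    using MVT2[OF h g] by blast
  let ?k = "\<lambda>s. partial i f (x + \<xi> *\<^sub>R ?u + s *\<^sub>R ?v)"
  have k: "(?k has_real_derivative partial j (partial i f) (x + \<xi> *\<^sub>R ?u + s *\<^sub>R ?v)) (at s)" for s
    unfolding has_real_derivative_iff_has_vector_derivative
    by (intro smooth_line_derivative_axis smooth_partial f)
  obtain \<eta> where \<eta>: "0 < \<eta>" "\<eta> < h" "?k h - ?k 0 = (h - 0) * partial j (partial i f) (x + \<xi> *\<^sub>R ?u + \<eta> *\<^sub>R ?v)"
    using MVT2[OF h k] by blast
  have "second_difference f x i j h = ?g h - ?g 0"
    by (simp add: second_difference_def algebra_simps)
  also have "\<dots> = h * (?k h - ?k 0)" using \<xi>(3) by (simp add: algebra_simps)
  also have "\<dots> = h * h * partial j (partial i f) (x + \<xi> *\<^sub>R ?u + \<eta> *\<^sub>R ?v)"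
    using \<eta>(3) by simp
  finally have "second_difference f x i j h = h * h * partial j (partial i f) (x + \<xi> *\<^sub>R ?u + \<eta> *\<^sub>R ?v)" .
  moreover have "norm ((x + \<xi> *\<^sub>R ?u + \<eta> *\<^sub>R ?v) - x) \<le> 2 * h"
  proof -
    have "norm (\<xi> *\<^sub>R ?u + \<eta> *\<^sub>R ?v) \<le> norm (\<xi> *\<^sub>R ?u) + norm (\<eta> *\<^sub>R ?v)"
      by (rule norm_triangle_ineq)
    then show ?thesis using \<xi> \<eta> by (simp add: add.assoc)
  qed
  ultimately show ?thesis using that by blast
qed

lemma second_difference_limit:
  assumes f: "smooth f"
  shows "(\<lambda>n. second_difference f x i j (1 / real (Suc n)) / (1 / real (Suc n))\<^sup>2) \<longlonglongrightarrow> partial j (partial i f) x"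
proof -
  have "\<exists>z. norm (z - x) \<le> 2 * (1 / real (Suc n)) \<and>
      second_difference f x i j (1 / real (Suc n)) = (1 / real (Suc n)) * (1 / real (Suc n)) * partial j (partial i f) z" for n
  proof -
    have "1 / real (Suc n) > 0" by simp
    from second_difference_mvt[OF f this, of x i j] show ?thesis by blast
  qed
  then have "\<exists>z. \<forall>n. norm (z n - x) \<le> 2 * (1 / real (Suc n)) \<and>
      second_difference f x i j (1 / real (Suc n)) = (1 / real (Suc n)) * (1 / real (Suc n)) * partial j (partial i f) (z n)"
    by (intro choice allI)
  then obtain z where z: "\<And>n. norm (z n - x) \<le> 2 * (1 / real (Suc n))"
      "\<And>n. second_difference f x i j (1 / real (Suc n)) = (1 / real (Suc n)) * (1 / real (Suc n)) * partial j (partial i f) (z n)"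
    by blast
  have "(\<lambda>n. 2 * (1 / real (Suc n))) \<longlonglongrightarrow> 0"
    using tendsto_mult_right_zero[OF LIMSEQ_inverse_real_of_nat, of 2] by (simp add: inverse_eq_divide)
  then have "(\<lambda>n. z n - x) \<longlonglongrightarrow> 0"
    by (rule Lim_null_comparison[rotated]) (use z in auto)
  then have "z \<longlonglongrightarrow> x" by (rule LIM_zero_cancel)
  moreover have "isCont (partial j (partial i f)) x"
    using smooth_continuous[OF smooth_partial[OF smooth_partial[OF f]], of UNIV]
    by (simp add: continuous_on_eq_continuous_at)
  ultimately have "(\<lambda>n. partial j (partial i f) (z n)) \<longlonglongrightarrow> partial j (partial i f) x"
    by (rule isCont_tendsto_compose[rotated])
  moreover have "second_difference f x i j (1 / real (Suc n)) / (1 / real (Suc n))\<^sup>2 = partial j (partial i f) (z n)" for n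
    unfolding z(2) by (simp add: power2_eq_square del: of_nat_Suc)
  ultimately show ?thesis by simp
qed

text \<open>Exchanging the two directions does not change the second difference, and each order of differentiation
  is its limit.\<close>
lemma partial_commute:
  fixes f :: "real^3 \<Rightarrow> real"
  assumes "smooth f"
  shows "partial i (partial j f) x = partial j (partial i f) x"
proof -
  have "second_difference f x i j = second_difference f x j i"
    by (rule ext) (simp add: second_difference_def algebra_simps)
  then show ?thesis
    using LIMSEQ_unique[OF second_difference_limit[OF assms, of x j i]] second_difference_limit[OF assms, of x i j]
    by simp
qed

lemma curl_nth:
  "curl f x $ 1 = partial 2 f x $ 3 - partial 3 f x $ 2"
  "curl f x $ 2 = partial 3 f x $ 1 - partial 1 f x $ 3"
  "curl f x $ 3 = partial 1 f x $ 2 - partial 2 f x $ 1"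
  by (simp_all only: curl_def vector_3)

lemma grad_nth [simp]: "grad f x $ i = partial i f x" by (simp add: grad_def)

lemma smooth_grad: "smooth f \<Longrightarrow> smooth (grad f)"
  by (rule smooth_componentwise) (simp add: smooth_partial)

lemma smooth_curl: "smooth f \<Longrightarrow> smooth (curl f)"
proof (rule smooth_componentwise)
  fix i :: 3 assume f: "smooth f"
  have "\<forall>i. smooth (\<lambda>x. curl f x $ i)"
    unfolding forall_3 curl_nth by (intro conjI smooth_diff smooth_nth smooth_partial f)
  then show "smooth (\<lambda>x. curl f x $ i)" ..
qed

lemma curl_grad: "smooth (f :: real^3 \<Rightarrow> real) \<Longrightarrow> curl (grad f) x = 0"
proof -
  assume f: "smooth f"
  have "partial i (grad f) x $ j = partial i (partial j f) x" for i j
    using partial_nth[OF smooth_differentiable[OF smooth_grad[OF f]], of i j x] by simp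
  then show ?thesis
    by (simp add: vec_eq_iff forall_3 curl_nth partial_commute[OF f, of 3 2] partial_commute[OF f, of 1 3] partial_commute[OF f, of 2 1])
qed

lemma div_curl: 
  assumes f: "smooth (f :: real^3 \<Rightarrow> real^3)"
  shows "partial 1 (\<lambda>x. curl f x $ 1) x + partial 2 (\<lambda>x. curl f x $ 2) x + partial 3 (\<lambda>x. curl f x $ 3) x = 0"
proof -
  define g where "g = (\<lambda>j x. f x $ j)"
  have g: "smooth (g j)" for j unfolding g_def by (rule smooth_nth[OF f])
  have pg: "(\<lambda>x. partial i f x $ j) = partial i (g j)" for i j
    unfolding g_def using partial_nth[OF smooth_differentiable[OF f]] by auto
  have "curl f = (\<lambda>x. vector [partial 2 (g 3) x - partial 3 (g 2) x, partial 3 (g 1) x - partial 1 (g 3) x, partial 1 (g 2) x - partial 2 (g 1) x])"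
    by (rule ext) (simp add: curl_def pg[THEN fun_cong])
  moreover have "partial i (\<lambda>x. partial j (g a) x - partial l (g b) x) x = partial i (partial j (g a)) x - partial i (partial l (g b)) x" for i j l a b
  proof -
    have "partial i (\<lambda>x. partial j (g a) x + - partial l (g b) x) x = partial i (partial j (g a)) x + partial i (\<lambda>x. - partial l (g b) x) x"
      by (intro partial_add smooth_differentiable smooth_minus smooth_partial g)
    also have "partial i (\<lambda>x. - partial l (g b) x) x = - partial i (partial l (g b)) x"
      by (rule partial_linear[OF bounded_linear_minus[OF bounded_linear_ident]]) (intro smooth_differentiable smooth_partial g)
    finally show ?thesis by simp
  qed
  ultimately show ?thesis
    by (simp add: partial_commute[OF g, of 3 2] partial_commute[OF g, of 1 3] partial_commute[OF g, of 2 1])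
qed

section \<open>Polynomials\<close>

definition monomial :: "nat \<Rightarrow> nat \<Rightarrow> nat \<Rightarrow> real^3 \<Rightarrow> real" where
  "monomial i j l x = (x $ 1) ^ i * (x $ 2) ^ j * (x $ 3) ^ l"

definition exponents :: "nat \<Rightarrow> (nat \<times> nat \<times> nat) set" where
  "exponents k = (SIGMA i:{..k}. SIGMA j:{..k - i}. {..k - i - j})"

lemma finite_exponents [simp]: "finite (exponents k)"
  by (simp add: exponents_def)

lemma exponents_iff: "(i, j, l) \<in> exponents k \<longleftrightarrow> i + j + l \<le> k"
  by (auto simp: exponents_def)

lemma P_poly_iff:
  "f \<in> P_poly k \<longleftrightarrow> (\<exists>a. f = (\<lambda>x. \<Sum>(i, j, l)\<in>exponents k. a (i, j, l) * monomial i j l x))"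
proof -
  have *: "(\<Sum>i\<le>k. \<Sum>j\<le>k - i. \<Sum>l\<le>k - i - j. b i j l) = (\<Sum>(i, j, l)\<in>exponents k. b i j l)" for b :: "nat \<Rightarrow> nat \<Rightarrow> nat \<Rightarrow> real"
    unfolding exponents_def by (simp add: sum.Sigma)
  show ?thesis unfolding P_poly_def mem_Collect_eq * 
    apply safe
    subgoal for a by (rule exI[of _ "\<lambda>(i,j,l). a i j l"]) (auto simp: monomial_def mult.assoc)
    subgoal for a by (rule exI[of _ "\<lambda>i j l. a (i,j,l)"]) (auto simp: monomial_def mult.assoc)
    done
qed

lemma P_poly_add: "f \<in> P_poly k \<Longrightarrow> g \<in> P_poly k \<Longrightarrow> (\<lambda>x. f x + g x) \<in> P_poly k"
  unfolding P_poly_iff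
  apply clarify
  subgoal for a b by (rule exI[of _ "\<lambda>e. a e + b e"]) (auto simp: sum.distrib[symmetric] algebra_simps intro!: sum.cong)
  done

lemma P_poly_scale: "f \<in> P_poly k \<Longrightarrow> (\<lambda>x. c * f x) \<in> P_poly k"
  unfolding P_poly_iff
  apply clarify
  subgoal for a by (rule exI[of _ "\<lambda>e. c * a e"]) (auto simp: sum_distrib_left algebra_simps intro!: sum.cong)
  done

lemma P_poly_zero: "(\<lambda>x. 0) \<in> P_poly k"
  unfolding P_poly_iff by (rule exI[of _ "\<lambda>e. 0"]) auto

lemma monomial_P_poly: assumes "i + j + l \<le> k" shows "monomial i j l \<in> P_poly k"
proof -
  have "(\<Sum>(i', j', l')\<in>exponents k. (if (i', j', l') = (i, j, l) then 1 else 0) * monomial i' j' l' x) = monomial i j l x" for x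
  proof -
    have "(\<Sum>(i', j', l')\<in>exponents k. (if (i', j', l') = (i, j, l) then 1 else 0) * monomial i' j' l' x)
      = (\<Sum>e\<in>exponents k. if e = (i, j, l) then monomial i j l x else 0)"
      by (rule sum.cong) (auto split: if_splits)
    then show ?thesis using assms by (simp add: exponents_iff)
  qed
  then show ?thesis unfolding P_poly_iff
    by (intro exI[of _ "\<lambda>e. if e = (i, j, l) then 1 else 0"]) auto
qed

text \<open>Reduces statements that are preserved by linear combinations to monomials, without the triple
  sum.\<close>
lemma P_poly_induct [consumes 1, case_names zero add scale monomial]:
  assumes "f \<in> P_poly k"
    and "Q (\<lambda>x. 0)"
    and "\<And>f g. f \<in> P_poly k \<Longrightarrow> g \<in> P_poly k \<Longrightarrow> Q f \<Longrightarrow> Q g \<Longrightarrow> Q (\<lambda>x. f x + g x)"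
    and "\<And>f c. f \<in> P_poly k \<Longrightarrow> Q f \<Longrightarrow> Q (\<lambda>x. c * f x)"
    and "\<And>i j l. i + j + l \<le> k \<Longrightarrow> Q (monomial i j l)"
  shows "Q f"
proof -
  obtain a where f: "f = (\<lambda>x. \<Sum>e\<in>exponents k. a e * monomial (fst e) (fst (snd e)) (snd (snd e)) x)"
    using assms(1) by (auto simp: P_poly_iff case_prod_beta)
  let ?g = "\<lambda>A x. \<Sum>e\<in>A. a e * monomial (fst e) (fst (snd e)) (snd (snd e)) x"
  have "?g A \<in> P_poly k \<and> Q (?g A)" if "finite A" "A \<subseteq> exponents k" for A
    using that
  proof (induction A rule: finite_induct)
    case empty then show ?case using assms(2) P_poly_zero by simp
  next
    case (insert e A)
    let ?m = "monomial (fst e) (fst (snd e)) (snd (snd e))"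
    have le: "fst e + fst (snd e) + snd (snd e) \<le> k" using insert.prems exponents_iff[of "fst e" "fst (snd e)" "snd (snd e)" k] by auto
    have 1: "?m \<in> P_poly k" "Q ?m" using monomial_P_poly[OF le] assms(5)[OF le] by auto
    have 2: "(\<lambda>x. a e * ?m x) \<in> P_poly k" "Q (\<lambda>x. a e * ?m x)" using P_poly_scale[OF 1(1)] assms(4)[OF 1] by auto
    show ?case using insert P_poly_add[OF 2(1), of "?g A"] assms(3)[OF 2(1) _ 2(2), of "?g A"] by auto
  qed
  then show ?thesis using f by auto
qed

lemma P_poly_mono: "f \<in> P_poly k \<Longrightarrow> k \<le> k' \<Longrightarrow> f \<in> P_poly k'"
  by (induction rule: P_poly_induct) (auto intro: P_poly_zero P_poly_add P_poly_scale monomial_P_poly)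

lemma P_poly_const: "(\<lambda>x. c) \<in> P_poly k"
  using P_poly_scale[OF monomial_P_poly[of 0 0 0 k], of c] by (simp add: monomial_def[abs_def])

lemma P_poly_minus: "f \<in> P_poly k \<Longrightarrow> (\<lambda>x. - f x) \<in> P_poly k"
  using P_poly_scale[of f k "-1"] by simp

lemma P_poly_diff: "f \<in> P_poly k \<Longrightarrow> g \<in> P_poly k \<Longrightarrow> (\<lambda>x. f x - g x) \<in> P_poly k"
  using P_poly_add[OF _ P_poly_minus] by fastforce

lemma P_poly_mult_coord: "f \<in> P_poly k \<Longrightarrow> (\<lambda>x. x $ r * f x) \<in> P_poly (k + 1)"
proof (induction rule: P_poly_induct)
  case zero then show ?case using P_poly_zero by simp
next
  case (add f g) then show ?case using P_poly_add[OF add(3,4)] by (simp add: algebra_simps)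
next
  case (scale f c) then show ?case using P_poly_scale[OF scale(2), of c] by (simp add: algebra_simps)
next
  case (monomial i j l)
  have "\<forall>r. (\<lambda>x. x $ r * monomial i j l x) \<in> P_poly (k + 1)"
    unfolding forall_3
    using monomial_P_poly[of "i + 1" j l "k + 1"] monomial_P_poly[of i "j + 1" l "k + 1"] monomial_P_poly[of i j "l + 1" "k + 1"] monomial
    by (simp add: monomial_def[abs_def] algebra_simps)
  then show ?case ..
qed

lemma smooth_P_poly: "f \<in> P_poly k \<Longrightarrow> smooth f"
proof (induction rule: P_poly_induct)
  case (monomial i j l)
  have "smooth (\<lambda>x. (x $ r) ^ n)" for r n
    by (induction n) (simp_all add: smooth_const smooth_mult[OF smooth_nth[OF smooth_ident]])
  then show ?case unfolding monomial_def[abs_def] by (intro smooth_mult)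
qed (auto intro: smooth_const smooth_add smooth_mult)

lemma partial_P_poly: "f \<in> P_poly k \<Longrightarrow> partial r f \<in> P_poly (k - 1)"
proof (induction rule: P_poly_induct)
  case zero then show ?case using P_poly_zero by simp
next
  case (add f g)
  have "partial r (\<lambda>x. f x + g x) = (\<lambda>x. partial r f x + partial r g x)"
    using add by (intro ext partial_add smooth_differentiable smooth_P_poly)
  then show ?case using P_poly_add[OF add(3,4)] by simp
next
  case (scale f c)
  have "partial r (\<lambda>x. c * f x) = (\<lambda>x. c * partial r f x)"
    using scale by (intro ext partial_linear[OF bounded_linear_mult_right] smooth_differentiable smooth_P_poly)
  then show ?case using P_poly_scale[OF scale(2), of c] by simp
next
  case (monomial i j l)
  have D: "(monomial i j l has_derivative (\<lambda>h. 
      real i * h $ 1 * monomial (i - 1) j l x + real j * h $ 2 * monomial i (j - 1) l x + real l * h $ 3 * monomial i j (l - 1) x)) (at x)" for x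
    unfolding monomial_def[abs_def]
    by (rule derivative_eq_intros bounded_linear_imp_has_derivative[OF bounded_linear_vec_nth] | simp add: algebra_simps)+
  have "partial r (monomial i j l) = (\<lambda>x. real i * axis r 1 $ 1 * monomial (i - 1) j l x + real j * axis r 1 $ 2 * monomial i (j - 1) l x 
         + real l * axis r 1 $ 3 * monomial i j (l - 1) x)"
    by (rule ext, rule partial_eqI[OF D])
  moreover have "(\<lambda>x. real n * c * monomial i' j' l' x) \<in> P_poly (k - 1)" if "n > 0 \<Longrightarrow> i' + j' + l' \<le> k - 1" for n c i' j' l'
    using that P_poly_zero P_poly_scale[OF monomial_P_poly] by (cases n) auto
  ultimately show ?case using monomial by (auto intro!: P_poly_add)
qed

section \<open>Finite-dimensional spaces of functions\<close>

text \<open>A finite-dimensional space of functions is determined by finitely many values. A point \<open>y\<close> at which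
  some member does not vanish splits \<open>V\<close> into the multiples of one function and the subspace of the
  functions that vanish at \<open>y\<close>; on this subspace the value at \<open>y\<close> is a linear relation that makes one
  generator superfluous. Members of \<open>V\<close> enter only through their values \<open>ev\<close> on \<open>S\<close>: broken fields are
  arbitrary outside the mesh, so as functions they do not form a finite-dimensional space.\<close>
lemma nodal_basis:
  fixes ev :: "'f \<Rightarrow> 'z \<Rightarrow> real" and b :: "'j \<Rightarrow> 'z \<Rightarrow> real" and V :: "'f set"
  assumes "finite J"
    and "\<And>f. f \<in> V \<Longrightarrow> \<exists>a. \<forall>z\<in>S. ev f z = (\<Sum>j\<in>J. a j * b j z)"
    and "\<And>f g c. f \<in> V \<Longrightarrow> g \<in> V \<Longrightarrow> \<exists>h\<in>V. \<forall>z\<in>S. ev h z = ev f z + c * ev g z"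
  shows "\<exists>(A::'z set) v. finite A \<and> A \<subseteq> S \<and> (\<forall>y\<in>A. v y \<in> V) \<and> (\<forall>f\<in>V. \<forall>z\<in>S. ev f z = (\<Sum>y\<in>A. ev f y * ev (v y) z))"
  using assms
proof (induction J arbitrary: V b rule: finite_induct)
  case empty
  then show ?case by (intro exI[of _ "{}"]) auto
next
  case (insert j J V b)
  show ?case
  proof (cases "\<exists>f\<in>V. \<exists>y\<in>S. ev f y \<noteq> 0")
    case False
    then show ?thesis by (intro exI[of _ "{}"]) auto
  next
    case True
    then obtain f0 y where f0: "f0 \<in> V" "y \<in> S" "ev f0 y \<noteq> 0" by blast
    \<comment> \<open>scale so that the value at y is 1\<close>
    obtain v0 where v0: "v0 \<in> V" "ev v0 y = 1"
    proof -
      obtain h where "h \<in> V" "\<forall>z\<in>S. ev h z = ev f0 z + (1 / ev f0 y - 1) * ev f0 z"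
        using insert.prems(2)[OF f0(1) f0(1)] by blast
      then show ?thesis using that f0 by (auto simp: field_simps)
    qed
    define V' where "V' = {f \<in> V. ev f y = 0}"
    obtain a0 where a0: "\<forall>z\<in>S. ev v0 z = (\<Sum>i\<in>insert j J. a0 i * b i z)" using insert.prems(1)[OF v0(1)] by blast
    obtain r where r: "r \<in> insert j J" "b r y \<noteq> 0"
    proof -
      have "(\<Sum>i\<in>insert j J. a0 i * b i y) \<noteq> 0" using a0 f0 v0 by auto
      then show ?thesis using that by (metis (no_types, lifting) mult_eq_0_iff sum.neutral)
    qed
    \<comment> \<open>on V' one generator can be eliminated; it is renamed so that j is the one\<close>
    define b1 where "b1 = (\<lambda>i. if i = r then b j else b i)"
    define b2 where "b2 = (\<lambda>i z. b1 i z - b1 i y / b r y * b r z)"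
    have span: "\<exists>a. \<forall>z\<in>S. ev f z = (\<Sum>i\<in>J. a i * b2 i z)" if f: "f \<in> V'" for f
    proof -
      obtain a where a: "\<forall>z\<in>S. ev f z = (\<Sum>i\<in>insert j J. a i * b i z)" using insert.prems(1) f V'_def by blast
      define a1 where "a1 = (\<lambda>i. if i = r then a j else a i)"
      have a': "ev f z = a r * b r z + (\<Sum>i\<in>J. a1 i * b1 i z)" if "z \<in> S" for z
      proof (cases "r = j")
        case True
        then have "(\<Sum>i\<in>J. a1 i * b1 i z) = (\<Sum>i\<in>J. a i * b i z)" using insert(2)
          by (intro sum.cong) (auto simp: a1_def b1_def)
        then show ?thesis using a that insert(1,2) True by simp
      next
        case False
        then have rJ: "r \<in> J" using r by simp
        have "(\<Sum>i\<in>J - {r}. a1 i * b1 i z) = (\<Sum>i\<in>J - {r}. a i * b i z)" 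
          by (intro sum.cong) (auto simp: a1_def b1_def)
        then have "(\<Sum>i\<in>J. a1 i * b1 i z) = a j * b j z + (\<Sum>i\<in>J - {r}. a i * b i z)"
          using sum.remove[OF insert(1) rJ, of "\<lambda>i. a1 i * b1 i z"] by (simp add: a1_def b1_def)
        moreover have "(\<Sum>i\<in>insert j J. a i * b i z) = a j * b j z + (a r * b r z + (\<Sum>i\<in>J - {r}. a i * b i z))"
          using insert(1,2) sum.remove[OF insert(1) rJ, of "\<lambda>i. a i * b i z"] by simp
        ultimately show ?thesis using a that by simp
      qed
      have y0: "a r * b r y + (\<Sum>i\<in>J. a1 i * b1 i y) = 0" using a'[OF f0(2)] f V'_def by simp
      have "ev f z = (\<Sum>i\<in>J. a1 i * b2 i z)" if z: "z \<in> S" for z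
      proof -
        have "(\<Sum>i\<in>J. a1 i * b2 i z) = (\<Sum>i\<in>J. a1 i * b1 i z) - (\<Sum>i\<in>J. a1 i * b1 i y) / b r y * b r z"
          by (simp add: b2_def right_diff_distrib sum_subtractf sum_divide_distrib sum_distrib_right mult.assoc)
        also have "(\<Sum>i\<in>J. a1 i * b1 i y) = - (a r * b r y)" using y0 by simp
        finally show ?thesis using a'[OF z] r(2) by simp
      qed
      then show ?thesis by blast
    qed
    have "\<exists>A v. finite A \<and> A \<subseteq> S \<and> (\<forall>y\<in>A. v y \<in> V') \<and> (\<forall>f\<in>V'. \<forall>z\<in>S. ev f z = (\<Sum>y\<in>A. ev f y * ev (v y) z))"
    proof (rule insert.IH[of V' b2])
      show "\<exists>h\<in>V'. \<forall>z\<in>S. ev h z = ev f z + c * ev g z" if fg: "f \<in> V'" "g \<in> V'" for f g c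
      proof -
        obtain h where "h \<in> V" "\<forall>z\<in>S. ev h z = ev f z + c * ev g z" using insert.prems(2) fg V'_def by blast
        then show ?thesis using fg f0(2) by (auto simp: V'_def)
      qed
    qed (use span in auto)
    then obtain A v where A: "finite A" "A \<subseteq> S" "\<And>y. y \<in> A \<Longrightarrow> v y \<in> V'"
      and rep: "\<And>f z. f \<in> V' \<Longrightarrow> z \<in> S \<Longrightarrow> ev f z = (\<Sum>y\<in>A. ev f y * ev (v y) z)" by blast
    define A' where "A' = A - {y}"
    have A': "finite A'" "A' \<subseteq> S" "y \<notin> A'" "\<And>z. z \<in> A' \<Longrightarrow> v z \<in> V"
      using A by (auto simp: A'_def V'_def)
    have rep': "ev f z = (\<Sum>x\<in>A'. ev f x * ev (v x) z)" if "f \<in> V'" "z \<in> S" for f z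
    proof -
      have "(\<Sum>x\<in>A'. ev f x * ev (v x) z) = (\<Sum>x\<in>A. ev f x * ev (v x) z)"
        using that A(1) by (intro sum.mono_neutral_left) (auto simp: A'_def V'_def)
      then show ?thesis using rep[OF that] by simp
    qed
    have "\<exists>h\<in>V. \<forall>z\<in>S. ev h z = ev v0 z - (\<Sum>x\<in>B. ev v0 x * ev (v x) z)" if "finite B" "B \<subseteq> A'" for B
      using that
    proof (induction B rule: finite_induct)
      case empty then show ?case using v0 by auto
    next
      case (insert x B)
      then obtain h where h: "h \<in> V" "\<forall>z\<in>S. ev h z = ev v0 z - (\<Sum>x\<in>B. ev v0 x * ev (v x) z)" by auto
      obtain h' where "h' \<in> V" "\<forall>z\<in>S. ev h' z = ev h z + (- ev v0 x) * ev (v x) z"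
        using \<open>\<And>f g c. f \<in> V \<Longrightarrow> g \<in> V \<Longrightarrow> \<exists>h\<in>V. \<forall>z\<in>S. ev h z = ev f z + c * ev g z\<close>[OF h(1) A'(4)] insert.prems by blast
      then show ?case using h(2) insert.hyps by (intro bexI[of _ h']) auto
    qed
    from this[OF A'(1) order_refl] obtain v1 where v1: "v1 \<in> V"
      "\<And>z. z \<in> S \<Longrightarrow> ev v1 z = ev v0 z - (\<Sum>x\<in>A'. ev v0 x * ev (v x) z)" by blast
    have "ev f z = (\<Sum>x\<in>insert y A'. ev f x * ev ((v(y := v1)) x) z)" if f: "f \<in> V" and z: "z \<in> S" for f z
    proof -
      obtain h where h: "h \<in> V" "\<forall>z\<in>S. ev h z = ev f z + (- ev f y) * ev v0 z"
        using insert.prems(2)[OF f v0(1)] by blast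
      then have "h \<in> V'" using v0 f0(2) by (simp add: V'_def)
      from rep'[OF this z] have "ev f z - ev f y * ev v0 z = (\<Sum>x\<in>A'. ev h x * ev (v x) z)"
        using h z by simp
      also have "\<dots> = (\<Sum>x\<in>A'. (ev f x - ev f y * ev v0 x) * ev (v x) z)"
        using h A' by (intro sum.cong) auto
      also have "\<dots> = (\<Sum>x\<in>A'. ev f x * ev (v x) z) - ev f y * (\<Sum>x\<in>A'. ev v0 x * ev (v x) z)"
        by (simp add: left_diff_distrib sum_subtractf sum_distrib_left mult.assoc)
      finally have "ev f z = ev f y * ev v1 z + (\<Sum>x\<in>A'. ev f x * ev (v x) z)"
        unfolding v1(2)[OF z] by (simp add: algebra_simps)
      moreover have "(\<Sum>x\<in>A'. ev f x * ev ((v(y := v1)) x) z) = (\<Sum>x\<in>A'. ev f x * ev (v x) z)"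
        using A'(3) by (intro sum.cong) auto
      ultimately show ?thesis using A'(1,3) by simp
    qed
    note rep1 = this
    have "\<forall>x\<in>insert y A'. (v(y := v1)) x \<in> V" using A'(4) v1(1) by simp
    moreover have "finite (insert y A')" "insert y A' \<subseteq> S" using A'(1,2) f0(2) by auto
    moreover have "\<forall>f\<in>V. \<forall>z\<in>S. ev f z = (\<Sum>x\<in>insert y A'. ev f x * ev ((v(y := v1)) x) z)"
      by (intro ballI rep1)
    ultimately show ?thesis by blast
  qed
qed

text \<open>A node is a cell, a point of it and a coordinate direction.\<close>
lemma field_nodal_basis:
  fixes V :: "(cell \<Rightarrow> real^3 \<Rightarrow> 'b::euclidean_space) set"
  assumes T: "finite T"
    and poly: "\<And>f K b. f \<in> V \<Longrightarrow> K \<in> T \<Longrightarrow> b \<in> Basis \<Longrightarrow> (\<lambda>x. f K x \<bullet> b) \<in> P_poly k"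
    and closed: "\<And>f g c. f \<in> V \<Longrightarrow> g \<in> V \<Longrightarrow> (\<lambda>K x. f K x + c *\<^sub>R g K x) \<in> V"
  obtains A v where "finite A" "A \<subseteq> {(K, x, b). K \<in> T \<and> x \<in> K \<and> b \<in> Basis}" "\<And>y. y \<in> A \<Longrightarrow> v y \<in> V"
    "\<And>f K x. f \<in> V \<Longrightarrow> K \<in> T \<Longrightarrow> x \<in> K \<Longrightarrow> f K x = (\<Sum>(K', x', b)\<in>A. (f K' x' \<bullet> b) *\<^sub>R v (K', x', b) K x)"
proof -
  let ?S = "{(K, x, b). K \<in> T \<and> x \<in> K \<and> b \<in> (Basis :: 'b set)}"
  let ?ev = "\<lambda>(f :: cell \<Rightarrow> real^3 \<Rightarrow> 'b) (K, x, b). f K x \<bullet> b"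
  let ?J = "T \<times> (Basis :: 'b set) \<times> exponents k"
  let ?b = "\<lambda>(K', b', (i, j, l)) (K, x, b). if K = K' \<and> b = b' then monomial i j l x else 0"
  have "\<exists>A v. finite A \<and> A \<subseteq> ?S \<and> (\<forall>y\<in>A. v y \<in> V) \<and> (\<forall>f\<in>V. \<forall>z\<in>?S. ?ev f z = (\<Sum>y\<in>A. ?ev f y * ?ev (v y) z))"
  proof (rule nodal_basis[where J = ?J and b = ?b])
    show "finite ?J" using T by auto
    show "\<exists>a. \<forall>z\<in>?S. ?ev f z = (\<Sum>j\<in>?J. a j * ?b j z)" if f: "f \<in> V" for f
    proof -
      define a where "a K b = (SOME a. (\<lambda>x. f K x \<bullet> b) = (\<lambda>x. \<Sum>(i, j, l)\<in>exponents k. a (i, j, l) * monomial i j l x))" for K b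
      have a: "f K x \<bullet> b = (\<Sum>(i, j, l)\<in>exponents k. a K b (i, j, l) * monomial i j l x)" if "K \<in> T" "b \<in> Basis" for K b x
        using someI_ex[OF poly[OF f that, unfolded P_poly_iff]] unfolding a_def[symmetric] by (rule fun_cong)
      have "f K x \<bullet> b = (\<Sum>j\<in>?J. (\<lambda>(K', b', e). a K' b' e) j * ?b j (K, x, b))" if "K \<in> T" "b \<in> Basis" for K x b
      proof -
        have "(\<Sum>j\<in>?J. (\<lambda>(K', b', e). a K' b' e) j * ?b j (K, x, b))
           = (\<Sum>j\<in>{K} \<times> {b} \<times> exponents k. (\<lambda>(K', b', e). a K' b' e) j * ?b j (K, x, b))"
          by (rule sum.mono_neutral_right) (use that T in \<open>auto split: if_splits\<close>)
        also have "\<dots> = (\<Sum>(i, j, l)\<in>exponents k. a K b (i, j, l) * monomial i j l x)"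
        proof -
          have "{K} \<times> {b} \<times> exponents k = (\<lambda>e. (K, b, e)) ` exponents k" by auto
          then show ?thesis by (simp add: sum.reindex inj_on_def case_prod_beta)
        qed
        finally show ?thesis using a[OF that] by simp
      qed
      then show ?thesis by (intro exI[of _ "\<lambda>(K', b', e). a K' b' e"]) auto
    qed
    show "\<exists>h\<in>V. \<forall>z\<in>?S. ?ev h z = ?ev f z + c * ?ev g z" if "f \<in> V" "g \<in> V" for f g c
      using closed[OF that, of c] by (intro bexI[of _ "\<lambda>K x. f K x + c *\<^sub>R g K x"]) (auto simp: inner_add_left)
  qed
  then obtain A v where Av: "finite A \<and> A \<subseteq> ?S \<and> (\<forall>y\<in>A. v y \<in> V) \<and> (\<forall>f\<in>V. \<forall>z\<in>?S. ?ev f z = (\<Sum>y\<in>A. ?ev f y * ?ev (v y) z))"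
    by (elim exE) (rule that)
  note A = Av[THEN conjunct1] Av[THEN conjunct2, THEN conjunct1] Av[THEN conjunct2, THEN conjunct2, THEN conjunct1, rule_format]
  have rep: "?ev f z = (\<Sum>y\<in>A. ?ev f y * ?ev (v y) z)" if "f \<in> V" "z \<in> ?S" for f z
    by (rule Av[THEN conjunct2, THEN conjunct2, THEN conjunct2, THEN bspec, OF that(1), THEN bspec, OF that(2)])
  have "f K x = (\<Sum>(K', x', b)\<in>A. (f K' x' \<bullet> b) *\<^sub>R v (K', x', b) K x)" if "f \<in> V" "K \<in> T" "x \<in> K" for f K x
  proof (rule euclidean_eqI)
    fix b :: 'b assume "b \<in> Basis"
    with rep[OF that(1), of "(K, x, b)"] that(2,3)
    show "f K x \<bullet> b = (\<Sum>(K', x', b)\<in>A. (f K' x' \<bullet> b) *\<^sub>R v (K', x', b) K x) \<bullet> b"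
      by (simp add: inner_sum_left case_prod_beta)
  qed
  with A show ?thesis by (rule that)
qed

text \<open>A symmetric system is solvable if the right-hand side annihilates the kernel. The kernel is described
  by the quadratic form, since \<open>G\<close> will be the Gram matrix of a family that may be linearly
  dependent. Elimination of one row \<open>r\<close> leaves the Schur complement \<open>s\<close>; where it vanishes, the vector
  \<open>e\<close> is in the kernel and the equation of row \<open>r\<close> follows from the others.\<close>
lemma gram_system_solvable:
  fixes G :: "'a \<Rightarrow> 'a \<Rightarrow> real"
  assumes "finite A" and sym: "\<And>a b. G a b = G b a"
    and "\<And>d a. (\<Sum>a\<in>A. \<Sum>b\<in>A. d a * G a b * d b) = 0 \<Longrightarrow> a \<in> A \<Longrightarrow> (\<Sum>b\<in>A. G a b * d b) = 0"
    and "\<And>d. (\<Sum>a\<in>A. \<Sum>b\<in>A. d a * G a b * d b) = 0 \<Longrightarrow> (\<Sum>a\<in>A. d a * l a) = 0"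
  shows "\<exists>c. \<forall>a\<in>A. (\<Sum>b\<in>A. G a b * c b) = l a"
  using assms(1,3,4)
proof (induction A arbitrary: l rule: finite_induct)
  case empty then show ?case by auto
next
  case (insert r A)
  have null: "(\<Sum>b\<in>A. G a b * d b) = 0" "(\<Sum>a\<in>A. d a * l a) = 0"
    if d: "(\<Sum>a\<in>A. \<Sum>b\<in>A. d a * G a b * d b) = 0" and a: "a \<in> insert r A" for d a
  proof -
    define d' where "d' = d(r := 0)"
    have eq: "(\<Sum>b\<in>A. h b * d' b) = (\<Sum>b\<in>A. h b * d b)" for h
      using insert.hyps by (intro sum.cong) (auto simp: d'_def)
    have eq': "(\<Sum>b\<in>A. d' b * h b) = (\<Sum>b\<in>A. d b * h b)" for h
      using eq[of h] by (simp add: mult.commute)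
    have "(\<Sum>a\<in>insert r A. \<Sum>b\<in>insert r A. d' a * G a b * d' b) = (\<Sum>a\<in>A. d' a * (\<Sum>b\<in>A. G a b * d' b))"
      using insert.hyps by (simp add: d'_def sum_distrib_left mult.assoc)
    also have "\<dots> = 0" unfolding eq eq' using d by (simp add: sum_distrib_left mult.assoc)
    finally have z: "(\<Sum>a\<in>insert r A. \<Sum>b\<in>insert r A. d' a * G a b * d' b) = 0" .
    show "(\<Sum>b\<in>A. G a b * d b) = 0" using insert.prems(1)[OF z a] insert.hyps eq[of "G a"] by (simp add: d'_def)
    show "(\<Sum>a\<in>A. d a * l a) = 0" using insert.prems(2)[OF z] insert.hyps eq'[of l] by (simp add: d'_def)
  qed
  have "\<exists>p. \<forall>a\<in>A. (\<Sum>b\<in>A. G a b * p b) = G a r"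
  proof (rule insert.IH)
    fix d assume "(\<Sum>a\<in>A. \<Sum>b\<in>A. d a * G a b * d b) = 0"
    from null(1)[OF this, of r] show "(\<Sum>a\<in>A. d a * G a r) = 0" by (simp add: sym[of _ r] mult.commute)
  qed (use null in auto)
  then obtain p where p: "\<And>a. a \<in> A \<Longrightarrow> (\<Sum>b\<in>A. G a b * p b) = G a r" by blast
  have "\<exists>c. \<forall>a\<in>A. (\<Sum>b\<in>A. G a b * c b) = l a"
    by (rule insert.IH) (use null in auto)
  then obtain c where c: "\<And>a. a \<in> A \<Longrightarrow> (\<Sum>b\<in>A. G a b * c b) = l a" by blast
  define s where "s = G r r - (\<Sum>b\<in>A. G r b * p b)"
  define e where "e = (\<lambda>a. if a = r then 1 else - p a)"
  have sumA: "(\<Sum>b\<in>A. h b * e b) = - (\<Sum>b\<in>A. h b * p b)" for h :: "'a \<Rightarrow> real"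
    unfolding sum_negf[symmetric] using insert.hyps by (intro sum.cong) (auto simp: e_def)
  have row: "(\<Sum>b\<in>insert r A. G a b * e b) = (if a = r then s else 0)" if "a \<in> insert r A" for a
    using that insert.hyps p[of a] sumA[of "G a"] by (auto simp: s_def e_def)
  obtain t where t: "(\<Sum>b\<in>A. G r b * c b) + t * s = l r"
  proof (cases "s = 0")
    case False
    then show ?thesis using that[of "(l r - (\<Sum>b\<in>A. G r b * c b)) / s"] by simp
  next
    case True
    have "(\<Sum>a\<in>insert r A. \<Sum>b\<in>insert r A. e a * G a b * e b) = (\<Sum>a\<in>insert r A. e a * (\<Sum>b\<in>insert r A. G a b * e b))"
      by (simp only: sum_distrib_left mult.assoc)
    also have "\<dots> = 0" by (rule sum.neutral) (use row True in auto)
    finally have "(\<Sum>a\<in>insert r A. e a * l a) = 0" by (rule insert.prems(2))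
    then have "l r = (\<Sum>a\<in>A. p a * l a)" using insert.hyps sumA[of l] by (simp add: e_def mult.commute)
    also have "\<dots> = (\<Sum>a\<in>A. p a * (\<Sum>b\<in>A. G a b * c b))" using c by simp
    also have "\<dots> = (\<Sum>b\<in>A. (\<Sum>a\<in>A. G b a * p a) * c b)"
      unfolding sum_distrib_left sum_distrib_right by (subst sum.swap) (intro sum.cong refl, simp add: sym)
    also have "\<dots> = (\<Sum>b\<in>A. G r b * c b)" by (intro sum.cong refl) (simp add: p sym)
    finally show ?thesis using that[of 0] by simp
  qed
  define c' where "c' = (\<lambda>a. (if a = r then 0 else c a) + t * e a)"
  have "(\<Sum>b\<in>insert r A. G a b * c' b) = l a" if "a \<in> insert r A" for a
  proof -
    have "(\<Sum>b\<in>insert r A. G a b * c' b) = (\<Sum>b\<in>insert r A. G a b * (if b = r then 0 else c b)) + t * (\<Sum>b\<in>insert r A. G a b * e b)"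
      by (simp only: c'_def distrib_left sum.distrib sum_distrib_left mult.left_commute)
    also have "(\<Sum>b\<in>insert r A. G a b * (if b = r then 0 else c b)) = (\<Sum>b\<in>A. G a b * c b)"
      using insert.hyps by (simp, intro sum.cong) auto
    finally show ?thesis using row[OF that] that c t insert.hyps by auto
  qed
  then show ?case by blast
qed

section \<open>Meshes and broken functions\<close>

lemma integrable_on_compact:
  fixes f :: "real^3 \<Rightarrow> 'b::euclidean_space"
  assumes "compact K" "continuous_on K f"
  shows "integrable (lebesgue_on K) f"
proof -
  have "integrable lborel (\<lambda>x. indicator K x *\<^sub>R f x)" using borel_integrable_compact[OF assms] by simp
  then have "integrable lebesgue (\<lambda>x. indicator K x *\<^sub>R f x)"
    by (metis borel_measurable_integrable integrable_completion measurable_lborel1)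
  then show ?thesis using assms(1)
    by (subst integrable_restrict_space) (auto simp: borel_compact)
qed

lemma measurable_bounded_integrable:
  fixes f :: "real^3 \<Rightarrow> 'b::euclidean_space"
  assumes "S \<in> lmeasurable" "f \<in> borel_measurable (lebesgue_on S)" "\<And>x. x \<in> S \<Longrightarrow> norm (f x) \<le> B"
  shows "integrable (lebesgue_on S) f"
proof -
  interpret finite_measure "lebesgue_on S"
    using assms(1) by (rule finite_measure_lebesgue_on)
  show ?thesis using assms by (intro integrable_const_bound[where B = B]) auto
qed

locale mesh =
  fixes \<Omega> :: "(real^3) set" and T :: "cell set"
  assumes conforming: "conforming_mesh \<Omega> T"
begin

lemma finite_cells [simp]: "finite T"
  and open_domain: "open \<Omega>"
  and bounded_domain: "bounded \<Omega>"
  and domain_eq: "\<Omega> = interior (\<Union>T)"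
  using conforming by (auto simp: conforming_mesh_def)

lemma cell:
  assumes "K \<in> T"
  shows cell_polytope: "polytope K" and cell_interior: "interior K \<noteq> {}"
    and cell_compact: "compact K" and cell_convex: "convex K" and cell_closed: "closed K"
    and interior_cell_subset: "interior K \<subseteq> \<Omega>"
    and closure_interior_cell: "closure (interior K) = K"
proof -
  show p: "polytope K" "interior K \<noteq> {}" using assms conforming by (auto simp: conforming_mesh_def)
  show c: "compact K" "convex K" using p polytope_imp_compact polytope_imp_convex by auto
  then show "closed K" by (simp add: compact_imp_closed)
  then show "closure (interior K) = K" using convex_closure_interior[OF c(2) p(2)] by simp
  show "interior K \<subseteq> \<Omega>" using assms unfolding domain_eq by (intro interior_mono) auto
qed

lemma cell_interiors_disjoint: "K \<in> T \<Longrightarrow> K' \<in> T \<Longrightarrow> K \<noteq> K' \<Longrightarrow> interior K \<inter> interior K' = {}"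
  using conforming by (auto simp: conforming_mesh_def)

lemma domain_lmeasurable: "\<Omega> \<in> lmeasurable"
  using bounded_domain open_domain by (simp add: lmeasurable_open)

lemma cell_lmeasurable: "K \<in> T \<Longrightarrow> K \<in> lmeasurable"
  by (simp add: cell_compact lmeasurable_compact)

lemma cell_in_frontier:
  assumes "K \<in> T" "x \<in> K" "x \<notin> \<Omega>" shows "x \<in> frontier \<Omega>"
proof -
  have "x \<in> closure (interior K)" using assms closure_interior_cell by simp
  then have "x \<in> closure \<Omega>" using closure_mono[OF interior_cell_subset[OF assms(1)]] by blast
  then show ?thesis using assms(3) open_domain by (simp add: frontier_def interior_open)
qed

lemma domain_subset_cells: "\<Omega> \<subseteq> \<Union>T"
  unfolding domain_eq by (rule interior_subset)

subsection \<open>Mesh integrals\<close>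

lemma cell_bound:
  fixes g :: "cell \<Rightarrow> real^3 \<Rightarrow> 'b::real_normed_vector"
  assumes "\<And>K. K \<in> T \<Longrightarrow> continuous_on K (g K)"
  shows "\<exists>G\<ge>0. \<forall>K\<in>T. \<forall>x\<in>K. norm (g K x) \<le> G"
proof -
  have "\<exists>P. \<forall>x\<in>K. norm (g K x) \<le> P" if K: "K \<in> T" for K
    using compact_imp_bounded[OF compact_continuous_image[OF assms[OF K] cell_compact[OF K]]] unfolding bounded_iff by auto
  then obtain P where P: "\<And>K x. K \<in> T \<Longrightarrow> x \<in> K \<Longrightarrow> norm (g K x) \<le> P K" by metis
  show ?thesis
  proof (intro exI[of _ "\<Sum>K\<in>T. \<bar>P K\<bar>"] conjI ballI)
    fix K x assume K: "K \<in> T" "x \<in> K"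
    have "\<bar>P K\<bar> \<le> (\<Sum>K\<in>T. \<bar>P K\<bar>)" using K by (intro member_le_sum) auto
    then show "norm (g K x) \<le> (\<Sum>K\<in>T. \<bar>P K\<bar>)" using P[OF K] by linarith
  qed (simp add: sum_nonneg)
qed

lemma mesh_integral_cong:
  "(\<And>K x. K \<in> T \<Longrightarrow> x \<in> K \<Longrightarrow> f K x = g K x) \<Longrightarrow> mesh_integral T f = mesh_integral T g"
  unfolding mesh_integral_def by (intro sum.cong refl Bochner_Integration.integral_cong) auto

lemma integrable_on_cell: "K \<in> T \<Longrightarrow> continuous_on K (f :: _ \<Rightarrow> real) \<Longrightarrow> integrable (lebesgue_on K) f"
  by (rule integrable_on_compact[OF cell_compact])

lemma mesh_integral_add:
  assumes "\<And>K. K \<in> T \<Longrightarrow> continuous_on K (f K)" "\<And>K. K \<in> T \<Longrightarrow> continuous_on K (g K)"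
  shows "mesh_integral T (\<lambda>K x. f K x + g K x) = mesh_integral T f + mesh_integral T g"
  unfolding mesh_integral_def sum.distrib[symmetric] using assms
  by (intro sum.cong refl Bochner_Integration.integral_add integrable_on_cell)

lemma mesh_integral_diff:
  assumes "\<And>K. K \<in> T \<Longrightarrow> continuous_on K (f K)" "\<And>K. K \<in> T \<Longrightarrow> continuous_on K (g K)"
  shows "mesh_integral T (\<lambda>K x. f K x - g K x) = mesh_integral T f - mesh_integral T g"
  unfolding mesh_integral_def sum_subtractf[symmetric] using assms
  by (intro sum.cong refl Bochner_Integration.integral_diff integrable_on_cell)

lemma mesh_integral_scale: "mesh_integral T (\<lambda>K x. c * f K x) = c * mesh_integral T f"
  unfolding mesh_integral_def sum_distrib_left by simp

lemma mesh_integral_minus: "mesh_integral T (\<lambda>K x. - f K x) = - mesh_integral T f"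
  unfolding mesh_integral_def by (simp add: sum_negf)

lemma mesh_integral_zero: "mesh_integral T (\<lambda>K x. 0) = 0"
  unfolding mesh_integral_def by simp

lemma mesh_integral_sum:
  assumes "\<And>i K. i \<in> A \<Longrightarrow> K \<in> T \<Longrightarrow> continuous_on K (f i K)"
  shows "mesh_integral T (\<lambda>K x. \<Sum>i\<in>A. f i K x) = (\<Sum>i\<in>A. mesh_integral T (f i))"
  using assms
proof (induction A rule: infinite_finite_induct)
  case (insert a A)
  then show ?case by (simp add: mesh_integral_add continuous_on_sum)
qed (auto simp: mesh_integral_zero)

lemma mesh_integral_mono:
  assumes "\<And>K. K \<in> T \<Longrightarrow> continuous_on K (f K)" "\<And>K. K \<in> T \<Longrightarrow> continuous_on K (g K)"
    "\<And>K x. K \<in> T \<Longrightarrow> x \<in> K \<Longrightarrow> f K x \<le> g K x"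
  shows "mesh_integral T f \<le> mesh_integral T g"
  unfolding mesh_integral_def using assms
  by (intro sum_mono Bochner_Integration.integral_mono integrable_on_cell) auto

text \<open>The function vanishes almost everywhere on each cell, by continuity everywhere in its interior, and
  the cell is the closure of its interior.\<close>
lemma mesh_integral_eq_0D:
  assumes cont: "\<And>K. K \<in> T \<Longrightarrow> continuous_on K (f K)"
    and nonneg: "\<And>K x. K \<in> T \<Longrightarrow> x \<in> K \<Longrightarrow> 0 \<le> f K x"
    and "mesh_integral T f = 0" and K: "K \<in> T" "x \<in> K"
  shows "f K x = 0"
proof -
  have "(LINT x|lebesgue_on K. f K x) = 0"
  proof -
    have "\<forall>K\<in>T. 0 \<le> (LINT x|lebesgue_on K. f K x)"
      using nonneg by (intro ballI Bochner_Integration.integral_nonneg) auto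
    then show ?thesis using assms(3) K(1) unfolding mesh_integral_def by (simp add: sum_nonneg_eq_0_iff)
  qed
  then have "AE x in lebesgue_on K. f K x = 0"
    by (subst (asm) integral_nonneg_eq_0_iff_AE[OF integrable_on_cell[OF K(1) cont[OF K(1)]]])
      (auto intro!: AE_I2 nonneg[OF K(1)])
  then have AE: "AE x in lebesgue. x \<in> K \<longrightarrow> f K x = 0"
    using cell_lmeasurable[OF K(1)] by (subst (asm) AE_restrict_space_iff) auto
  have int0: "f K y = 0" if y: "y \<in> interior K" for y
  proof (rule ccontr)
    assume "f K y \<noteq> 0"
    have "open {z \<in> interior K. f K z \<noteq> 0}"
      using continuous_open_preimage[OF continuous_on_subset[OF cont[OF K(1)] interior_subset] open_interior open_Compl[OF closed_singleton[of 0]]]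
      by (simp add: vimage_def Int_def)
    moreover have "negligible {z \<in> interior K. f K z \<noteq> 0}"
    proof -
      obtain N where N: "N \<in> null_sets lebesgue" "{x. \<not> (x \<in> K \<longrightarrow> f K x = 0)} \<subseteq> N"
        using AE by (auto simp: eventually_ae_filter)
      have "negligible N" using N(1) by (simp add: negligible_iff_null_sets)
      then show ?thesis by (rule negligible_subset) (use N(2) interior_subset[of K] in auto)
    qed
    ultimately show False using open_not_negligible y \<open>f K y \<noteq> 0\<close> by blast
  qed
  show ?thesis
    using continuous_constant_on_closure[of "interior K" "f K" 0 x] int0 K cont closure_interior_cell[OF K(1)] by auto
qed

subsection \<open>Broken functions\<close>

lemma broken_bounded_measurable:
  fixes f :: "cell \<Rightarrow> real^3 \<Rightarrow> 'b::euclidean_space"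
  assumes "\<And>K. K \<in> T \<Longrightarrow> continuous_on K (f K)"
  shows "broken T f \<in> borel_measurable borel" "\<exists>B. \<forall>x. norm (broken T f x) \<le> B"
proof -
  show "broken T f \<in> borel_measurable borel"
    unfolding broken_def[abs_def]
  proof (rule borel_measurable_sum)
    fix K assume "K \<in> T"
    then show "(\<lambda>x. indicat_real (interior K) x *\<^sub>R f K x) \<in> borel_measurable borel"
      by (intro borel_measurable_continuous_on_indicator) (auto intro: continuous_on_subset[OF assms interior_subset])
  qed
  have "\<exists>B. \<forall>x. norm (indicat_real (interior K) x *\<^sub>R f K x) \<le> B" if K: "K \<in> T" for K
  proof -
    have "bounded (f K ` K)" using compact_continuous_image[OF assms[OF K] cell_compact[OF K]] compact_imp_bounded by blast
    then obtain B where "\<forall>x\<in>K. norm (f K x) \<le> B" unfolding bounded_iff by auto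
    then show ?thesis using interior_subset[of K]
      by (intro exI[of _ "max B 0"]) (auto simp: indicator_def le_max_iff_disj)
  qed
  then obtain B where "\<And>K x. K \<in> T \<Longrightarrow> norm (indicat_real (interior K) x *\<^sub>R f K x) \<le> B K" by metis
  then show "\<exists>B. \<forall>x. norm (broken T f x) \<le> B"
    by (intro exI[of _ "\<Sum>K\<in>T. B K"] allI) (unfold broken_def, rule sum_norm_le)
qed

lemma broken_L2:
  fixes f :: "cell \<Rightarrow> real^3 \<Rightarrow> 'b::euclidean_space"
  assumes "\<And>K. K \<in> T \<Longrightarrow> continuous_on K (f K)"
  shows "broken T f \<in> L2 \<Omega>"
proof -
  have m: "broken T f \<in> borel_measurable (lebesgue_on \<Omega>)"
    using broken_bounded_measurable(1)[OF assms] by (intro measurable_restrict_space1) (simp add: measurable_completion)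
  obtain B where B: "\<And>x. norm (broken T f x) \<le> B" using broken_bounded_measurable(2)[OF assms] by blast
  have "integrable (lebesgue_on \<Omega>) (\<lambda>x. (norm (broken T f x))\<^sup>2)"
    using m B by (intro measurable_bounded_integrable[OF domain_lmeasurable, of _ "B\<^sup>2"]) (auto intro: power_mono)
  with m show ?thesis by (simp add: L2_def)
qed

text \<open>The boundaries of the cells, on which broken functions are set to 0, are null sets by convexity.\<close>
lemma LINT_broken:
  assumes cont: "\<And>K. K \<in> T \<Longrightarrow> continuous_on K (h K)"
  shows "(LINT x|lebesgue_on \<Omega>. broken T h x) = mesh_integral T h"
    and "integrable (lebesgue_on \<Omega>) (broken T h)"
proof -
  have int: "integrable lebesgue (\<lambda>x. indicat_real K x *\<^sub>R h K x)" if K: "K \<in> T" for K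
    using integrable_on_cell[OF K cont[OF K]] cell_lmeasurable[OF K] by (subst (asm) integrable_restrict_space) auto
  have ae: "AE x in lebesgue. indicat_real K x *\<^sub>R h K x = indicat_real \<Omega> x * (indicat_real (interior K) x *\<^sub>R h K x)"
    if K: "K \<in> T" for K
  proof -
    have "frontier K \<in> null_sets lebesgue"
      using negligible_convex_frontier[OF cell_convex[OF K]] by (simp add: negligible_iff_null_sets)
    then have "AE x in lebesgue. x \<notin> frontier K" by (rule AE_not_in)
    then show ?thesis
    proof eventually_elim
      case (elim x)
      then show ?case using interior_cell_subset[OF K] interior_subset[of K] cell_closed[OF K]
        by (auto simp: frontier_def indicator_def)
    qed
  qed
  have m: "(\<lambda>x. indicat_real \<Omega> x * (indicat_real (interior K) x *\<^sub>R h K x)) \<in> borel_measurable lebesgue" if K: "K \<in> T" for K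
  proof -
    have "(\<lambda>x. indicat_real (interior K) x *\<^sub>R h K x) \<in> borel_measurable borel"
      by (rule borel_measurable_continuous_on_indicator) (auto intro: continuous_on_subset[OF cont[OF K] interior_subset])
    then show ?thesis using domain_lmeasurable by (intro borel_measurable_times) (auto simp: measurable_completion)
  qed
  have int2: "integrable lebesgue (\<lambda>x. indicat_real \<Omega> x * (indicat_real (interior K) x *\<^sub>R h K x))" if K: "K \<in> T" for K
    by (rule integrable_cong_AE_imp[OF int[OF K] m[OF K] ae[OF K]])
  have b: "indicat_real \<Omega> x *\<^sub>R broken T h x = (\<Sum>K\<in>T. indicat_real \<Omega> x * (indicat_real (interior K) x *\<^sub>R h K x))" for x
    by (simp only: broken_def real_scaleR_def sum_distrib_left)
  show "integrable (lebesgue_on \<Omega>) (broken T h)"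
  proof (subst integrable_restrict_space)
    show "integrable lebesgue (\<lambda>x. indicat_real \<Omega> x *\<^sub>R broken T h x)"
      unfolding b using int2 by (rule Bochner_Integration.integrable_sum)
  qed (use domain_lmeasurable in auto)
  have "(LINT x|lebesgue_on \<Omega>. broken T h x) = (LINT x|lebesgue. indicat_real \<Omega> x *\<^sub>R broken T h x)"
    by (rule integral_restrict_space) (use domain_lmeasurable in auto)
  also have "\<dots> = (LINT x|lebesgue. (\<Sum>K\<in>T. indicat_real \<Omega> x * (indicat_real (interior K) x *\<^sub>R h K x)))"
    unfolding b ..
  also have "\<dots> = (\<Sum>K\<in>T. (LINT x|lebesgue. indicat_real \<Omega> x * (indicat_real (interior K) x *\<^sub>R h K x)))"
    using int2 by (rule Bochner_Integration.integral_sum)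
  also have "\<dots> = (\<Sum>K\<in>T. (LINT x|lebesgue. indicat_real K x *\<^sub>R h K x))"
  proof (rule sum.cong[OF refl])
    fix K assume K: "K \<in> T"
    show "(LINT x|lebesgue. indicat_real \<Omega> x * (indicat_real (interior K) x *\<^sub>R h K x)) = (LINT x|lebesgue. indicat_real K x *\<^sub>R h K x)"
      by (rule integral_cong_AE[symmetric, OF borel_measurable_integrable[OF int[OF K]] m[OF K] ae[OF K]])
  qed
  also have "\<dots> = mesh_integral T h"
    unfolding mesh_integral_def using cell_lmeasurable
    by (intro sum.cong refl) (subst integral_restrict_space, auto)
  finally show "(LINT x|lebesgue_on \<Omega>. broken T h x) = mesh_integral T h" .
qed

lemma broken_inner: "broken T f x \<bullet> \<psi> x = broken T (\<lambda>K x. f K x \<bullet> \<psi> x) x"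
  by (simp add: broken_def inner_sum_left)

lemma LINT_broken_inner:
  fixes f :: "cell \<Rightarrow> real^3 \<Rightarrow> 'b::euclidean_space"
  assumes "\<And>K. K \<in> T \<Longrightarrow> continuous_on K (f K)" "continuous_on UNIV \<psi>"
  shows "(LINT x|lebesgue_on \<Omega>. broken T f x \<bullet> \<psi> x) = mesh_integral T (\<lambda>K x. f K x \<bullet> \<psi> x)"
    and "integrable (lebesgue_on \<Omega>) (\<lambda>x. broken T f x \<bullet> \<psi> x)"
  unfolding broken_inner using assms
  by (auto intro!: LINT_broken continuous_on_inner intro: continuous_on_subset)

end

section \<open>Differentiation of integrals with respect to time\<close>

text \<open>The difference quotients are dominated by the constant \<open>B\<close>. The Lipschitz bound is required
  at the single time \<open>t\<close> only, since absolutely continuous functions need not be Lipschitz in a neighbourhood.\<close>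
lemma has_vector_derivative_integral:
  fixes h :: "real \<Rightarrow> 'a \<Rightarrow> real"
  assumes "finite_measure M" and t: "t \<in> I"
    and int: "\<And>s. s \<in> I \<Longrightarrow> integrable M (h s)"
    and deriv: "\<And>x. x \<in> space M \<Longrightarrow> ((\<lambda>s. h s x) has_vector_derivative dh x) (at t within I)"
    and bound: "\<forall>\<^sub>F s in at t within I. \<forall>x\<in>space M. \<bar>h s x - h t x\<bar> \<le> B * \<bar>s - t\<bar>"
  shows "((\<lambda>s. integral\<^sup>L M (h s)) has_vector_derivative integral\<^sup>L M dh) (at t within I)"
proof -
  interpret finite_measure M by fact
  have "((\<lambda>s. (integral\<^sup>L M (h s) - integral\<^sup>L M (h t)) / (s - t)) \<longlongrightarrow> integral\<^sup>L M dh) (at t within I)"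
    unfolding tendsto_at_iff_sequentially
  proof (intro allI impI)
    fix S :: "nat \<Rightarrow> real"
    assume S: "\<forall>i. S i \<in> I - {t}" and lim: "S \<longlonglongrightarrow> t"
    have at: "filterlim S (at t within I) sequentially"
      using S lim by (auto simp: filterlim_at)
    have "\<forall>\<^sub>F i in sequentially. \<forall>x\<in>space M. \<bar>h (S i) x - h t x\<bar> \<le> B * \<bar>S i - t\<bar>"
      using at bound by (rule eventually_compose_filterlim[rotated])
    then obtain n0 where n0: "\<And>i x. i \<ge> n0 \<Longrightarrow> x \<in> space M \<Longrightarrow> \<bar>h (S i) x - h t x\<bar> \<le> B * \<bar>S i - t\<bar>"
      unfolding eventually_sequentially by blast
    let ?q = "\<lambda>i x. (h (S (i + n0)) x - h t x) / (S (i + n0) - t)"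
    have intq: "integrable M (?q i)" for i
      using int S t by (intro Bochner_Integration.integrable_divide Bochner_Integration.integrable_diff) auto
    have limq: "(\<lambda>i. ?q i x) \<longlonglongrightarrow> dh x" if x: "x \<in> space M" for x
    proof -
      have "((\<lambda>s. (h s x - h t x) / (s - t)) \<longlongrightarrow> dh x) (at t within I)"
        using deriv[OF x] unfolding has_real_derivative_iff_has_vector_derivative[symmetric] has_field_derivative_iff .
      then have "(\<lambda>i. (h (S i) x - h t x) / (S i - t)) \<longlonglongrightarrow> dh x"
        using at by (rule filterlim_compose)
      then show ?thesis by (rule LIMSEQ_ignore_initial_segment)
    qed
    have "(\<lambda>i. integral\<^sup>L M (?q i)) \<longlonglongrightarrow> integral\<^sup>L M dh"
    proof (rule integral_dominated_convergence)
      show "dh \<in> borel_measurable M"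
        by (rule borel_measurable_LIMSEQ_metric[OF borel_measurable_integrable[OF intq] limq])
      show "integrable M (\<lambda>x. \<bar>B\<bar>)" by simp
      show "AE x in M. norm (?q i x) \<le> \<bar>B\<bar>" for i
      proof (rule AE_I2)
        fix x assume x: "x \<in> space M"
        have ne: "S (i + n0) \<noteq> t" using S by auto
        have "\<bar>h (S (i + n0)) x - h t x\<bar> \<le> B * \<bar>S (i + n0) - t\<bar>" using n0[of "i + n0" x] x by simp
        also have "\<dots> \<le> \<bar>B\<bar> * \<bar>S (i + n0) - t\<bar>" by (intro mult_right_mono) auto
        finally show "norm (?q i x) \<le> \<bar>B\<bar>" using ne by (simp add: divide_le_eq)
      qed
    qed (use intq limq in \<open>auto intro: borel_measurable_integrable\<close>)
    moreover have "integral\<^sup>L M (?q i) = (integral\<^sup>L M (h (S (i + n0))) - integral\<^sup>L M (h t)) / (S (i + n0) - t)" for i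
      using int S t by (subst Bochner_Integration.integral_divide_zero) (auto simp: Bochner_Integration.integral_diff)
    ultimately have "(\<lambda>i. (integral\<^sup>L M (h (S (i + n0))) - integral\<^sup>L M (h t)) / (S (i + n0) - t)) \<longlonglongrightarrow> integral\<^sup>L M dh" by (simp only:)
    then show "((\<lambda>s. (integral\<^sup>L M (h s) - integral\<^sup>L M (h t)) / (s - t)) \<circ> S) \<longlonglongrightarrow> integral\<^sup>L M dh"
      unfolding comp_def by (rule LIMSEQ_offset)
  qed
  then show ?thesis
    unfolding has_real_derivative_iff_has_vector_derivative[symmetric] has_field_derivative_iff .
qed

lemma (in mesh) has_vector_derivative_mesh_integral:
  assumes t: "t \<in> I"
    and cont: "\<And>s K. s \<in> I \<Longrightarrow> K \<in> T \<Longrightarrow> continuous_on K (h s K)"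
    and deriv: "\<And>K x. K \<in> T \<Longrightarrow> x \<in> K \<Longrightarrow> ((\<lambda>s. h s K x) has_vector_derivative dh K x) (at t within I)"
    and bound: "\<forall>\<^sub>F s in at t within I. \<forall>K\<in>T. \<forall>x\<in>K. \<bar>h s K x - h t K x\<bar> \<le> B * \<bar>s - t\<bar>"
  shows "((\<lambda>s. mesh_integral T (h s)) has_vector_derivative mesh_integral T dh) (at t within I)"
  unfolding mesh_integral_def
proof (intro has_vector_derivative_sum)
  fix K assume K: "K \<in> T"
  have ev: "\<forall>\<^sub>F s in at t within I. \<forall>x\<in>K. \<bar>h s K x - h t K x\<bar> \<le> B * \<bar>s - t\<bar>"
    using bound by eventually_elim (use K in auto)
  show "((\<lambda>s. integral\<^sup>L (lebesgue_on K) (h s K)) has_vector_derivative integral\<^sup>L (lebesgue_on K) (dh K)) (at t within I)"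
  proof (rule has_vector_derivative_integral[where B = B])
    show "finite_measure (lebesgue_on K)" by (rule finite_measure_lebesgue_on[OF cell_lmeasurable[OF K]])
    show "integrable (lebesgue_on K) (h s K)" if "s \<in> I" for s
      by (rule integrable_on_cell[OF K cont[OF that K]])
    show "((\<lambda>s. h s K x) has_vector_derivative dh K x) (at t within I)" if "x \<in> space (lebesgue_on K)" for x
      using that deriv[OF K] by simp
    show "\<forall>\<^sub>F s in at t within I. \<forall>x\<in>space (lebesgue_on K). \<bar>h s K x - h t K x\<bar> \<le> B * \<bar>s - t\<bar>"
      using ev by simp
  qed (rule t)
qed

section \<open>Smooth cutoff functions of polyhedra\<close>

text \<open>The function \<open>exp (- 1 / s)\<close>, extended by 0, times a power of \<open>1 / s\<close>. With these factors the family is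
  closed under differentiation, up to linear combinations.\<close>
definition flat_exp :: "nat \<Rightarrow> real \<Rightarrow> real" where
  "flat_exp m s = (if s > 0 then inverse s ^ m * exp (- inverse s) else 0)"

lemma flat_exp_deriv:
  "(flat_exp m has_real_derivative (flat_exp (m + 2) s - real m * flat_exp (m + 1) s)) (at s)"
proof -
  consider "s > 0" | "s < 0" | "s = 0" by linarith
  then show ?thesis
  proof cases
    case 1
    have "((\<lambda>s. inverse s ^ m * exp (- inverse s)) has_real_derivative
      (real m * (- (inverse s ^ 2) * inverse s ^ (m - 1)) * exp (- inverse s) + exp (- inverse s) * inverse s ^ 2 * inverse s ^ m)) (at s)"
      using 1 by (auto intro!: derivative_eq_intros simp: power2_eq_square)
    also have "real m * (- (inverse s ^ 2) * inverse s ^ (m - 1)) * exp (- inverse s) + exp (- inverse s) * inverse s ^ 2 * inverse s ^ m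
      = inverse s ^ (m + 2) * exp (- inverse s) - real m * (inverse s ^ (m + 1) * exp (- inverse s))"
      by (cases m) (simp_all add: power2_eq_square algebra_simps)
    finally have "((\<lambda>s. inverse s ^ m * exp (- inverse s)) has_real_derivative
      (inverse s ^ (m + 2) * exp (- inverse s) - real m * (inverse s ^ (m + 1) * exp (- inverse s)))) (at s)" .
    moreover have "\<forall>\<^sub>F t in nhds s. inverse t ^ m * exp (- inverse t) = flat_exp m t"
      using eventually_nhds_in_open[of "{0<..}" s] 1 by (auto elim!: eventually_mono simp: flat_exp_def)
    ultimately have "(flat_exp m has_real_derivative
      (inverse s ^ (m + 2) * exp (- inverse s) - real m * (inverse s ^ (m + 1) * exp (- inverse s)))) (at s)"
      by (subst (asm) DERIV_cong_ev[OF refl _ refl])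
    then show ?thesis using 1 by (simp add: flat_exp_def)
  next
    case 2
    have "\<forall>\<^sub>F t in nhds s. 0 = flat_exp m t"
      using eventually_nhds_in_open[of "{..<0}" s] 2 by (auto elim!: eventually_mono simp: flat_exp_def)
    then have "(flat_exp m has_real_derivative 0) (at s)"
      using DERIV_cong_ev[OF refl _ refl, of "\<lambda>t. 0" "flat_exp m" s 0] by simp
    then show ?thesis using 2 by (simp add: flat_exp_def)
  next
    case 3
    have "((\<lambda>t. flat_exp m t / t) \<longlongrightarrow> 0) (at_right 0)"
    proof -
      have "((\<lambda>t::real. inverse t ^ (m + 1) / exp (inverse t)) \<longlongrightarrow> 0) (at_right 0)"
        by (rule filterlim_compose[OF tendsto_power_div_exp_0 filterlim_inverse_at_top_right])
      moreover have "\<forall>\<^sub>F t in at_right 0. inverse t ^ (m + 1) / exp (inverse t) = flat_exp m t / t"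
        unfolding eventually_at_right_field
        by (intro exI[of _ 1]) (auto simp: flat_exp_def exp_minus field_simps)
      ultimately show ?thesis by (rule Lim_transform_eventually)
    qed
    moreover have "((\<lambda>t. flat_exp m t / t) \<longlongrightarrow> 0) (at_left 0)"
    proof (rule Lim_transform_eventually[OF tendsto_const])
      show "\<forall>\<^sub>F t in at_left 0. 0 = flat_exp m t / t"
        unfolding eventually_at_left_field
        by (intro exI[of _ "-1"]) (auto simp: flat_exp_def)
    qed
    ultimately have "((\<lambda>t. flat_exp m t / t) \<longlongrightarrow> 0) (at 0)"
      by (simp add: filterlim_split_at)
    then show ?thesis using 3 by (simp add: has_field_derivative_iff flat_exp_def)
  qed
qed

lemma smooth_flat_exp: "smooth (\<lambda>x. flat_exp m (a \<bullet> x + \<beta>))"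
  unfolding smooth_def
proof
  have D: "((\<lambda>x. flat_exp m (a \<bullet> x + \<beta>)) has_derivative
     (\<lambda>h. (flat_exp (m + 2) (a \<bullet> x + \<beta>) - real m * flat_exp (m + 1) (a \<bullet> x + \<beta>)) * (a \<bullet> h))) (at x)" for m x
  proof -
    have 1: "((\<lambda>x. a \<bullet> x + \<beta>) has_derivative (\<lambda>h. a \<bullet> h)) (at x)" by (auto intro!: derivative_eq_intros)
    show ?thesis using has_derivative_compose[OF 1 flat_exp_deriv[unfolded has_field_derivative_def]] by simp
  qed
  fix n show "C_diff n (\<lambda>x. flat_exp m (a \<bullet> x + \<beta>))"
  proof (induction n arbitrary: m)
    case 0
    show ?case using D by (simp add: continuous_on_eq_continuous_within) (meson has_derivative_continuous)
  next
    case (Suc n)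
    have "partial i (\<lambda>x. flat_exp m (a \<bullet> x + \<beta>)) = (\<lambda>x. (a $ i) * (flat_exp (m + 2) (a \<bullet> x + \<beta>) + (- real m) * flat_exp (m + 1) (a \<bullet> x + \<beta>)))" for i
      by (rule ext, subst partial_eqI[OF D]) (simp add: inner_axis algebra_simps)
    moreover have "C_diff n (\<lambda>x. (a $ i) * (flat_exp (m + 2) (a \<bullet> x + \<beta>) + (- real m) * flat_exp (m + 1) (a \<bullet> x + \<beta>)))" for i
      by (intro C_diff_linear[OF bounded_linear_mult_right] C_diff_add Suc)
    moreover have "(\<lambda>x. flat_exp m (a \<bullet> x + \<beta>)) differentiable (at x)" for x
      using D unfolding differentiable_def by blast
    ultimately show ?case by (simp only: C_diff.simps) simp
  qed
qed

lemma flat_exp_0_bounds: "0 \<le> flat_exp 0 s" "flat_exp 0 s \<le> 1"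
  by (auto simp: flat_exp_def)

lemma flat_exp_0_limit:
  assumes "y > 0" shows "(\<lambda>n. flat_exp 0 (real (Suc n) * y - 1)) \<longlonglongrightarrow> 1"
proof -
  have 1: "filterlim (\<lambda>n. real (Suc n) * y - 1) at_top sequentially"
  proof -
    have "filterlim (\<lambda>n. (y - 1) + y * real n) at_top sequentially"
      by (rule filterlim_tendsto_add_at_top[OF tendsto_const filterlim_tendsto_pos_mult_at_top[OF tendsto_const assms filterlim_real_sequentially]])
    then show ?thesis by (simp add: algebra_simps)
  qed
  have "((\<lambda>s. exp (- inverse s)) \<longlongrightarrow> exp (- 0)) (at_top :: real filter)"
    by (intro tendsto_intros tendsto_inverse_0_at_top filterlim_ident)
  then have "((\<lambda>s. flat_exp 0 s) \<longlongrightarrow> exp (- 0)) (at_top :: real filter)"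
    by (rule Lim_transform_eventually) (use eventually_gt_at_top[of 0] in \<open>auto elim!: eventually_mono simp: flat_exp_def\<close>)
  from filterlim_compose[OF this 1] show ?thesis by simp
qed

text \<open>A product over the half-spaces whose intersection is the polyhedron. In the \<open>n\<close>-th cutoff each factor is
  shifted inwards so that it vanishes within the slack \<open>1 / (n + 1)\<close> of its half-space, which keeps the support
  away from the boundary.\<close>
lemma polyhedron_cutoffs:
  fixes K :: "(real^3) set"
  assumes "polyhedron K" "bounded K"
  obtains \<kappa> :: "nat \<Rightarrow> real^3 \<Rightarrow> real" and C where
    "\<And>n. smooth (\<kappa> n)" "\<And>n x. 0 \<le> \<kappa> n x" "\<And>n x. \<kappa> n x \<le> 1"
    "\<And>n. compact (C n)" "\<And>n. C n \<subseteq> interior K" "\<And>n x. x \<notin> C n \<Longrightarrow> \<kappa> n x = 0"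
    "\<And>x. x \<in> interior K \<Longrightarrow> (\<lambda>n. \<kappa> n x) \<longlonglongrightarrow> 1"
proof -
  obtain H where H: "finite H" "K = \<Inter>H" "\<forall>h\<in>H. \<exists>a b. a \<noteq> 0 \<and> h = {x. a \<bullet> x \<le> b}"
    using assms(1) unfolding polyhedron_def by blast
  from H(3) obtain a b where ab: "\<And>h. h \<in> H \<Longrightarrow> a h \<noteq> 0" "\<And>h. h \<in> H \<Longrightarrow> h = {x. a h \<bullet> x \<le> b h}" by metis
  define \<kappa> where "\<kappa> n x = (\<Prod>h\<in>H. flat_exp 0 (real (Suc n) * (b h - a h \<bullet> x) - 1))" for n x
  define C where "C n = (\<Inter>h\<in>H. {x. a h \<bullet> x \<le> b h - 1 / real (Suc n)}) \<inter> closure K" for n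
  show thesis
  proof (rule that[of \<kappa> C])
    fix n x
    show "smooth (\<kappa> n)" unfolding \<kappa>_def[abs_def]
    proof (rule smooth_prod)
      fix h
      have "(\<lambda>x. flat_exp 0 (real (Suc n) * (b h - a h \<bullet> x) - 1)) = (\<lambda>x. flat_exp 0 ((- real (Suc n) *\<^sub>R a h) \<bullet> x + (real (Suc n) * b h - 1)))"
        by (simp add: algebra_simps)
      then show "smooth (\<lambda>x. flat_exp 0 (real (Suc n) * (b h - a h \<bullet> x) - 1))" by (simp only: smooth_flat_exp)
    qed
    show "0 \<le> \<kappa> n x" "\<kappa> n x \<le> 1" unfolding \<kappa>_def using flat_exp_0_bounds by (auto intro!: prod_nonneg prod_le_1)
    show "compact (C n)" unfolding C_def using assms(2)
      by (intro closed_Int_compact) (auto simp: compact_closure intro!: closed_INT closed_halfspace_le)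
    have "\<Inter>H \<inter> (\<Inter>h\<in>H. {x. a h \<bullet> x < b h}) = (\<Inter>h\<in>H. {x. a h \<bullet> x < b h})" using ab by fastforce
    moreover have "open (\<Inter>h\<in>H. {x. a h \<bullet> x < b h})" using H(1) by (intro open_INT) (auto simp: open_halfspace_lt)
    ultimately have "(\<Inter>h\<in>H. {x. a h \<bullet> x < b h}) \<subseteq> interior K" unfolding H(2) by (intro interior_maximal) auto
    moreover have "C n \<subseteq> (\<Inter>h\<in>H. {x. a h \<bullet> x < b h})"
    proof -
      have "a h \<bullet> x < b h" if "x \<in> C n" "h \<in> H" for x h
      proof -
        have "a h \<bullet> x \<le> b h - 1 / real (Suc n)" using that unfolding C_def by blast
        moreover have "1 / real (Suc n) > 0" by simp
        ultimately show ?thesis by linarith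
      qed
      then show ?thesis by blast
    qed
    ultimately show "C n \<subseteq> interior K" by blast
    show "\<kappa> n x = 0" if x: "x \<notin> C n"
    proof -
      have "\<exists>h\<in>H. b h - 1 / real (Suc n) < a h \<bullet> x"
      proof (rule ccontr)
        assume "\<not> ?thesis"
        then have le: "\<And>h. h \<in> H \<Longrightarrow> a h \<bullet> x \<le> b h - 1 / real (Suc n)" by (auto simp: not_less)
        have "a h \<bullet> x \<le> b h" if "h \<in> H" for h using le[OF that] by (rule order_trans) simp
        then have "x \<in> h" if "h \<in> H" for h using ab(2)[OF that] that by blast
        then have "x \<in> closure K" unfolding H(2) using closure_subset by blast
        with le have "x \<in> C n" unfolding C_def by blast
        with x show False ..
      qed
      then obtain h where h: "h \<in> H" "b h - 1 / real (Suc n) < a h \<bullet> x" by blast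
      have "real (Suc n) * (b h - a h \<bullet> x) \<le> real (Suc n) * (1 / real (Suc n))"
        using h(2) by (intro mult_left_mono) auto
      then have "flat_exp 0 (real (Suc n) * (b h - a h \<bullet> x) - 1) = 0" by (simp add: flat_exp_def del: of_nat_Suc)
      then show ?thesis unfolding \<kappa>_def using h(1) H(1) by (auto intro: prod_zero)
    qed
  next
    fix x assume x: "x \<in> interior K"
    have "a h \<bullet> x < b h" if h: "h \<in> H" for h
    proof -
      have "interior K \<subseteq> interior h" using h H(2) by (intro interior_mono) auto
      then show ?thesis using x interior_halfspace_le[OF ab(1)[OF h], of "b h"] ab(2)[OF h] by auto
    qed
    then have "(\<lambda>n. \<Prod>h\<in>H. flat_exp 0 (real (Suc n) * (b h - a h \<bullet> x) - 1)) \<longlonglongrightarrow> (\<Prod>h\<in>H. 1)"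
      by (intro tendsto_prod flat_exp_0_limit) simp
    then show "(\<lambda>n. \<kappa> n x) \<longlonglongrightarrow> 1" by (simp add: \<kappa>_def)
  qed
qed

section \<open>Compactly supported functions\<close>

definition supported_in :: "(real^3) set \<Rightarrow> (real^3 \<Rightarrow> 'b::real_normed_vector) \<Rightarrow> bool" where
  "supported_in S \<psi> \<longleftrightarrow> (\<exists>C. compact C \<and> C \<subseteq> S \<and> (\<forall>x. x \<notin> C \<longrightarrow> \<psi> x = 0))"

lemma test_functions_iff: "\<psi> \<in> test_functions S \<longleftrightarrow> smooth \<psi> \<and> supported_in S \<psi>"
  by (auto simp: test_functions_def smooth_def supported_in_def)

lemma supported_in_mono: "supported_in S \<psi> \<Longrightarrow> S \<subseteq> S' \<Longrightarrow> supported_in S' \<psi>"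
  unfolding supported_in_def by blast

lemma supported_in_zero: "supported_in S \<psi> \<Longrightarrow> x \<notin> S \<Longrightarrow> \<psi> x = 0"
  unfolding supported_in_def by blast

lemma supported_in_imp: "supported_in S f \<Longrightarrow> (\<And>x. f x = 0 \<Longrightarrow> g x = 0) \<Longrightarrow> supported_in S g"
  unfolding supported_in_def by blast

lemma supported_in_partial:
  assumes "supported_in S f" shows "supported_in S (partial i f)"
proof -
  obtain C where C: "compact C" "C \<subseteq> S" "\<And>x. x \<notin> C \<Longrightarrow> f x = 0" using assms unfolding supported_in_def by blast
  have "partial i f x = 0" if "x \<notin> C" for x
  proof -
    have "(f has_derivative (\<lambda>h. 0)) (at x)"
      by (rule has_derivative_transform_within_open[of "\<lambda>x. 0" _ _ _ "- C"])
         (use that C compact_imp_closed in auto)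
    then show ?thesis by (rule partial_eqI)
  qed
  then show ?thesis using C unfolding supported_in_def by blast
qed

lemma supported_bounded:
  fixes f :: "real^3 \<Rightarrow> 'b::real_normed_vector"
  assumes "supported_in S f" "continuous_on UNIV f"
  obtains B where "B > 0" "\<And>x. norm (f x) \<le> B"
proof -
  obtain C where C: "compact C" "\<And>x. x \<notin> C \<Longrightarrow> f x = 0" using assms unfolding supported_in_def by blast
  have "bounded (f ` C)" using compact_continuous_image[OF continuous_on_subset[OF assms(2)] C(1)] compact_imp_bounded by blast
  then obtain B where B: "\<And>x. x \<in> C \<Longrightarrow> norm (f x) \<le> B" unfolding bounded_iff by auto
  show thesis
  proof (rule that[of "max B 1"])
    fix x show "norm (f x) \<le> max B 1" using B[of x] C(2)[of x] by (cases "x \<in> C") auto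
  qed simp
qed

lemma LINT_supported:
  fixes f :: "real^3 \<Rightarrow> real"
  assumes "S \<in> sets lebesgue" "\<And>x. x \<notin> S \<Longrightarrow> f x = 0"
  shows "(LINT x|lebesgue_on S. f x) = (LINT x|lebesgue. f x)"
proof -
  have "(\<lambda>x. indicator S x *\<^sub>R f x) = f" using assms(2) by (force simp: indicator_def fun_eq_iff)
  moreover have "(LINT x|lebesgue_on S. f x) = (LINT x|lebesgue. indicator S x *\<^sub>R f x)"
    using assms(1) by (intro integral_restrict_space) simp
  ultimately show ?thesis by simp
qed

lemma LINT_translate:
  fixes f :: "real^3 \<Rightarrow> real"
  assumes "continuous_on UNIV f"
  shows "(LINT x|lebesgue. f (c + x)) = (LINT x|lebesgue. f x)"
proof -
  have m: "f \<in> borel_measurable borel" using assms by (rule borel_measurable_continuous_onI)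
  have m': "(\<lambda>x. f (c + x)) \<in> borel_measurable borel" using m by measurable
  have "(LINT x|lborel. f x) = (LINT x|distr lborel borel ((+) c). f x)" by (simp only: lborel_distr_plus)
  also have "\<dots> = (LINT x|lborel. f (c + x))" using m by (intro integral_distr) auto
  finally show ?thesis using m m' by (simp add: integral_completion)
qed

text \<open>The factor 3 is the number of coordinates.\<close>
lemma smooth_lipschitz:
  assumes f: "smooth f" and B: "\<And>x i. norm (partial i f x) \<le> B"
  shows "norm (f (x + v) - f x) \<le> 3 * B * norm v"
proof -
  have B0: "B \<ge> 0" using B norm_ge_zero order_trans by blast
  have "norm (f (x + 1 *\<^sub>R v) - f (x + 0 *\<^sub>R v)) \<le> (3 * B * norm v) * norm (1 - 0 :: real)"
  proof (rule differentiable_bound[of "{0..1}" _ "\<lambda>s h. h *\<^sub>R (\<Sum>i\<in>UNIV. v $ i *\<^sub>R partial i f (x + s *\<^sub>R v))"])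
    fix s :: real
    show "((\<lambda>s. f (x + s *\<^sub>R v)) has_derivative (\<lambda>h. h *\<^sub>R (\<Sum>i\<in>UNIV. v $ i *\<^sub>R partial i f (x + s *\<^sub>R v)))) (at s within {0..1})"
      using smooth_line_derivative[OF f] unfolding has_vector_derivative_def .
    have "norm (\<Sum>i\<in>UNIV. v $ i *\<^sub>R partial i f (x + s *\<^sub>R v)) \<le> (\<Sum>i\<in>(UNIV::3 set). norm v * B)"
    proof (rule sum_norm_le)
      fix i show "norm (v $ i *\<^sub>R partial i f (x + s *\<^sub>R v)) \<le> norm v * B"
        using component_le_norm_cart[of v i] B[of i "x + s *\<^sub>R v"] by (simp add: mult_mono)
    qed
    then have "norm (\<Sum>i\<in>UNIV. v $ i *\<^sub>R partial i f (x + s *\<^sub>R v)) \<le> 3 * B * norm v" by (simp add: mult_ac)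
    then show "onorm (\<lambda>h. h *\<^sub>R (\<Sum>i\<in>UNIV. v $ i *\<^sub>R partial i f (x + s *\<^sub>R v))) \<le> 3 * B * norm v"
      by (intro onorm_bound) (use B0 in \<open>auto simp: mult.commute intro!: mult_left_mono\<close>)
  qed auto
  then show ?thesis by simp
qed

lemma supported_partials_bounded:
  fixes f :: "real^3 \<Rightarrow> real"
  assumes f: "smooth f" "supported_in S f"
  obtains B where "\<And>i x. norm (partial i f x) \<le> B"
proof -
  have "\<exists>B>0. \<forall>x. norm (partial i f x) \<le> B" for i
    by (rule supported_bounded[OF supported_in_partial[OF f(2), of i] smooth_continuous[OF smooth_partial[OF f(1)]]]) blast
  then obtain Bi where Bi: "\<And>i. Bi i > 0" "\<And>i x. norm (partial i f x) \<le> Bi i" by metis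
  define B where "B = (\<Sum>i\<in>UNIV. Bi i)"
  have "norm (partial i f x) \<le> B" for i x
  proof -
    have "Bi i \<le> B" unfolding B_def by (rule member_le_sum) (auto intro: less_imp_le Bi(1))
    then show ?thesis using Bi(2)[of i x] by linarith
  qed
  then show thesis by (rule that)
qed

text \<open>Translations do not change the integral, and its derivative with respect to the translation is the
  integral of the partial derivative. Enlarging the radius by 1 leaves room for translations of
  length less than 1.\<close>
lemma LINT_partial_eq_0:
  fixes f :: "real^3 \<Rightarrow> real"
  assumes f: "smooth f" "supported_in S f"
  shows "(LINT x|lebesgue. partial i f x) = 0"
proof -
  obtain C where C: "compact C" "\<And>x. x \<notin> C \<Longrightarrow> f x = 0" using f unfolding supported_in_def by blast
  obtain R where "\<forall>x\<in>C. norm x \<le> R" using compact_imp_bounded[OF C(1)] unfolding bounded_iff by blast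
  then have R: "C \<subseteq> cball 0 R" by auto
  obtain B where B: "\<And>i x. norm (partial i f x) \<le> B" using supported_partials_bounded[OF f] by blast
  let ?K = "cball 0 (R + 1) :: (real^3) set"
  let ?e = "axis i 1 :: real^3"
  have D: "((\<lambda>s. integral\<^sup>L (lebesgue_on ?K) (\<lambda>x. f (x + s *\<^sub>R ?e))) has_vector_derivative
      integral\<^sup>L (lebesgue_on ?K) (partial i f)) (at 0 within {-1<..<1})"
  proof (rule has_vector_derivative_integral[where B = "3 * B"])
    show "finite_measure (lebesgue_on ?K)" by (rule finite_measure_lebesgue_on) (simp add: lmeasurable_compact)
    show "integrable (lebesgue_on ?K) (\<lambda>x. f (x + s *\<^sub>R ?e))" for s
      by (intro integrable_on_compact continuous_on_compose2[OF smooth_continuous[OF f(1), of UNIV]] continuous_intros) auto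
    show "((\<lambda>s. f (x + s *\<^sub>R ?e)) has_vector_derivative partial i f x) (at 0 within {-1<..<1})" for x
      using smooth_line_derivative_axis[OF f(1), of x i 0] by simp
    have "\<bar>f (x + s *\<^sub>R ?e) - f (x + 0 *\<^sub>R ?e)\<bar> \<le> 3 * B * \<bar>s - 0\<bar>" for s x
      using smooth_lipschitz[OF f(1) B, of x "s *\<^sub>R ?e"] by simp
    then show "\<forall>\<^sub>F s in at 0 within {-1<..<1}. \<forall>x\<in>space (lebesgue_on ?K). \<bar>f (x + s *\<^sub>R ?e) - f (x + 0 *\<^sub>R ?e)\<bar> \<le> 3 * B * \<bar>s - 0\<bar>"
      by (intro always_eventually allI ballI)
  qed auto
  have const: "integral\<^sup>L (lebesgue_on ?K) (\<lambda>x. f (x + s *\<^sub>R ?e)) = (LINT x|lebesgue. f x)" if s: "s \<in> {-1<..<1}" for s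
  proof -
    have "integral\<^sup>L (lebesgue_on ?K) (\<lambda>x. f (x + s *\<^sub>R ?e)) = (LINT x|lebesgue. f (x + s *\<^sub>R ?e))"
    proof (rule LINT_supported)
      fix x :: "real^3" assume "x \<notin> ?K"
      then have "norm x > R + 1" by simp
      moreover have "norm x \<le> norm (x + s *\<^sub>R ?e) + norm (s *\<^sub>R ?e)"
        using norm_triangle_ineq4[of "x + s *\<^sub>R ?e" "s *\<^sub>R ?e"] by simp
      moreover have "norm (s *\<^sub>R ?e) < 1" using s by auto
      ultimately have "x + s *\<^sub>R ?e \<notin> cball 0 R" by simp
      then show "f (x + s *\<^sub>R ?e) = 0" using R C(2) by blast
    qed simp
    also have "\<dots> = (LINT x|lebesgue. f (s *\<^sub>R ?e + x))" by (simp add: add.commute)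
    also have "\<dots> = (LINT x|lebesgue. f x)" by (rule LINT_translate[OF smooth_continuous[OF f(1)]])
    finally show ?thesis .
  qed
  have "((\<lambda>s. integral\<^sup>L (lebesgue_on ?K) (\<lambda>x. f (x + s *\<^sub>R ?e))) has_vector_derivative 0) (at 0 within {-1<..<1})"
    by (rule has_vector_derivative_transform[OF _ const has_vector_derivative_const]) auto
  then have "integral\<^sup>L (lebesgue_on ?K) (partial i f) = 0"
    using D vector_derivative_unique_at by (simp add: at_within_open[of 0 "{-1<..<1::real}"])
  moreover have "integral\<^sup>L (lebesgue_on ?K) (partial i f) = (LINT x|lebesgue. partial i f x)"
  proof (rule LINT_supported)
    fix x assume "x \<notin> ?K"
    then have "x \<notin> cball 0 R" by simp
    moreover have "supported_in (cball 0 R) f" using C R unfolding supported_in_def by blast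
    ultimately show "partial i f x = 0" using supported_in_zero[OF supported_in_partial] by blast
  qed simp
  ultimately show ?thesis by simp
qed

section \<open>Integration by parts\<close>

lemma bounded_bilinear_cross3: "bounded_bilinear cross3"
proof
  show "\<exists>C. \<forall>a b. norm (cross3 a b) \<le> norm a * norm b * C"
  proof (intro exI[of _ 1] allI)
    fix a b :: "real^3"
    have "(norm (cross3 a b))\<^sup>2 \<le> (norm a * norm b)\<^sup>2"
      unfolding norm_cross power_mult_distrib by simp
    then have "norm (cross3 a b) \<le> norm a * norm b" by (rule power2_le_imp_le) simp
    then show "norm (cross3 a b) \<le> norm a * norm b * 1" by simp
  qed
qed (simp_all add: cross_add_left cross_add_right cross_mult_left cross_mult_right)

lemma smooth_cross3: "smooth f \<Longrightarrow> smooth g \<Longrightarrow> smooth (\<lambda>x. cross3 (f x) (g x))"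
  by (rule smooth_bilinear[OF bounded_bilinear_cross3])

lemma supported_in_nth: "supported_in S f \<Longrightarrow> supported_in S (\<lambda>x. f x $ i)"
  by (erule supported_in_imp) simp

lemma supported_in_grad: "supported_in S f \<Longrightarrow> supported_in S (grad f)"
proof -
  assume "supported_in S f"
  then obtain C where C: "compact C" "C \<subseteq> S" "\<And>x. x \<notin> C \<Longrightarrow> f x = 0" unfolding supported_in_def by blast
  then have "supported_in C f" unfolding supported_in_def by blast
  then have "partial i f x = 0" if "x \<notin> C" for i x
    using supported_in_partial supported_in_zero that by blast
  then show ?thesis using C unfolding supported_in_def by (intro exI[of _ C]) (auto simp: vec_eq_iff)
qed

lemma supported_in_curl: "supported_in S f \<Longrightarrow> supported_in S (curl f)"
proof -
  assume "supported_in S f"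
  then obtain C where C: "compact C" "C \<subseteq> S" "\<And>x. x \<notin> C \<Longrightarrow> f x = 0" unfolding supported_in_def by blast
  then have "supported_in C f" unfolding supported_in_def by blast
  then have "partial i f x = 0" if "x \<notin> C" for i x
    using supported_in_partial supported_in_zero that by blast
  then show ?thesis using C unfolding supported_in_def
    by (intro exI[of _ C]) (auto simp: vec_eq_iff forall_3 curl_nth)
qed

lemma integral_by_parts:
  fixes f \<psi> :: "real^3 \<Rightarrow> real"
  assumes K: "compact K" and f: "smooth f" and \<psi>: "smooth \<psi>" "supported_in K \<psi>"
  shows "(LINT x|lebesgue_on K. partial i f x * \<psi> x) = - (LINT x|lebesgue_on K. f x * partial i \<psi> x)"
proof -
  have p: "partial i (\<lambda>x. f x * \<psi> x) = (\<lambda>x. f x * partial i \<psi> x + partial i f x * \<psi> x)"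
    by (intro ext partial_bilinear[OF bounded_bilinear_mult] smooth_differentiable f \<psi>)
  have s: "supported_in K (\<lambda>x. f x * \<psi> x)" by (rule supported_in_imp[OF \<psi>(2)]) simp
  have "(LINT x|lebesgue_on K. partial i (\<lambda>x. f x * \<psi> x) x) = (LINT x|lebesgue. partial i (\<lambda>x. f x * \<psi> x) x)"
    using K by (intro LINT_supported supported_in_zero[OF supported_in_partial[OF s]]) (auto simp: borel_compact)
  also have "\<dots> = 0" by (rule LINT_partial_eq_0[OF smooth_mult[OF f \<psi>(1)] s])
  finally have "(LINT x|lebesgue_on K. f x * partial i \<psi> x + partial i f x * \<psi> x) = 0" unfolding p .
  moreover have "(LINT x|lebesgue_on K. f x * partial i \<psi> x + partial i f x * \<psi> x)
     = (LINT x|lebesgue_on K. f x * partial i \<psi> x) + (LINT x|lebesgue_on K. partial i f x * \<psi> x)"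
    by (intro Bochner_Integration.integral_add integrable_on_compact K smooth_continuous smooth_mult smooth_partial f \<psi>)
  ultimately show ?thesis by simp
qed

lemma div_cross:
  assumes "f differentiable (at x)" "g differentiable (at x)"
  shows "(\<Sum>i\<in>UNIV. partial i (\<lambda>x. cross3 (f x) (g x) $ i) x) = curl f x \<bullet> g x - f x \<bullet> curl g x"
proof -
  have d: "(\<lambda>x. cross3 (f x) (g x)) differentiable (at x)"
    by (rule differentiable_bilinear[OF bounded_bilinear_cross3 assms])
  have "partial i (\<lambda>x. cross3 (f x) (g x) $ i) x = (cross3 (f x) (partial i g x) + cross3 (partial i f x) (g x)) $ i" for i
    by (simp only: partial_nth[OF d] partial_bilinear[OF bounded_bilinear_cross3 assms])
  then show ?thesis
    by (simp add: sum_3 cross_components inner_vec_def curl_nth algebra_simps)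
qed

text \<open>The difference of the two integrands is a divergence.\<close>
lemma integral_curl_by_parts:
  fixes f \<psi> :: "real^3 \<Rightarrow> real^3"
  assumes K: "compact K" and f: "smooth f" and \<psi>: "smooth \<psi>" "supported_in K \<psi>"
  shows "(LINT x|lebesgue_on K. curl f x \<bullet> \<psi> x) = (LINT x|lebesgue_on K. f x \<bullet> curl \<psi> x)"
proof -
  define h where "h i x = cross3 (f x) (\<psi> x) $ i" for i x
  have sm: "smooth (h i)" for i unfolding h_def by (intro smooth_nth smooth_cross3 f \<psi>)
  have s: "supported_in K (h i)" for i by (rule supported_in_imp[OF \<psi>(2)]) (simp add: h_def)
  have z: "(LINT x|lebesgue_on K. partial i (h i) x) = 0" for i
  proof -
    have "(LINT x|lebesgue_on K. partial i (h i) x) = (LINT x|lebesgue. partial i (h i) x)"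
      using K by (intro LINT_supported supported_in_zero[OF supported_in_partial[OF s]]) (auto simp: borel_compact)
    then show ?thesis using LINT_partial_eq_0[OF sm s] by simp
  qed
  have "(LINT x|lebesgue_on K. curl f x \<bullet> \<psi> x) - (LINT x|lebesgue_on K. f x \<bullet> curl \<psi> x)
     = (LINT x|lebesgue_on K. curl f x \<bullet> \<psi> x - f x \<bullet> curl \<psi> x)"
    by (intro Bochner_Integration.integral_diff[symmetric] integrable_on_compact K smooth_continuous smooth_bilinear[OF bounded_bilinear_inner] smooth_curl f \<psi>)
  also have "\<dots> = (LINT x|lebesgue_on K. (\<Sum>i\<in>UNIV. partial i (h i) x))"
    unfolding h_def by (subst div_cross) (auto intro: smooth_differentiable f \<psi>)
  also have "\<dots> = (\<Sum>i\<in>UNIV. (LINT x|lebesgue_on K. partial i (h i) x))"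
    by (intro Bochner_Integration.integral_sum integrable_on_compact K smooth_continuous smooth_partial sm)
  finally show ?thesis using z by simp
qed

lemma L2_integrable:
  fixes u :: "real^3 \<Rightarrow> 'b::euclidean_space"
  assumes "S \<in> lmeasurable" "u \<in> L2 S"
  shows "integrable (lebesgue_on S) u"
proof -
  interpret finite_measure "lebesgue_on S" using assms(1) by (rule finite_measure_lebesgue_on)
  have "integrable (lebesgue_on S) (\<lambda>x. 1 + (norm (u x))\<^sup>2)" using assms(2) by (auto simp: L2_def)
  then show ?thesis
  proof (rule Bochner_Integration.integrable_bound)
    have "norm (u x) \<le> 1 + (norm (u x))\<^sup>2" for x
    proof -
      have "0 \<le> (norm (u x) - 1/2)\<^sup>2" by simp
      then show ?thesis by (simp add: power2_eq_square algebra_simps)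
    qed
    then show "AE x in lebesgue_on S. norm (u x) \<le> norm (1 + (norm (u x))\<^sup>2)" by simp
  qed (use assms(2) in \<open>auto simp: L2_def\<close>)
qed

lemma integrable_inner_bounded:
  fixes u :: "real^3 \<Rightarrow> 'b::euclidean_space"
  assumes "integrable (lebesgue_on S) u" "continuous_on UNIV \<psi>" "\<And>x. norm (\<psi> x) \<le> B"
  shows "integrable (lebesgue_on S) (\<lambda>x. u x \<bullet> \<psi> x)"
proof (rule Bochner_Integration.integrable_bound)
  show "integrable (lebesgue_on S) (\<lambda>x. B * norm (u x))" using assms(1) by auto
  have "\<psi> \<in> borel_measurable (lebesgue_on S)"
    using borel_measurable_continuous_onI[OF assms(2)] by (intro measurable_restrict_space1) (simp add: measurable_completion)
  then show "(\<lambda>x. u x \<bullet> \<psi> x) \<in> borel_measurable (lebesgue_on S)"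
    using borel_measurable_integrable[OF assms(1)] by (rule borel_measurable_inner[rotated])
  have "B \<ge> 0" using assms(3) norm_ge_zero order_trans by blast
  moreover have "\<bar>u x \<bullet> \<psi> x\<bar> \<le> B * norm (u x)" for x
    using Cauchy_Schwarz_ineq2[of "u x" "\<psi> x"] mult_left_mono[OF assms(3)[of x] norm_ge_zero[of "u x"]] by (simp add: mult.commute)
  ultimately show "AE x in lebesgue_on S. norm (u x \<bullet> \<psi> x) \<le> norm (B * norm (u x))" by simp
qed

section \<open>Weak derivatives of broken functions\<close>

context mesh
begin

text \<open>Cutting a test function off inside the cells changes the integral arbitrarily little, since what is
  lost concentrates on the boundaries of the cells. This localization turns information on single
  cells into information across faces.\<close>
lemma integral_eq_0_if_locally:
  fixes u :: "real^3 \<Rightarrow> 'b::euclidean_space"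
  assumes u: "integrable (lebesgue_on \<Omega>) u"
    and local: "\<And>K \<psi>. K \<in> T \<Longrightarrow> smooth \<psi> \<Longrightarrow> supported_in (interior K) \<psi> \<Longrightarrow> (LINT x|lebesgue_on \<Omega>. u x \<bullet> \<psi> x) = 0"
    and \<psi>: "\<psi> \<in> test_functions \<Omega>"
  shows "(LINT x|lebesgue_on \<Omega>. u x \<bullet> \<psi> x) = 0"
proof -
  have sm: "smooth \<psi>" and sup: "supported_in \<Omega> \<psi>" using \<psi> by (auto simp: test_functions_iff)
  obtain B where B: "\<And>x. norm (\<psi> x) \<le> B" using supported_bounded[OF sup smooth_continuous[OF sm]] by metis
  have int: "integrable (lebesgue_on \<Omega>) (\<lambda>x. u x \<bullet> \<psi> x)"
    by (rule integrable_inner_bounded[OF u smooth_continuous[OF sm] B])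
  have int_K: "integrable (lebesgue_on \<Omega>) (\<lambda>x. indicat_real (interior K) x * (u x \<bullet> \<psi> x))" if K: "K \<in> T" for K
  proof -
    have "interior K \<in> sets (lebesgue_on \<Omega>)"
      using domain_lmeasurable interior_cell_subset[OF K] by (simp add: sets_restrict_space_iff)
    from integrable_real_mult_indicator[OF this int] show ?thesis by (simp add: mult.commute)
  qed
  have zero: "(LINT x|lebesgue_on \<Omega>. indicat_real (interior K) x * (u x \<bullet> \<psi> x)) = 0" if K: "K \<in> T" for K
  proof -
    have p: "polyhedron K" "bounded K"
      using cell_polytope[OF K] polytope_imp_polyhedron polytope_imp_bounded by auto
    show ?thesis
    proof (rule polyhedron_cutoffs[OF p])
    fix \<kappa> :: "nat \<Rightarrow> real^3 \<Rightarrow> real" and C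
    assume \<kappa>: "\<And>n. smooth (\<kappa> n)" "\<And>n x. 0 \<le> \<kappa> n x" "\<And>n x. \<kappa> n x \<le> 1"
      and C: "\<And>n. compact (C n)" "\<And>n. C n \<subseteq> interior K" "\<And>n x. x \<notin> C n \<Longrightarrow> \<kappa> n x = 0"
      and lim: "\<And>x. x \<in> interior K \<Longrightarrow> (\<lambda>n. \<kappa> n x) \<longlonglongrightarrow> 1"
    have "(\<lambda>n. LINT x|lebesgue_on \<Omega>. u x \<bullet> (\<kappa> n x *\<^sub>R \<psi> x)) \<longlonglongrightarrow> (LINT x|lebesgue_on \<Omega>. indicat_real (interior K) x * (u x \<bullet> \<psi> x))"
    proof (rule integral_dominated_convergence)
      show "integrable (lebesgue_on \<Omega>) (\<lambda>x. \<bar>u x \<bullet> \<psi> x\<bar>)" using int by simp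
      have m: "smooth (\<lambda>x. \<kappa> n x *\<^sub>R \<psi> x)" for n by (intro smooth_bilinear[OF bounded_bilinear_scaleR] \<kappa> sm)
      have "norm (\<kappa> n x *\<^sub>R \<psi> x) \<le> B" for n x
      proof -
        have "\<bar>\<kappa> n x\<bar> * norm (\<psi> x) \<le> 1 * B" using \<kappa>(2,3)[of n x] B[of x] by (intro mult_mono) auto
        then show ?thesis by simp
      qed
      from integrable_inner_bounded[OF u smooth_continuous[OF m] this]
      show "(\<lambda>x. u x \<bullet> (\<kappa> n x *\<^sub>R \<psi> x)) \<in> borel_measurable (lebesgue_on \<Omega>)" for n by (rule borel_measurable_integrable)
      show "(\<lambda>x. indicat_real (interior K) x * (u x \<bullet> \<psi> x)) \<in> borel_measurable (lebesgue_on \<Omega>)"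
        by (rule borel_measurable_integrable[OF int_K[OF K]])
      show "AE x in lebesgue_on \<Omega>. (\<lambda>n. u x \<bullet> (\<kappa> n x *\<^sub>R \<psi> x)) \<longlonglongrightarrow> indicat_real (interior K) x * (u x \<bullet> \<psi> x)"
      proof (rule AE_I2)
        fix x
        have "(\<lambda>n. \<kappa> n x) \<longlonglongrightarrow> indicat_real (interior K) x"
        proof (cases "x \<in> interior K")
          case True then show ?thesis using lim by simp
        next
          case False
          then have "\<kappa> n x = 0" for n using C(2,3) by blast
          then show ?thesis using False by simp
        qed
        from tendsto_mult_right[OF this, of "u x \<bullet> \<psi> x"]
        show "(\<lambda>n. u x \<bullet> (\<kappa> n x *\<^sub>R \<psi> x)) \<longlonglongrightarrow> indicat_real (interior K) x * (u x \<bullet> \<psi> x)" by simp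
      qed
      show "AE x in lebesgue_on \<Omega>. norm (u x \<bullet> (\<kappa> n x *\<^sub>R \<psi> x)) \<le> \<bar>u x \<bullet> \<psi> x\<bar>" for n
      proof (rule AE_I2)
        fix x
        have "\<bar>\<kappa> n x\<bar> * \<bar>u x \<bullet> \<psi> x\<bar> \<le> 1 * \<bar>u x \<bullet> \<psi> x\<bar>" using \<kappa>(2,3)[of n x] by (intro mult_right_mono) auto
        then show "norm (u x \<bullet> (\<kappa> n x *\<^sub>R \<psi> x)) \<le> \<bar>u x \<bullet> \<psi> x\<bar>" by (simp add: abs_mult)
      qed
    qed
    moreover have "(LINT x|lebesgue_on \<Omega>. u x \<bullet> (\<kappa> n x *\<^sub>R \<psi> x)) = 0" for n
    proof (rule local[OF K])
      show "smooth (\<lambda>x. \<kappa> n x *\<^sub>R \<psi> x)" by (intro smooth_bilinear[OF bounded_bilinear_scaleR] \<kappa> sm)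
      show "supported_in (interior K) (\<lambda>x. \<kappa> n x *\<^sub>R \<psi> x)"
        unfolding supported_in_def using C by (intro exI[of _ "C n"]) auto
    qed
    ultimately show ?thesis by (simp add: LIMSEQ_const_iff)
    qed
  qed
  have "AE x in lebesgue. \<forall>K\<in>T. x \<notin> frontier K"
  proof (rule AE_finite_allI[OF finite_cells])
    fix K assume K: "K \<in> T"
    have "frontier K \<in> null_sets lebesgue"
      using negligible_convex_frontier[OF cell_convex[OF K]] by (simp add: negligible_iff_null_sets)
    then show "AE x in lebesgue. x \<notin> frontier K" by (rule AE_not_in)
  qed
  then have ae: "AE x in lebesgue_on \<Omega>. u x \<bullet> \<psi> x = (\<Sum>K\<in>T. indicat_real (interior K) x * (u x \<bullet> \<psi> x))"
    using domain_lmeasurable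
  proof (subst AE_restrict_space_iff, simp, elim eventually_mono, intro impI)
    fix x assume fr: "\<forall>K\<in>T. x \<notin> frontier K" and x: "x \<in> \<Omega>"
    obtain K where K: "K \<in> T" "x \<in> K" using domain_subset_cells x by blast
    have xi: "x \<in> interior K" using fr K cell_closed[OF K(1)] by (auto simp: frontier_def)
    have "(\<Sum>K'\<in>T. indicat_real (interior K') x * (u x \<bullet> \<psi> x)) = (\<Sum>K'\<in>T. if K' = K then u x \<bullet> \<psi> x else 0)"
      using cell_interiors_disjoint[OF _ K(1)] xi by (intro sum.cong) (auto simp: indicator_def)
    then show "u x \<bullet> \<psi> x = (\<Sum>K\<in>T. indicat_real (interior K) x * (u x \<bullet> \<psi> x))" using K by simp
  qed
  have "(LINT x|lebesgue_on \<Omega>. u x \<bullet> \<psi> x) = (LINT x|lebesgue_on \<Omega>. (\<Sum>K\<in>T. indicat_real (interior K) x * (u x \<bullet> \<psi> x)))"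
    by (rule integral_cong_AE[OF borel_measurable_integrable[OF int]
          borel_measurable_integrable[OF Bochner_Integration.integrable_sum[OF int_K]] ae])
  also have "\<dots> = (\<Sum>K\<in>T. (LINT x|lebesgue_on \<Omega>. indicat_real (interior K) x * (u x \<bullet> \<psi> x)))"
    by (rule Bochner_Integration.integral_sum[OF int_K])
  finally show ?thesis using zero by simp
qed

lemma mesh_integral_supported:
  assumes K: "K \<in> T" and "\<And>K' x. K' \<in> T \<Longrightarrow> x \<in> K' \<Longrightarrow> x \<notin> interior K \<Longrightarrow> f K' x = 0"
  shows "mesh_integral T f = (LINT x|lebesgue_on K. f K x)"
proof -
  have "(LINT x|lebesgue_on K'. f K' x) = (if K' = K then (LINT x|lebesgue_on K. f K x) else 0)" if K': "K' \<in> T" for K'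
  proof (cases "K' = K")
    case False
    have "x \<notin> interior K" if "x \<in> K'" for x
    proof
      assume "x \<in> interior K"
      then have "interior K \<inter> closure (interior K') \<noteq> {}" using that closure_interior_cell[OF K'] by blast
      then have "interior K \<inter> interior K' \<noteq> {}" using open_Int_closure_eq_empty[OF open_interior] by blast
      then show False using cell_interiors_disjoint[OF K K'] False by blast
    qed
    then have "(LINT x|lebesgue_on K'. f K' x) = (LINT x|lebesgue_on K'. 0)"
      using assms(2)[OF K'] by (intro Bochner_Integration.integral_cong) auto
    then show ?thesis using False by simp
  qed simp
  then have "mesh_integral T f = (\<Sum>K'\<in>T. if K' = K then (LINT x|lebesgue_on K. f K x) else 0)"
    unfolding mesh_integral_def by (intro sum.cong refl)
  then show ?thesis using K by simp
qed

text \<open>Within a cell the weak gradient is the classical one, by integration by parts; the difference \<open>u\<close> of the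
  weak gradient and the cellwise gradient is thus orthogonal to the test functions of each cell, and
  by localization to all test functions. The equation has no boundary terms at the faces, which is
  the conformity of \<open>\<phi>\<close>.\<close>
theorem H1_mesh:
  assumes sm: "\<And>K. K \<in> T \<Longrightarrow> smooth (\<phi> K)" and "broken T \<phi> \<in> H1 \<Omega>" and \<psi>: "\<psi> \<in> test_functions \<Omega>"
  shows "mesh_integral T (\<lambda>K x. partial i (\<phi> K) x * \<psi> x) = - mesh_integral T (\<lambda>K x. \<phi> K x * partial i \<psi> x)"
proof -
  obtain g where g: "has_weak_grad \<Omega> (broken T \<phi>) g" using assms(2) unfolding H1_def by blast
  define u where "u x = g x $ i - broken T (\<lambda>K. partial i (\<phi> K)) x" for x
  have gi: "integrable (lebesgue_on \<Omega>) (\<lambda>x. g x $ i)"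
    using L2_integrable[OF domain_lmeasurable, of g] g integrable_bounded_linear[OF bounded_linear_vec_nth]
    unfolding has_weak_grad_def by blast
  have bi: "integrable (lebesgue_on \<Omega>) (broken T (\<lambda>K. partial i (\<phi> K)))"
    by (intro LINT_broken smooth_continuous smooth_partial sm)
  have eq: "(LINT x|lebesgue_on \<Omega>. u x \<bullet> \<psi> x) = - mesh_integral T (\<lambda>K x. \<phi> K x * partial i \<psi> x) - mesh_integral T (\<lambda>K x. partial i (\<phi> K) x * \<psi> x)"
    if \<psi>: "\<psi> \<in> test_functions \<Omega>" for \<psi>
  proof -
    have s: "smooth \<psi>" "supported_in \<Omega> \<psi>" using \<psi> by (auto simp: test_functions_iff)
    obtain B where B: "\<And>x. norm (\<psi> x) \<le> B" using supported_bounded[OF s(2) smooth_continuous[OF s(1)]] by metis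
    have "(LINT x|lebesgue_on \<Omega>. u x \<bullet> \<psi> x) = (LINT x|lebesgue_on \<Omega>. g x $ i \<bullet> \<psi> x - broken T (\<lambda>K. partial i (\<phi> K)) x \<bullet> \<psi> x)"
      by (simp add: u_def left_diff_distrib)
    also have "\<dots> = (LINT x|lebesgue_on \<Omega>. g x $ i \<bullet> \<psi> x) - (LINT x|lebesgue_on \<Omega>. broken T (\<lambda>K. partial i (\<phi> K)) x \<bullet> \<psi> x)"
      by (intro Bochner_Integration.integral_diff integrable_inner_bounded[OF _ _ B] gi bi smooth_continuous s)
    also have "(LINT x|lebesgue_on \<Omega>. broken T (\<lambda>K. partial i (\<phi> K)) x \<bullet> \<psi> x) = mesh_integral T (\<lambda>K x. partial i (\<phi> K) x \<bullet> \<psi> x)"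
      by (intro LINT_broken_inner smooth_continuous smooth_partial sm s)
    also have "(LINT x|lebesgue_on \<Omega>. g x $ i \<bullet> \<psi> x) = - (LINT x|lebesgue_on \<Omega>. broken T \<phi> x \<bullet> partial i \<psi> x)"
      using g \<psi> unfolding has_weak_grad_def by simp
    also have "(LINT x|lebesgue_on \<Omega>. broken T \<phi> x \<bullet> partial i \<psi> x) = mesh_integral T (\<lambda>K x. \<phi> K x \<bullet> partial i \<psi> x)"
      by (intro LINT_broken_inner smooth_continuous smooth_partial sm s)
    finally show ?thesis by simp
  qed
  have "(LINT x|lebesgue_on \<Omega>. u x \<bullet> \<psi> x) = 0"
  proof (rule integral_eq_0_if_locally[OF _ _ \<psi>])
    show "integrable (lebesgue_on \<Omega>) u" unfolding u_def[abs_def] using gi bi by (rule Bochner_Integration.integrable_diff)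
    fix K and \<psi>' :: "real^3 \<Rightarrow> real" assume K: "K \<in> T" and \<psi>': "smooth \<psi>'" "supported_in (interior K) \<psi>'"
    have t: "\<psi>' \<in> test_functions \<Omega>"
      using \<psi>' supported_in_mono[OF _ interior_cell_subset[OF K]] by (auto simp: test_functions_iff)
    have "mesh_integral T (\<lambda>K x. \<phi> K x * partial i \<psi>' x) = (LINT x|lebesgue_on K. \<phi> K x * partial i \<psi>' x)"
      "mesh_integral T (\<lambda>K x. partial i (\<phi> K) x * \<psi>' x) = (LINT x|lebesgue_on K. partial i (\<phi> K) x * \<psi>' x)"
      using supported_in_zero[OF \<psi>'(2)] supported_in_zero[OF supported_in_partial[OF \<psi>'(2)]]
      by (auto intro!: mesh_integral_supported[OF K])
    then show "(LINT x|lebesgue_on \<Omega>. u x \<bullet> \<psi>' x) = 0"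
      using eq[OF t] integral_by_parts[OF cell_compact[OF K] sm[OF K] \<psi>'(1) supported_in_mono[OF \<psi>'(2) interior_subset], of i] by simp
  qed
  then show ?thesis using eq[OF \<psi>] by simp
qed

text \<open>The same localization for the curl; here the absence of face terms says that the tangential traces match.\<close>
theorem Hcurl_mesh:
  assumes sm: "\<And>K. K \<in> T \<Longrightarrow> smooth (E K)" and "broken T E \<in> Hcurl \<Omega>" and \<psi>: "\<psi> \<in> test_functions \<Omega>"
  shows "mesh_integral T (\<lambda>K x. curl (E K) x \<bullet> \<psi> x) = mesh_integral T (\<lambda>K x. E K x \<bullet> curl \<psi> x)"
proof -
  obtain g where g: "has_weak_curl \<Omega> (broken T E) g" using assms(2) unfolding Hcurl_def mem_Collect_eq by (rule exE)
  define u where "u x = g x - broken T (\<lambda>K. curl (E K)) x" for x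
  have gi: "integrable (lebesgue_on \<Omega>) g"
    using L2_integrable[OF domain_lmeasurable, of g] g unfolding has_weak_curl_def by simp
  have bi: "integrable (lebesgue_on \<Omega>) (broken T (\<lambda>K. curl (E K)))"
    by (intro L2_integrable[OF domain_lmeasurable] broken_L2 smooth_continuous smooth_curl sm)
  have eq: "(LINT x|lebesgue_on \<Omega>. u x \<bullet> \<psi> x) = mesh_integral T (\<lambda>K x. E K x \<bullet> curl \<psi> x) - mesh_integral T (\<lambda>K x. curl (E K) x \<bullet> \<psi> x)"
    if \<psi>: "\<psi> \<in> test_functions \<Omega>" for \<psi>
  proof -
    have s: "smooth \<psi>" "supported_in \<Omega> \<psi>" using \<psi> by (auto simp: test_functions_iff)
    obtain B where B: "\<And>x. norm (\<psi> x) \<le> B" using supported_bounded[OF s(2) smooth_continuous[OF s(1)]] by metis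
    have "(LINT x|lebesgue_on \<Omega>. u x \<bullet> \<psi> x) = (LINT x|lebesgue_on \<Omega>. g x \<bullet> \<psi> x - broken T (\<lambda>K. curl (E K)) x \<bullet> \<psi> x)"
      by (simp add: u_def inner_diff_left)
    also have "\<dots> = (LINT x|lebesgue_on \<Omega>. g x \<bullet> \<psi> x) - (LINT x|lebesgue_on \<Omega>. broken T (\<lambda>K. curl (E K)) x \<bullet> \<psi> x)"
      by (intro Bochner_Integration.integral_diff integrable_inner_bounded[OF _ _ B] gi bi smooth_continuous s)
    also have "(LINT x|lebesgue_on \<Omega>. broken T (\<lambda>K. curl (E K)) x \<bullet> \<psi> x) = mesh_integral T (\<lambda>K x. curl (E K) x \<bullet> \<psi> x)"
      by (intro LINT_broken_inner smooth_continuous smooth_curl sm s)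
    also have "(LINT x|lebesgue_on \<Omega>. g x \<bullet> \<psi> x) = (LINT x|lebesgue_on \<Omega>. broken T E x \<bullet> curl \<psi> x)"
      using g \<psi> unfolding has_weak_curl_def by simp
    also have "(LINT x|lebesgue_on \<Omega>. broken T E x \<bullet> curl \<psi> x) = mesh_integral T (\<lambda>K x. E K x \<bullet> curl \<psi> x)"
      by (intro LINT_broken_inner smooth_continuous smooth_curl sm s)
    finally show ?thesis .
  qed
  have "(LINT x|lebesgue_on \<Omega>. u x \<bullet> \<psi> x) = 0"
  proof (rule integral_eq_0_if_locally[OF _ _ \<psi>])
    show "integrable (lebesgue_on \<Omega>) u" unfolding u_def[abs_def] using gi bi by (rule Bochner_Integration.integrable_diff)
    fix K and \<psi>' :: "real^3 \<Rightarrow> real^3" assume K: "K \<in> T" and \<psi>': "smooth \<psi>'" "supported_in (interior K) \<psi>'"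
    have t: "\<psi>' \<in> test_functions \<Omega>"
      using \<psi>' supported_in_mono[OF _ interior_cell_subset[OF K]] by (auto simp: test_functions_iff)
    have "mesh_integral T (\<lambda>K x. E K x \<bullet> curl \<psi>' x) = (LINT x|lebesgue_on K. E K x \<bullet> curl \<psi>' x)"
      "mesh_integral T (\<lambda>K x. curl (E K) x \<bullet> \<psi>' x) = (LINT x|lebesgue_on K. curl (E K) x \<bullet> \<psi>' x)"
      using supported_in_zero[OF \<psi>'(2)] supported_in_zero[OF supported_in_curl[OF \<psi>'(2)]]
      by (auto intro!: mesh_integral_supported[OF K])
    then show "(LINT x|lebesgue_on \<Omega>. u x \<bullet> \<psi>' x) = 0"
      using eq[OF t] integral_curl_by_parts[OF cell_compact[OF K] sm[OF K] \<psi>'(1) supported_in_mono[OF \<psi>'(2) interior_subset]] by simp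
  qed
  then show ?thesis using eq[OF \<psi>] by simp
qed

text \<open>Since \<open>\<phi>\<close> is conforming, the cellwise gradient may be moved to the test function, where the divergence
  of a curl vanishes.\<close>
theorem broken_grad_weak_curl:
  assumes sm: "\<And>K. K \<in> T \<Longrightarrow> smooth (\<phi> K)" and H1: "broken T \<phi> \<in> H1 \<Omega>"
  shows "has_weak_curl \<Omega> (broken T (\<lambda>K. grad (\<phi> K))) (\<lambda>x. 0)"
  unfolding has_weak_curl_def
proof (intro conjI ballI)
  show "broken T (\<lambda>K. grad (\<phi> K)) \<in> L2 \<Omega>" by (intro broken_L2 smooth_continuous smooth_grad sm)
  show "(\<lambda>x. 0) \<in> L2 \<Omega>" by (simp add: L2_def)
  fix \<psi> :: "real^3 \<Rightarrow> real^3" assume \<psi>: "\<psi> \<in> test_functions \<Omega>"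
  then have s: "smooth \<psi>" "supported_in \<Omega> \<psi>" by (auto simp: test_functions_iff)
  have c: "(\<lambda>x. curl \<psi> x $ i) \<in> test_functions \<Omega>" for i
    by (simp add: test_functions_iff smooth_nth smooth_curl supported_in_nth supported_in_curl s)
  have "(LINT x|lebesgue_on \<Omega>. broken T (\<lambda>K. grad (\<phi> K)) x \<bullet> curl \<psi> x) = mesh_integral T (\<lambda>K x. grad (\<phi> K) x \<bullet> curl \<psi> x)"
    by (intro LINT_broken_inner smooth_continuous smooth_grad smooth_curl sm s)
  also have "\<dots> = mesh_integral T (\<lambda>K x. \<Sum>i\<in>UNIV. partial i (\<phi> K) x * curl \<psi> x $ i)"
    by (simp add: inner_vec_def)
  also have "\<dots> = (\<Sum>i\<in>UNIV. mesh_integral T (\<lambda>K x. partial i (\<phi> K) x * curl \<psi> x $ i))"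
    by (intro mesh_integral_sum smooth_continuous smooth_mult smooth_partial smooth_nth smooth_curl sm s)
  also have "\<dots> = (\<Sum>i\<in>UNIV. - mesh_integral T (\<lambda>K x. \<phi> K x * partial i (\<lambda>x. curl \<psi> x $ i) x))"
    by (intro sum.cong refl H1_mesh[OF sm H1 c])
  also have "\<dots> = - mesh_integral T (\<lambda>K x. \<Sum>i\<in>UNIV. \<phi> K x * partial i (\<lambda>x. curl \<psi> x $ i) x)"
    unfolding sum_negf
    by (subst mesh_integral_sum) (auto intro!: smooth_continuous smooth_mult smooth_partial smooth_nth smooth_curl sm s)
  also have "(\<lambda>K x. \<Sum>i\<in>UNIV. \<phi> K x * partial i (\<lambda>x. curl \<psi> x $ i) x) = (\<lambda>K x. 0)"
  proof (intro ext)
    fix K x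
    have "(\<Sum>i\<in>UNIV. \<phi> K x * partial i (\<lambda>x. curl \<psi> x $ i) x) = \<phi> K x * (\<Sum>i\<in>UNIV. partial i (\<lambda>x. curl \<psi> x $ i) x)"
      by (simp only: sum_distrib_left)
    also have "(\<Sum>i\<in>UNIV. partial i (\<lambda>x. curl \<psi> x $ i) x) = 0"
      unfolding sum_3 by (rule div_curl[OF s(1)])
    finally show "(\<Sum>i\<in>UNIV. \<phi> K x * partial i (\<lambda>x. curl \<psi> x $ i) x) = 0" by simp
  qed
  finally show "(LINT x|lebesgue_on \<Omega>. 0 \<bullet> \<psi> x) = (LINT x|lebesgue_on \<Omega>. broken T (\<lambda>K. grad (\<phi> K)) x \<bullet> curl \<psi> x)"
    by (simp add: mesh_integral_zero)
qed

theorem broken_curl_weak_divergence: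
  assumes sm: "\<And>K. K \<in> T \<Longrightarrow> smooth (E K)" and Hcurl: "broken T E \<in> Hcurl \<Omega>"
  shows "has_weak_divergence \<Omega> (broken T (\<lambda>K. curl (E K))) (\<lambda>x. 0)"
  unfolding has_weak_divergence_def
proof (intro conjI ballI)
  show "broken T (\<lambda>K. curl (E K)) \<in> L2 \<Omega>" by (intro broken_L2 smooth_continuous smooth_curl sm)
  show "(\<lambda>x. 0) \<in> L2 \<Omega>" by (simp add: L2_def)
  fix \<psi> :: "real^3 \<Rightarrow> real" assume \<psi>: "\<psi> \<in> test_functions \<Omega>"
  then have s: "smooth \<psi>" "supported_in \<Omega> \<psi>" by (auto simp: test_functions_iff)
  have c: "grad \<psi> \<in> test_functions \<Omega>"
    by (simp add: test_functions_iff smooth_grad supported_in_grad s)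
  have "(LINT x|lebesgue_on \<Omega>. broken T (\<lambda>K. curl (E K)) x \<bullet> grad \<psi> x) = mesh_integral T (\<lambda>K x. curl (E K) x \<bullet> grad \<psi> x)"
    by (intro LINT_broken_inner smooth_continuous smooth_grad smooth_curl sm s)
  also have "\<dots> = mesh_integral T (\<lambda>K x. E K x \<bullet> curl (grad \<psi>) x)"
    by (rule Hcurl_mesh[OF sm Hcurl c])
  also have "\<dots> = 0" by (simp add: curl_grad[OF s(1)] mesh_integral_zero)
  finally show "(LINT x|lebesgue_on \<Omega>. 0 * \<psi> x) = - (LINT x|lebesgue_on \<Omega>. broken T (\<lambda>K. curl (E K)) x \<bullet> grad \<psi> x)"
    by simp
qed

end

section \<open>Mollification\<close>

lemma
  fixes f :: "real^3 \<Rightarrow> 'b::real_normed_vector"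
  shows smooth_shift: "smooth f \<Longrightarrow> smooth (\<lambda>x. f (x + c))"
  and partial_shift: "smooth f \<Longrightarrow> partial i (\<lambda>x. f (x + c)) x = partial i f (x + c)"
proof -
  have D: "((\<lambda>x. f (x + c)) has_derivative (\<lambda>h. \<Sum>i\<in>UNIV. h $ i *\<^sub>R partial i f (x + c))) (at x)"
    if "\<And>x. f differentiable (at x)" for x and f :: "real^3 \<Rightarrow> 'b::real_normed_vector"
  proof -
    have "((\<lambda>x. x + c) has_derivative (\<lambda>h. h)) (at x)" by (auto intro!: derivative_eq_intros)
    from has_derivative_compose[OF this has_derivative_partials[OF that]] show ?thesis by simp
  qed
  have p: "partial i (\<lambda>x. f (x + c)) x = partial i f (x + c)"
    if "\<And>x. f differentiable (at x)" for i x and f :: "real^3 \<Rightarrow> 'b::real_normed_vector"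
    unfolding partial_eqI[OF D[OF that]] by (simp add: axis_def if_distrib[of "\<lambda>a. a *\<^sub>R _"] cong: if_cong)
  show "partial i (\<lambda>x. f (x + c)) x = partial i f (x + c)" if "smooth f"
    by (rule p) (rule smooth_differentiable[OF that])
  have "C_diff n (\<lambda>x. f (x + c))" if "C_diff n f" for n and f :: "real^3 \<Rightarrow> 'b"
    using that
  proof (induction n arbitrary: f)
    case 0
    then show ?case by (auto intro!: continuous_on_compose2[of UNIV f] continuous_intros)
  next
    case (Suc n)
    then have d: "\<And>x. f differentiable (at x)" by simp
    have "partial i (\<lambda>x. f (x + c)) = (\<lambda>x. partial i f (x + c))" for i using p[OF d] by (rule ext)
    moreover have "(\<lambda>x. f (x + c)) differentiable (at x)" for x using D[OF d] unfolding differentiable_def by blast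
    ultimately show ?case using Suc by simp
  qed
  then show "smooth (\<lambda>x. f (x + c))" if "smooth f" using that by (simp add: smooth_def)
qed

text \<open>A cutoff function of a small box; it is positive at the centre if its index is large.\<close>
lemma bump_function:
  assumes "r > 0"
  obtains b :: "real^3 \<Rightarrow> real" and C where "smooth b" "\<And>x. 0 \<le> b x" "compact C" "C \<subseteq> ball 0 r" "\<And>x. x \<notin> C \<Longrightarrow> b x = 0"
    "(LINT x|lebesgue. b x) > 0"
proof -
  obtain l u :: "real^3" where lu: "cbox l u \<subseteq> ball 0 r" "0 \<in> box l u"
    by (rule open_contains_cbox[of "ball 0 r" "0 :: real^3"]) (use assms that in auto)
  show thesis
  proof (rule polyhedron_cutoffs[of "cbox l u"])
    show "polyhedron (cbox l u)" using polytope_imp_polyhedron polytope_interval by blast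
    show "bounded (cbox l u)" by (rule bounded_cbox)
    fix \<kappa> :: "nat \<Rightarrow> real^3 \<Rightarrow> real" and C
    assume \<kappa>: "\<And>n. smooth (\<kappa> n)" "\<And>n x. 0 \<le> \<kappa> n x" "\<And>n x. \<kappa> n x \<le> 1"
      and C: "\<And>n. compact (C n)" "\<And>n. C n \<subseteq> interior (cbox l u)" "\<And>n x. x \<notin> C n \<Longrightarrow> \<kappa> n x = 0"
      and lim: "\<And>x. x \<in> interior (cbox l u) \<Longrightarrow> (\<lambda>n. \<kappa> n x) \<longlonglongrightarrow> 1"
    have "\<forall>\<^sub>F n in sequentially. \<kappa> n 0 > 0"
      using order_tendstoD(1)[OF lim, of 0 0] lu(2) by simp
    then obtain n where n: "\<kappa> n 0 > 0" by (meson eventually_sequentially order_refl)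
    have Cn: "C n \<subseteq> ball 0 r" using C(2)[of n] lu(1) interior_subset[of "cbox l u"] by blast
    have int: "integrable (lebesgue_on (C n)) (\<kappa> n)"
      by (rule integrable_on_compact[OF C(1) smooth_continuous[OF \<kappa>(1)]])
    have sets: "C n \<in> sets lebesgue" using C(1) by (simp add: borel_compact)
    have eq: "(LINT x|lebesgue_on (C n). \<kappa> n x) = (LINT x|lebesgue. \<kappa> n x)"
      by (rule LINT_supported[OF sets C(3)])
    have "(LINT x|lebesgue_on (C n). \<kappa> n x) \<noteq> 0"
    proof
      assume "(LINT x|lebesgue_on (C n). \<kappa> n x) = 0"
      then have "AE x in lebesgue_on (C n). \<kappa> n x = 0"
        by (subst (asm) integral_nonneg_eq_0_iff_AE[OF int]) (auto intro!: AE_I2 \<kappa>)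
      then have "AE x in lebesgue. x \<in> C n \<longrightarrow> \<kappa> n x = 0"
        using sets by (subst (asm) AE_restrict_space_iff) auto
      then obtain N where N: "N \<in> null_sets lebesgue" "{x. \<not> (x \<in> C n \<longrightarrow> \<kappa> n x = 0)} \<subseteq> N"
        by (auto simp: eventually_ae_filter)
      have "negligible N" using N(1) by (simp add: negligible_iff_null_sets)
      then have "negligible {x. \<kappa> n x \<noteq> 0}" by (rule negligible_subset) (use N(2) C(3) in blast)
      moreover have "open {x. \<kappa> n x \<noteq> 0}"
        using continuous_open_preimage[OF smooth_continuous[OF \<kappa>(1)] open_UNIV open_Compl[OF closed_singleton[of 0]], of n]
        by (simp add: vimage_def)
      ultimately show False using open_not_negligible n by fastforce
    qed
    moreover have "(LINT x|lebesgue. \<kappa> n x) \<ge> 0" by (rule Bochner_Integration.integral_nonneg) (rule \<kappa>)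
    ultimately have "(LINT x|lebesgue. \<kappa> n x) > 0" unfolding eq by simp
    with \<kappa>(1,2) C(1) Cn C(3) show thesis by (rule that)
  qed
qed

context mesh
begin

text \<open>The cells cover the domain up to a null set, again by localization.\<close>
lemma mesh_integral_test_function:
  fixes \<psi> :: "real^3 \<Rightarrow> real"
  assumes \<psi>: "\<psi> \<in> test_functions \<Omega>"
  shows "mesh_integral T (\<lambda>K. \<psi>) = (LINT x|lebesgue. \<psi> x)"
proof -
  define u where "u x = 1 - broken T (\<lambda>K x. 1 :: real) x" for x
  interpret finite_measure "lebesgue_on \<Omega>" using domain_lmeasurable by (rule finite_measure_lebesgue_on)
  have bi: "integrable (lebesgue_on \<Omega>) (broken T (\<lambda>K x. 1 :: real))"
    by (rule LINT_broken) simp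
  have eq: "(LINT x|lebesgue_on \<Omega>. u x \<bullet> \<psi> x) = (LINT x|lebesgue. \<psi> x) - mesh_integral T (\<lambda>K. \<psi>)"
    if \<psi>: "\<psi> \<in> test_functions \<Omega>" for \<psi>
  proof -
    have s: "smooth \<psi>" "supported_in \<Omega> \<psi>" using \<psi> by (auto simp: test_functions_iff)
    obtain B where B: "\<And>x. norm (\<psi> x) \<le> B" using supported_bounded[OF s(2) smooth_continuous[OF s(1)]] by metis
    have "(LINT x|lebesgue_on \<Omega>. u x \<bullet> \<psi> x) = (LINT x|lebesgue_on \<Omega>. 1 \<bullet> \<psi> x - broken T (\<lambda>K x. 1) x \<bullet> \<psi> x)"
      by (simp add: u_def left_diff_distrib)
    also have "\<dots> = (LINT x|lebesgue_on \<Omega>. 1 \<bullet> \<psi> x) - (LINT x|lebesgue_on \<Omega>. broken T (\<lambda>K x. 1 :: real) x \<bullet> \<psi> x)"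
      by (intro Bochner_Integration.integral_diff integrable_inner_bounded[OF _ _ B] integrable_const bi smooth_continuous s)
    also have "(LINT x|lebesgue_on \<Omega>. broken T (\<lambda>K x. 1 :: real) x \<bullet> \<psi> x) = mesh_integral T (\<lambda>K x. 1 \<bullet> \<psi> x)"
      by (intro LINT_broken_inner smooth_continuous s continuous_on_const)
    also have "(LINT x|lebesgue_on \<Omega>. 1 \<bullet> \<psi> x) = (LINT x|lebesgue. \<psi> x)"
      using LINT_supported[of \<Omega> \<psi>] supported_in_zero[OF s(2)] domain_lmeasurable by simp
    finally show ?thesis by simp
  qed
  have "(LINT x|lebesgue_on \<Omega>. u x \<bullet> \<psi> x) = 0"
  proof (rule integral_eq_0_if_locally[OF _ _ \<psi>])
    show "integrable (lebesgue_on \<Omega>) u"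
      unfolding u_def[abs_def] by (rule Bochner_Integration.integrable_diff[OF integrable_const bi])
    fix K and \<psi>' :: "real^3 \<Rightarrow> real" assume K: "K \<in> T" and \<psi>': "smooth \<psi>'" "supported_in (interior K) \<psi>'"
    have t: "\<psi>' \<in> test_functions \<Omega>"
      using \<psi>' supported_in_mono[OF _ interior_cell_subset[OF K]] by (auto simp: test_functions_iff)
    have "mesh_integral T (\<lambda>K. \<psi>') = (LINT x|lebesgue_on K. \<psi>' x)"
      by (rule mesh_integral_supported[OF K]) (rule supported_in_zero[OF \<psi>'(2)])
    also have "\<dots> = (LINT x|lebesgue. \<psi>' x)"
      using supported_in_zero[OF supported_in_mono[OF \<psi>'(2) interior_subset]] cell_lmeasurable[OF K]
      by (intro LINT_supported) auto
    finally show "(LINT x|lebesgue_on \<Omega>. u x \<bullet> \<psi>' x) = 0" using eq[OF t] by simp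
  qed
  then show ?thesis using eq[OF \<psi>] by simp
qed

text \<open>Where the bump at \<open>y\<close> fits into one cell, it averages the values of that cell only.\<close>
lemma mollified_value:
  assumes K: "K \<in> T" and cont: "continuous_on K (\<phi> K)"
    and b: "smooth b" "\<And>x. 0 \<le> b x" "compact C" "C \<subseteq> ball 0 r" "\<And>x. x \<notin> C \<Longrightarrow> b x = (0::real)"
    and y: "cball y r \<subseteq> interior K" and osc: "\<And>x. x \<in> cball y r \<Longrightarrow> \<bar>\<phi> K x - v\<bar> \<le> \<epsilon>"
  shows "\<bar>mesh_integral T (\<lambda>K x. \<phi> K x * b (x - y)) - v * (LINT x|lebesgue. b x)\<bar> \<le> \<epsilon> * (LINT x|lebesgue. b x)"
proof -
  have z: "b (x - y) = 0" if "x \<notin> cball y r" for x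
  proof (rule b(5))
    have "x - y \<notin> ball 0 r" using that by (simp add: dist_norm norm_minus_commute)
    then show "x - y \<notin> C" using b(4) by blast
  qed
  have sb: "smooth (\<lambda>x. b (x - y))" using smooth_shift[OF b(1), of "- y"] by simp
  have cb: "continuous_on K (\<lambda>x. b (x - y))" by (rule smooth_continuous[OF sb])
  have zK: "b (x - y) = 0" if "x \<notin> K" for x
    by (rule z) (use that y interior_subset[of K] in blast)
  have J: "(LINT x|lebesgue_on K. b (x - y)) = (LINT x|lebesgue. b x)"
  proof -
    have "(LINT x|lebesgue_on K. b (x - y)) = (LINT x|lebesgue. b (x - y))"
      by (rule LINT_supported[OF _ zK]) (use cell_lmeasurable[OF K] in simp)
    then show ?thesis using LINT_translate[OF smooth_continuous[OF b(1)], of "- y"] by simp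
  qed
  have "mesh_integral T (\<lambda>K x. \<phi> K x * b (x - y)) = (LINT x|lebesgue_on K. \<phi> K x * b (x - y))"
  proof (rule mesh_integral_supported[OF K])
    fix K' x assume "x \<notin> interior K"
    then have "x \<notin> cball y r" using y by blast
    then show "\<phi> K' x * b (x - y) = 0" using z by simp
  qed
  moreover have "v * (LINT x|lebesgue. b x) = (LINT x|lebesgue_on K. v * b (x - y))" by (simp add: J)
  ultimately have "mesh_integral T (\<lambda>K x. \<phi> K x * b (x - y)) - v * (LINT x|lebesgue. b x)
      = (LINT x|lebesgue_on K. \<phi> K x * b (x - y) - v * b (x - y))"
    using cont cb by (subst Bochner_Integration.integral_diff) (auto intro!: integrable_on_cell[OF K] continuous_intros)
  also have "\<bar>\<dots>\<bar> \<le> (LINT x|lebesgue_on K. \<bar>\<phi> K x * b (x - y) - v * b (x - y)\<bar>)"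
    by (rule integral_abs_bound)
  also have "\<dots> \<le> (LINT x|lebesgue_on K. \<epsilon> * b (x - y))"
  proof (rule Bochner_Integration.integral_mono)
    show "integrable (lebesgue_on K) (\<lambda>x. \<bar>\<phi> K x * b (x - y) - v * b (x - y)\<bar>)" "integrable (lebesgue_on K) (\<lambda>x. \<epsilon> * b (x - y))"
      using cont cb by (auto intro!: integrable_on_cell[OF K] continuous_intros)
    fix x
    show "\<bar>\<phi> K x * b (x - y) - v * b (x - y)\<bar> \<le> \<epsilon> * b (x - y)"
    proof (cases "x \<in> cball y r")
      case True
      have "\<bar>\<phi> K x - v\<bar> * b (x - y) \<le> \<epsilon> * b (x - y)" by (rule mult_right_mono[OF osc[OF True] b(2)])
      then show ?thesis using b(2)[of "x - y"] by (simp add: left_diff_distrib[symmetric] abs_mult)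
    qed (simp add: z)
  qed
  also have "\<dots> = \<epsilon> * (LINT x|lebesgue. b x)" by (simp add: J)
  finally show ?thesis .
qed

text \<open>The bump is moved along the segment from \<open>y\<close> to \<open>z\<close>. The derivative with respect to the motion falls on
  the bump, and conformity transfers it to the cellwise gradient, which is bounded, also while the bump
  straddles several cells.\<close>
lemma H1_mollification_lipschitz:
  assumes sm: "\<And>K. K \<in> T \<Longrightarrow> smooth (\<phi> K)" and H1: "broken T \<phi> \<in> H1 \<Omega>"
    and L: "\<And>K x. K \<in> T \<Longrightarrow> x \<in> K \<Longrightarrow> norm (grad (\<phi> K) x) \<le> L"
    and b: "smooth b" "\<And>x. 0 \<le> b x" "compact C" "\<And>x. x \<notin> C \<Longrightarrow> b x = (0::real)"
    and C: "\<And>s x. s \<in> {0..1} \<Longrightarrow> x \<in> C \<Longrightarrow> y + s *\<^sub>R (z - y) + x \<in> \<Omega>"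
  shows "\<bar>mesh_integral T (\<lambda>K x. \<phi> K x * b (x - z)) - mesh_integral T (\<lambda>K x. \<phi> K x * b (x - y))\<bar>
    \<le> L * norm (z - y) * (LINT x|lebesgue. b x)"
proof -
  define v where "v = z - y"
  define p where "p s = y + s *\<^sub>R v" for s
  define F where "F s = mesh_integral T (\<lambda>K x. \<phi> K x * b (x - p s))" for s
  have sb: "smooth (\<lambda>x. b (x - a))" for a using smooth_shift[OF b(1), of "- a"] by simp
  have pb: "partial i (\<lambda>x. b (x - a)) x = partial i b (x - a)" for i a x
    using partial_shift[OF b(1), of i "- a"] by simp
  have test: "(\<lambda>x. b (x - p s)) \<in> test_functions \<Omega>" if s: "s \<in> {0..1}" for s
    unfolding test_functions_iff supported_in_def
  proof (intro conjI exI[of _ "(+) (p s) ` C"] allI impI)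
    show "compact ((+) (p s) ` C)" by (rule compact_translation[OF b(3)])
    show "(+) (p s) ` C \<subseteq> \<Omega>" using C[OF s] by (auto simp: p_def v_def)
    fix x assume "x \<notin> (+) (p s) ` C"
    then have "x - p s \<notin> C" by (metis add_diff_cancel_left' add.commute diff_add_cancel image_eqI)
    then show "b (x - p s) = 0" by (rule b(4))
  qed (rule sb)
  have bsup: "supported_in C b" using b(3,4) unfolding supported_in_def by blast
  obtain B where B: "\<And>i x. norm (partial i b x) \<le> B" using supported_partials_bounded[OF b(1) bsup] by blast
  obtain Q where Q: "\<And>K x. K \<in> T \<Longrightarrow> x \<in> K \<Longrightarrow> \<bar>\<phi> K x\<bar> \<le> Q"
    using cell_bound[of \<phi>, OF smooth_continuous[OF sm]] by auto
  define dF where "dF s = mesh_integral T (\<lambda>K x. (\<Sum>i\<in>UNIV. v $ i *\<^sub>R partial i (\<phi> K) x) * b (x - p s))" for s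
  have dF: "(F has_vector_derivative dF s) (at s within {0..1})" if s: "s \<in> {0..1}" for s
  proof -
    have "(F has_vector_derivative mesh_integral T (\<lambda>K x. \<phi> K x * (\<Sum>i\<in>UNIV. (- v) $ i *\<^sub>R partial i b (x - p s)))) (at s within {0..1})"
      unfolding F_def
    proof (rule has_vector_derivative_mesh_integral[OF s, where B = "Q * (3 * B * norm v)"])
      show "continuous_on K (\<lambda>x. \<phi> K x * b (x - p s'))" if "K \<in> T" for K s'
        by (intro smooth_continuous smooth_mult sm sb that)
      fix K x assume K: "K \<in> T" "x \<in> K"
      have "((\<lambda>s. b ((x - y) + s *\<^sub>R (- v))) has_vector_derivative (\<Sum>i\<in>UNIV. (- v) $ i *\<^sub>R partial i b ((x - y) + s *\<^sub>R (- v)))) (at s within {0..1})"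
        by (rule smooth_line_derivative[OF b(1)])
      moreover have "(x - y) + s *\<^sub>R (- v) = x - p s" for s by (simp add: p_def)
      ultimately show "((\<lambda>s. \<phi> K x * b (x - p s)) has_vector_derivative \<phi> K x * (\<Sum>i\<in>UNIV. (- v) $ i *\<^sub>R partial i b (x - p s))) (at s within {0..1})"
        by (intro has_vector_derivative_mult_right) (simp only:)
    next
      have "\<bar>\<phi> K x * b (x - p t) - \<phi> K x * b (x - p s)\<bar> \<le> Q * (3 * B * norm v) * \<bar>t - s\<bar>" if "K \<in> T" "x \<in> K" for t K x
      proof -
        have "norm (b ((x - p s) + (p s - p t)) - b (x - p s)) \<le> 3 * B * norm (p s - p t)"
          by (rule smooth_lipschitz[OF b(1) B])
        also have "norm (p s - p t) = norm v * \<bar>t - s\<bar>"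
        proof -
          have "p s - p t = (s - t) *\<^sub>R v" by (simp add: p_def algebra_simps)
          then show ?thesis by (simp add: abs_minus_commute mult.commute)
        qed
        finally have "\<bar>b (x - p t) - b (x - p s)\<bar> \<le> 3 * B * (norm v * \<bar>t - s\<bar>)" by simp
        then have "\<bar>\<phi> K x\<bar> * \<bar>b (x - p t) - b (x - p s)\<bar> \<le> Q * (3 * B * (norm v * \<bar>t - s\<bar>))"
          by (rule mult_mono[OF Q[OF that]]) (use Q[OF that] in auto)
        then show ?thesis by (simp add: right_diff_distrib[symmetric] abs_mult mult.assoc)
      qed
      then show "\<forall>\<^sub>F t in at s within {0..1}. \<forall>K\<in>T. \<forall>x\<in>K. \<bar>\<phi> K x * b (x - p t) - \<phi> K x * b (x - p s)\<bar> \<le> Q * (3 * B * norm v) * \<bar>t - s\<bar>"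
        by (intro always_eventually allI ballI)
    qed
    moreover have "mesh_integral T (\<lambda>K x. \<phi> K x * (\<Sum>i\<in>UNIV. (- v) $ i *\<^sub>R partial i b (x - p s))) = dF s"
    proof -
      have "mesh_integral T (\<lambda>K x. \<phi> K x * (\<Sum>i\<in>UNIV. (- v) $ i *\<^sub>R partial i b (x - p s)))
        = mesh_integral T (\<lambda>K x. \<Sum>i\<in>UNIV. (- v $ i) * (\<phi> K x * partial i (\<lambda>x. b (x - p s)) x))"
        by (simp only: pb) (simp add: sum_distrib_left algebra_simps)
      also have "\<dots> = (\<Sum>i\<in>UNIV. mesh_integral T (\<lambda>K x. (- v $ i) * (\<phi> K x * partial i (\<lambda>x. b (x - p s)) x)))"
        by (intro mesh_integral_sum smooth_continuous smooth_mult smooth_const smooth_partial sm sb)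
      also have "\<dots> = (\<Sum>i\<in>UNIV. v $ i * mesh_integral T (\<lambda>K x. partial i (\<phi> K) x * b (x - p s)))"
      proof (rule sum.cong[OF refl])
        fix i
        have "mesh_integral T (\<lambda>K x. partial i (\<phi> K) x * b (x - p s)) = - mesh_integral T (\<lambda>K x. \<phi> K x * partial i (\<lambda>x. b (x - p s)) x)"
          by (rule H1_mesh[OF sm H1 test[OF s]])
        then show "mesh_integral T (\<lambda>K x. (- v $ i) * (\<phi> K x * partial i (\<lambda>x. b (x - p s)) x)) = v $ i * mesh_integral T (\<lambda>K x. partial i (\<phi> K) x * b (x - p s))"
          unfolding mesh_integral_scale by simp
      qed
      also have "\<dots> = (\<Sum>i\<in>UNIV. mesh_integral T (\<lambda>K x. v $ i * (partial i (\<phi> K) x * b (x - p s))))"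
        unfolding mesh_integral_scale ..
      also have "\<dots> = mesh_integral T (\<lambda>K x. \<Sum>i\<in>UNIV. v $ i * (partial i (\<phi> K) x * b (x - p s)))"
        by (rule mesh_integral_sum[symmetric]) (intro smooth_continuous smooth_mult smooth_const smooth_partial sm sb)
      finally show ?thesis by (simp add: dF_def sum_distrib_right mult.assoc)
    qed
    ultimately show ?thesis by simp
  qed
  have bound: "\<bar>dF s\<bar> \<le> L * norm v * (LINT x|lebesgue. b x)" if s: "s \<in> {0..1}" for s
  proof -
    have c1: "continuous_on K (\<lambda>x. (\<Sum>i\<in>UNIV. v $ i *\<^sub>R partial i (\<phi> K) x) * b (x - p s))" if "K \<in> T" for K
      by (intro smooth_continuous smooth_mult smooth_sum smooth_bilinear[OF bounded_bilinear_scaleR] smooth_const smooth_partial sm sb that)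
    have c2: "continuous_on K (\<lambda>x. L * norm v * b (x - p s))" for K
      by (intro smooth_continuous smooth_mult smooth_const sb)
    have le: "\<bar>(\<Sum>i\<in>UNIV. v $ i *\<^sub>R partial i (\<phi> K) x) * b (x - p s)\<bar> \<le> L * norm v * b (x - p s)" if K: "K \<in> T" "x \<in> K" for K x
    proof -
      have "(\<Sum>i\<in>UNIV. v $ i *\<^sub>R partial i (\<phi> K) x) = v \<bullet> grad (\<phi> K) x" by (simp add: inner_vec_def)
      also have "\<bar>\<dots>\<bar> \<le> norm v * norm (grad (\<phi> K) x)" by (rule Cauchy_Schwarz_ineq2)
      also have "\<dots> \<le> L * norm v" using mult_left_mono[OF L[OF K] norm_ge_zero[of v]] by (simp add: mult.commute)
      finally show ?thesis using mult_right_mono[OF _ b(2)] b(2) by (simp add: abs_mult)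
    qed
    have "dF s \<le> mesh_integral T (\<lambda>K x. L * norm v * b (x - p s))" unfolding dF_def
      by (rule mesh_integral_mono[OF c1 c2]) (use le abs_le_D1 in blast)+
    moreover have "- dF s \<le> mesh_integral T (\<lambda>K x. L * norm v * b (x - p s))" unfolding dF_def mesh_integral_minus[symmetric]
      by (rule mesh_integral_mono[OF continuous_on_minus[OF c1] c2]) (use le abs_le_D2 in blast)+
    moreover have "mesh_integral T (\<lambda>K x. L * norm v * b (x - p s)) = L * norm v * (LINT x|lebesgue. b x)"
    proof -
      have "mesh_integral T (\<lambda>K x. b (x - p s)) = (LINT x|lebesgue. b (x - p s))"
        by (rule mesh_integral_test_function[OF test[OF s]])
      also have "\<dots> = (LINT x|lebesgue. b x)" using LINT_translate[OF smooth_continuous[OF b(1)], of "- p s"] by simp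
      finally show ?thesis unfolding mesh_integral_scale by simp
    qed
    ultimately show ?thesis by linarith
  qed
  have "norm (F 1 - F 0) \<le> (L * norm v * (LINT x|lebesgue. b x)) * norm (1 - 0 :: real)"
  proof (rule differentiable_bound[of "{0..1}" _ "\<lambda>s h. h *\<^sub>R dF s"])
    fix s :: real assume s: "s \<in> {0..1}"
    show "(F has_derivative (\<lambda>h. h *\<^sub>R dF s)) (at s within {0..1})" using dF[OF s] unfolding has_vector_derivative_def .
    show "onorm (\<lambda>h. h *\<^sub>R dF s) \<le> L * norm v * (LINT x|lebesgue. b x)"
    proof (rule onorm_bound)
      show "norm (h *\<^sub>R dF s) \<le> (L * norm v * (LINT x|lebesgue. b x)) * norm h" for h
        using mult_right_mono[OF bound[OF s] abs_ge_zero[of h]] by (simp add: abs_mult mult.commute)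
      show "0 \<le> L * norm v * (LINT x|lebesgue. b x)" using bound[OF s] abs_ge_zero order_trans by blast
    qed
  qed auto
  then show ?thesis by (simp add: F_def p_def v_def)
qed

end

section \<open>Continuity of scalar conforming fields\<close>

context mesh
begin

lemma gradient_bound:
  assumes "\<And>K. K \<in> T \<Longrightarrow> smooth (\<phi> K)"
  shows "\<exists>L\<ge>0. \<forall>K\<in>T. \<forall>x\<in>K. norm (grad (\<phi> K) x) \<le> L"
  by (rule cell_bound) (intro smooth_continuous smooth_grad assms)

text \<open>The values at \<open>y\<close> and \<open>z\<close> are compared through their averages against ever smaller bumps. The ball \<open>ball x0 R\<close>
  keeps the segment between the points in the domain.\<close>
lemma H1_values_lipschitz:
  assumes sm: "\<And>K. K \<in> T \<Longrightarrow> smooth (\<phi> K)" and H1: "broken T \<phi> \<in> H1 \<Omega>"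
    and L: "\<And>K x. K \<in> T \<Longrightarrow> x \<in> K \<Longrightarrow> norm (grad (\<phi> K) x) \<le> L"
    and R: "ball x0 R \<subseteq> \<Omega>" and K: "K \<in> T" "y \<in> interior K" "y \<in> ball x0 R" and K': "K' \<in> T" "z \<in> interior K'" "z \<in> ball x0 R"
  shows "\<bar>\<phi> K' z - \<phi> K y\<bar> \<le> L * norm (z - y)"
proof (rule field_le_epsilon)
  fix \<epsilon> :: real assume "\<epsilon> > 0"
  have near: "\<exists>r>0. cball p r \<subseteq> interior K \<and> (\<forall>x\<in>cball p r. \<bar>\<phi> K x - \<phi> K p\<bar> \<le> \<epsilon> / 2) \<and> r \<le> R - dist x0 p"
    if K: "K \<in> T" and p: "p \<in> interior K" "p \<in> ball x0 R" for K p
  proof -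
    obtain r1 where r1: "r1 > 0" "cball p r1 \<subseteq> interior K" using p open_contains_cball[of "interior K"] by blast
    have "isCont (\<phi> K) p" using smooth_continuous[OF sm[OF K], of UNIV] by (simp add: continuous_on_eq_continuous_at)
    then obtain r2 where r2: "r2 > 0" "\<And>x. dist x p < r2 \<Longrightarrow> dist (\<phi> K x) (\<phi> K p) < \<epsilon> / 2"
      unfolding continuous_at_eps_delta using \<open>\<epsilon> > 0\<close> by (metis half_gt_zero)
    define r where "r = min r1 (min (r2 / 2) (R - dist x0 p))"
    have "r > 0" using r1 r2 p by (simp add: r_def)
    moreover have "cball p r \<subseteq> interior K" using r1(2) by (rule order_trans[rotated]) (auto simp: r_def)
    moreover have "\<bar>\<phi> K x - \<phi> K p\<bar> \<le> \<epsilon> / 2" if "x \<in> cball p r" for x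
    proof -
      have "dist x p < r2" using that r2(1) by (auto simp: r_def dist_commute)
      from r2(2)[OF this] show ?thesis by (simp add: dist_real_def)
    qed
    moreover have "r \<le> R - dist x0 p" by (simp add: r_def)
    ultimately show ?thesis by blast
  qed
  obtain r1 where r1: "r1 > 0" "cball y r1 \<subseteq> interior K" "\<And>x. x \<in> cball y r1 \<Longrightarrow> \<bar>\<phi> K x - \<phi> K y\<bar> \<le> \<epsilon> / 2" "r1 \<le> R - dist x0 y"
    using near[OF K] by blast
  obtain r2 where r2: "r2 > 0" "cball z r2 \<subseteq> interior K'" "\<And>x. x \<in> cball z r2 \<Longrightarrow> \<bar>\<phi> K' x - \<phi> K' z\<bar> \<le> \<epsilon> / 2" "r2 \<le> R - dist x0 z"
    using near[OF K'] by blast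
  define r where "r = min r1 r2"
  have r: "r > 0" "r \<le> r1" "r \<le> r2" using r1 r2 by (auto simp: r_def)
  show "\<bar>\<phi> K' z - \<phi> K y\<bar> \<le> L * norm (z - y) + \<epsilon>"
  proof (rule bump_function[OF r(1)])
    fix b :: "real^3 \<Rightarrow> real" and C
    assume b: "smooth b" "\<And>x. 0 \<le> b x" "compact C" "C \<subseteq> ball 0 r" "\<And>x. x \<notin> C \<Longrightarrow> b x = 0" "(LINT x|lebesgue. b x) > 0"
    let ?J = "LINT x|lebesgue. b x"
    have y: "\<bar>mesh_integral T (\<lambda>K x. \<phi> K x * b (x - y)) - \<phi> K y * ?J\<bar> \<le> \<epsilon> / 2 * ?J"
      by (rule mollified_value[where \<phi> = \<phi>, OF K(1) smooth_continuous[OF sm[OF K(1)]] b(1-5)]) (use r1 r in auto)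
    have z: "\<bar>mesh_integral T (\<lambda>K x. \<phi> K x * b (x - z)) - \<phi> K' z * ?J\<bar> \<le> \<epsilon> / 2 * ?J"
      by (rule mollified_value[where \<phi> = \<phi>, OF K'(1) smooth_continuous[OF sm[OF K'(1)]] b(1-5)]) (use r2 r in auto)
    have "\<bar>mesh_integral T (\<lambda>K x. \<phi> K x * b (x - z)) - mesh_integral T (\<lambda>K x. \<phi> K x * b (x - y))\<bar> \<le> L * norm (z - y) * ?J"
    proof (rule H1_mollification_lipschitz[OF sm H1 L b(1-3) b(5)])
      fix s x assume s: "s \<in> {0..1::real}" and x: "x \<in> C"
      have "x \<in> ball 0 r" using x b(4) by blast
      then have nx: "norm x < r" by simp
      have by': "y + x \<in> ball x0 R"
        using norm_triangle_ineq4[of "x0 - y" x] nx r1(4) r(2) by (simp add: dist_norm diff_diff_eq)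
      have bz: "z + x \<in> ball x0 R"
        using norm_triangle_ineq4[of "x0 - z" x] nx r2(4) r(3) by (simp add: dist_norm diff_diff_eq)
      \<comment> \<open>The moving bump stays in the ball, which is convex.\<close>
      have "(1 - s) *\<^sub>R (y + x) + s *\<^sub>R (z + x) \<in> ball x0 R"
        using convexD[OF convex_ball by' bz, of "1 - s" s] s by simp
      moreover have "(1 - s) *\<^sub>R (y + x) + s *\<^sub>R (z + x) = y + s *\<^sub>R (z - y) + x" by (simp add: algebra_simps)
      ultimately show "y + s *\<^sub>R (z - y) + x \<in> \<Omega>" using R by auto
    qed
    then have "\<bar>\<phi> K' z * ?J - \<phi> K y * ?J\<bar> \<le> L * norm (z - y) * ?J + \<epsilon> / 2 * ?J + \<epsilon> / 2 * ?J"
      using y z by linarith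
    then have "\<bar>\<phi> K' z - \<phi> K y\<bar> * ?J \<le> (L * norm (z - y) + \<epsilon>) * ?J"
      using b(6) by (simp add: left_diff_distrib[symmetric] abs_mult distrib_right)
    then show ?thesis using b(6) by simp
  qed
qed

lemma H1_continuous:
  assumes sm: "\<And>K. K \<in> T \<Longrightarrow> smooth (\<phi> K)" and H1: "broken T \<phi> \<in> H1 \<Omega>"
    and K: "K \<in> T" "x \<in> K" and K': "K' \<in> T" "x \<in> K'" and x: "x \<in> \<Omega>"
  shows "\<phi> K x = \<phi> K' x"
proof -
  obtain L where L: "\<And>K x. K \<in> T \<Longrightarrow> x \<in> K \<Longrightarrow> norm (grad (\<phi> K) x) \<le> L" using gradient_bound[of \<phi>, OF sm] by blast
  obtain R where R: "R > 0" "ball x R \<subseteq> \<Omega>" using x open_domain open_contains_ball by blast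
  obtain Y where Y: "\<And>n. Y n \<in> interior K" "Y \<longlonglongrightarrow> x"
    using K closure_interior_cell[OF K(1)] closure_sequential[of x "interior K"] by auto
  obtain Z where Z: "\<And>n. Z n \<in> interior K'" "Z \<longlonglongrightarrow> x"
    using K' closure_interior_cell[OF K'(1)] closure_sequential[of x "interior K'"] by auto
  have cont: "(\<lambda>n. \<phi> K (S n)) \<longlonglongrightarrow> \<phi> K x" if "K \<in> T" "S \<longlonglongrightarrow> x" for K S
    using smooth_continuous[OF sm[OF that(1)], of UNIV] that(2) by (auto simp: continuous_on_eq_continuous_at intro: isCont_tendsto_compose)
  have ev: "\<forall>\<^sub>F n in sequentially. S n \<in> ball x R" if "S \<longlonglongrightarrow> x" for S
    using topological_tendstoD[OF that open_ball, of x R] R by simp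
  have "\<forall>\<^sub>F n in sequentially. \<bar>\<phi> K' (Z n) - \<phi> K (Y n)\<bar> \<le> L * norm (Z n - Y n)"
    using ev[OF Y(2)] ev[OF Z(2)]
    by eventually_elim (rule H1_values_lipschitz[OF sm H1 L R(2) K(1) Y(1) _ K'(1) Z(1)])
  moreover have "(\<lambda>n. \<bar>\<phi> K' (Z n) - \<phi> K (Y n)\<bar>) \<longlonglongrightarrow> \<bar>\<phi> K' x - \<phi> K x\<bar>"
    by (intro tendsto_intros cont K(1) K'(1) Y Z)
  moreover have "(\<lambda>n. L * norm (Z n - Y n)) \<longlonglongrightarrow> L * norm (x - x)"
    by (intro tendsto_intros Y Z)
  ultimately have "\<bar>\<phi> K' x - \<phi> K x\<bar> \<le> L * norm (x - x)"
    by (intro tendsto_le[OF sequentially_bot]) auto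
  then show ?thesis by simp
qed

text \<open>On the boundary of the domain both traces vanish.\<close>
lemma Q0_continuous:
  assumes \<phi>: "\<phi> \<in> Q0_space \<Omega> T k" and K: "K \<in> T" "x \<in> K" and K': "K' \<in> T" "x \<in> K'"
  shows "\<phi> K x = \<phi> K' x"
proof (cases "x \<in> \<Omega>")
  case True
  have "\<And>K. K \<in> T \<Longrightarrow> smooth (\<phi> K)" "broken T \<phi> \<in> H1 \<Omega>"
    using \<phi> smooth_P_poly by (auto simp: Q0_space_def Q_space_def)
  from H1_continuous[OF this K K' True] show ?thesis .
next
  case False
  then have "x \<in> frontier \<Omega>" using cell_in_frontier[OF K] by blast
  then show ?thesis using \<phi> K K' by (auto simp: Q0_space_def)
qed

end

text \<open>The pieces need not be intervals, nor is their order known. A piece that contains \<open>a\<close> is followed to its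
  last point \<open>c\<close>; the remaining interval is covered by the remaining pieces, also at \<open>c\<close>, as they are closed.\<close>
lemma piecewise_lipschitz:
  fixes f :: "real \<Rightarrow> real"
  assumes "finite A" "\<And>i. i \<in> A \<Longrightarrow> closed (C i)" "{a..b} \<subseteq> (\<Union>i\<in>A. C i)" "a \<le> b"
    and "\<And>i s t. i \<in> A \<Longrightarrow> s \<in> C i \<inter> {a..b} \<Longrightarrow> t \<in> C i \<inter> {a..b} \<Longrightarrow> \<bar>f s - f t\<bar> \<le> L * \<bar>s - t\<bar>"
  shows "\<bar>f b - f a\<bar> \<le> L * (b - a)"
  using assms
proof (induction "card A" arbitrary: A a)
  case 0
  then show ?case by auto
next
  case (Suc n)
  obtain i where i: "i \<in> A" "a \<in> C i" using Suc.prems(3,4) by auto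
  have "compact (C i \<inter> {a..b})" using Suc.prems(2)[OF i(1)] by (intro closed_Int_compact) auto
  moreover have "a \<in> C i \<inter> {a..b}" using i Suc.prems(4) by simp
  ultimately obtain c where c: "c \<in> C i \<inter> {a..b}" "\<And>s. s \<in> C i \<inter> {a..b} \<Longrightarrow> s \<le> c"
    using compact_attains_sup[of "C i \<inter> {a..b}"] by blast
  have ac: "\<bar>f c - f a\<bar> \<le> L * (c - a)"
    using Suc.prems(5)[OF i(1) c(1) \<open>a \<in> C i \<inter> {a..b}\<close>] c(1) by simp
  show ?case
  proof (cases "c = b")
    case True then show ?thesis using ac by simp
  next
    case False
    then have cb: "c < b" using c(1) by simp
    let ?A = "A - {i}"
    have cl: "closed (\<Union>j\<in>?A. C j)" using Suc.prems(1,2) by (intro closed_UN) auto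
    have "{c<..b} \<subseteq> (\<Union>j\<in>?A. C j)"
    proof
      fix s assume s: "s \<in> {c<..b}"
      then have "s \<in> {a..b}" using c(1) by simp
      then obtain j where j: "j \<in> A" "s \<in> C j" using Suc.prems(3) by blast
      have "j \<noteq> i" using c(2)[of s] j s \<open>s \<in> {a..b}\<close> by auto
      then show "s \<in> (\<Union>j\<in>?A. C j)" using j by blast
    qed
    then have "closure {c<..b} \<subseteq> (\<Union>j\<in>?A. C j)" using cl by (rule closure_minimal)
    then have sub: "{c..b} \<subseteq> (\<Union>j\<in>?A. C j)" using closure_greaterThanAtMost[OF cb] by simp
    have "\<bar>f b - f c\<bar> \<le> L * (b - c)"
    proof (rule Suc.hyps(1)[of ?A c])
      show "n = card ?A" using Suc.hyps(2) Suc.prems(1) i(1) by simp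
      show "\<bar>f s - f t\<bar> \<le> L * \<bar>s - t\<bar>" if "j \<in> ?A" "s \<in> C j \<inter> {c..b}" "t \<in> C j \<inter> {c..b}" for j s t
        using Suc.prems(5)[of j s t] that c(1) by auto
    qed (use Suc.prems sub cb in auto)
    moreover have "L * (b - a) = L * (c - a) + L * (b - c)" by (simp add: algebra_simps)
    ultimately show ?thesis using ac by linarith
  qed
qed

context mesh
begin

text \<open>The domain need not be convex, so \<open>\<phi>\<close> is extended by 0, continuously because it vanishes on the
  boundary, and the complement of the domain is one more piece of the segment from \<open>x\<close> to \<open>y\<close>.\<close>
lemma Q0_lipschitz:
  assumes \<phi>: "\<phi> \<in> Q0_space \<Omega> T k"
  obtains L where "L \<ge> 0" "\<And>K K' x y. K \<in> T \<Longrightarrow> x \<in> K \<Longrightarrow> K' \<in> T \<Longrightarrow> y \<in> K' \<Longrightarrow> \<bar>\<phi> K x - \<phi> K' y\<bar> \<le> L * norm (x - y)"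
proof -
  have sm: "\<And>K. K \<in> T \<Longrightarrow> smooth (\<phi> K)" using \<phi> smooth_P_poly by (auto simp: Q0_space_def Q_space_def)
  obtain L where L: "L \<ge> 0" "\<And>K x. K \<in> T \<Longrightarrow> x \<in> K \<Longrightarrow> norm (grad (\<phi> K) x) \<le> L" using gradient_bound[of \<phi>, OF sm] by blast
  have cellL: "\<bar>\<phi> K x - \<phi> K y\<bar> \<le> L * norm (x - y)" if K: "K \<in> T" "x \<in> K" "y \<in> K" for K x y
  proof -
    have "norm (\<phi> K x - \<phi> K y) \<le> L * norm (x - y)"
    proof (rule differentiable_bound[where S = K and f = "\<phi> K" and f' = "\<lambda>p h. \<Sum>i\<in>UNIV. h $ i *\<^sub>R partial i (\<phi> K) p", OF cell_convex[OF K(1)] _ _ K(2,3)])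
      fix p assume p: "p \<in> K"
      show "(\<phi> K has_derivative (\<lambda>h. \<Sum>i\<in>UNIV. h $ i *\<^sub>R partial i (\<phi> K) p)) (at p within K)"
        by (rule has_derivative_at_withinI[OF has_derivative_partials[OF smooth_differentiable[OF sm[OF K(1)]]]])
      have "(\<Sum>i\<in>UNIV. h $ i *\<^sub>R partial i (\<phi> K) p) = h \<bullet> grad (\<phi> K) p" for h by (simp add: inner_vec_def)
      then have "norm (\<Sum>i\<in>UNIV. h $ i *\<^sub>R partial i (\<phi> K) p) \<le> L * norm h" for h
        using Cauchy_Schwarz_ineq2[of h "grad (\<phi> K) p"] mult_left_mono[OF L(2)[OF K(1) p] norm_ge_zero[of h]] by (simp add: mult.commute)
      then show "onorm (\<lambda>h. \<Sum>i\<in>UNIV. h $ i *\<^sub>R partial i (\<phi> K) p) \<le> L" by (rule onorm_bound[OF L(1)])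
    qed
    then show ?thesis by simp
  qed
  define f where "f x = (if x \<in> \<Union>T then \<phi> (SOME K. K \<in> T \<and> x \<in> K) x else 0)" for x
  have f: "f x = \<phi> K x" if "K \<in> T" "x \<in> K" for K x
  proof -
    have "(SOME K. K \<in> T \<and> x \<in> K) \<in> T \<and> x \<in> (SOME K. K \<in> T \<and> x \<in> K)"
      by (rule someI[of "\<lambda>K. K \<in> T \<and> x \<in> K" K]) (use that in blast)
    then have "\<phi> (SOME K. K \<in> T \<and> x \<in> K) x = \<phi> K x"
      using Q0_continuous[OF \<phi> _ _ that] by blast
    moreover have "x \<in> \<Union>T" using that by blast
    ultimately show ?thesis by (simp add: f_def)
  qed
  have f0: "f x = 0" if "x \<notin> \<Omega>" for x
  proof (cases "x \<in> \<Union>T")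
    case True
    then obtain K where K: "K \<in> T" "x \<in> K" by blast
    then have "x \<in> frontier \<Omega>" using cell_in_frontier that by blast
    then show ?thesis using f[OF K] \<phi> K by (auto simp: Q0_space_def)
  qed (simp add: f_def)
  have lip: "\<bar>f y - f x\<bar> \<le> L * norm (y - x)" for x y
  proof -
    let ?p = "\<lambda>s. x + s *\<^sub>R (y - x)"
    let ?C = "\<lambda>K. {s. ?p s \<in> K}"
    have cont: "continuous_on UNIV ?p" by (intro continuous_intros)
    have cl: "closed (?C K)" if "closed K" for K
      using continuous_closed_preimage[OF cont closed_UNIV that] by (simp add: vimage_def)
    have nd: "norm (?p s - ?p t) = norm (y - x) * \<bar>s - t\<bar>" for s t
    proof -
      have "?p s - ?p t = (s - t) *\<^sub>R (y - x)" by (simp add: algebra_simps)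
      then show ?thesis by (simp add: mult.commute)
    qed
    have "\<bar>f (?p 1) - f (?p 0)\<bar> \<le> (L * norm (y - x)) * (1 - 0)"
    proof (rule piecewise_lipschitz[where A = "insert (- \<Omega>) T" and C = ?C])
      show "closed (?C K)" if "K \<in> insert (- \<Omega>) T" for K
        using that cell_closed open_domain by (intro cl) auto
      show "{0..1} \<subseteq> (\<Union>K\<in>insert (- \<Omega>) T. ?C K)" using domain_subset_cells by auto
      fix K s t assume K: "K \<in> insert (- \<Omega>) T" and s: "s \<in> ?C K \<inter> {0..1}" and t: "t \<in> ?C K \<inter> {0..1}"
      show "\<bar>f (?p s) - f (?p t)\<bar> \<le> L * norm (y - x) * \<bar>s - t\<bar>"
      proof (cases "K \<in> T")
        case True
        then have "\<bar>f (?p s) - f (?p t)\<bar> \<le> L * norm (?p s - ?p t)"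
          using f[OF True, of "?p s"] f[OF True, of "?p t"] cellL[OF True, of "?p s" "?p t"] s t by simp
        then show ?thesis by (simp only: nd mult.assoc)
      next
        case False
        then have "K = - \<Omega>" using K by blast
        then show ?thesis using f0 s t L(1) by simp
      qed
    qed auto
    then show ?thesis by simp
  qed
  show thesis
  proof (rule that[OF L(1)])
    fix K K' x y assume "K \<in> T" "x \<in> K" "K' \<in> T" "y \<in> K'"
    then show "\<bar>\<phi> K x - \<phi> K' y\<bar> \<le> L * norm (x - y)" using lip[of x y] f by simp
  qed
qed

end

section \<open>Tangential derivatives on facets\<close>

text \<open>A facet spans its supporting plane, so that short segments in tangential directions from a point of the
  relative interior stay on the facet; continuity gives the remaining points.\<close>
lemma facet_tangential_derivative:
  fixes g :: "real^3 \<Rightarrow> 'b::real_normed_vector"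
  assumes K: "interior K \<noteq> {}" "convex K" and e: "e facet_of K" "boundary_normal K e n"
    and g: "smooth g" "\<And>x. x \<in> e \<Longrightarrow> g x = 0" and v: "n \<bullet> v = 0" and x: "x \<in> e"
  shows "(\<Sum>i\<in>UNIV. v $ i *\<^sub>R partial i g x) = 0"
proof -
  obtain b where n: "norm n = 1" and eb: "e = K \<inter> {x. n \<bullet> x = b}" using e(2) unfolding boundary_normal_def by blast
  have n0: "n \<noteq> 0" using n by auto
  have dK: "aff_dim K = 3" using aff_dim_nonempty_interior[OF K(1)] by simp
  have de: "aff_dim e = 2" using e(1) dK unfolding facet_of_def by simp
  have "aff_dim {x. n \<bullet> x = b} = 2" using aff_dim_hyperplane[OF n0, of b] by simp
  then have "affine hull e = affine hull {x. n \<bullet> x = b}"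
    using aff_dim_eq_full_gen[of e "{x. n \<bullet> x = b}"] de eb by auto
  then have hull: "affine hull e = {x. n \<bullet> x = b}" using affine_hyperplane[of n b] by (simp add: affine_hull_eq)
  have ce: "convex e" unfolding eb by (intro convex_Int K(2) convex_hyperplane)
  let ?D = "\<lambda>x. \<Sum>i\<in>UNIV. v $ i *\<^sub>R partial i g x"
  have D0: "?D x = 0" if x: "x \<in> rel_interior e" for x
  proof -
    obtain r where r: "r > 0" "ball x r \<inter> {x. n \<bullet> x = b} \<subseteq> e" and xe: "x \<in> e"
      using x unfolding mem_rel_interior_ball hull by blast
    define d where "d = r / (norm v + 1)"
    have nv: "norm v + 1 > 0" using norm_ge_zero[of v] by linarith
    have d: "d > 0" using r nv by (simp add: d_def)
    have on_e: "x + s *\<^sub>R v \<in> e" if s: "\<bar>s\<bar> < d" for s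
    proof -
      have "\<bar>s\<bar> * norm v \<le> \<bar>s\<bar> * (norm v + 1)" by (intro mult_left_mono) auto
      also have "\<dots> < d * (norm v + 1)" using s nv by (intro mult_strict_right_mono)
      also have "\<dots> = r" using nv by (simp add: d_def)
      finally have "x + s *\<^sub>R v \<in> ball x r" by (simp add: dist_norm)
      moreover have "n \<bullet> (x + s *\<^sub>R v) = b" using xe eb v by (simp add: inner_add_right)
      ultimately show ?thesis using r(2) by blast
    qed
    have "((\<lambda>s. g (x + s *\<^sub>R v)) has_vector_derivative ?D (x + 0 *\<^sub>R v)) (at 0)"
      by (rule smooth_line_derivative[OF g(1)])
    moreover have "((\<lambda>s. g (x + s *\<^sub>R v)) has_vector_derivative 0) (at 0)"
    proof (rule has_vector_derivative_transform_within_open[where S = "{-d<..<d}" and f = "\<lambda>s. 0"])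
      show "0 = g (x + s *\<^sub>R v)" if "s \<in> {-d<..<d}" for s using g(2)[OF on_e[of s]] that by auto
    qed (use d in auto)
    ultimately show ?thesis using vector_derivative_unique_at by fastforce
  qed
  have cont: "continuous_on (closure (rel_interior e)) ?D"
    by (intro smooth_continuous smooth_sum smooth_bilinear[OF bounded_bilinear_scaleR] smooth_const smooth_partial g)
  have "x \<in> closure (rel_interior e)" using x convex_closure_rel_interior[OF ce] closure_subset by blast
  from continuous_constant_on_closure[OF cont D0 this] show ?thesis by blast
qed

section \<open>The finite element spaces\<close>

lemma P_vec_iff: "f \<in> P_vec k \<longleftrightarrow> (\<forall>i. (\<lambda>x. f x $ i) \<in> P_poly k)" by (simp add: P_vec_def)

lemma smooth_P_vec: "f \<in> P_vec k \<Longrightarrow> smooth f"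
  by (rule smooth_componentwise) (auto simp: P_vec_def intro: smooth_P_poly)

lemma P_vec_zero: "(\<lambda>x. 0) \<in> P_vec k" by (simp add: P_vec_def P_poly_zero)

lemma P_vec_comb: "f \<in> P_vec k \<Longrightarrow> g \<in> P_vec k \<Longrightarrow> (\<lambda>x. f x + c *\<^sub>R g x) \<in> P_vec k"
  by (simp add: P_vec_def P_poly_add P_poly_scale)

lemma grad_P_vec: "f \<in> P_poly (k + 1) \<Longrightarrow> grad f \<in> P_vec k"
  using partial_P_poly[of f "k + 1"] by (simp add: P_vec_def)

lemma coordinate_times_partial_P_poly:
  assumes "f \<in> P_poly k" shows "(\<lambda>x. x $ r * partial s f x) \<in> P_poly k"
proof (cases k)
  case 0
  have "partial s f = (\<lambda>x. 0)"
  proof -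
    have "\<exists>c. f = (\<lambda>x. c)" using assms[unfolded 0]
    proof (induction rule: P_poly_induct)
      case (add f g) then show ?case by auto
    next
      case (scale f c) then show ?case by auto
    next
      case (monomial i j l) then show ?case by (auto simp: monomial_def[abs_def])
    qed blast
    then show ?thesis by auto
  qed
  then show ?thesis using P_poly_zero by simp
next
  case (Suc k')
  have "partial s f \<in> P_poly k'" using partial_P_poly[OF assms] Suc by simp
  from P_poly_mult_coord[OF this] show ?thesis using Suc by simp
qed

text \<open>The curl of \<open>x \<times> b\<close> is \<open>(div b) x - 2 b - (x \<cdot> grad) b\<close>, and \<open>x \<cdot> grad\<close> does not raise the degree.\<close>
lemma curl_N_shape:
  assumes a: "a \<in> P_vec k" and b: "b \<in> P_vec k"
  shows "\<exists>a'\<in>P_vec k. \<exists>b'\<in>P_poly k. curl (\<lambda>x. a x + cross3 x (b x)) = (\<lambda>x. a' x + b' x *\<^sub>R x)"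
proof -
  have sa: "smooth a" and sb: "smooth b" using a b smooth_P_vec by auto
  have pa: "partial i a x $ j = partial i (\<lambda>x. a x $ j) x" for i j x
    using partial_nth[OF smooth_differentiable[OF sa]] by simp
  have pb: "partial i b x $ j = partial i (\<lambda>x. b x $ j) x" for i j x
    using partial_nth[OF smooth_differentiable[OF sb]] by simp
  define d where "d x = partial 1 b x $ 1 + partial 2 b x $ 2 + partial 3 b x $ 3" for x
  define a' where "a' x = curl a x - (2 *\<^sub>R b x + (x $ 1 *\<^sub>R partial 1 b x + x $ 2 *\<^sub>R partial 2 b x + x $ 3 *\<^sub>R partial 3 b x))" for x
  have pid: "partial i (\<lambda>x. x) x = axis i 1" for i x
    by (rule partial_eqI) (rule has_derivative_ident)
  have pf: "partial i (\<lambda>x. a x + cross3 x (b x)) x = partial i a x + (cross3 x (partial i b x) + cross3 (axis i 1) (b x))" for i x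
  proof -
    have "partial i (\<lambda>x. cross3 x (b x)) x = cross3 x (partial i b x) + cross3 (partial i (\<lambda>x. x) x) (b x)"
      by (intro partial_bilinear[OF bounded_bilinear_cross3] smooth_differentiable smooth_ident sb)
    moreover have "partial i (\<lambda>x. a x + cross3 x (b x)) x = partial i a x + partial i (\<lambda>x. cross3 x (b x)) x"
      by (intro partial_add smooth_differentiable smooth_cross3 smooth_ident sa sb)
    ultimately show ?thesis by (simp add: pid)
  qed
  have ax: "axis i 1 $ j = (if i = j then 1 else (0::real))" for i j :: 3 by (simp add: axis_def)
  have "curl (\<lambda>x. a x + cross3 x (b x)) x = a' x + d x *\<^sub>R x" for x
    by (simp add: vec_eq_iff forall_3 curl_nth pf cross_components a'_def d_def ax algebra_simps)
  moreover have "d \<in> P_poly k"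
    unfolding d_def[abs_def] pb using b by (intro P_poly_add P_poly_mono[OF partial_P_poly]) (auto simp: P_vec_def)
  moreover have "a' \<in> P_vec k"
  proof -
    have c: "(\<lambda>x. curl a x $ j) \<in> P_poly k" for j
    proof -
      have "\<forall>j. (\<lambda>x. curl a x $ j) \<in> P_poly k"
        unfolding forall_3 curl_nth pa using a
        by (intro conjI P_poly_diff P_poly_mono[OF partial_P_poly]) (auto simp: P_vec_def)
      then show ?thesis ..
    qed
    have t: "(\<lambda>x. x $ i * partial i (\<lambda>x. b x $ j) x) \<in> P_poly k" for i j
      using b by (intro coordinate_times_partial_P_poly) (auto simp: P_vec_def)
    have bj: "(\<lambda>x. 2 * b x $ j) \<in> P_poly k" for j using b by (intro P_poly_scale) (auto simp: P_vec_def)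
    show ?thesis unfolding P_vec_iff a'_def using c t bj
      by (simp add: pb) (intro allI P_poly_diff P_poly_add; assumption?)
  qed
  ultimately show ?thesis by blast
qed

lemma N_shape_components:
  assumes "a \<in> P_vec k" "b \<in> P_vec k" shows "(\<lambda>x. (a x + cross3 x (b x)) $ i) \<in> P_poly (k + 1)"
proof -
  have A: "(\<lambda>x. a x $ i) \<in> P_poly (k + 1)" for i
    using assms(1) by (intro P_poly_mono[of _ k "k + 1"]) (auto simp: P_vec_def)
  have L: "(\<lambda>x. x $ j * b x $ i) \<in> P_poly (k + 1)" for i j
    using assms(2) by (intro P_poly_mult_coord) (auto simp: P_vec_def)
  have R: "(\<lambda>x. b x $ i * x $ j) \<in> P_poly (k + 1)" for i j
    using L[of j i] by (simp only: mult.commute)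
  have "\<forall>i. (\<lambda>x. (a x + cross3 x (b x)) $ i) \<in> P_poly (k + 1)"
    unfolding forall_3 vector_add_component cross_components
    by (intro conjI P_poly_add P_poly_diff A L R)
  then show ?thesis ..
qed

lemma RT_shape_components:
  assumes "a \<in> P_vec k" "b \<in> P_poly k" shows "(\<lambda>x. (a x + b x *\<^sub>R x) $ i) \<in> P_poly (k + 1)"
proof -
  have "(\<lambda>x. a x $ i + x $ i * b x) \<in> P_poly (k + 1)"
    using P_poly_add[OF P_poly_mono[of "\<lambda>x. a x $ i" k "k + 1"] P_poly_mult_coord[OF assms(2), of i]] assms(1)
    by (simp add: P_vec_def)
  then show ?thesis by (simp add: mult.commute)
qed

lemma broken_comb: "broken T (\<lambda>K x. f K x + c *\<^sub>R g K x) = (\<lambda>x. broken T f x + c *\<^sub>R broken T g x)"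
  by (rule ext) (simp add: broken_def scaleR_add_right sum.distrib scaleR_sum_right mult.commute)

lemma L2_comb:
  fixes f g :: "real^3 \<Rightarrow> 'b::euclidean_space"
  assumes "f \<in> L2 S" "g \<in> L2 S" shows "(\<lambda>x. f x + c *\<^sub>R g x) \<in> L2 S"
proof -
  have m: "(\<lambda>x. f x + c *\<^sub>R g x) \<in> borel_measurable (lebesgue_on S)" using assms by (auto simp: L2_def)
  have "integrable (lebesgue_on S) (\<lambda>x. 2 * (norm (f x))\<^sup>2 + 2 * c\<^sup>2 * (norm (g x))\<^sup>2)"
    using assms by (auto simp: L2_def)
  then have "integrable (lebesgue_on S) (\<lambda>x. (norm (f x + c *\<^sub>R g x))\<^sup>2)"
  proof (rule Bochner_Integration.integrable_bound)
    have "(norm (f x + c *\<^sub>R g x))\<^sup>2 \<le> 2 * (norm (f x))\<^sup>2 + 2 * c\<^sup>2 * (norm (g x))\<^sup>2" for x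
    proof -
      have "(norm (f x + c *\<^sub>R g x))\<^sup>2 \<le> (norm (f x) + \<bar>c\<bar> * norm (g x))\<^sup>2"
        using norm_triangle_ineq[of "f x" "c *\<^sub>R g x"] by (intro power_mono) auto
      also have "\<dots> \<le> 2 * (norm (f x))\<^sup>2 + 2 * (\<bar>c\<bar> * norm (g x))\<^sup>2"
        using zero_le_power2[of "norm (f x) - \<bar>c\<bar> * norm (g x)"] by (simp add: power2_eq_square algebra_simps)
      finally show ?thesis by (simp add: power_mult_distrib)
    qed
    then show "AE x in lebesgue_on S. norm ((norm (f x + c *\<^sub>R g x))\<^sup>2) \<le> norm (2 * (norm (f x))\<^sup>2 + 2 * c\<^sup>2 * (norm (g x))\<^sup>2)"
      by simp
  qed (use m in measurable)
  then show ?thesis using m by (simp add: L2_def)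
qed

lemma LINT_inner_comb:
  fixes f g :: "real^3 \<Rightarrow> 'b::euclidean_space"
  assumes S: "S \<in> lmeasurable" and "f \<in> L2 S" "g \<in> L2 S" and \<psi>: "smooth \<psi>" "supported_in S' \<psi>"
  shows "(LINT x|lebesgue_on S. (f x + c *\<^sub>R g x) \<bullet> \<psi> x)
    = (LINT x|lebesgue_on S. f x \<bullet> \<psi> x) + c * (LINT x|lebesgue_on S. g x \<bullet> \<psi> x)"
proof -
  obtain B where B: "\<And>x. norm (\<psi> x) \<le> B" using supported_bounded[OF \<psi>(2) smooth_continuous[OF \<psi>(1)]] by metis
  have int: "integrable (lebesgue_on S) (\<lambda>x. f x \<bullet> \<psi> x)" "integrable (lebesgue_on S) (\<lambda>x. g x \<bullet> \<psi> x)"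
    using assms by (auto intro!: integrable_inner_bounded[OF L2_integrable[OF S] smooth_continuous[OF \<psi>(1)] B])
  have "(LINT x|lebesgue_on S. (f x + c *\<^sub>R g x) \<bullet> \<psi> x) = (LINT x|lebesgue_on S. f x \<bullet> \<psi> x + c * (g x \<bullet> \<psi> x))"
    by (simp add: inner_add_left)
  also have "\<dots> = (LINT x|lebesgue_on S. f x \<bullet> \<psi> x) + (LINT x|lebesgue_on S. c * (g x \<bullet> \<psi> x))"
    using int by (intro Bochner_Integration.integral_add) auto
  finally show ?thesis by simp
qed

context mesh
begin

lemma weak_divergence_comb:
  assumes "has_weak_divergence \<Omega> f g" "has_weak_divergence \<Omega> f' g'"
  shows "has_weak_divergence \<Omega> (\<lambda>x. f x + c *\<^sub>R f' x) (\<lambda>x. g x + c *\<^sub>R g' x)"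
  unfolding has_weak_divergence_def
proof (intro conjI ballI)
  show "(\<lambda>x. f x + c *\<^sub>R f' x) \<in> L2 \<Omega>" "(\<lambda>x. g x + c *\<^sub>R g' x) \<in> L2 \<Omega>"
    using assms by (auto simp only: has_weak_divergence_def intro!: L2_comb)
  fix \<psi> :: "real^3 \<Rightarrow> real" assume \<psi>: "\<psi> \<in> test_functions \<Omega>"
  then have s: "smooth \<psi>" "supported_in \<Omega> \<psi>" by (auto simp: test_functions_iff)
  note c1 = LINT_inner_comb[OF domain_lmeasurable _ _ s, of g g' c]
    and c2 = LINT_inner_comb[OF domain_lmeasurable _ _ smooth_grad[OF s(1)] supported_in_grad[OF s(2)], of f f' c]
  show "(LINT x|lebesgue_on \<Omega>. (g x + c *\<^sub>R g' x) * \<psi> x) = - (LINT x|lebesgue_on \<Omega>. (f x + c *\<^sub>R f' x) \<bullet> grad \<psi> x)"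
    using assms \<psi> c1 c2 unfolding has_weak_divergence_def by (simp add: algebra_simps)
qed

lemma weak_grad_comb:
  assumes "has_weak_grad \<Omega> f g" "has_weak_grad \<Omega> f' g'"
  shows "has_weak_grad \<Omega> (\<lambda>x. f x + c *\<^sub>R f' x) (\<lambda>x. g x + c *\<^sub>R g' x)"
  unfolding has_weak_grad_def
proof (intro conjI ballI allI)
  show "(\<lambda>x. f x + c *\<^sub>R f' x) \<in> L2 \<Omega>" "(\<lambda>x. g x + c *\<^sub>R g' x) \<in> L2 \<Omega>"
    using assms by (auto simp only: has_weak_grad_def intro!: L2_comb)
  fix \<psi> :: "real^3 \<Rightarrow> real" and i assume \<psi>: "\<psi> \<in> test_functions \<Omega>"
  then have s: "smooth \<psi>" "supported_in \<Omega> \<psi>" by (auto simp: test_functions_iff)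
  have s': "smooth (\<lambda>x. \<psi> x *\<^sub>R axis i 1 :: real^3)" "supported_in \<Omega> (\<lambda>x. \<psi> x *\<^sub>R axis i 1 :: real^3)"
    by (intro smooth_bilinear[OF bounded_bilinear_scaleR] smooth_const s) (rule supported_in_imp[OF s(2)], simp)
  note c1 = LINT_inner_comb[OF domain_lmeasurable _ _ s', of g g' c]
    and c2 = LINT_inner_comb[OF domain_lmeasurable _ _ smooth_partial[OF s(1)] supported_in_partial[OF s(2)], of f f' c i]
  show "(LINT x|lebesgue_on \<Omega>. (g x + c *\<^sub>R g' x) $ i * \<psi> x) = - (LINT x|lebesgue_on \<Omega>. (f x + c *\<^sub>R f' x) * partial i \<psi> x)"
    using assms \<psi> c1 c2 unfolding has_weak_grad_def by (simp add: inner_axis algebra_simps)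
qed

lemma DG_space_iff: "f \<in> DG_space \<Omega> T k \<longleftrightarrow> (\<forall>K\<in>T. f K \<in> P_poly k)"
  unfolding DG_space_def by (auto intro!: broken_L2 smooth_continuous smooth_P_poly)

lemma Hdiv_comb: "broken T f \<in> Hdiv \<Omega> \<Longrightarrow> broken T g \<in> Hdiv \<Omega> \<Longrightarrow> broken T (\<lambda>K x. f K x + c *\<^sub>R g K x) \<in> Hdiv \<Omega>"
  unfolding Hdiv_def broken_comb using weak_divergence_comb by blast

lemma RT_space_comb:
  assumes "f \<in> RT_space \<Omega> T k" "g \<in> RT_space \<Omega> T k"
  shows "(\<lambda>K x. f K x + c *\<^sub>R g K x) \<in> RT_space \<Omega> T k"
  unfolding RT_space_def
proof (intro CollectI conjI ballI)
  show "broken T (\<lambda>K x. f K x + c *\<^sub>R g K x) \<in> Hdiv \<Omega>" using assms Hdiv_comb by (simp add: RT_space_def)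
  fix K assume K: "K \<in> T"
  obtain a b where ab: "a \<in> P_vec k" "b \<in> P_poly k" "f K = (\<lambda>x. a x + b x *\<^sub>R x)" using assms(1) K by (auto simp: RT_space_def)
  obtain a' b' where ab': "a' \<in> P_vec k" "b' \<in> P_poly k" "g K = (\<lambda>x. a' x + b' x *\<^sub>R x)" using assms(2) K by (auto simp: RT_space_def)
  show "\<exists>a\<in>P_vec k. \<exists>b\<in>P_poly k. (\<lambda>x. f K x + c *\<^sub>R g K x) = (\<lambda>x. a x + b x *\<^sub>R x)"
    by (rule bexI[OF _ P_vec_comb[OF ab(1) ab'(1), of c]], rule bexI[OF _ P_poly_add[OF ab(2) P_poly_scale[OF ab'(2), of c]]])
       (simp add: ab(3) ab'(3) algebra_simps)
qed

lemma RT0_space_comb: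
  assumes "f \<in> RT0_space \<Omega> T k" "g \<in> RT0_space \<Omega> T k"
  shows "(\<lambda>K x. f K x + c *\<^sub>R g K x) \<in> RT0_space \<Omega> T k"
proof -
  have "(\<lambda>K x. f K x + c *\<^sub>R g K x) \<in> RT_space \<Omega> T k" using assms by (intro RT_space_comb) (auto simp: RT0_space_def)
  moreover have "n \<bullet> (f K x + c *\<^sub>R g K x) = 0"
    if "K \<in> T" "e facet_of K" "e \<subseteq> frontier \<Omega>" "boundary_normal K e n" "x \<in> e" for K e n x
  proof -
    have "n \<bullet> f K x = 0" "n \<bullet> g K x = 0" using assms that unfolding RT0_space_def by blast+
    then show ?thesis by (simp add: inner_add_right)
  qed
  ultimately show ?thesis unfolding RT0_space_def by blast
qed

lemma Q0_space_comb:
  assumes "f \<in> Q0_space \<Omega> T k" "g \<in> Q0_space \<Omega> T k"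
  shows "(\<lambda>K x. f K x + c *\<^sub>R g K x) \<in> Q0_space \<Omega> T k"
proof -
  have "broken T (\<lambda>K x. f K x + c *\<^sub>R g K x) \<in> H1 \<Omega>"
    using assms weak_grad_comb unfolding Q0_space_def Q_space_def H1_def broken_comb by blast
  moreover have "(\<lambda>x. f K x + c *\<^sub>R g K x) \<in> P_poly k" if "K \<in> T" for K
  proof -
    have "f K \<in> P_poly k" "g K \<in> P_poly k" using assms that by (auto simp: Q0_space_def Q_space_def)
    from P_poly_add[OF this(1) P_poly_scale[OF this(2), of c]] show ?thesis by simp
  qed
  ultimately show ?thesis using assms by (simp add: Q0_space_def Q_space_def)
qed

lemma RT_space_components:
  assumes "f \<in> RT_space \<Omega> T k" "K \<in> T" shows "(\<lambda>x. f K x $ i) \<in> P_poly (k + 1)"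
proof -
  have "\<exists>a\<in>P_vec k. \<exists>b\<in>P_poly k. f K = (\<lambda>x. a x + b x *\<^sub>R x)" using assms by (simp add: RT_space_def)
  then obtain a b where ab: "a \<in> P_vec k" "b \<in> P_poly k" "f K = (\<lambda>x. a x + b x *\<^sub>R x)" by blast
  show ?thesis unfolding ab(3) by (rule RT_shape_components[OF ab(1,2)])
qed

lemma N_space_components:
  assumes "f \<in> N_space \<Omega> T k" "K \<in> T" shows "(\<lambda>x. f K x $ i) \<in> P_poly (k + 1)"
proof -
  have "\<exists>a\<in>P_vec k. \<exists>b\<in>P_vec k. f K = (\<lambda>x. a x + cross3 x (b x))" using assms by (simp add: N_space_def)
  then obtain a b where ab: "a \<in> P_vec k" "b \<in> P_vec k" "f K = (\<lambda>x. a x + cross3 x (b x))" by blast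
  show ?thesis unfolding ab(3) by (rule N_shape_components[OF ab(1,2)])
qed

lemma RT_space_smooth:
  assumes "f \<in> RT_space \<Omega> T k" "K \<in> T" shows "smooth (f K)"
proof (rule smooth_componentwise)
  fix i show "smooth (\<lambda>x. f K x $ i)" using RT_space_components[OF assms, of i] by (rule smooth_P_poly)
qed

lemma N_space_smooth:
  assumes "f \<in> N_space \<Omega> T k" "K \<in> T" shows "smooth (f K)"
proof (rule smooth_componentwise)
  fix i show "smooth (\<lambda>x. f K x $ i)" using N_space_components[OF assms, of i] by (rule smooth_P_poly)
qed

text \<open>A scalar field that vanishes on a boundary facet has only a normal derivative there.\<close>
theorem grad_Q0_in_N0:
  assumes \<phi>: "\<phi> \<in> Q0_space \<Omega> T (k + 1)"
  shows "(\<lambda>K. grad (\<phi> K)) \<in> N0_space \<Omega> T k"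
proof -
  have P: "\<And>K. K \<in> T \<Longrightarrow> \<phi> K \<in> P_poly (k + 1)" and H1: "broken T \<phi> \<in> H1 \<Omega>"
    using \<phi> by (auto simp: Q0_space_def Q_space_def)
  have sm: "smooth (\<phi> K)" if "K \<in> T" for K using P[OF that] by (rule smooth_P_poly)
  have "broken T (\<lambda>K. grad (\<phi> K)) \<in> Hcurl \<Omega>" unfolding Hcurl_def using broken_grad_weak_curl[of \<phi>, OF sm H1] by auto
  moreover have "\<exists>a\<in>P_vec k. \<exists>b\<in>P_vec k. grad (\<phi> K) = (\<lambda>x. a x + cross3 x (b x))" if "K \<in> T" for K
    by (rule bexI[OF _ grad_P_vec[OF P[OF that]]], rule bexI[OF _ P_vec_zero]) simp
  ultimately have N: "(\<lambda>K. grad (\<phi> K)) \<in> N_space \<Omega> T k" by (simp add: N_space_def)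
  have "cross3 n (grad (\<phi> K) x) = 0"
    if K: "K \<in> T" and e: "e facet_of K" "e \<subseteq> frontier \<Omega>" "boundary_normal K e n" and x: "x \<in> e" for K e n x
  proof -
    have n: "n \<bullet> n = 1" using e(3) by (simp add: boundary_normal_def dot_square_norm)
    have z: "\<phi> K y = 0" if "y \<in> e" for y
    proof -
      have "y \<in> K" using e(3) that by (auto simp: boundary_normal_def)
      then show ?thesis using \<phi> K e(2) that by (auto simp: Q0_space_def)
    qed
    define v where "v = grad (\<phi> K) x - (n \<bullet> grad (\<phi> K) x) *\<^sub>R n"
    have nv: "n \<bullet> v = 0" by (simp add: v_def inner_diff_right n)
    have "(\<Sum>i\<in>UNIV. v $ i *\<^sub>R partial i (\<phi> K) x) = 0"
      by (rule facet_tangential_derivative[OF cell_interior[OF K] cell_convex[OF K] e(1,3) sm[OF K] z nv x])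
    then have "v \<bullet> grad (\<phi> K) x = 0" by (simp add: inner_vec_def)
    moreover have "grad (\<phi> K) x = v + (n \<bullet> grad (\<phi> K) x) *\<^sub>R n" by (simp add: v_def)
    ultimately have "v \<bullet> v = 0" using nv by (metis add.right_neutral inner_add_right inner_commute inner_scaleR_right mult_zero_right)
    then have "grad (\<phi> K) x = (n \<bullet> grad (\<phi> K) x) *\<^sub>R n" by (simp add: v_def)
    then show ?thesis by (metis cross_mult_right cross_refl scaleR_zero_right)
  qed
  then show ?thesis using N by (auto simp: N0_space_def)
qed

lemma orthogonal_pair_cross:
  fixes n :: "real^3"
  assumes n: "norm n = 1"
  obtains a b where "n \<bullet> a = 0" "n \<bullet> b = 0" "cross3 a b = n"
proof -
  have "n \<noteq> 0" using n by auto
  then obtain c where c: "cross3 n c \<noteq> 0" using cross_basis_nonzero by blast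
  define a where "a = cross3 n ((1 / norm (cross3 n c)) *\<^sub>R c)"
  have na: "n \<bullet> a = 0" by (simp add: a_def dot_cross_self)
  have "norm a = 1" using c by (simp add: a_def cross_mult_right)
  then have aa: "a \<bullet> a = 1" by (simp add: dot_square_norm)
  have "cross3 a (cross3 n a) = n" unfolding Lagrange using na aa by (simp add: inner_commute)
  moreover have "n \<bullet> cross3 n a = 0" by (rule dot_cross_self)
  ultimately show ?thesis using that na by blast
qed

text \<open>On a boundary facet with \<open>n = a \<times> b\<close>, the normal component of the curl of \<open>E\<close> is
  \<open>D a \<cdot> b - D b \<cdot> a\<close>, which involves tangential derivatives of tangential components only.\<close>
theorem curl_N0_in_RT0:
  assumes E: "E \<in> N0_space \<Omega> T k"
  shows "(\<lambda>K. curl (E K)) \<in> RT0_space \<Omega> T k"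
proof -
  have EN: "E \<in> N_space \<Omega> T k" and Hcurl: "broken T E \<in> Hcurl \<Omega>" using E by (auto simp: N0_space_def N_space_def)
  have sm: "smooth (E K)" if "K \<in> T" for K using EN that by (rule N_space_smooth)
  have "broken T (\<lambda>K. curl (E K)) \<in> Hdiv \<Omega>" unfolding Hdiv_def using broken_curl_weak_divergence[of E, OF sm Hcurl] by auto
  moreover have "\<exists>a\<in>P_vec k. \<exists>b\<in>P_poly k. curl (E K) = (\<lambda>x. a x + b x *\<^sub>R x)" if K: "K \<in> T" for K
  proof -
    obtain a b where "a \<in> P_vec k" "b \<in> P_vec k" "E K = (\<lambda>x. a x + cross3 x (b x))" using EN K by (auto simp: N_space_def)
    then show ?thesis using curl_N_shape by simp
  qed
  ultimately have RT: "(\<lambda>K. curl (E K)) \<in> RT_space \<Omega> T k" by (simp add: RT_space_def)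
  have "n \<bullet> curl (E K) x = 0"
    if K: "K \<in> T" and e: "e facet_of K" "e \<subseteq> frontier \<Omega>" "boundary_normal K e n" and x: "x \<in> e" for K e n x
  proof -
    have n: "norm n = 1" using e(3) by (simp add: boundary_normal_def)
    have nn: "n \<bullet> n = 1" using n by (simp add: dot_square_norm)
    have z: "cross3 n (E K y) = 0" if "y \<in> e" for y
      using E K e that unfolding N0_space_def by blast
    define D where "D v = (\<Sum>i\<in>UNIV. v $ i *\<^sub>R partial i (E K) x)" for v
    have normal: "D v \<bullet> u = 0" if v: "n \<bullet> v = 0" and u: "n \<bullet> u = 0" for v u
    proof -
      have pn: "partial i (\<lambda>x. cross3 n (E K x)) x = cross3 n (partial i (E K) x)" for i
        by (rule partial_linear[OF bounded_bilinear.bounded_linear_right[OF bounded_bilinear_cross3] smooth_differentiable[OF sm[OF K]]])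
      have "(\<Sum>i\<in>UNIV. v $ i *\<^sub>R partial i (\<lambda>x. cross3 n (E K x)) x) = 0"
        by (rule facet_tangential_derivative[OF cell_interior[OF K] cell_convex[OF K] e(1,3) smooth_cross3[OF smooth_const sm[OF K]] z v x])
      then have "cross3 n (D v) = 0"
        unfolding pn D_def by (simp add: sum_3 cross_add_right cross_mult_right)
      then have "cross3 n (cross3 n (D v)) = 0" by simp
      then have "D v = (n \<bullet> D v) *\<^sub>R n" unfolding Lagrange by (simp add: nn)
      then have "D v \<bullet> u = (n \<bullet> D v) * (n \<bullet> u)" by (metis inner_scaleR_left)
      then show ?thesis using u by simp
    qed
    obtain a b where ab: "n \<bullet> a = 0" "n \<bullet> b = 0" "cross3 a b = n" by (rule orthogonal_pair_cross[OF n])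
    have "cross3 a b \<bullet> curl (E K) x = D a \<bullet> b - D b \<bullet> a"
      by (simp add: D_def inner_vec_def sum_3 cross_components curl_nth algebra_simps)
    then show ?thesis using normal ab by simp
  qed
  then show ?thesis using RT by (auto simp: RT0_space_def)
qed

end

section \<open>Absolute continuity\<close>

definition subintervals :: "real \<Rightarrow> real \<Rightarrow> nat \<Rightarrow> (nat \<Rightarrow> real) \<Rightarrow> (nat \<Rightarrow> real) \<Rightarrow> bool" where
  "subintervals a b n s t \<longleftrightarrow> (\<forall>i<n. a \<le> s i \<and> s i \<le> t i \<and> t i \<le> b) \<and>
     (\<forall>i<n. \<forall>j<n. i \<noteq> j \<longrightarrow> {s i<..<t i} \<inter> {s j<..<t j} = {})"

text \<open>Absolute continuity of a function of intervals. With \<open>d s t = norm (f t - f s)\<close> it is that of \<open>f\<close>;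
  in general \<open>d\<close> may bound the increments of many functions at once, such as the values of a field at all
  points of the mesh.\<close>
definition ac_ivl :: "real \<Rightarrow> real \<Rightarrow> (real \<Rightarrow> real \<Rightarrow> real) \<Rightarrow> bool" where
  "ac_ivl a b d \<longleftrightarrow> (\<forall>\<epsilon>>0. \<exists>\<delta>>0. \<forall>n s t. subintervals a b n s t \<and> (\<Sum>i<n. t i - s i) < \<delta> \<longrightarrow>
     (\<Sum>i<n. d (s i) (t i)) < \<epsilon>)"

lemma abs_continuous_iff_ac: "abs_continuous_on_ivl a b f \<longleftrightarrow> ac_ivl a b (\<lambda>s t. norm (f t - f s))"
  by (simp add: abs_continuous_on_ivl_def ac_ivl_def subintervals_def conj_assoc)

lemma ac_ivlD:
  assumes "ac_ivl a b d" "\<epsilon> > 0"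
  shows "\<exists>\<delta>>0. \<forall>n s t. subintervals a b n s t \<longrightarrow> (\<Sum>i<n. t i - s i) < \<delta> \<longrightarrow> (\<Sum>i<n. d (s i) (t i)) < \<epsilon>"
  using assms by (simp add: ac_ivl_def imp_conjL)

lemma ac_ivl_dominated:
  assumes ac: "ac_ivl a b d" and nn: "\<And>s t. 0 \<le> d s t"
    and le: "\<And>s t. a \<le> s \<Longrightarrow> s \<le> t \<Longrightarrow> t \<le> b \<Longrightarrow> d' s t \<le> C * d s t"
  shows "ac_ivl a b d'"
  unfolding ac_ivl_def
proof (intro allI impI)
  fix \<epsilon> :: real assume "\<epsilon> > 0"
  then have e: "\<epsilon> / (\<bar>C\<bar> + 1) > 0" by simp
  obtain \<delta> where \<delta>: "\<delta> > 0"
    "\<And>n s t. subintervals a b n s t \<Longrightarrow> (\<Sum>i<n. t i - s i) < \<delta> \<Longrightarrow> (\<Sum>i<n. d (s i) (t i)) < \<epsilon> / (\<bar>C\<bar> + 1)"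
    using ac_ivlD[OF ac e] by auto
  show "\<exists>\<delta>>0. \<forall>n s t. subintervals a b n s t \<and> (\<Sum>i<n. t i - s i) < \<delta> \<longrightarrow> (\<Sum>i<n. d' (s i) (t i)) < \<epsilon>"
  proof (intro exI[of _ \<delta>] conjI allI impI \<delta>(1))
    fix n s t
    assume st: "subintervals a b n s t \<and> (\<Sum>i<n. t i - s i) < \<delta>"
    have "(\<Sum>i<n. d' (s i) (t i)) \<le> (\<Sum>i<n. (\<bar>C\<bar> + 1) * d (s i) (t i))"
    proof (rule sum_mono)
      fix i assume "i \<in> {..<n}"
      then have "d' (s i) (t i) \<le> C * d (s i) (t i)" using st by (intro le) (auto simp: subintervals_def)
      also have "\<dots> \<le> (\<bar>C\<bar> + 1) * d (s i) (t i)" using nn by (intro mult_right_mono) auto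
      finally show "d' (s i) (t i) \<le> (\<bar>C\<bar> + 1) * d (s i) (t i)" .
    qed
    also have "\<dots> = (\<bar>C\<bar> + 1) * (\<Sum>i<n. d (s i) (t i))" by (rule sum_distrib_left[symmetric])
    also have "\<dots> < (\<bar>C\<bar> + 1) * (\<epsilon> / (\<bar>C\<bar> + 1))"
      using \<delta>(2)[of n s t] st by (intro mult_strict_left_mono) auto
    also have "\<dots> = \<epsilon>" by simp
    finally show "(\<Sum>i<n. d' (s i) (t i)) < \<epsilon>" .
  qed
qed

lemma ac_ivl_add:
  assumes "ac_ivl a b d" "ac_ivl a b d'"
  shows "ac_ivl a b (\<lambda>s t. d s t + d' s t)"
  unfolding ac_ivl_def
proof (intro allI impI)
  fix \<epsilon> :: real assume "\<epsilon> > 0"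
  then have e: "\<epsilon> / 2 > 0" by simp
  obtain \<delta> where \<delta>: "\<delta> > 0"
    "\<And>n s t. subintervals a b n s t \<Longrightarrow> (\<Sum>i<n. t i - s i) < \<delta> \<Longrightarrow> (\<Sum>i<n. d (s i) (t i)) < \<epsilon> / 2"
    using ac_ivlD[OF assms(1) e] by auto
  obtain \<delta>' where \<delta>': "\<delta>' > 0"
    "\<And>n s t. subintervals a b n s t \<Longrightarrow> (\<Sum>i<n. t i - s i) < \<delta>' \<Longrightarrow> (\<Sum>i<n. d' (s i) (t i)) < \<epsilon> / 2"
    using ac_ivlD[OF assms(2) e] by auto
  show "\<exists>\<delta>>0. \<forall>n s t. subintervals a b n s t \<and> (\<Sum>i<n. t i - s i) < \<delta> \<longrightarrow> (\<Sum>i<n. d (s i) (t i) + d' (s i) (t i)) < \<epsilon>"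
  proof (intro exI[of _ "min \<delta> \<delta>'"] conjI allI impI)
    show "min \<delta> \<delta>' > 0" using \<delta>(1) \<delta>'(1) by simp
    fix n s t
    assume st: "subintervals a b n s t \<and> (\<Sum>i<n. t i - s i) < min \<delta> \<delta>'"
    then have "(\<Sum>i<n. d (s i) (t i)) < \<epsilon> / 2" "(\<Sum>i<n. d' (s i) (t i)) < \<epsilon> / 2"
      using \<delta>(2)[of n s t] \<delta>'(2)[of n s t] by auto
    then show "(\<Sum>i<n. d (s i) (t i) + d' (s i) (t i)) < \<epsilon>" by (simp add: sum.distrib)
  qed
qed

lemma ac_ivl_zero: "ac_ivl a b (\<lambda>s t. 0)"
  unfolding ac_ivl_def by (auto intro: exI[of _ 1])

lemma ac_ivl_continuous:
  assumes "abs_continuous_on_ivl a b f" shows "continuous_on {a..b} f"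
  unfolding continuous_on_iff
proof (intro ballI allI impI)
  fix x and \<epsilon> :: real assume x: "x \<in> {a..b}" and e: "\<epsilon> > 0"
  obtain \<delta> where \<delta>: "\<delta> > 0"
    "\<And>n s t. subintervals a b n s t \<Longrightarrow> (\<Sum>i<n. t i - s i) < \<delta> \<Longrightarrow> (\<Sum>i<n. norm (f (t i) - f (s i))) < \<epsilon>"
    using ac_ivlD[OF assms[unfolded abs_continuous_iff_ac] e] by auto
  show "\<exists>d>0. \<forall>x'\<in>{a..b}. dist x' x < d \<longrightarrow> dist (f x') (f x) < \<epsilon>"
  proof (intro exI[of _ \<delta>] conjI ballI impI \<delta>(1))
    fix y assume y: "y \<in> {a..b}" "dist y x < \<delta>"
    have "norm (f (max x y) - f (min x y)) < \<epsilon>"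
      using \<delta>(2)[of 1 "\<lambda>_. min x y" "\<lambda>_. max x y"] x y by (auto simp: dist_real_def subintervals_def)
    then show "dist (f y) (f x) < \<epsilon>" by (cases "x \<le> y") (auto simp: dist_norm norm_minus_commute max_def min_def)
  qed
qed

text \<open>The exceptional null set is covered by an open set \<open>U\<close> of small measure. The gauge \<open>g\<close> forces an interval
  tagged outside \<open>N\<close> to have increment at most \<open>\<epsilon>\<close> times its length, and one tagged in \<open>N\<close> to lie in \<open>U\<close>. In a
  tagged division that is fine for it, the intervals of the first kind contribute at most
  \<open>\<epsilon> (b - a)\<close> to \<open>f b - f a\<close>, and those of the second kind at most \<open>\<epsilon>\<close> by absolute continuity.\<close>
theorem ac_derivative_zero_constant:
  fixes f :: "real \<Rightarrow> real"
  assumes ab: "a \<le> b" and ac: "abs_continuous_on_ivl a b f" and N: "negligible N"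
    and deriv: "\<And>t. t \<in> {a..b} - N \<Longrightarrow> (f has_vector_derivative 0) (at t within {a..b})"
  shows "f b = f a"
proof -
  have "\<bar>f b - f a\<bar> \<le> \<epsilon> * (b - a) + \<epsilon>" if \<epsilon>: "\<epsilon> > 0" for \<epsilon>
  proof -
    obtain \<delta> where \<delta>: "\<delta> > 0"
      "\<And>n s t. subintervals a b n s t \<Longrightarrow> (\<Sum>i<n. t i - s i) < \<delta> \<Longrightarrow> (\<Sum>i<n. norm (f (t i) - f (s i))) < \<epsilon>"
      using ac_ivlD[OF ac[unfolded abs_continuous_iff_ac] \<epsilon>] by auto
    have Nn: "N \<in> null_sets lebesgue" using N by (simp add: negligible_iff_null_sets)
    obtain U where U: "open U" "N \<subseteq> U" "emeasure lebesgue (U - N) < ennreal \<delta>"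
      using sets_lebesgue_outer_open[OF null_setsD2[OF Nn] \<delta>(1)] by blast
    have eU: "emeasure lebesgue U < ennreal \<delta>"
      using U(3) emeasure_Diff_null_set[OF Nn, of U] U(1) by simp
    have Ul: "U \<in> lmeasurable" using U(1) eU by (intro fmeasurableI) (auto simp: top.not_eq_extremum[symmetric] intro: less_trans)
    have mU: "measure lebesgue U < \<delta>"
      using eU \<delta>(1) Ul by (simp add: emeasure_eq_measure2 ennreal_less_iff)
    have "\<exists>r>0. \<forall>s\<in>{a..b}. \<bar>s - t\<bar> < r \<longrightarrow> \<bar>f s - f t\<bar> \<le> \<epsilon> * \<bar>s - t\<bar>" if t: "t \<in> {a..b} - N" for t
    proof -
      have "(f has_derivative (\<lambda>h. 0)) (at t within {a..b})" using deriv[OF t] by (simp add: has_vector_derivative_def)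
      then show ?thesis unfolding has_derivative_within_alt using \<epsilon> by (auto simp: dist_norm)
    qed
    then obtain r where r: "\<And>t. t \<in> {a..b} - N \<Longrightarrow> r t > 0"
      "\<And>t s. t \<in> {a..b} - N \<Longrightarrow> s \<in> {a..b} \<Longrightarrow> \<bar>s - t\<bar> < r t \<Longrightarrow> \<bar>f s - f t\<bar> \<le> \<epsilon> * \<bar>s - t\<bar>"
      by metis
    define g where "g t = (if t \<in> N then U else if t \<in> {a..b} then ball t (r t) else ball t 1)" for t
    have "gauge g" unfolding gauge_def g_def using U r(1) by auto
    then obtain p where p: "p tagged_division_of {a..b}" "g fine p" by (rule fine_division_exists_real)
    note pD = tagged_division_ofD[OF p(1)]
    have ivl: "\<exists>u v. K = {u..v} \<and> u \<le> x \<and> x \<le> v \<and> a \<le> u \<and> v \<le> b \<and> Inf K = u \<and> Sup K = v" if xK: "(x, K) \<in> p" for x K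
    proof -
      obtain u v where K: "K = {u..v}" using pD(4)[OF xK] by auto
      have "x \<in> K" "K \<subseteq> {a..b}" using pD(2,3) xK by auto
      then show ?thesis unfolding K by (intro exI[of _ u] exI[of _ v]) auto
    qed
    let ?h = "\<lambda>(x::real, K). f (Sup K) - f (Inf K)"
    define p1 where "p1 = {y \<in> p. fst y \<notin> N}"
    define p2 where "p2 = {y \<in> p. fst y \<in> N}"
    have fin: "finite p1" "finite p2" "p = p1 \<union> p2" "p1 \<inter> p2 = {}" using pD(1) by (auto simp: p1_def p2_def)
    have split: "f b - f a = sum ?h p1 + sum ?h p2"
      using additive_tagged_division_1[OF ab p(1), of f] fin sum.union_disjoint[of p1 p2 ?h] by simp
    have "\<bar>sum ?h p1\<bar> \<le> (\<Sum>(x, K)\<in>p1. \<epsilon> * (Sup K - Inf K))"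
    proof (rule order_trans[OF sum_abs], rule sum_mono)
      fix y assume y: "y \<in> p1"
      obtain x K where yx: "y = (x, K)" by (cases y)
      have xK: "(x, K) \<in> p" and xN: "x \<notin> N" using y yx by (auto simp: p1_def)
      obtain u v where uv: "K = {u..v}" "u \<le> x" "x \<le> v" "a \<le> u" "v \<le> b" "Inf K = u" "Sup K = v" using ivl[OF xK] by blast
      have xab: "x \<in> {a..b} - N" using uv xN by simp
      have "K \<subseteq> g x" using p(2) xK unfolding fine_def by blast
      then have "K \<subseteq> ball x (r x)" using xab by (simp add: g_def)
      moreover have "u \<in> K" "v \<in> K" using uv by auto
      ultimately have "u \<in> ball x (r x)" "v \<in> ball x (r x)" by blast+
      then have "\<bar>u - x\<bar> < r x" "\<bar>v - x\<bar> < r x" by (auto simp: dist_real_def)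
      then have "\<bar>f u - f x\<bar> \<le> \<epsilon> * \<bar>u - x\<bar>" "\<bar>f v - f x\<bar> \<le> \<epsilon> * \<bar>v - x\<bar>" using uv r(2)[OF xab, of u] r(2)[OF xab, of v] by auto
      then have "\<bar>f v - f u\<bar> \<le> \<epsilon> * (x - u) + \<epsilon> * (v - x)" using uv by simp
      also have "\<dots> = \<epsilon> * (v - u)" by (simp add: algebra_simps)
      finally show "\<bar>?h y\<bar> \<le> (case y of (x, K) \<Rightarrow> \<epsilon> * (Sup K - Inf K))" using uv yx by simp
    qed
    also have "\<dots> \<le> (\<Sum>(x, K)\<in>p. \<epsilon> * (Sup K - Inf K))"
    proof (rule sum_mono2[OF pD(1)])
      show "p1 \<subseteq> p" by (auto simp: p1_def)
      fix y assume "y \<in> p - p1"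
      then show "0 \<le> (case y of (x, K) \<Rightarrow> \<epsilon> * (Sup K - Inf K))"
        using ivl[of "fst y" "snd y"] \<epsilon> by (cases y) fastforce
    qed
    also have "\<dots> = \<epsilon> * (\<Sum>(x, K)\<in>p. Sup K - Inf K)" by (simp add: sum_distrib_left case_prod_beta)
    also have "(\<Sum>(x, K)\<in>p. Sup K - Inf K) = b - a" using additive_tagged_division_1[OF ab p(1), of "\<lambda>x. x"] .
    finally have 1: "\<bar>sum ?h p1\<bar> \<le> \<epsilon> * (b - a)" .
    obtain e where e: "bij_betw e {..<card p2} p2" using ex_bij_betw_nat_finite[OF fin(2)] by (auto simp: atLeast0LessThan)
    define s where "s i = Inf (snd (e i))" for i
    define t where "t i = Sup (snd (e i))" for i
    have ep: "e i \<in> p2" if "i < card p2" for i using bij_betwE[OF e] that by auto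
    have eiv: "snd (e i) = {s i..t i} \<and> a \<le> s i \<and> s i \<le> t i \<and> t i \<le> b" if i: "i < card p2" for i
    proof -
      have "(fst (e i), snd (e i)) \<in> p" using ep[OF i] by (simp add: p2_def)
      from ivl[OF this] show ?thesis unfolding s_def t_def by auto
    qed
    have intr: "interior (snd (e i)) \<inter> interior (snd (e j)) = {}" if "i < card p2" "j < card p2" "i \<noteq> j" for i j
    proof -
      have "e i \<noteq> e j" using e that unfolding bij_betw_def inj_on_def by auto
      then show ?thesis using pD(5)[of "fst (e i)" "snd (e i)" "fst (e j)" "snd (e j)"] ep that by (auto simp: p2_def)
    qed
    have "(\<Sum>i<card p2. norm (f (t i) - f (s i))) < \<epsilon>"
    proof (rule \<delta>(2))
      have "{s i<..<t i} \<inter> {s j<..<t j} = {}" if "i < card p2" "j < card p2" "i \<noteq> j" for i j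
        using intr[OF that] eiv[OF that(1)] eiv[OF that(2)] by simp
      then show "subintervals a b (card p2) s t" using eiv unfolding subintervals_def by blast
      have "(\<Sum>i<card p2. t i - s i) = (\<Sum>i<card p2. measure lebesgue (snd (e i)))"
        by (rule sum.cong) (use eiv in auto)
      also have "\<dots> = measure lebesgue (\<Union>i<card p2. snd (e i))"
      proof (rule measure_negligible_finite_Union_image[symmetric])
        show "snd (e i) \<in> lmeasurable" if "i \<in> {..<card p2}" for i
          using eiv[of i] that by (metis lessThan_iff lmeasurable_interval(1) box_real(2) lmeasurable_cbox)
        show "pairwise (\<lambda>x y. negligible (snd (e x) \<inter> snd (e y))) {..<card p2}"
        proof (rule pairwiseI)
          fix i j assume ij: "i \<in> {..<card p2}" "j \<in> {..<card p2}" "i \<noteq> j"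
          have "convex (snd (e i) \<inter> snd (e j))" using eiv[of i] eiv[of j] ij by auto
          then show "negligible (snd (e i) \<inter> snd (e j))" using intr[of i j] ij by (simp add: negligible_convex_interior)
        qed
      qed simp
      also have "\<dots> \<le> measure lebesgue U"
      proof (rule measure_mono_fmeasurable)
        show "(\<Union>i<card p2. snd (e i)) \<subseteq> U"
        proof
          fix z assume "z \<in> (\<Union>i<card p2. snd (e i))"
          then obtain i where i: "i < card p2" "z \<in> snd (e i)" by auto
          have "(fst (e i), snd (e i)) \<in> p" "fst (e i) \<in> N" using ep[OF i(1)] by (auto simp: p2_def)
          then have "snd (e i) \<subseteq> g (fst (e i))" using p(2) unfolding fine_def by blast
          then have "snd (e i) \<subseteq> U" using \<open>fst (e i) \<in> N\<close> by (simp add: g_def)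
          then show "z \<in> U" using i(2) by blast
        qed
        have "snd (e i) \<in> sets lebesgue" if "i < card p2" for i using eiv[OF that] by auto
        then show "(\<Union>i<card p2. snd (e i)) \<in> sets lebesgue" by auto
      qed (rule Ul)
      finally show "(\<Sum>i<card p2. t i - s i) < \<delta>" using mU by simp
    qed
    moreover have "\<bar>sum ?h p2\<bar> \<le> (\<Sum>i<card p2. norm (f (t i) - f (s i)))"
    proof -
      have "sum ?h p2 = (\<Sum>i<card p2. ?h (e i))" by (rule sum.reindex_bij_betw[OF e, symmetric])
      also have "\<bar>\<dots>\<bar> \<le> (\<Sum>i<card p2. \<bar>?h (e i)\<bar>)" by (rule sum_abs)
      finally show ?thesis by (simp add: s_def t_def case_prod_beta)
    qed
    ultimately show ?thesis using 1 split by linarith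
  qed
  then have le: "\<bar>f b - f a\<bar> \<le> \<epsilon> * (b - a + 1)" if "\<epsilon> > 0" for \<epsilon> using that by (simp add: algebra_simps)
  have "\<bar>f b - f a\<bar> \<le> 0"
  proof (rule field_le_epsilon)
    fix \<epsilon> :: real assume "\<epsilon> > 0"
    then have "\<epsilon> / (b - a + 1) > 0" using ab by simp
    from le[OF this] show "\<bar>f b - f a\<bar> \<le> 0 + \<epsilon>" using ab by simp
  qed
  then show ?thesis by simp
qed

theorem ac_ae_derivative_zero_constant:
  fixes f :: "real \<Rightarrow> real"
  assumes I: "is_interval I" and ac: "loc_abs_continuous_on I f"
    and AE: "AE t in lebesgue_on I. (f has_vector_derivative 0) (at t within I)"
  shows "f constant_on I"
proof -
  have sets: "I \<in> sets lebesgue" using real_interval_borel_measurable[OF I] by simp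
  have "AE t in lebesgue. t \<in> I \<longrightarrow> (f has_vector_derivative 0) (at t within I)"
    using AE sets by (subst (asm) AE_restrict_space_iff) auto
  then obtain N where N: "N \<in> null_sets lebesgue" "{t. \<not> (t \<in> I \<longrightarrow> (f has_vector_derivative 0) (at t within I))} \<subseteq> N"
    by (auto simp: eventually_ae_filter)
  have eq: "f b = f a" if ab: "a \<in> I" "b \<in> I" "a \<le> b" for a b
  proof (rule ac_derivative_zero_constant[OF ab(3)])
    show "abs_continuous_on_ivl a b f" using ac ab unfolding loc_abs_continuous_on_def by blast
    show "negligible N" using N(1) by (simp add: negligible_iff_null_sets)
    have sub: "{a..b} \<subseteq> I" using mem_is_interval_1_I[OF I ab(1,2)] by auto
    fix t assume t: "t \<in> {a..b} - N"
    then have "(f has_vector_derivative 0) (at t within I)" using N(2) sub by blast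
    then show "(f has_vector_derivative 0) (at t within {a..b})" by (rule has_vector_derivative_within_subset[OF _ sub])
  qed
  have "f x = f y" if xy: "x \<in> I" "y \<in> I" for x y
  proof (cases "x \<le> y")
    case True
    then show ?thesis using eq[OF xy] by simp
  next
    case False
    then show ?thesis using eq[OF xy(2,1)] by simp
  qed
  then show ?thesis unfolding constant_on_def by blast
qed

lemma eventually_derivative_bound:
  fixes g :: "real \<Rightarrow> 'b::real_normed_vector"
  assumes "(g has_vector_derivative g') (at t within I)"
  shows "\<forall>\<^sub>F s in at t within I. norm (g s - g t) \<le> (norm g' + 1) * \<bar>s - t\<bar>"
proof -
  have "\<forall>\<^sub>F s in at t within I. norm (g s - g t - (s - t) *\<^sub>R g') \<le> 1 * norm (s - t)"
    using assms unfolding has_vector_derivative_def has_derivative_within_alt2 by (elim conjE allE[of _ 1]) simp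
  then show ?thesis
  proof eventually_elim
    case (elim s)
    have "norm (g s - g t) \<le> norm (g s - g t - (s - t) *\<^sub>R g') + norm ((s - t) *\<^sub>R g')"
      using norm_triangle_ineq[of "g s - g t - (s - t) *\<^sub>R g'" "(s - t) *\<^sub>R g'"] by simp
    also have "\<dots> \<le> \<bar>s - t\<bar> + \<bar>s - t\<bar> * norm g'" using elim by simp
    also have "\<dots> = (norm g' + 1) * \<bar>s - t\<bar>" by (simp add: algebra_simps)
    finally show ?case .
  qed
qed

definition loc_modulus :: "real set \<Rightarrow> (real \<Rightarrow> real \<Rightarrow> real) \<Rightarrow> bool" where
  "loc_modulus I d \<longleftrightarrow> (\<forall>a\<in>I. \<forall>b\<in>I. ac_ivl a b d) \<and> (\<forall>s t. 0 \<le> d s t)"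

lemma loc_modulus_norm: "loc_abs_continuous_on I f \<Longrightarrow> loc_modulus I (\<lambda>s t. norm (f t - f s))"
  by (simp add: loc_abs_continuous_on_def loc_modulus_def abs_continuous_iff_ac)

lemma loc_modulus_add: "loc_modulus I d \<Longrightarrow> loc_modulus I d' \<Longrightarrow> loc_modulus I (\<lambda>s t. d s t + d' s t)"
  by (simp add: loc_modulus_def ac_ivl_add)

lemma loc_modulus_scale: "loc_modulus I d \<Longrightarrow> C \<ge> 0 \<Longrightarrow> loc_modulus I (\<lambda>s t. C * d s t)"
  unfolding loc_modulus_def
proof (elim conjE, intro conjI ballI allI)
  fix a b assume d: "\<forall>a\<in>I. \<forall>b\<in>I. ac_ivl a b d" "\<forall>s t. 0 \<le> d s t" and ab: "a \<in> I" "b \<in> I"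
  have "ac_ivl a b d" using d(1) ab by blast
  then show "ac_ivl a b (\<lambda>s t. C * d s t)"
    by (rule ac_ivl_dominated[where C = C]) (use d(2) in auto)
qed auto

lemma loc_modulus_sum: "(\<And>j. j \<in> J \<Longrightarrow> loc_modulus I (d j)) \<Longrightarrow> loc_modulus I (\<lambda>s t. \<Sum>j\<in>J. d j s t)"
proof (induction J rule: infinite_finite_induct)
  case (insert x F) then show ?case by (simp add: loc_modulus_add)
qed (auto simp: loc_modulus_def ac_ivl_zero)

lemma loc_ac_dominated:
  assumes "loc_modulus I d"
    and "\<And>a b. a \<in> I \<Longrightarrow> b \<in> I \<Longrightarrow> a \<le> b \<Longrightarrow> \<exists>C. \<forall>s t. a \<le> s \<longrightarrow> s \<le> t \<longrightarrow> t \<le> b \<longrightarrow> norm (f t - f s) \<le> C * d s t"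
  shows "loc_abs_continuous_on I f"
  unfolding loc_abs_continuous_on_def abs_continuous_iff_ac
proof (intro ballI)
  fix a b assume ab: "a \<in> I" "b \<in> I"
  show "ac_ivl a b (\<lambda>s t. norm (f t - f s))"
  proof (cases "a \<le> b")
    case True
    obtain C where C: "\<forall>s t. a \<le> s \<longrightarrow> s \<le> t \<longrightarrow> t \<le> b \<longrightarrow> norm (f t - f s) \<le> C * d s t" using assms(2)[OF ab True] by blast
    have d: "ac_ivl a b d" "\<forall>s t. 0 \<le> d s t" using assms(1) ab unfolding loc_modulus_def by blast+
    show ?thesis by (rule ac_ivl_dominated[OF d(1), of _ C]) (use C d(2) in blast)+
  next
    case False
    \<comment> \<open>An interval with \<open>a > b\<close> has no subintervals at all, so absolute continuity is trivial.\<close>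
    have n0: "n = 0" if "subintervals a b n s t" for n s t
    proof (rule ccontr)
      assume "n \<noteq> 0"
      then have "a \<le> s 0 \<and> s 0 \<le> t 0 \<and> t 0 \<le> b" using that unfolding subintervals_def by blast
      then show False using False by simp
    qed
    have "(\<Sum>i<n. norm (f (t i) - f (s i))) < \<epsilon>" if "subintervals a b n s t" "\<epsilon> > 0" for n s t and \<epsilon> :: real
      using n0[OF that(1)] that(2) by simp
    then show ?thesis unfolding ac_ivl_def by (intro allI impI exI[of _ 1]) simp
  qed
qed

lemma loc_ac_add:
  assumes "loc_abs_continuous_on I f" "loc_abs_continuous_on I g"
  shows "loc_abs_continuous_on I (\<lambda>t. f t + g t)"
proof (rule loc_ac_dominated[OF loc_modulus_add[OF loc_modulus_norm[OF assms(1)] loc_modulus_norm[OF assms(2)]]], intro exI[of _ 1] allI impI)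
  fix s t
  show "norm (f t + g t - (f s + g s)) \<le> 1 * (norm (f t - f s) + norm (g t - g s))"
    using norm_triangle_ineq[of "f t - f s" "g t - g s"] by (simp add: algebra_simps)
qed

lemma loc_ac_lipschitz:
  assumes "loc_abs_continuous_on I f" "\<And>s t. s \<in> I \<Longrightarrow> t \<in> I \<Longrightarrow> norm (g t - g s) \<le> C * norm (f t - f s)" "is_interval I"
  shows "loc_abs_continuous_on I g"
proof (rule loc_ac_dominated[OF loc_modulus_norm[OF assms(1)]], intro exI[of _ C] allI impI)
  fix a b s t assume ab: "a \<in> I" "b \<in> I" "a \<le> s" "s \<le> t" "t \<le> b"
  then have "s \<in> I" "t \<in> I" by (auto intro!: mem_is_interval_1_I[OF assms(3) ab(1,2)])
  then show "norm (g t - g s) \<le> C * norm (f t - f s)" by (rule assms(2))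
qed

lemma loc_ac_scale:
  fixes f :: "real \<Rightarrow> real"
  assumes "loc_abs_continuous_on I f" shows "loc_abs_continuous_on I (\<lambda>t. c * f t)"
proof (rule loc_ac_dominated[OF loc_modulus_norm[OF assms]], intro exI[of _ "\<bar>c\<bar>"] allI impI)
  fix s t show "norm (c * f t - c * f s) \<le> \<bar>c\<bar> * norm (f t - f s)"
    by (simp add: right_diff_distrib[symmetric] abs_mult)
qed

lemma loc_ac_const: "loc_abs_continuous_on I (\<lambda>t. c)"
  by (auto simp: loc_abs_continuous_on_def abs_continuous_iff_ac ac_ivl_zero)

lemma loc_ac_sum:
  "(\<And>j. j \<in> J \<Longrightarrow> loc_abs_continuous_on I (f j)) \<Longrightarrow> loc_abs_continuous_on I (\<lambda>t. \<Sum>j\<in>J. f j t)"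
proof (induction J rule: infinite_finite_induct)
  case (insert j J)
  then show ?case using loc_ac_add[of I "f j" "\<lambda>t. \<Sum>j\<in>J. f j t"] by simp
qed (simp_all add: loc_ac_const)

context mesh
begin

lemma loc_ac_mesh_integral:
  assumes I: "is_interval I" and d: "loc_modulus I d"
    and cont: "\<And>t K. t \<in> I \<Longrightarrow> K \<in> T \<Longrightarrow> continuous_on K (h t K)"
    and bound: "\<And>a b. a \<in> I \<Longrightarrow> b \<in> I \<Longrightarrow> a \<le> b \<Longrightarrow>
      \<exists>C. \<forall>s t. a \<le> s \<longrightarrow> s \<le> t \<longrightarrow> t \<le> b \<longrightarrow> (\<forall>K\<in>T. \<forall>x\<in>K. \<bar>h t K x - h s K x\<bar> \<le> C * d s t)"
  shows "loc_abs_continuous_on I (\<lambda>t. mesh_integral T (h t))"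
proof (rule loc_ac_dominated[OF d])
  fix a b assume ab: "a \<in> I" "b \<in> I" "a \<le> b"
  obtain C where C: "\<And>s t K x. a \<le> s \<Longrightarrow> s \<le> t \<Longrightarrow> t \<le> b \<Longrightarrow> K \<in> T \<Longrightarrow> x \<in> K \<Longrightarrow> \<bar>h t K x - h s K x\<bar> \<le> C * d s t"
    using bound[OF ab] by blast
  define V where "V = mesh_integral T (\<lambda>K x. 1)"
  have "\<bar>mesh_integral T (h t) - mesh_integral T (h s)\<bar> \<le> (C * V) * d s t" if st: "a \<le> s" "s \<le> t" "t \<le> b" for s t
  proof -
    have sI: "s \<in> I" "t \<in> I" using st by (auto intro!: mem_is_interval_1_I[OF I ab(1,2)])
    have eq: "mesh_integral T (h t) - mesh_integral T (h s) = mesh_integral T (\<lambda>K x. h t K x - h s K x)"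
      using cont sI by (intro mesh_integral_diff[symmetric]) auto
    have c: "continuous_on K (\<lambda>x. h t K x - h s K x)" if "K \<in> T" for K
      using cont sI that by (intro continuous_on_diff) auto
    have "mesh_integral T (\<lambda>K x. h t K x - h s K x) \<le> mesh_integral T (\<lambda>K x. (C * d s t) * 1)"
      by (rule mesh_integral_mono[OF c]) (use C[OF st] in \<open>auto simp: abs_le_iff\<close>)
    moreover have "mesh_integral T (\<lambda>K x. - (h t K x - h s K x)) \<le> mesh_integral T (\<lambda>K x. (C * d s t) * 1)"
      by (rule mesh_integral_mono[OF continuous_on_minus[OF c]]) (use C[OF st] in \<open>auto simp: abs_le_iff\<close>)
    ultimately show ?thesis unfolding eq mesh_integral_minus mesh_integral_scale V_def[symmetric] by (simp add: abs_le_iff mult_ac)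
  qed
  then show "\<exists>C. \<forall>s t. a \<le> s \<longrightarrow> s \<le> t \<longrightarrow> t \<le> b \<longrightarrow> norm (mesh_integral T (h t) - mesh_integral T (h s)) \<le> C * d s t"
    by (intro exI[of _ "C * V"]) simp
qed

text \<open>The coefficients in the expansion by nodal values are values of the field at the nodes, each of which
  is absolutely continuous, bounded on compact intervals, and differentiable at \<open>t\<close>. The fixed fields \<open>v y\<close> of the
  expansion are bounded on the mesh, so these properties become uniform in space. At a time at which
  derivatives are unique, the time derivative is the member of \<open>V\<close> with the derivatives of the
  coefficients.\<close>
lemma field_in_time:
  fixes V :: "(cell \<Rightarrow> real^3 \<Rightarrow> 'b::euclidean_space) set"
  assumes I: "is_interval I"
    and poly: "\<And>f K b. f \<in> V \<Longrightarrow> K \<in> T \<Longrightarrow> b \<in> Basis \<Longrightarrow> (\<lambda>x. f K x \<bullet> b) \<in> P_poly k"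
    and smV: "\<And>f K. f \<in> V \<Longrightarrow> K \<in> T \<Longrightarrow> smooth (f K)"
    and closed: "\<And>f g c. f \<in> V \<Longrightarrow> g \<in> V \<Longrightarrow> (\<lambda>K x. f K x + c *\<^sub>R g K x) \<in> V"
    and fV: "\<And>t. t \<in> I \<Longrightarrow> f t \<in> V" and ac: "field_abs_continuous T I f"
  shows field_modulus: "\<exists>d. loc_modulus I d \<and> (\<forall>s\<in>I. \<forall>t\<in>I. \<forall>K\<in>T. \<forall>x\<in>K. norm (f t K x - f s K x) \<le> d s t)"
    and field_locally_bounded: "\<And>a b. a \<in> I \<Longrightarrow> b \<in> I \<Longrightarrow> \<exists>P. \<forall>t\<in>{a..b}. \<forall>K\<in>T. \<forall>x\<in>K. norm (f t K x) \<le> P"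
    and field_difference_bound: "\<And>t df. t \<in> I \<Longrightarrow> field_has_time_deriv T I f t df \<Longrightarrow>
      \<exists>B. \<forall>\<^sub>F s in at t within I. \<forall>K\<in>T. \<forall>x\<in>K. norm (f s K x - f t K x) \<le> B * \<bar>s - t\<bar>"
    and field_derivative_in_space: "\<And>t df. t \<in> I \<Longrightarrow> at t within I \<noteq> bot \<Longrightarrow> field_has_time_deriv T I f t df \<Longrightarrow>
      \<exists>g\<in>V. \<forall>K\<in>T. \<forall>x\<in>K. df K x = g K x"
proof -
  have "\<exists>A v. finite A \<and> A \<subseteq> {(K, x, b). K \<in> T \<and> x \<in> K \<and> b \<in> Basis} \<and> (\<forall>y\<in>A. v y \<in> V) \<and>
    (\<forall>f\<in>V. \<forall>K\<in>T. \<forall>x\<in>K. f K x = (\<Sum>(K', x', b)\<in>A. (f K' x' \<bullet> b) *\<^sub>R v (K', x', b) K x))"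
  proof (rule field_nodal_basis[where V = V and T = T and k = k])
    fix A :: "(cell \<times> (real^3) \<times> 'b) set" and v
    assume "finite A" "A \<subseteq> {(K, x, b). K \<in> T \<and> x \<in> K \<and> b \<in> Basis}" "\<And>y. y \<in> A \<Longrightarrow> v y \<in> V"
      "\<And>f K x. f \<in> V \<Longrightarrow> K \<in> T \<Longrightarrow> x \<in> K \<Longrightarrow> f K x = (\<Sum>(K', x', b)\<in>A. (f K' x' \<bullet> b) *\<^sub>R v (K', x', b) K x)"
    then show ?thesis by (intro exI[of _ A] exI[of _ v] conjI ballI)
  next
    fix f K and b :: 'b assume "f \<in> V" "K \<in> T" "b \<in> Basis"
    then show "(\<lambda>x. f K x \<bullet> b) \<in> P_poly k" by (rule poly)
  next
    fix f g c assume "f \<in> V" "g \<in> V"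
    then show "(\<lambda>K x. f K x + c *\<^sub>R g K x) \<in> V" by (rule closed)
  qed simp
  then obtain A v where Av: "finite A \<and> A \<subseteq> {(K, x, b). K \<in> T \<and> x \<in> K \<and> b \<in> Basis} \<and> (\<forall>y\<in>A. v y \<in> V) \<and>
    (\<forall>f\<in>V. \<forall>K\<in>T. \<forall>x\<in>K. f K x = (\<Sum>(K', x', b)\<in>A. (f K' x' \<bullet> b) *\<^sub>R v (K', x', b) K x))"
    by (elim exE) (rule that)
  note A = Av[THEN conjunct1] Av[THEN conjunct2, THEN conjunct1]
    and vV = Av[THEN conjunct2, THEN conjunct2, THEN conjunct1, rule_format]
    and rep = Av[THEN conjunct2, THEN conjunct2, THEN conjunct2, rule_format]
  define c where "c y g = g (fst y) (fst (snd y)) \<bullet> snd (snd y)" for y :: "cell \<times> (real^3) \<times> 'b" and g :: "cell \<Rightarrow> real^3 \<Rightarrow> 'b"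
  define z where "z y g = g (fst y) (fst (snd y))" for y :: "cell \<times> (real^3) \<times> 'b" and g :: "cell \<Rightarrow> real^3 \<Rightarrow> 'b"
  have rep': "g K x = (\<Sum>y\<in>A. c y g *\<^sub>R v y K x)" if "g \<in> V" "K \<in> T" "x \<in> K" for g K x
    using rep[OF that] by (simp add: c_def case_prod_beta)
  have node: "fst y \<in> T" "fst (snd y) \<in> fst y" "snd (snd y) \<in> Basis" if "y \<in> A" for y
    using subsetD[OF A(2) that] by (simp_all add: case_prod_beta)
  have cz: "\<bar>c y g\<bar> \<le> norm (z y g)" "\<bar>c y g - c y h\<bar> \<le> norm (z y g - z y h)" if "y \<in> A" for y g h
  proof -
    show "\<bar>c y g\<bar> \<le> norm (z y g)" using Basis_le_norm[OF node(3)[OF that]] by (simp add: c_def z_def)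
    show "\<bar>c y g - c y h\<bar> \<le> norm (z y g - z y h)"
      using Basis_le_norm[OF node(3)[OF that], of "z y g - z y h"] by (simp add: c_def z_def inner_diff_left)
  qed
  have "\<exists>W\<ge>0. \<forall>K\<in>T. \<forall>x\<in>K. norm (v y K x) \<le> W" if y: "y \<in> A" for y
    by (rule cell_bound) (intro smooth_continuous smV vV y)
  then obtain W where W: "\<And>y. y \<in> A \<Longrightarrow> W y \<ge> 0" "\<And>y K x. y \<in> A \<Longrightarrow> K \<in> T \<Longrightarrow> x \<in> K \<Longrightarrow> norm (v y K x) \<le> W y"
    by metis
  have est: "norm (\<Sum>y\<in>A. \<alpha> y *\<^sub>R v y K x) \<le> (\<Sum>y\<in>A. W y * \<beta> y)"
    if K: "K \<in> T" "x \<in> K" and \<alpha>: "\<And>y. y \<in> A \<Longrightarrow> \<bar>\<alpha> y\<bar> \<le> \<beta> y" for \<alpha> \<beta> K x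
  proof (rule sum_norm_le)
    fix y assume y: "y \<in> A"
    have "\<bar>\<alpha> y\<bar> * norm (v y K x) \<le> \<beta> y * W y"
      using \<alpha>[OF y] W[OF y] K by (intro mult_mono) auto
    then show "norm (\<alpha> y *\<^sub>R v y K x) \<le> W y * \<beta> y" by (simp add: mult.commute)
  qed
  have diff: "norm (f t K x - f s K x) \<le> (\<Sum>y\<in>A. W y * norm (z y (f t) - z y (f s)))"
    if "s \<in> I" "t \<in> I" "K \<in> T" "x \<in> K" for s t K x
  proof -
    have "f t K x - f s K x = (\<Sum>y\<in>A. (c y (f t) - c y (f s)) *\<^sub>R v y K x)"
      using rep'[OF fV[OF that(1)] that(3,4)] rep'[OF fV[OF that(2)] that(3,4)] by (simp add: scaleR_diff_left sum_subtractf)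
    then show ?thesis using est[OF that(3,4), of "\<lambda>y. c y (f t) - c y (f s)" "\<lambda>y. norm (z y (f t) - z y (f s))"] cz(2) by simp
  qed
  have zac: "loc_abs_continuous_on I (\<lambda>t. z y (f t))" if "y \<in> A" for y
    using node[OF that] ac unfolding field_abs_continuous_def z_def by simp
  show "\<exists>d. loc_modulus I d \<and> (\<forall>s\<in>I. \<forall>t\<in>I. \<forall>K\<in>T. \<forall>x\<in>K. norm (f t K x - f s K x) \<le> d s t)"
  proof (intro exI conjI ballI)
    show "loc_modulus I (\<lambda>s t. \<Sum>y\<in>A. W y * norm (z y (f t) - z y (f s)))"
      by (intro loc_modulus_sum loc_modulus_scale loc_modulus_norm zac W)
  qed (use diff in blast)
  show "\<exists>P. \<forall>t\<in>{a..b}. \<forall>K\<in>T. \<forall>x\<in>K. norm (f t K x) \<le> P" if ab: "a \<in> I" "b \<in> I" for a b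
  proof -
    have "\<exists>Q. \<forall>t\<in>{a..b}. norm (z y (f t)) \<le> Q" if y: "y \<in> A" for y
    proof -
      have "continuous_on {a..b} (\<lambda>t. z y (f t))"
        using zac[OF y] ab unfolding loc_abs_continuous_on_def by (intro ac_ivl_continuous) blast
      from compact_imp_bounded[OF compact_continuous_image[OF this compact_Icc]] show ?thesis unfolding bounded_iff by auto
    qed
    then obtain Q where Q: "\<And>y t. y \<in> A \<Longrightarrow> t \<in> {a..b} \<Longrightarrow> norm (z y (f t)) \<le> Q y" by metis
    have "norm (f t K x) \<le> (\<Sum>y\<in>A. W y * Q y)" if t: "t \<in> {a..b}" and K: "K \<in> T" "x \<in> K" for t K x
    proof -
      have tI: "t \<in> I" using t by (auto intro!: mem_is_interval_1_I[OF I ab])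
      show ?thesis unfolding rep'[OF fV[OF tI] K]
        by (rule est[OF K]) (use cz(1) Q t order_trans in blast)
    qed
    then show ?thesis by blast
  qed
  have zder: "((\<lambda>s. z y (f s)) has_vector_derivative z y df) (at t within I)"
    if "field_has_time_deriv T I f t df" "y \<in> A" for t df y
    using node[OF that(2)] that(1) unfolding field_has_time_deriv_def z_def by simp
  show "\<exists>B. \<forall>\<^sub>F s in at t within I. \<forall>K\<in>T. \<forall>x\<in>K. norm (f s K x - f t K x) \<le> B * \<bar>s - t\<bar>"
    if t: "t \<in> I" and df: "field_has_time_deriv T I f t df" for t df
  proof -
    have "\<forall>\<^sub>F s in at t within I. \<forall>y\<in>A. norm (z y (f s) - z y (f t)) \<le> (norm (z y df) + 1) * \<bar>s - t\<bar>"
      using A(1) eventually_derivative_bound[OF zder[OF df]] by (intro eventually_ball_finite) auto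
    moreover have "\<forall>\<^sub>F s in at t within I. s \<in> I" by (simp add: eventually_at_filter)
    ultimately have "\<forall>\<^sub>F s in at t within I. \<forall>K\<in>T. \<forall>x\<in>K. norm (f s K x - f t K x) \<le> (\<Sum>y\<in>A. W y * (norm (z y df) + 1)) * \<bar>s - t\<bar>"
    proof eventually_elim
      case (elim s)
      have "(\<Sum>y\<in>A. W y * norm (z y (f s) - z y (f t))) \<le> (\<Sum>y\<in>A. W y * ((norm (z y df) + 1) * \<bar>s - t\<bar>))"
        using elim(1) W(1) by (intro sum_mono mult_left_mono) auto
      also have "\<dots> = (\<Sum>y\<in>A. W y * (norm (z y df) + 1)) * \<bar>s - t\<bar>" by (simp add: sum_distrib_right mult.assoc)
      finally show ?case using diff[OF t elim(2)] order_trans by blast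
    qed
    then show ?thesis by blast
  qed
  show "\<exists>g\<in>V. \<forall>K\<in>T. \<forall>x\<in>K. df K x = g K x"
    if t: "t \<in> I" and nt: "at t within I \<noteq> bot" and df: "field_has_time_deriv T I f t df" for t df
  proof -
    have "\<exists>g\<in>V. \<forall>K x. g K x = (\<Sum>y\<in>B. \<alpha> y *\<^sub>R v y K x)" if "finite B" "B \<subseteq> A" for B and \<alpha> :: "_ \<Rightarrow> real"
      using that
    proof (induction B rule: finite_induct)
      case empty
      \<comment> \<open>The zero field is a difference of members.\<close>
      show ?case using closed[OF fV[OF t] fV[OF t], of "-1"] by (intro bexI) auto
    next
      case (insert y B)
      then obtain g where g: "g \<in> V" "\<And>K x. g K x = (\<Sum>y\<in>B. \<alpha> y *\<^sub>R v y K x)" by auto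
      have yA: "y \<in> A" using insert by simp
      show ?case by (rule bexI[OF _ closed[OF g(1) vV[OF yA], of "\<alpha> y"]]) (use insert g(2) in \<open>simp add: add.commute\<close>)
    qed
    from this[OF A(1) order_refl, of "\<lambda>y. c y df"]
    obtain g where g: "g \<in> V" "\<And>K x. g K x = (\<Sum>y\<in>A. c y df *\<^sub>R v y K x)" by blast
    have "df K x = g K x" if K: "K \<in> T" "x \<in> K" for K x
    proof (rule vector_derivative_unique_within[OF nt])
      show "((\<lambda>s. f s K x) has_vector_derivative df K x) (at t within I)" using df K unfolding field_has_time_deriv_def by blast
      have "((\<lambda>s. \<Sum>y\<in>A. c y (f s) *\<^sub>R v y K x) has_vector_derivative (\<Sum>y\<in>A. c y df *\<^sub>R v y K x)) (at t within I)"
      proof (rule has_vector_derivative_sum)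
        fix y assume y: "y \<in> A"
        have "((\<lambda>s. c y (f s)) has_vector_derivative c y df) (at t within I)"
          using bounded_linear.has_vector_derivative[OF bounded_linear_inner_left zder[OF df y], of "snd (snd y)"]
          by (simp add: c_def z_def)
        then show "((\<lambda>s. c y (f s) *\<^sub>R v y K x) has_vector_derivative c y df *\<^sub>R v y K x) (at t within I)"
          by (rule bounded_linear.has_vector_derivative[OF bounded_linear_scaleR_left])
      qed
      then show "((\<lambda>s. f s K x) has_vector_derivative g K x) (at t within I)"
        unfolding g(2) by (rule has_vector_derivative_transform[OF t, rotated]) (use rep'[OF fV _ _, OF _ K] in simp)
    qed
    then show ?thesis using g(1) by blast
  qed
qed

end

section \<open>The weak divergence\<close>

context mesh
begin

lemma smooth_eq_on_cell_grad:
  fixes f g :: "real^3 \<Rightarrow> real"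
  assumes K: "K \<in> T" and f: "smooth f" and g: "smooth g" and eq: "\<And>x. x \<in> K \<Longrightarrow> f x = g x" and x: "x \<in> K"
  shows "grad f x = grad g x"
proof -
  have "partial i f y - partial i g y = 0" if y: "y \<in> interior K" for i y
  proof -
    have "(f has_derivative (\<lambda>h. \<Sum>i\<in>UNIV. h $ i *\<^sub>R partial i g y)) (at y)"
      by (rule has_derivative_transform_within_open[OF has_derivative_partials[OF smooth_differentiable[OF g]] open_interior y])
         (use eq interior_subset[of K] in auto)
    from partial_eqI[OF this, of i] show ?thesis by (simp add: axis_def if_distrib[of "\<lambda>a. a * _"] cong: if_cong)
  qed
  moreover have "continuous_on (closure (interior K)) (\<lambda>y. partial i f y - partial i g y)" for i
    by (intro smooth_continuous smooth_diff smooth_partial f g)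
  ultimately have "partial i f x - partial i g x = 0" for i
    using continuous_constant_on_closure[of "interior K" "\<lambda>y. partial i f y - partial i g y" 0 x] x closure_interior_cell[OF K] by blast
  then show ?thesis by (simp add: vec_eq_iff)
qed

lemma Q0_zero: "(\<lambda>K x. 0) \<in> Q0_space \<Omega> T k"
proof -
  have "broken T (\<lambda>K x. 0 :: real) = (\<lambda>x. 0)" by (rule ext) (simp add: broken_def)
  moreover have "has_weak_grad \<Omega> (\<lambda>x. 0) (\<lambda>x. 0)" by (simp add: has_weak_grad_def L2_def)
  ultimately show ?thesis by (auto simp: Q0_space_def Q_space_def H1_def P_poly_zero)
qed

lemma Q0_smooth: "\<phi> \<in> Q0_space \<Omega> T k \<Longrightarrow> K \<in> T \<Longrightarrow> smooth (\<phi> K)"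
  by (auto simp: Q0_space_def Q_space_def intro: smooth_P_poly)

lemma grad_lincomb:
  assumes "\<And>a. a \<in> A \<Longrightarrow> smooth (u a)"
  shows "grad (\<lambda>x. \<Sum>a\<in>A. d a * u a x) x = (\<Sum>a\<in>A. d a *\<^sub>R grad (u a) x)"
proof -
  have "partial i (\<lambda>x. \<Sum>a\<in>A. d a * u a x) x = (\<Sum>a\<in>A. d a * partial i (u a) x)" for i
    using assms
  proof (induction A rule: infinite_finite_induct)
    case (insert a A)
    have "partial i (\<lambda>x. d a * u a x + (\<Sum>a\<in>A. d a * u a x)) x = partial i (\<lambda>x. d a * u a x) x + partial i (\<lambda>x. \<Sum>a\<in>A. d a * u a x) x"
      by (intro partial_add smooth_differentiable smooth_sum smooth_mult smooth_const insert.prems) auto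
    moreover have "partial i (\<lambda>x. d a * u a x) x = d a * partial i (u a) x"
      by (rule partial_linear[OF bounded_linear_mult_right]) (intro smooth_differentiable insert.prems, simp)
    ultimately show ?case using insert by simp
  qed simp_all
  then show ?thesis by (simp add: vec_eq_iff)
qed

text \<open>The defining equation is a linear system for the coefficients of the expansion by nodal values. Its
  matrix may be singular, but a combination in its kernel vanishes on all cells, hence so does its
  gradient, and the right-hand side with it.\<close>
theorem weak_div_defining:
  assumes E: "\<And>K. K \<in> T \<Longrightarrow> smooth (E K)"
  shows "weak_div \<Omega> T k E \<in> Q0_space \<Omega> T (k + 1)"
    and "\<And>\<phi>. \<phi> \<in> Q0_space \<Omega> T (k + 1) \<Longrightarrow>
      mesh_integral T (\<lambda>K x. weak_div \<Omega> T k E K x * \<phi> K x) = - mesh_integral T (\<lambda>K x. E K x \<bullet> grad (\<phi> K) x)"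
proof -
  let ?V = "Q0_space \<Omega> T (k + 1)"
  have "\<exists>D. D \<in> ?V \<and> (\<forall>\<phi>\<in>?V. mesh_integral T (\<lambda>K x. D K x * \<phi> K x) = - mesh_integral T (\<lambda>K x. E K x \<bullet> grad (\<phi> K) x))"
  proof (rule field_nodal_basis[where V = ?V and T = T and k = "k + 1"])
    show "finite T" by simp
    show "(\<lambda>x. f K x \<bullet> b) \<in> P_poly (k + 1)" if "f \<in> ?V" "K \<in> T" "b \<in> Basis" for f K and b :: real
      using that by (simp add: Q0_space_def Q_space_def)
    show "(\<lambda>K x. f K x + c *\<^sub>R g K x) \<in> ?V" if "f \<in> ?V" "g \<in> ?V" for f g c
      using that by (rule Q0_space_comb)
    fix A :: "(cell \<times> (real^3) \<times> real) set" and v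
    assume A: "finite A" and vV: "\<And>y. y \<in> A \<Longrightarrow> v y \<in> ?V"
      and rep0: "\<And>f K x. f \<in> ?V \<Longrightarrow> K \<in> T \<Longrightarrow> x \<in> K \<Longrightarrow> f K x = (\<Sum>(K', x', b)\<in>A. (f K' x' \<bullet> b) *\<^sub>R v (K', x', b) K x)"
    have sv: "smooth (v a K)" if "a \<in> A" "K \<in> T" for a K using Q0_smooth[OF vV[OF that(1)] that(2)] .
    have comb: "(\<lambda>K x. \<Sum>a\<in>B. d a * v a K x) \<in> ?V" if "finite B" "B \<subseteq> A" for B d
      using that
    proof (induction B rule: finite_induct)
      case empty then show ?case using Q0_zero by simp
    next
      case (insert a B)
      have "(\<lambda>K x. (\<Sum>a\<in>B. d a * v a K x) + d a *\<^sub>R v a K x) \<in> ?V"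
        using insert by (intro Q0_space_comb vV) auto
      then show ?case using insert by (simp add: add.commute)
    qed
    define G where "G a b = mesh_integral T (\<lambda>K x. v a K x * v b K x)" for a b
    define l where "l a = - mesh_integral T (\<lambda>K x. E K x \<bullet> grad (v a K) x)" for a
    have Gsum: "(\<Sum>b\<in>A. G a b * d b) = mesh_integral T (\<lambda>K x. v a K x * (\<Sum>b\<in>A. d b * v b K x))" if a: "a \<in> A" for a d
    proof -
      have "mesh_integral T (\<lambda>K x. v a K x * (\<Sum>b\<in>A. d b * v b K x)) = mesh_integral T (\<lambda>K x. \<Sum>b\<in>A. d b * (v a K x * v b K x))"
        by (simp add: sum_distrib_left mult.left_commute)
      also have "\<dots> = (\<Sum>b\<in>A. mesh_integral T (\<lambda>K x. d b * (v a K x * v b K x)))"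
        by (intro mesh_integral_sum smooth_continuous smooth_mult smooth_const sv a)
      finally show ?thesis by (simp add: G_def mesh_integral_scale mult.commute)
    qed
    have lsum: "(\<Sum>a\<in>A. d a * l a) = - mesh_integral T (\<lambda>K x. E K x \<bullet> grad (\<lambda>x. \<Sum>a\<in>A. d a * v a K x) x)" for d
    proof -
      have "mesh_integral T (\<lambda>K x. E K x \<bullet> grad (\<lambda>x. \<Sum>a\<in>A. d a * v a K x) x) = mesh_integral T (\<lambda>K x. \<Sum>a\<in>A. d a * (E K x \<bullet> grad (v a K) x))"
        by (rule mesh_integral_cong) (simp add: grad_lincomb[OF sv] inner_sum_right)
      also have "\<dots> = (\<Sum>a\<in>A. mesh_integral T (\<lambda>K x. d a * (E K x \<bullet> grad (v a K) x)))"
        by (intro mesh_integral_sum smooth_continuous smooth_mult smooth_const smooth_bilinear[OF bounded_bilinear_inner] smooth_grad sv E)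
      finally show ?thesis by (simp add: l_def mesh_integral_scale sum_negf)
    qed
    have null: "(\<Sum>a\<in>A. d a * v a K x) = 0"
      if d: "(\<Sum>a\<in>A. \<Sum>b\<in>A. d a * G a b * d b) = 0" and K: "K \<in> T" "x \<in> K" for d K x
    proof -
      let ?\<phi> = "\<lambda>K x. \<Sum>a\<in>A. d a * v a K x"
      have sm: "smooth (?\<phi> K)" if "K \<in> T" for K by (intro smooth_sum smooth_mult smooth_const sv that)
      have "mesh_integral T (\<lambda>K x. ?\<phi> K x * ?\<phi> K x) = mesh_integral T (\<lambda>K x. \<Sum>a\<in>A. d a * (v a K x * ?\<phi> K x))"
        by (simp add: sum_distrib_right mult.assoc)
      also have "\<dots> = (\<Sum>a\<in>A. mesh_integral T (\<lambda>K x. d a * (v a K x * ?\<phi> K x)))"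
        by (intro mesh_integral_sum smooth_continuous smooth_mult smooth_const sv sm)
      also have "\<dots> = (\<Sum>a\<in>A. d a * (\<Sum>b\<in>A. G a b * d b))"
        by (intro sum.cong refl) (simp add: Gsum mesh_integral_scale)
      also have "\<dots> = 0" using d by (simp add: sum_distrib_left mult.assoc)
      finally have "?\<phi> K x * ?\<phi> K x = 0"
        by (intro mesh_integral_eq_0D[where f = "\<lambda>K x. ?\<phi> K x * ?\<phi> K x"] K smooth_continuous smooth_mult sm) auto
      then show ?thesis by simp
    qed
    have "\<exists>c. \<forall>a\<in>A. (\<Sum>b\<in>A. G a b * c b) = l a"
    proof (rule gram_system_solvable[OF A])
      show "G a b = G b a" for a b by (simp add: G_def mult.commute)
      fix d assume d: "(\<Sum>a\<in>A. \<Sum>b\<in>A. d a * G a b * d b) = 0"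
      show "(\<Sum>b\<in>A. G a b * d b) = 0" if a: "a \<in> A" for a
      proof -
        have "mesh_integral T (\<lambda>K x. v a K x * (\<Sum>b\<in>A. d b * v b K x)) = mesh_integral T (\<lambda>K x. 0)"
          by (rule mesh_integral_cong) (simp add: null[OF d])
        then show ?thesis by (simp add: Gsum[OF a] mesh_integral_zero)
      qed
      have "mesh_integral T (\<lambda>K x. E K x \<bullet> grad (\<lambda>x. \<Sum>a\<in>A. d a * v a K x) x) = mesh_integral T (\<lambda>K x. 0)"
      proof (rule mesh_integral_cong)
        fix K x assume K: "K \<in> T" "x \<in> K"
        have "grad (\<lambda>x. \<Sum>a\<in>A. d a * v a K x) x = grad (\<lambda>x. 0) x"
          by (rule smooth_eq_on_cell_grad[OF K(1) _ smooth_const null[OF d K(1)] K(2)])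
             (intro smooth_sum smooth_mult smooth_const sv K)
        also have "\<dots> = 0" by (simp add: vec_eq_iff)
        finally show "E K x \<bullet> grad (\<lambda>x. \<Sum>a\<in>A. d a * v a K x) x = 0" by simp
      qed
      then show "(\<Sum>a\<in>A. d a * l a) = 0" by (simp add: lsum mesh_integral_zero)
    qed
    then obtain c where c: "\<And>a. a \<in> A \<Longrightarrow> (\<Sum>b\<in>A. G a b * c b) = l a" by blast
    let ?D = "\<lambda>K x. \<Sum>a\<in>A. c a * v a K x"
    show ?thesis
    proof (intro exI[of _ ?D] conjI ballI)
      show "?D \<in> ?V" by (rule comb[OF A order_refl])
      fix \<phi> assume \<phi>: "\<phi> \<in> ?V"
      define d where "d y = \<phi> (fst y) (fst (snd y)) \<bullet> snd (snd y)" for y :: "cell \<times> (real^3) \<times> real"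
      have rep: "\<phi> K x = (\<Sum>a\<in>A. d a * v a K x)" if "K \<in> T" "x \<in> K" for K x
        using rep0[OF \<phi> that] by (simp add: d_def case_prod_beta)
      have sD: "smooth (?D K)" if "K \<in> T" for K by (intro smooth_sum smooth_mult smooth_const sv that)
      have "mesh_integral T (\<lambda>K x. ?D K x * \<phi> K x) = mesh_integral T (\<lambda>K x. \<Sum>a\<in>A. d a * (v a K x * ?D K x))"
      proof (rule mesh_integral_cong)
        fix K x assume "K \<in> T" "x \<in> K"
        from rep[OF this] have "?D K x * \<phi> K x = ?D K x * (\<Sum>a\<in>A. d a * v a K x)" by simp
        also have "\<dots> = (\<Sum>a\<in>A. d a * (v a K x * ?D K x))" unfolding sum_distrib_left[of "?D K x"] by (intro sum.cong refl) simp
        finally show "?D K x * \<phi> K x = (\<Sum>a\<in>A. d a * (v a K x * ?D K x))" .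
      qed
      also have "\<dots> = (\<Sum>a\<in>A. mesh_integral T (\<lambda>K x. d a * (v a K x * ?D K x)))"
        by (intro mesh_integral_sum smooth_continuous smooth_mult smooth_const sv sD)
      also have "\<dots> = (\<Sum>a\<in>A. d a * l a)"
        by (intro sum.cong refl) (simp add: mesh_integral_scale Gsum[symmetric] c)
      also have "\<dots> = - mesh_integral T (\<lambda>K x. E K x \<bullet> grad (\<lambda>x. \<Sum>a\<in>A. d a * v a K x) x)" by (rule lsum)
      also have "mesh_integral T (\<lambda>K x. E K x \<bullet> grad (\<lambda>x. \<Sum>a\<in>A. d a * v a K x) x) = mesh_integral T (\<lambda>K x. E K x \<bullet> grad (\<phi> K) x)"
      proof (rule mesh_integral_cong)
        fix K x assume K: "K \<in> T" "x \<in> K"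
        have "grad (\<phi> K) x = grad (\<lambda>x. \<Sum>a\<in>A. d a * v a K x) x"
          by (rule smooth_eq_on_cell_grad[OF K(1) Q0_smooth[OF \<phi> K(1)] _ rep[OF K(1)] K(2)])
             (intro smooth_sum smooth_mult smooth_const sv K)
        then show "E K x \<bullet> grad (\<lambda>x. \<Sum>a\<in>A. d a * v a K x) x = E K x \<bullet> grad (\<phi> K) x" by simp
      qed
      finally show "mesh_integral T (\<lambda>K x. ?D K x * \<phi> K x) = - mesh_integral T (\<lambda>K x. E K x \<bullet> grad (\<phi> K) x)" .
    qed
  qed
  from someI_ex[OF this]
  have *: "weak_div \<Omega> T k E \<in> ?V \<and> (\<forall>\<phi>\<in>?V. mesh_integral T (\<lambda>K x. weak_div \<Omega> T k E K x * \<phi> K x) = - mesh_integral T (\<lambda>K x. E K x \<bullet> grad (\<phi> K) x))"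
    unfolding weak_div_def[symmetric] .
  then show "weak_div \<Omega> T k E \<in> ?V" by (rule conjunct1)
  show "mesh_integral T (\<lambda>K x. weak_div \<Omega> T k E K x * \<phi> K x) = - mesh_integral T (\<lambda>K x. E K x \<bullet> grad (\<phi> K) x)" if "\<phi> \<in> ?V" for \<phi>
    using * that by blast
qed

end

section \<open>Particles crossing the mesh\<close>

text \<open>For the set of times at which a particle is in a given cell, these are the times at which
  it is in the cell, but not shortly afterwards.\<close>
definition right_isolated :: "real set \<Rightarrow> real set" where
  "right_isolated S = {t \<in> S. \<exists>\<delta>>0. {t<..<t + \<delta>} \<inter> S = {}}"

text \<open>The gaps to the right of such points are disjoint open intervals.\<close>
lemma countable_right_isolated: "countable (right_isolated S)"
proof -
  have "\<forall>t. \<exists>\<delta>. t \<in> right_isolated S \<longrightarrow> \<delta> > 0 \<and> {t<..<t + \<delta>} \<inter> S = {}" by (auto simp: right_isolated_def)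
  then obtain \<delta> where \<delta>: "\<And>t. t \<in> right_isolated S \<Longrightarrow> \<delta> t > 0" "\<And>t. t \<in> right_isolated S \<Longrightarrow> {t<..<t + \<delta> t} \<inter> S = {}"
    by metis
  let ?J = "\<lambda>t. {t<..<t + \<delta> t}"
  have sub: "right_isolated S \<subseteq> S" by (auto simp: right_isolated_def)
  have disj: "?J s \<inter> ?J t = {}" if st: "s \<in> right_isolated S" "t \<in> right_isolated S" "s < t" for s t
  proof -
    have "t \<notin> ?J s" using \<delta>(2)[OF st(1)] st(2) sub by blast
    then have "s + \<delta> s \<le> t" using st(3) by auto
    then show ?thesis by auto
  qed
  have inj: "inj_on ?J (right_isolated S)"
  proof (rule inj_onI, rule ccontr)
    fix s t assume st: "s \<in> right_isolated S" "t \<in> right_isolated S" "?J s = ?J t" "s \<noteq> t"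
    have "?J s \<inter> ?J t = {}" using disj[OF st(1,2)] disj[OF st(2,1)] st(4) by (cases "s < t") auto
    then have "?J s = {}" using st(3) by simp
    then show False using \<delta>(1)[OF st(1)] by simp
  qed
  have "countable (?J ` right_isolated S)"
  proof (rule countable_disjoint_open_subsets)
    show "pairwise disjnt (?J ` right_isolated S)"
    proof (rule pairwiseI)
      fix A B assume "A \<in> ?J ` right_isolated S" "B \<in> ?J ` right_isolated S" "A \<noteq> B"
      then obtain s t where st: "s \<in> right_isolated S" "t \<in> right_isolated S" "A = ?J s" "B = ?J t" "s \<noteq> t" by blast
      show "disjnt A B" unfolding disjnt_def st(3,4)
        using disj[OF st(1,2)] disj[OF st(2,1)] st(5) by (cases "s < t") auto
    qed
  qed auto
  then show ?thesis using inj countable_image_inj_on by blast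
qed

text \<open>The curve returns to \<open>K\<close> at times that approach \<open>t\<close> from the right, so its velocity cannot point out of a
  half-space whose boundary plane contains \<open>X t\<close>.\<close>
lemma polyhedron_feasible_direction:
  fixes X :: "real \<Rightarrow> 'a::euclidean_space"
  assumes K: "polyhedron K" and x: "X t \<in> K" and d: "(X has_vector_derivative V) (at t within I)"
    and acc: "t \<notin> right_isolated {s \<in> I. X s \<in> K}" and tI: "t \<in> I"
  shows "\<exists>e>0. \<forall>\<epsilon>\<in>{0..e}. X t + \<epsilon> *\<^sub>R V \<in> K"
proof -
  obtain H where H: "finite H" "K = \<Inter>H" "\<forall>h\<in>H. \<exists>a b. a \<noteq> 0 \<and> h = {x. a \<bullet> x \<le> b}"
    using K unfolding polyhedron_def by blast
  have "\<exists>e>0. \<forall>\<epsilon>\<in>{0..e}. X t + \<epsilon> *\<^sub>R V \<in> h" if h: "h \<in> H" for h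
  proof -
    obtain a b where ab: "a \<noteq> 0" "h = {x. a \<bullet> x \<le> b}" using H(3) h by blast
    have Xh: "X s \<in> K \<Longrightarrow> a \<bullet> X s \<le> b" for s using H(2) h ab(2) by blast
    show ?thesis
    proof (cases "a \<bullet> X t < b")
      case True
      show ?thesis
      proof (intro exI[of _ "(b - a \<bullet> X t) / (\<bar>a \<bullet> V\<bar> + 1)"] conjI ballI)
        show "(b - a \<bullet> X t) / (\<bar>a \<bullet> V\<bar> + 1) > 0" using True by simp
        fix \<epsilon> assume e: "\<epsilon> \<in> {0..(b - a \<bullet> X t) / (\<bar>a \<bullet> V\<bar> + 1)}"
        then have "\<epsilon> * (\<bar>a \<bullet> V\<bar> + 1) \<le> b - a \<bullet> X t" by (simp add: pos_le_divide_eq)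
        moreover have "\<epsilon> * (a \<bullet> V) \<le> \<epsilon> * (\<bar>a \<bullet> V\<bar> + 1)" using e by (intro mult_left_mono) auto
        ultimately show "X t + \<epsilon> *\<^sub>R V \<in> h" by (simp add: ab(2) inner_add_right)
      qed
    next
      case False
      then have eq: "a \<bullet> X t = b" using Xh[OF x] by simp
      have "a \<bullet> V \<le> 0"
      proof (rule ccontr)
        assume "\<not> a \<bullet> V \<le> 0"
        then have pos: "a \<bullet> V > 0" by simp
        define e where "e = (a \<bullet> V) / (2 * norm a)"
        have e: "e > 0" using pos ab(1) by (simp add: e_def)
        obtain \<delta> where \<delta>: "\<delta> > 0" "\<And>s. s \<in> I \<Longrightarrow> norm (s - t) < \<delta> \<Longrightarrow> norm (X s - X t - (s - t) *\<^sub>R V) \<le> e * norm (s - t)"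
          using d e unfolding has_vector_derivative_def has_derivative_within_alt by blast
        have "\<not> ({t<..<t + \<delta>} \<inter> {s \<in> I. X s \<in> K} = {})"
          using acc tI x \<delta>(1) unfolding right_isolated_def by blast
        then obtain s where s: "t < s" "s < t + \<delta>" "s \<in> I" "X s \<in> K" by auto
        have "\<bar>a \<bullet> (X s - X t - (s - t) *\<^sub>R V)\<bar> \<le> norm a * (e * (s - t))"
          using Cauchy_Schwarz_ineq2[of a "X s - X t - (s - t) *\<^sub>R V"] mult_left_mono[OF \<delta>(2)[OF s(3)] norm_ge_zero[of a]] s
          by (simp add: real_norm_def)
        also have "norm a * (e * (s - t)) = (a \<bullet> V) * (s - t) / 2" using ab(1) by (simp add: e_def)
        finally have "a \<bullet> (X s - X t - (s - t) *\<^sub>R V) \<ge> - ((a \<bullet> V) * (s - t) / 2)" by linarith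
        then have "a \<bullet> X s - a \<bullet> X t - (s - t) * (a \<bullet> V) \<ge> - ((a \<bullet> V) * (s - t) / 2)"
          by (simp add: inner_diff_right)
        then have "a \<bullet> X s - a \<bullet> X t \<ge> (a \<bullet> V) * (s - t) / 2"
          using mult.commute[of "s - t" "a \<bullet> V"] by linarith
        moreover have "(a \<bullet> V) * (s - t) / 2 > 0" using pos s by simp
        ultimately show False using Xh[OF s(4)] eq by simp
      qed
      then show ?thesis using eq by (intro exI[of _ 1]) (auto simp: ab(2) inner_add_right mult_nonneg_nonpos)
    qed
  qed
  then obtain e where e: "\<And>h. h \<in> H \<Longrightarrow> e h > 0" "\<And>h \<epsilon>. h \<in> H \<Longrightarrow> \<epsilon> \<in> {0..e h} \<Longrightarrow> X t + \<epsilon> *\<^sub>R V \<in> h" by metis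
  define r where "r = Min (insert 1 (e ` H))"
  have "r > 0" unfolding r_def using H(1) e(1) by (subst Min_gr_iff) auto
  moreover have "X t + \<epsilon> *\<^sub>R V \<in> \<Inter>H" if "\<epsilon> \<in> {0..r}" for \<epsilon>
  proof (rule InterI)
    fix h assume h: "h \<in> H"
    have "r \<le> e h" unfolding r_def using H(1) h by (intro Min_le) auto
    then show "X t + \<epsilon> *\<^sub>R V \<in> h" using that by (intro e(2)[OF h]) auto
  qed
  ultimately show ?thesis unfolding H(2) by blast
qed

context mesh
begin

text \<open>The two cells share a segment that starts in direction \<open>V\<close>, and on it the two traces agree.\<close>
lemma Q0_directional_derivative_eq:
  assumes \<phi>: "\<phi> \<in> Q0_space \<Omega> T k" and K: "K \<in> T" and K': "K' \<in> T"
    and e: "e > 0" "\<forall>\<epsilon>\<in>{0..e}. x + \<epsilon> *\<^sub>R V \<in> K" "e' > 0" "\<forall>\<epsilon>\<in>{0..e'}. x + \<epsilon> *\<^sub>R V \<in> K'"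
  shows "grad (\<phi> K) x \<bullet> V = grad (\<phi> K') x \<bullet> V"
proof -
  define r where "r = min e e'"
  have r: "r > 0" "r \<le> e" "r \<le> e'" using e by (auto simp: r_def)
  have D: "((\<lambda>s. \<phi> L (x + s *\<^sub>R V)) has_vector_derivative grad (\<phi> L) x \<bullet> V) (at 0 within {0..r})" if "L \<in> T" for L
    using smooth_line_derivative[OF Q0_smooth[OF \<phi> that], of x V 0 "{0..r}"] by (simp add: inner_vec_def mult.commute)
  have "((\<lambda>s. \<phi> K' (x + s *\<^sub>R V)) has_vector_derivative grad (\<phi> K) x \<bullet> V) (at 0 within {0..r})"
  proof (rule has_vector_derivative_transform[OF _ _ D[OF K]])
    fix s assume "s \<in> {0..r}"
    then show "\<phi> K' (x + s *\<^sub>R V) = \<phi> K (x + s *\<^sub>R V)"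
      using e r by (intro Q0_continuous[OF \<phi> K' _ K]) auto
  qed (use r in simp)
  note D1 = this
  show ?thesis
  proof (rule vector_derivative_unique_within_closed_interval[of 0 r 0 "\<lambda>s. \<phi> K' (x + s *\<^sub>R V)"])
    show "0 \<in> cbox 0 r" using r(1) by simp
  qed (unfold box_real, rule r(1), rule D1, rule D[OF K'])
qed

text \<open>At all times outside a countable set the velocity points into each of the cells that contain the
  particle, so all of them give the same rate of change. The cell that \<open>loc\<close> selects at nearby times is
  one of these cells, and there are finitely many of them.\<close>
theorem particle_derivative:
  assumes \<phi>: "\<phi> \<in> Q0_space \<Omega> T k" and loc: "cell_selection T loc"
    and X: "\<And>s. s \<in> I \<Longrightarrow> X s \<in> \<Union>T" and tI: "t \<in> I"
    and d: "(X has_vector_derivative V) (at t within I)"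
    and acc: "\<And>K. K \<in> T \<Longrightarrow> t \<notin> right_isolated {s \<in> I. X s \<in> K}"
  shows "((\<lambda>s. \<phi> (loc (X s)) (X s)) has_vector_derivative grad (\<phi> (loc (X t))) (X t) \<bullet> V) (at t within I)"
proof -
  let ?x = "X t"
  define C where "C = {K \<in> T. ?x \<in> K}"
  define D where "D = grad (\<phi> (loc ?x)) ?x \<bullet> V"
  have finC: "finite C" by (simp add: C_def)
  have locX: "loc (X s) \<in> T" "X s \<in> loc (X s)" if "s \<in> I" for s using loc X[OF that] unfolding cell_selection_def by auto
  have feas: "\<exists>e>0. \<forall>\<epsilon>\<in>{0..e}. ?x + \<epsilon> *\<^sub>R V \<in> K" if "K \<in> C" for K
    using that polyhedron_feasible_direction[OF polytope_imp_polyhedron[OF cell_polytope] _ d acc tI] by (auto simp: C_def)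
  have locC: "loc ?x \<in> C" using locX[OF tI] by (simp add: C_def)
  have D: "grad (\<phi> K) ?x \<bullet> V = D" if K: "K \<in> C" for K
  proof -
    obtain e where e: "e > 0" "\<forall>\<epsilon>\<in>{0..e}. ?x + \<epsilon> *\<^sub>R V \<in> K" using feas[OF K] by blast
    obtain e' where e': "e' > 0" "\<forall>\<epsilon>\<in>{0..e'}. ?x + \<epsilon> *\<^sub>R V \<in> loc ?x" using feas[OF locC] by blast
    show ?thesis unfolding D_def
      by (rule Q0_directional_derivative_eq[OF \<phi> _ _ e e']) (use K locC in \<open>auto simp: C_def\<close>)
  qed
  have cellD: "((\<lambda>s. \<phi> K (X s)) has_vector_derivative D) (at t within I)" if K: "K \<in> C" for K
  proof -
    have KT: "K \<in> T" using K by (simp add: C_def)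
    have "((\<lambda>s. \<phi> K (X s)) has_derivative (\<lambda>h. \<Sum>i\<in>UNIV. (h *\<^sub>R V) $ i *\<^sub>R partial i (\<phi> K) ?x)) (at t within I)"
      using has_derivative_compose[OF d[unfolded has_vector_derivative_def] has_derivative_partials[OF smooth_differentiable[OF Q0_smooth[OF \<phi> KT]]]] .
    moreover have "(\<Sum>i\<in>UNIV. (h *\<^sub>R V) $ i *\<^sub>R partial i (\<phi> K) ?x) = h *\<^sub>R D" for h
      unfolding D[OF K, symmetric] by (simp add: inner_vec_def sum_distrib_left mult_ac)
    ultimately show ?thesis by (simp add: has_vector_derivative_def)
  qed
  have near: "\<forall>\<^sub>F s in at t within I. loc (X s) \<in> C"
  proof -
    have "closed (\<Union>(T - C))" using cell_closed by (intro closed_Union) auto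
    moreover have "?x \<notin> \<Union>(T - C)" by (auto simp: C_def)
    moreover have "(X \<longlongrightarrow> ?x) (at t within I)"
      using has_vector_derivative_continuous[OF d] by (simp add: continuous_within)
    ultimately have "\<forall>\<^sub>F s in at t within I. X s \<in> - \<Union>(T - C)"
      by (intro topological_tendstoD[of X ?x]) (auto simp: open_Compl)
    moreover have "\<forall>\<^sub>F s in at t within I. s \<in> I" by (simp add: eventually_at_filter)
    ultimately show ?thesis
    proof eventually_elim
      case (elim s)
      then show ?case using locX[of s] by blast
    qed
  qed
  have "((\<lambda>s. \<phi> (loc (X s)) (X s)) has_derivative (\<lambda>h. h *\<^sub>R D)) (at t within I)"
    unfolding has_derivative_within_alt2
  proof (intro conjI allI impI)
    show "bounded_linear (\<lambda>h. h *\<^sub>R D)" by (rule bounded_linear_scaleR_left)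
    fix e :: real assume "e > 0"
    have "\<forall>\<^sub>F s in at t within I. norm (\<phi> K (X s) - \<phi> K (X t) - (s - t) *\<^sub>R D) \<le> e * norm (s - t)" if "K \<in> C" for K
      using cellD[OF that] \<open>e > 0\<close> unfolding has_vector_derivative_def has_derivative_within_alt2 by blast
    then have "\<forall>\<^sub>F s in at t within I. \<forall>K\<in>C. norm (\<phi> K (X s) - \<phi> K (X t) - (s - t) *\<^sub>R D) \<le> e * norm (s - t)"
      using finC by (intro eventually_ball_finite) auto
    with near show "\<forall>\<^sub>F s in at t within I. norm (\<phi> (loc (X s)) (X s) - \<phi> (loc (X t)) (X t) - (s - t) *\<^sub>R D) \<le> e * norm (s - t)"
    proof eventually_elim
      case (elim s)
      have "\<phi> (loc (X s)) ?x = \<phi> (loc ?x) ?x"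
        by (rule Q0_continuous[OF \<phi>]) (use elim(1) locC in \<open>auto simp: C_def\<close>)
      then show ?case using elim by auto
    qed
  qed
  then show ?thesis by (simp add: has_vector_derivative_def D_def)
qed

end

section \<open>The relativistic energy\<close>

lemma lorentz_arg_ge_1: "1 + (u \<bullet> u) / (m\<^sup>2 * c\<^sup>2) \<ge> (1::real)" by simp

lemma lorentz_ge_1: "lorentz m c u \<ge> 1" by (simp add: lorentz_def)

text \<open>As the norm of an affine function, \<open>\<gamma>\<close> is Lipschitz.\<close>
lemma lorentz_eq_norm: "m > 0 \<Longrightarrow> c > 0 \<Longrightarrow> lorentz m c u = norm (1::real, (1 / (m * c)) *\<^sub>R u)"
  by (simp add: lorentz_def norm_Pair power_mult_distrib power_divide power2_norm_eq_inner)

lemma lorentz_lipschitz: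
  assumes "m > 0" "c > 0" shows "\<bar>lorentz m c u - lorentz m c v\<bar> \<le> 1 / (m * c) * norm (u - v)"
proof -
  have "\<bar>norm (1::real, (1 / (m * c)) *\<^sub>R u) - norm (1::real, (1 / (m * c)) *\<^sub>R v)\<bar>
      \<le> norm ((1::real, (1 / (m * c)) *\<^sub>R u) - (1, (1 / (m * c)) *\<^sub>R v))"
    by (rule norm_triangle_ineq3)
  also have "\<dots> = norm ((1 / (m * c)) *\<^sub>R (u - v))" by (simp add: norm_Pair scaleR_diff_right)
  also have "\<dots> = 1 / (m * c) * norm (u - v)" using assms by simp
  finally show ?thesis using assms by (simp add: lorentz_eq_norm)
qed

lemma inner_self_derivative:
  fixes U :: "real \<Rightarrow> real^3"
  assumes "(U has_vector_derivative U') (at t within I)"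
  shows "((\<lambda>s. U s \<bullet> U s) has_real_derivative 2 * (U t \<bullet> U')) (at t within I)"
  using bounded_bilinear.has_vector_derivative[OF bounded_bilinear_inner assms assms]
  by (simp add: has_real_derivative_iff_has_vector_derivative inner_commute)

lemma lorentz_derivative:
  assumes "m > 0" "c > 0" "(U has_vector_derivative U') (at t within I)"
  shows "((\<lambda>s. lorentz m c (U s)) has_real_derivative (U t \<bullet> U') / (m\<^sup>2 * c\<^sup>2 * lorentz m c (U t))) (at t within I)"
proof -
  have "((\<lambda>s. 1 + (U s \<bullet> U s) / (m\<^sup>2 * c\<^sup>2)) has_real_derivative 2 * (U t \<bullet> U') / (m\<^sup>2 * c\<^sup>2)) (at t within I)"
    using DERIV_add[OF DERIV_const DERIV_cdivide[OF inner_self_derivative[OF assms(3)]], of 1 "m\<^sup>2 * c\<^sup>2"] by simp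
  moreover have "0 < 1 + (U t \<bullet> U t) / (m\<^sup>2 * c\<^sup>2)" using lorentz_arg_ge_1[of "U t" m c] by linarith
  ultimately have "((\<lambda>s. sqrt (1 + (U s \<bullet> U s) / (m\<^sup>2 * c\<^sup>2))) has_real_derivative
      inverse (sqrt (1 + (U t \<bullet> U t) / (m\<^sup>2 * c\<^sup>2))) / 2 * (2 * (U t \<bullet> U') / (m\<^sup>2 * c\<^sup>2))) (at t within I)"
    by (intro DERIV_chain2[OF DERIV_real_sqrt])
  then show ?thesis by (simp add: lorentz_def field_simps)
qed

lemma fluid_gamma_eq: "m > 0 \<Longrightarrow> \<rho> \<noteq> 0 \<Longrightarrow> fluid_gamma m c \<rho> M = sqrt (1 + (M \<bullet> M) / (c\<^sup>2 * \<rho>\<^sup>2))"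
  by (simp add: lorentz_def power_divide power2_eq_square)

text \<open>As long as the density does not change sign, the energy density is up to a linear term the norm of the
  vector of density and scaled momentum, and so it is Lipschitz in both, without a positive lower bound on the density.\<close>
lemma density_times_gamma:
  assumes "m > 0" "c > 0" "\<rho> \<noteq> 0"
  shows "\<rho> * fluid_gamma m c \<rho> M = sgn \<rho> * norm (\<rho>, (1 / c) *\<^sub>R M)"
proof -
  have "norm (\<rho>, (1 / c) *\<^sub>R M) = sqrt (\<rho>\<^sup>2 + (M \<bullet> M) / c\<^sup>2)"
    by (simp add: norm_Pair power_divide power2_norm_eq_inner power_mult_distrib)
  also have "\<rho>\<^sup>2 + (M \<bullet> M) / c\<^sup>2 = \<rho>\<^sup>2 * (1 + (M \<bullet> M) / (c\<^sup>2 * \<rho>\<^sup>2))"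
    using assms by (simp add: field_simps)
  also have "sqrt \<dots> = \<bar>\<rho>\<bar> * fluid_gamma m c \<rho> M"
    by (simp only: real_sqrt_mult real_sqrt_abs fluid_gamma_eq[OF assms(1,3)])
  finally have "sgn \<rho> * norm (\<rho>, (1 / c) *\<^sub>R M) = (sgn \<rho> * \<bar>\<rho>\<bar>) * fluid_gamma m c \<rho> M" by simp
  then show ?thesis by (simp add: sgn_mult_abs)
qed

lemma energy_density_lipschitz:
  assumes mc: "m > 0" "c > 0" and \<rho>: "\<rho>1 \<noteq> 0" "\<rho>2 \<noteq> 0" "sgn \<rho>1 = sgn \<rho>2"
  shows "\<bar>\<rho>1 * (fluid_gamma m c \<rho>1 M1 - 1) * c\<^sup>2 - \<rho>2 * (fluid_gamma m c \<rho>2 M2 - 1) * c\<^sup>2\<bar>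
    \<le> c\<^sup>2 * (2 * \<bar>\<rho>1 - \<rho>2\<bar> + 1 / c * norm (M1 - M2))"
proof -
  let ?n1 = "norm (\<rho>1, (1 / c) *\<^sub>R M1)" and ?n2 = "norm (\<rho>2, (1 / c) *\<^sub>R M2)"
  have "\<rho>1 * (fluid_gamma m c \<rho>1 M1 - 1) - \<rho>2 * (fluid_gamma m c \<rho>2 M2 - 1) = sgn \<rho>2 * (?n1 - ?n2) - (\<rho>1 - \<rho>2)"
    using density_times_gamma[OF mc \<rho>(1), of M1] density_times_gamma[OF mc \<rho>(2), of M2] \<rho>(3) by (simp add: algebra_simps)
  also have "\<bar>\<dots>\<bar> \<le> \<bar>sgn \<rho>2 * (?n1 - ?n2)\<bar> + \<bar>\<rho>1 - \<rho>2\<bar>" by (rule abs_triangle_ineq4)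
  also have "\<bar>sgn \<rho>2 * (?n1 - ?n2)\<bar> = \<bar>?n1 - ?n2\<bar>" using \<rho>(2) by (simp add: abs_mult abs_sgn_eq)
  also have "\<dots> \<le> norm ((\<rho>1, (1 / c) *\<^sub>R M1) - (\<rho>2, (1 / c) *\<^sub>R M2))" by (rule norm_triangle_ineq3)
  also have "\<dots> = norm (\<rho>1 - \<rho>2, (1 / c) *\<^sub>R (M1 - M2))" by (simp add: scaleR_diff_right)
  also have "\<dots> \<le> \<bar>\<rho>1 - \<rho>2\<bar> + 1 / c * norm (M1 - M2)"
    using norm_Pair_le[of "\<rho>1 - \<rho>2" "(1 / c) *\<^sub>R (M1 - M2)"] mc by simp
  finally have "\<bar>\<rho>1 * (fluid_gamma m c \<rho>1 M1 - 1) - \<rho>2 * (fluid_gamma m c \<rho>2 M2 - 1)\<bar> \<le> 2 * \<bar>\<rho>1 - \<rho>2\<bar> + 1 / c * norm (M1 - M2)" by simp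
  then have "c\<^sup>2 * \<bar>\<rho>1 * (fluid_gamma m c \<rho>1 M1 - 1) - \<rho>2 * (fluid_gamma m c \<rho>2 M2 - 1)\<bar> \<le> c\<^sup>2 * (2 * \<bar>\<rho>1 - \<rho>2\<bar> + 1 / c * norm (M1 - M2))"
    by (rule mult_left_mono) simp
  moreover have "c\<^sup>2 * \<bar>\<rho>1 * (fluid_gamma m c \<rho>1 M1 - 1) - \<rho>2 * (fluid_gamma m c \<rho>2 M2 - 1)\<bar>
    = \<bar>\<rho>1 * (fluid_gamma m c \<rho>1 M1 - 1) * c\<^sup>2 - \<rho>2 * (fluid_gamma m c \<rho>2 M2 - 1) * c\<^sup>2\<bar>"
    by (simp add: left_diff_distrib[symmetric] abs_mult)
  ultimately show ?thesis by simp
qed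

text \<open>The coefficients of the two derivatives are the functions that the scheme projects onto the discrete
  spaces to define the potential \<open>G\<close> and the velocity \<open>w\<close>.\<close>
lemma energy_density_derivative:
  fixes \<rho> :: "real \<Rightarrow> real" and M :: "real \<Rightarrow> real^3"
  assumes mc: "m > 0" "c > 0" and t: "t \<in> I" and \<rho>: "\<And>s. s \<in> I \<Longrightarrow> \<rho> s \<noteq> 0"
    and d\<rho>: "(\<rho> has_vector_derivative \<rho>') (at t within I)" and dM: "(M has_vector_derivative M') (at t within I)"
  shows "((\<lambda>s. \<rho> s * (fluid_gamma m c (\<rho> s) (M s) - 1) * c\<^sup>2) has_vector_derivative
     c\<^sup>2 * ((fluid_gamma m c (\<rho> t) (M t) - 1 - (M t \<bullet> M t) / (c\<^sup>2 * (\<rho> t)\<^sup>2 * fluid_gamma m c (\<rho> t) (M t))) * \<rho>')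
     + ((1 / (\<rho> t * fluid_gamma m c (\<rho> t) (M t))) *\<^sub>R M t) \<bullet> M') (at t within I)"
proof -
  define Q where "Q s = M s \<bullet> M s" for s
  define u where "u s = 1 + Q s / (c\<^sup>2 * (\<rho> s)\<^sup>2)" for s
  define \<gamma> where "\<gamma> = sqrt (u t)"
  have u1: "u t \<ge> 1" by (simp add: u_def Q_def)
  have g: "\<gamma> \<ge> 1" unfolding \<gamma>_def using u1 by simp
  have r: "\<rho> t \<noteq> 0" by (rule \<rho>[OF t])
  have gam: "fluid_gamma m c (\<rho> s) (M s) = sqrt (u s)" if "s \<in> I" for s
    using fluid_gamma_eq[OF mc(1) \<rho>[OF that]] by (simp add: u_def Q_def)
  have D\<rho>: "(\<rho> has_real_derivative \<rho>') (at t within I)" using d\<rho> by (simp add: has_real_derivative_iff_has_vector_derivative)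
  have DQ: "(Q has_real_derivative 2 * (M t \<bullet> M')) (at t within I)" unfolding Q_def[abs_def] by (rule inner_self_derivative[OF dM])
  define u' where "u' = 2 * (M t \<bullet> M') / (c\<^sup>2 * (\<rho> t)\<^sup>2) - 2 * Q t * \<rho>' / (c\<^sup>2 * (\<rho> t) ^ 3)"
  have Du: "(u has_real_derivative u') (at t within I)"
  proof -
    have "(u has_real_derivative (2 * (M t \<bullet> M') * (c\<^sup>2 * (\<rho> t)\<^sup>2) - Q t * (c\<^sup>2 * (2 * \<rho> t * \<rho>'))) / ((c\<^sup>2 * (\<rho> t)\<^sup>2) * (c\<^sup>2 * (\<rho> t)\<^sup>2))) (at t within I)"
      unfolding u_def[abs_def] using r mc
      by (auto intro!: derivative_eq_intros DQ D\<rho> simp: power2_eq_square)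
    also have "(2 * (M t \<bullet> M') * (c\<^sup>2 * (\<rho> t)\<^sup>2) - Q t * (c\<^sup>2 * (2 * \<rho> t * \<rho>'))) / ((c\<^sup>2 * (\<rho> t)\<^sup>2) * (c\<^sup>2 * (\<rho> t)\<^sup>2)) = u'"
      unfolding u'_def using r mc by (simp add: field_simps power2_eq_square power3_eq_cube)
    finally show ?thesis .
  qed
  have "((\<lambda>s. sqrt (u s)) has_real_derivative inverse (sqrt (u t)) / 2 * u') (at t within I)"
    using u1 by (intro DERIV_chain2[OF DERIV_real_sqrt] Du) simp
  then have Ds: "((\<lambda>s. \<rho> s * (sqrt (u s) - 1) * c\<^sup>2) has_real_derivative (\<rho>' * (\<gamma> - 1) + inverse \<gamma> / 2 * u' * \<rho> t) * c\<^sup>2) (at t within I)"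
    unfolding \<gamma>_def
    using DERIV_cmult_right[OF DERIV_mult[OF D\<rho> DERIV_diff[OF _ DERIV_const[of 1]]], of "\<lambda>s. sqrt (u s)" "inverse (sqrt (u t)) / 2 * u'" "c\<^sup>2"]
    by simp
  have eq: "(\<rho>' * (\<gamma> - 1) + inverse \<gamma> / 2 * u' * \<rho> t) * c\<^sup>2
     = c\<^sup>2 * ((\<gamma> - 1 - Q t / (c\<^sup>2 * (\<rho> t)\<^sup>2 * \<gamma>)) * \<rho>') + ((1 / (\<rho> t * \<gamma>)) *\<^sub>R M t) \<bullet> M'"
  proof -
    have "\<gamma> \<noteq> 0" using g by simp
    then show ?thesis unfolding u'_def using r mc by (simp add: field_simps power2_eq_square power3_eq_cube)
  qed
  have "((\<lambda>s. \<rho> s * (sqrt (u s) - 1) * c\<^sup>2) has_vector_derivative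
     c\<^sup>2 * ((\<gamma> - 1 - Q t / (c\<^sup>2 * (\<rho> t)\<^sup>2 * \<gamma>)) * \<rho>') + ((1 / (\<rho> t * \<gamma>)) *\<^sub>R M t) \<bullet> M') (at t within I)"
    using Ds unfolding eq has_real_derivative_iff_has_vector_derivative .
  then have "((\<lambda>s. \<rho> s * (fluid_gamma m c (\<rho> s) (M s) - 1) * c\<^sup>2) has_vector_derivative
     c\<^sup>2 * ((\<gamma> - 1 - Q t / (c\<^sup>2 * (\<rho> t)\<^sup>2 * \<gamma>)) * \<rho>') + ((1 / (\<rho> t * \<gamma>)) *\<^sub>R M t) \<bullet> M') (at t within I)"
    by (rule has_vector_derivative_transform[OF t, rotated]) (simp add: gam)
  then show ?thesis unfolding gam[OF t] Q_def \<gamma>_def[symmetric] .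
qed

section \<open>Integrals of time-dependent fields\<close>

lemma real3_Basis: "b \<in> (Basis :: (real^3) set) \<Longrightarrow> \<exists>i. b = axis i 1"
  by (auto simp: Basis_vec_def)

context mesh
begin

text \<open>The uniformity in space that makes integrals over the mesh absolutely continuous and differentiable in
  time.\<close>
definition regular_in_time :: "real set \<Rightarrow> (real \<Rightarrow> cell \<Rightarrow> real^3 \<Rightarrow> 'b::euclidean_space) \<Rightarrow> bool" where
  "regular_in_time I f \<longleftrightarrow>
     (\<exists>d. loc_modulus I d \<and> (\<forall>s\<in>I. \<forall>t\<in>I. \<forall>K\<in>T. \<forall>x\<in>K. norm (f t K x - f s K x) \<le> d s t)) \<and>
     (\<forall>t\<in>I. \<forall>K\<in>T. continuous_on K (f t K)) \<and>
     (\<forall>a\<in>I. \<forall>b\<in>I. \<exists>P. \<forall>t\<in>{a..b}. \<forall>K\<in>T. \<forall>x\<in>K. norm (f t K x) \<le> P) \<and>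
     (\<forall>t\<in>I. \<forall>df. field_has_time_deriv T I f t df \<longrightarrow>
        (\<exists>B. \<forall>\<^sub>F s in at t within I. \<forall>K\<in>T. \<forall>x\<in>K. norm (f s K x - f t K x) \<le> B * \<bar>s - t\<bar>))"

lemma regular_in_timeD:
  assumes "regular_in_time I f"
  shows "\<exists>d. loc_modulus I d \<and> (\<forall>s\<in>I. \<forall>t\<in>I. \<forall>K\<in>T. \<forall>x\<in>K. norm (f t K x - f s K x) \<le> d s t)"
    and "\<And>t K. t \<in> I \<Longrightarrow> K \<in> T \<Longrightarrow> continuous_on K (f t K)"
    and "\<And>a b. a \<in> I \<Longrightarrow> b \<in> I \<Longrightarrow> \<exists>P. \<forall>t\<in>{a..b}. \<forall>K\<in>T. \<forall>x\<in>K. norm (f t K x) \<le> P"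
    and "\<And>t df. t \<in> I \<Longrightarrow> field_has_time_deriv T I f t df \<Longrightarrow>
      \<exists>B. \<forall>\<^sub>F s in at t within I. \<forall>K\<in>T. \<forall>x\<in>K. norm (f s K x - f t K x) \<le> B * \<bar>s - t\<bar>"
  using assms unfolding regular_in_time_def by auto

lemma regular_linear:
  fixes f :: "real \<Rightarrow> cell \<Rightarrow> real^3 \<Rightarrow> 'b::euclidean_space"
  assumes I: "is_interval I" and f: "regular_in_time I f" and g: "\<And>K. K \<in> T \<Longrightarrow> continuous_on K (g K)"
  shows regular_linear_ac: "loc_abs_continuous_on I (\<lambda>t. mesh_integral T (\<lambda>K x. f t K x \<bullet> g K x))"
    and regular_linear_deriv: "\<And>t df. t \<in> I \<Longrightarrow> field_has_time_deriv T I f t df \<Longrightarrow>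
      ((\<lambda>t. mesh_integral T (\<lambda>K x. f t K x \<bullet> g K x)) has_vector_derivative mesh_integral T (\<lambda>K x. df K x \<bullet> g K x)) (at t within I)"
proof -
  obtain G where G: "G \<ge> 0" "\<And>K x. K \<in> T \<Longrightarrow> x \<in> K \<Longrightarrow> norm (g K x) \<le> G" using cell_bound[of g, OF g] by blast
  have le: "\<bar>a \<bullet> g K x - b \<bullet> g K x\<bar> \<le> G * norm (a - b)" if "K \<in> T" "x \<in> K" for a b K x
  proof -
    have "\<bar>(a - b) \<bullet> g K x\<bar> \<le> norm (a - b) * norm (g K x)" by (rule Cauchy_Schwarz_ineq2)
    also have "\<dots> \<le> norm (a - b) * G" by (rule mult_left_mono[OF G(2)[OF that]]) simp
    finally show ?thesis by (simp add: inner_diff_left mult.commute)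
  qed
  obtain d where d: "loc_modulus I d" "\<And>s t K x. s \<in> I \<Longrightarrow> t \<in> I \<Longrightarrow> K \<in> T \<Longrightarrow> x \<in> K \<Longrightarrow> norm (f t K x - f s K x) \<le> d s t"
    using regular_in_timeD(1)[OF f] by blast
  have c: "continuous_on K (\<lambda>x. f t K x \<bullet> g K x)" if "t \<in> I" "K \<in> T" for t K
    using regular_in_timeD(2)[OF f that] g[OF that(2)] by (rule continuous_on_inner)
  show "loc_abs_continuous_on I (\<lambda>t. mesh_integral T (\<lambda>K x. f t K x \<bullet> g K x))"
  proof (rule loc_ac_mesh_integral[OF I d(1) c])
    fix a b assume ab: "a \<in> I" "b \<in> I" "a \<le> b"
    show "\<exists>C. \<forall>s t. a \<le> s \<longrightarrow> s \<le> t \<longrightarrow> t \<le> b \<longrightarrow> (\<forall>K\<in>T. \<forall>x\<in>K. \<bar>f t K x \<bullet> g K x - f s K x \<bullet> g K x\<bar> \<le> C * d s t)"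
    proof (intro exI[of _ G] allI impI ballI)
      fix s t K x assume st: "a \<le> s" "s \<le> t" "t \<le> b" and K: "K \<in> T" "x \<in> K"
      have "s \<in> I" "t \<in> I" using st by (auto intro!: mem_is_interval_1_I[OF I ab(1,2)])
      then have "G * norm (f t K x - f s K x) \<le> G * d s t" by (intro mult_left_mono d(2) K G(1))
      then show "\<bar>f t K x \<bullet> g K x - f s K x \<bullet> g K x\<bar> \<le> G * d s t" using le[OF K] order_trans by blast
    qed
  qed
  fix t df assume t: "t \<in> I" and df: "field_has_time_deriv T I f t df"
  obtain B where B: "\<forall>\<^sub>F s in at t within I. \<forall>K\<in>T. \<forall>x\<in>K. norm (f s K x - f t K x) \<le> B * \<bar>s - t\<bar>"
    using regular_in_timeD(4)[OF f t df] by blast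
  show "((\<lambda>t. mesh_integral T (\<lambda>K x. f t K x \<bullet> g K x)) has_vector_derivative mesh_integral T (\<lambda>K x. df K x \<bullet> g K x)) (at t within I)"
  proof (rule has_vector_derivative_mesh_integral[OF t c, where B = "G * B"])
    fix K x assume "K \<in> T" "x \<in> K"
    then have "((\<lambda>s. f s K x) has_vector_derivative df K x) (at t within I)" using df unfolding field_has_time_deriv_def by blast
    then show "((\<lambda>s. f s K x \<bullet> g K x) has_vector_derivative df K x \<bullet> g K x) (at t within I)"
      by (rule bounded_linear.has_vector_derivative[OF bounded_linear_inner_left])
  next
    show "\<forall>\<^sub>F s in at t within I. \<forall>K\<in>T. \<forall>x\<in>K. \<bar>f s K x \<bullet> g K x - f t K x \<bullet> g K x\<bar> \<le> G * B * \<bar>s - t\<bar>"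
      using B
    proof eventually_elim
      case (elim s)
      show ?case
      proof (intro ballI)
        fix K x assume K: "K \<in> T" "x \<in> K"
        then have "norm (f s K x - f t K x) \<le> B * \<bar>s - t\<bar>" using elim by blast
        then have "G * norm (f s K x - f t K x) \<le> G * (B * \<bar>s - t\<bar>)" by (rule mult_left_mono[OF _ G(1)])
        then show "\<bar>f s K x \<bullet> g K x - f t K x \<bullet> g K x\<bar> \<le> G * B * \<bar>s - t\<bar>" using le[OF K, of "f s K x" "f t K x"] by (simp add: mult.assoc)
      qed
    qed
  qed
qed

lemma square_diff_bound:
  fixes a b :: "'b::real_inner"
  shows "\<bar>(norm a)\<^sup>2 - (norm b)\<^sup>2\<bar> \<le> (norm a + norm b) * norm (a - b)"
proof -
  have "(norm a)\<^sup>2 - (norm b)\<^sup>2 = (norm a + norm b) * (norm a - norm b)" by (simp add: power2_eq_square algebra_simps)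
  then have "\<bar>(norm a)\<^sup>2 - (norm b)\<^sup>2\<bar> = (norm a + norm b) * \<bar>norm a - norm b\<bar>" by (simp add: abs_mult)
  also have "\<dots> \<le> (norm a + norm b) * norm (a - b)" by (intro mult_left_mono norm_triangle_ineq3) simp
  finally show ?thesis .
qed

lemma regular_square:
  fixes f :: "real \<Rightarrow> cell \<Rightarrow> real^3 \<Rightarrow> 'b::euclidean_space"
  assumes I: "is_interval I" and f: "regular_in_time I f"
  shows regular_square_ac: "loc_abs_continuous_on I (\<lambda>t. mesh_integral T (\<lambda>K x. (norm (f t K x))\<^sup>2))"
    and regular_square_deriv: "\<And>t df. t \<in> I \<Longrightarrow> field_has_time_deriv T I f t df \<Longrightarrow>
      ((\<lambda>t. mesh_integral T (\<lambda>K x. (norm (f t K x))\<^sup>2)) has_vector_derivative 2 * mesh_integral T (\<lambda>K x. df K x \<bullet> f t K x)) (at t within I)"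
proof -
  obtain d where d: "loc_modulus I d" "\<And>s t K x. s \<in> I \<Longrightarrow> t \<in> I \<Longrightarrow> K \<in> T \<Longrightarrow> x \<in> K \<Longrightarrow> norm (f t K x - f s K x) \<le> d s t"
    using regular_in_timeD(1)[OF f] by blast
  have c: "continuous_on K (\<lambda>x. (norm (f t K x))\<^sup>2)" if "t \<in> I" "K \<in> T" for t K
    using regular_in_timeD(2)[OF f that] by (intro continuous_intros)
  show "loc_abs_continuous_on I (\<lambda>t. mesh_integral T (\<lambda>K x. (norm (f t K x))\<^sup>2))"
  proof (rule loc_ac_mesh_integral[OF I d(1) c])
    fix a b assume ab: "a \<in> I" "b \<in> I" "a \<le> b"
    obtain P where P: "\<And>t K x. t \<in> {a..b} \<Longrightarrow> K \<in> T \<Longrightarrow> x \<in> K \<Longrightarrow> norm (f t K x) \<le> P" using regular_in_timeD(3)[OF f ab(1,2)] by blast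
    show "\<exists>C. \<forall>s t. a \<le> s \<longrightarrow> s \<le> t \<longrightarrow> t \<le> b \<longrightarrow> (\<forall>K\<in>T. \<forall>x\<in>K. \<bar>(norm (f t K x))\<^sup>2 - (norm (f s K x))\<^sup>2\<bar> \<le> C * d s t)"
    proof (intro exI[of _ "P + P"] allI impI ballI)
      fix s t K x assume st: "a \<le> s" "s \<le> t" "t \<le> b" and K: "K \<in> T" "x \<in> K"
      have sI: "s \<in> I" "t \<in> I" using st by (auto intro!: mem_is_interval_1_I[OF I ab(1,2)])
      have p: "norm (f t K x) \<le> P" "norm (f s K x) \<le> P" using st by (auto intro!: P K)
      have "0 \<le> P" using p(1) norm_ge_zero[of "f t K x"] by linarith
      then have "(norm (f t K x) + norm (f s K x)) * norm (f t K x - f s K x) \<le> (P + P) * d s t"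
        by (intro mult_mono d(2) sI K add_mono p) auto
      then show "\<bar>(norm (f t K x))\<^sup>2 - (norm (f s K x))\<^sup>2\<bar> \<le> (P + P) * d s t" using square_diff_bound order_trans by blast
    qed
  qed
  fix t df assume t: "t \<in> I" and df: "field_has_time_deriv T I f t df"
  obtain B where B: "\<forall>\<^sub>F s in at t within I. \<forall>K\<in>T. \<forall>x\<in>K. norm (f s K x - f t K x) \<le> B * \<bar>s - t\<bar>"
    using regular_in_timeD(4)[OF f t df] by blast
  obtain P where P: "P \<ge> 0" "\<And>K x. K \<in> T \<Longrightarrow> x \<in> K \<Longrightarrow> norm (f t K x) \<le> P"
    using cell_bound[of "f t", OF regular_in_timeD(2)[OF f t]] by blast
  have near: "\<forall>\<^sub>F s in at t within I. \<bar>s - t\<bar> < 1"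
    unfolding eventually_at by (intro exI[of _ 1]) (auto simp: dist_real_def)
  have "((\<lambda>t. mesh_integral T (\<lambda>K x. (norm (f t K x))\<^sup>2)) has_vector_derivative mesh_integral T (\<lambda>K x. 2 * (df K x \<bullet> f t K x))) (at t within I)"
  proof (rule has_vector_derivative_mesh_integral[OF t c, where B = "(2 * P + \<bar>B\<bar>) * \<bar>B\<bar>"])
    fix K x assume "K \<in> T" "x \<in> K"
    then have D: "((\<lambda>s. f s K x) has_vector_derivative df K x) (at t within I)" using df unfolding field_has_time_deriv_def by blast
    show "((\<lambda>s. (norm (f s K x))\<^sup>2) has_vector_derivative 2 * (df K x \<bullet> f t K x)) (at t within I)"
      using bounded_bilinear.has_vector_derivative[OF bounded_bilinear_inner D D] by (simp add: power2_norm_eq_inner inner_commute)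
  next
    show "\<forall>\<^sub>F s in at t within I. \<forall>K\<in>T. \<forall>x\<in>K. \<bar>(norm (f s K x))\<^sup>2 - (norm (f t K x))\<^sup>2\<bar> \<le> (2 * P + \<bar>B\<bar>) * \<bar>B\<bar> * \<bar>s - t\<bar>"
      using B near
    proof eventually_elim
      case (elim s)
      show ?case
      proof (intro ballI)
        fix K x assume K: "K \<in> T" "x \<in> K"
        have "norm (f s K x - f t K x) \<le> B * \<bar>s - t\<bar>" using elim(1) K by blast
        also have "\<dots> \<le> \<bar>B\<bar> * \<bar>s - t\<bar>" by (intro mult_right_mono) auto
        finally have 1: "norm (f s K x - f t K x) \<le> \<bar>B\<bar> * \<bar>s - t\<bar>" .
        also have "\<dots> \<le> \<bar>B\<bar> * 1" using elim(2) by (intro mult_left_mono) auto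
        finally have "norm (f s K x) + norm (f t K x) \<le> 2 * P + \<bar>B\<bar>"
          using P(2)[OF K] norm_triangle_sub[of "f s K x" "f t K x"] by simp
        then have "(norm (f s K x) + norm (f t K x)) * norm (f s K x - f t K x) \<le> (2 * P + \<bar>B\<bar>) * (\<bar>B\<bar> * \<bar>s - t\<bar>)"
          using 1 P(1) by (intro mult_mono) auto
        then show "\<bar>(norm (f s K x))\<^sup>2 - (norm (f t K x))\<^sup>2\<bar> \<le> (2 * P + \<bar>B\<bar>) * \<bar>B\<bar> * \<bar>s - t\<bar>"
          using square_diff_bound[of "f s K x" "f t K x"] by (simp add: mult.assoc)
      qed
    qed
  qed
  then show "((\<lambda>t. mesh_integral T (\<lambda>K x. (norm (f t K x))\<^sup>2)) has_vector_derivative 2 * mesh_integral T (\<lambda>K x. df K x \<bullet> f t K x)) (at t within I)"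
    by (simp only: mesh_integral_scale)
qed

lemma sgn_constant:
  fixes r :: "real \<Rightarrow> real"
  assumes I: "is_interval I" and ac: "loc_abs_continuous_on I r" and nz: "\<And>t. t \<in> I \<Longrightarrow> r t \<noteq> 0"
    and st: "s \<in> I" "t \<in> I" "s \<le> t"
  shows "sgn (r s) = sgn (r t)"
proof (rule ccontr)
  assume ne: "sgn (r s) \<noteq> sgn (r t)"
  have cont: "continuous_on {s..t} r" using ac st unfolding loc_abs_continuous_on_def by (intro ac_ivl_continuous) blast
  have "\<exists>z. s \<le> z \<and> z \<le> t \<and> r z = 0"
  proof (cases "r s < 0")
    case True
    then have "r t \<ge> 0" using ne by (cases "r t < 0") (auto simp: sgn_if)
    then show ?thesis using IVT'[of r s 0 t] True st(3) cont by auto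
  next
    case False
    then have "r s > 0" using nz[OF st(1)] by simp
    then have "r t \<le> 0" using ne by (cases "r t > 0") (auto simp: sgn_if)
    then show ?thesis using IVT2'[of r t 0 s] False st(3) cont by auto
  qed
  then obtain z where "s \<le> z" "z \<le> t" "r z = 0" by blast
  then show False using nz mem_is_interval_1_I[OF I st(1,2)] by blast
qed

text \<open>The bounds for the increments of density and momentum carry over to the energy density, since the density keeps
  its sign at each point.\<close>
lemma regular_fluid_energy:
  assumes mc: "m > 0" "c > 0" and I: "is_interval I" and \<rho>: "regular_in_time I \<rho>" and M: "regular_in_time I M"
    and ac: "field_abs_continuous T I \<rho>" and nz: "\<And>t K x. t \<in> I \<Longrightarrow> K \<in> T \<Longrightarrow> x \<in> K \<Longrightarrow> \<rho> t K x \<noteq> 0"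
  shows regular_fluid_energy_ac:
      "loc_abs_continuous_on I (\<lambda>t. mesh_integral T (\<lambda>K x. \<rho> t K x * (fluid_gamma m c (\<rho> t K x) (M t K x) - 1) * c\<^sup>2))"
    and regular_fluid_energy_deriv: "\<And>t d\<rho> dM. t \<in> I \<Longrightarrow> field_has_time_deriv T I \<rho> t d\<rho> \<Longrightarrow> field_has_time_deriv T I M t dM \<Longrightarrow>
      ((\<lambda>t. mesh_integral T (\<lambda>K x. \<rho> t K x * (fluid_gamma m c (\<rho> t K x) (M t K x) - 1) * c\<^sup>2)) has_vector_derivative
        mesh_integral T (\<lambda>K x. c\<^sup>2 * (potential_arg m c (\<rho> t) (M t) K x * d\<rho> K x) + velocity_arg m c (\<rho> t) (M t) K x \<bullet> dM K x)) (at t within I)"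
    and continuous_gamma: "\<And>t K. t \<in> I \<Longrightarrow> K \<in> T \<Longrightarrow> continuous_on K (\<lambda>x. fluid_gamma m c (\<rho> t K x) (M t K x))"
proof -
  show cg: "continuous_on K (\<lambda>x. fluid_gamma m c (\<rho> t K x) (M t K x))" if t: "t \<in> I" and K: "K \<in> T" for t K
  proof -
    have "continuous_on K (\<lambda>x. (m / \<rho> t K x) *\<^sub>R M t K x)"
      using regular_in_timeD(2)[OF \<rho> t K] regular_in_timeD(2)[OF M t K] nz[OF t K] by (intro continuous_intros) auto
    from continuous_on_inner[OF this this]
    have "continuous_on K (\<lambda>x. 1 + ((m / \<rho> t K x) *\<^sub>R M t K x) \<bullet> ((m / \<rho> t K x) *\<^sub>R M t K x) / (m\<^sup>2 * c\<^sup>2))"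
      using mc by (intro continuous_on_add[OF continuous_on_const] continuous_on_divide[OF _ continuous_on_const]) simp_all
    from continuous_on_real_sqrt[OF this] show ?thesis unfolding lorentz_def .
  qed
  let ?h = "\<lambda>t K x. \<rho> t K x * (fluid_gamma m c (\<rho> t K x) (M t K x) - 1) * c\<^sup>2"
  have c: "continuous_on K (?h t K)" if "t \<in> I" "K \<in> T" for t K
    using regular_in_timeD(2)[OF \<rho> that] cg[OF that] by (intro continuous_intros)
  have sg: "sgn (\<rho> s K x) = sgn (\<rho> t K x)" if "s \<in> I" "t \<in> I" "K \<in> T" "x \<in> K" for s t K x
  proof -
    have a: "loc_abs_continuous_on I (\<lambda>t. \<rho> t K x)" using ac that(3,4) unfolding field_abs_continuous_def by blast
    have "sgn (\<rho> s K x) = sgn (\<rho> t K x)" if "s \<le> t" by (rule sgn_constant[OF I a nz[OF _ \<open>K \<in> T\<close> \<open>x \<in> K\<close>] \<open>s \<in> I\<close> \<open>t \<in> I\<close> that])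
    moreover have "sgn (\<rho> t K x) = sgn (\<rho> s K x)" if "t \<le> s" by (rule sgn_constant[OF I a nz[OF _ \<open>K \<in> T\<close> \<open>x \<in> K\<close>] \<open>t \<in> I\<close> \<open>s \<in> I\<close> that])
    ultimately show ?thesis by (metis linear)
  qed
  have lip: "\<bar>?h t K x - ?h s K x\<bar> \<le> c\<^sup>2 * (2 * norm (\<rho> t K x - \<rho> s K x) + 1 / c * norm (M t K x - M s K x))"
    if "s \<in> I" "t \<in> I" "K \<in> T" "x \<in> K" for s t K x
    using energy_density_lipschitz[OF mc nz[OF that(2,3,4)] nz[OF that(1,3,4)] sg[OF that(2,1,3,4)]] by simp
  obtain d where d: "loc_modulus I d" "\<And>s t K x. s \<in> I \<Longrightarrow> t \<in> I \<Longrightarrow> K \<in> T \<Longrightarrow> x \<in> K \<Longrightarrow> norm (\<rho> t K x - \<rho> s K x) \<le> d s t"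
    using regular_in_timeD(1)[OF \<rho>] by blast
  obtain d' where d': "loc_modulus I d'" "\<And>s t K x. s \<in> I \<Longrightarrow> t \<in> I \<Longrightarrow> K \<in> T \<Longrightarrow> x \<in> K \<Longrightarrow> norm (M t K x - M s K x) \<le> d' s t"
    using regular_in_timeD(1)[OF M] by blast
  have c0: "0 \<le> 1 / c" using mc by simp
  show "loc_abs_continuous_on I (\<lambda>t. mesh_integral T (?h t))"
  proof (rule loc_ac_mesh_integral[OF I loc_modulus_add[OF loc_modulus_scale[OF d(1), of 2] loc_modulus_scale[OF d'(1) c0]] c])
    show "(0::real) \<le> 2" by simp
    fix a b assume ab: "a \<in> I" "b \<in> I" "a \<le> b"
    show "\<exists>C. \<forall>s t. a \<le> s \<longrightarrow> s \<le> t \<longrightarrow> t \<le> b \<longrightarrow> (\<forall>K\<in>T. \<forall>x\<in>K. \<bar>?h t K x - ?h s K x\<bar> \<le> C * (2 * d s t + 1 / c * d' s t))"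
    proof (intro exI[of _ "c\<^sup>2"] allI impI ballI)
      fix s t K x assume st: "a \<le> s" "s \<le> t" "t \<le> b" and K: "K \<in> T" "x \<in> K"
      have sI: "s \<in> I" "t \<in> I" using st by (auto intro!: mem_is_interval_1_I[OF I ab(1,2)])
      have "c\<^sup>2 * (2 * norm (\<rho> t K x - \<rho> s K x) + 1 / c * norm (M t K x - M s K x)) \<le> c\<^sup>2 * (2 * d s t + 1 / c * d' s t)"
        by (intro mult_left_mono add_mono d(2) d'(2) sI K c0) auto
      then show "\<bar>?h t K x - ?h s K x\<bar> \<le> c\<^sup>2 * (2 * d s t + 1 / c * d' s t)" using lip[OF sI K] by (rule order_trans[rotated])
    qed
  qed
  fix t d\<rho> dM assume t: "t \<in> I" and d\<rho>: "field_has_time_deriv T I \<rho> t d\<rho>" and dM: "field_has_time_deriv T I M t dM"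
  obtain B where B: "\<forall>\<^sub>F s in at t within I. \<forall>K\<in>T. \<forall>x\<in>K. norm (\<rho> s K x - \<rho> t K x) \<le> B * \<bar>s - t\<bar>"
    using regular_in_timeD(4)[OF \<rho> t d\<rho>] by blast
  obtain B' where B': "\<forall>\<^sub>F s in at t within I. \<forall>K\<in>T. \<forall>x\<in>K. norm (M s K x - M t K x) \<le> B' * \<bar>s - t\<bar>"
    using regular_in_timeD(4)[OF M t dM] by blast
  have sI: "\<forall>\<^sub>F s in at t within I. s \<in> I" by (simp add: eventually_at_filter)
  show "((\<lambda>t. mesh_integral T (?h t)) has_vector_derivative
        mesh_integral T (\<lambda>K x. c\<^sup>2 * (potential_arg m c (\<rho> t) (M t) K x * d\<rho> K x) + velocity_arg m c (\<rho> t) (M t) K x \<bullet> dM K x)) (at t within I)"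
  proof (rule has_vector_derivative_mesh_integral[OF t c, where B = "c\<^sup>2 * (2 * B + 1 / c * B')"])
    fix K x assume K: "K \<in> T" "x \<in> K"
    have "((\<lambda>s. \<rho> s K x) has_vector_derivative d\<rho> K x) (at t within I)" "((\<lambda>s. M s K x) has_vector_derivative dM K x) (at t within I)"
      using d\<rho> dM K unfolding field_has_time_deriv_def by blast+
    from energy_density_derivative[OF mc t nz[OF _ K] this]
    show "((\<lambda>s. ?h s K x) has_vector_derivative c\<^sup>2 * (potential_arg m c (\<rho> t) (M t) K x * d\<rho> K x) + velocity_arg m c (\<rho> t) (M t) K x \<bullet> dM K x) (at t within I)"
      unfolding potential_arg_def velocity_arg_def .
  next
    show "\<forall>\<^sub>F s in at t within I. \<forall>K\<in>T. \<forall>x\<in>K. \<bar>?h s K x - ?h t K x\<bar> \<le> c\<^sup>2 * (2 * B + 1 / c * B') * \<bar>s - t\<bar>"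
      using B B' sI
    proof eventually_elim
      case (elim s)
      show ?case
      proof (intro ballI)
        fix K x assume K: "K \<in> T" "x \<in> K"
        have b: "norm (\<rho> s K x - \<rho> t K x) \<le> B * \<bar>s - t\<bar>" "norm (M s K x - M t K x) \<le> B' * \<bar>s - t\<bar>" using elim K by blast+
        have "c\<^sup>2 * (2 * norm (\<rho> s K x - \<rho> t K x) + 1 / c * norm (M s K x - M t K x)) \<le> c\<^sup>2 * (2 * (B * \<bar>s - t\<bar>) + 1 / c * (B' * \<bar>s - t\<bar>))"
          by (intro mult_left_mono add_mono b c0) auto
        also have "\<dots> = c\<^sup>2 * (2 * B + 1 / c * B') * \<bar>s - t\<bar>" by (simp add: algebra_simps)
        finally show "\<bar>?h s K x - ?h t K x\<bar> \<le> c\<^sup>2 * (2 * B + 1 / c * B') * \<bar>s - t\<bar>"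
          using lip[OF t elim(3) K] by (rule order_trans[rotated])
      qed
    qed
  qed
qed

end

section \<open>Fluxes and time-dependent fields in the discrete spaces\<close>

lemma constant_onD: "f constant_on A \<Longrightarrow> x \<in> A \<Longrightarrow> y \<in> A \<Longrightarrow> f x = f y"
  by (auto simp: constant_on_def)

lemma constant_on_cong: "f constant_on A \<Longrightarrow> (\<And>x. x \<in> A \<Longrightarrow> g x = f x) \<Longrightarrow> g constant_on A"
  by (auto simp: constant_on_def)

lemma grad_const: "grad (\<lambda>x. c) = (\<lambda>x. 0)"
  by (simp add: grad_def fun_eq_iff vec_eq_iff)

lemma face_flux_zero:
  assumes "\<And>K1 K2 x. (K1, K2) \<in> F \<Longrightarrow> x \<in> K1 \<inter> K2 \<Longrightarrow> j (face_normal K1 K2) K1 K2 x = 0"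
  shows "face_flux M F a j = 0"
proof -
  have "face_integral (K1 \<inter> K2) (\<lambda>x. upwind (M K1 x) (face_normal K1 K2) (a (face_normal K1 K2) K1 x) (a (face_normal K1 K2) K2 x) \<bullet> j (face_normal K1 K2) K1 K2 x) = 0"
    if "(K1, K2) \<in> F" for K1 K2
    unfolding face_integral_def Let_def
    by (rule integral_eq_zero_AE) (intro AE_I2, simp add: assms[OF that])
  then show ?thesis unfolding face_flux_def Let_def by (intro sum.neutral) auto
qed

lemma face_flux_scale: "face_flux M F a (\<lambda>n K1 K2 x. r *\<^sub>R j n K1 K2 x) = r * face_flux M F a j"
  unfolding face_flux_def face_integral_def Let_def
  by (simp add: sum_distrib_left case_prod_unfold)

context mesh
begin

text \<open>The space \<open>V\<close> need not be the one in which the solution is sought: where only regularity in time matters, it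
  may be the space of all piecewise polynomials.\<close>
lemma polynomial_field_regular:
  fixes V :: "(cell \<Rightarrow> real^3 \<Rightarrow> real^3) set"
  assumes I: "is_interval I"
    and poly: "\<And>f K i. f \<in> V \<Longrightarrow> K \<in> T \<Longrightarrow> (\<lambda>x. f K x $ i) \<in> P_poly d"
    and closed: "\<And>f g c. f \<in> V \<Longrightarrow> g \<in> V \<Longrightarrow> (\<lambda>K x. f K x + c *\<^sub>R g K x) \<in> V"
    and fV: "\<And>t. t \<in> I \<Longrightarrow> f t \<in> V" and ac: "field_abs_continuous T I f"
  shows polynomial_field_regular_in_time: "regular_in_time I f"
    and polynomial_field_derivative: "\<And>t df. t \<in> I \<Longrightarrow> at t within I \<noteq> bot \<Longrightarrow> field_has_time_deriv T I f t df \<Longrightarrow>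
      \<exists>g\<in>V. \<forall>K\<in>T. \<forall>x\<in>K. df K x = g K x"
proof -
  have p: "(\<lambda>x. f K x \<bullet> b) \<in> P_poly d" if "f \<in> V" "K \<in> T" "b \<in> Basis" for f K b
    using poly[OF that(1,2)] real3_Basis[OF that(3)] by (auto simp: inner_axis)
  have sm: "smooth (f K)" if "f \<in> V" "K \<in> T" for f K
    by (intro smooth_componentwise smooth_P_poly[of _ d] poly that)
  show "regular_in_time I f"
    unfolding regular_in_time_def
  proof (intro conjI ballI allI impI)
    show "\<exists>d. loc_modulus I d \<and> (\<forall>s\<in>I. \<forall>t\<in>I. \<forall>K\<in>T. \<forall>x\<in>K. norm (f t K x - f s K x) \<le> d s t)"
      by (rule field_modulus[where V = V and k = d, OF I], erule (2) p, erule (1) sm, erule (1) closed, erule fV, rule ac)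
    show "continuous_on K (f t K)" if "t \<in> I" "K \<in> T" for t K by (rule smooth_continuous[OF sm[OF fV that(2)]]) (rule that)
    show "\<exists>P. \<forall>t\<in>{a..b}. \<forall>K\<in>T. \<forall>x\<in>K. norm (f t K x) \<le> P" if "a \<in> I" "b \<in> I" for a b
      by (rule field_locally_bounded[where V = V and k = d, OF I _ _ _ _ _ that], erule (2) p, erule (1) sm, erule (1) closed, erule fV, rule ac)
    show "\<exists>B. \<forall>\<^sub>F s in at t within I. \<forall>K\<in>T. \<forall>x\<in>K. norm (f s K x - f t K x) \<le> B * \<bar>s - t\<bar>"
      if "t \<in> I" "field_has_time_deriv T I f t df" for t df
      by (rule field_difference_bound[where V = V and k = d, OF I _ _ _ _ _ that], erule (2) p, erule (1) sm, erule (1) closed, erule fV, rule ac)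
  qed
  show "\<exists>g\<in>V. \<forall>K\<in>T. \<forall>x\<in>K. df K x = g K x"
    if "t \<in> I" "at t within I \<noteq> bot" "field_has_time_deriv T I f t df" for t df
    by (rule field_derivative_in_space[where V = V and k = d, OF I _ _ _ _ _ that], erule (2) p, erule (1) sm, erule (1) closed, erule fV, rule ac)
qed

lemma DG_field_regular:
  assumes I: "is_interval I"
    and fV: "\<And>t. t \<in> I \<Longrightarrow> f t \<in> DG_space \<Omega> T k" and ac: "field_abs_continuous T I f"
  shows DG_field_regular_in_time: "regular_in_time I f"
    and DG_field_derivative: "\<And>t df. t \<in> I \<Longrightarrow> at t within I \<noteq> bot \<Longrightarrow> field_has_time_deriv T I f t df \<Longrightarrow>
      \<exists>g\<in>DG_space \<Omega> T k. \<forall>K\<in>T. \<forall>x\<in>K. df K x = g K x"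
proof -
  have p: "(\<lambda>x. f K x \<bullet> b) \<in> P_poly k" if "f \<in> DG_space \<Omega> T k" "K \<in> T" "b \<in> Basis" for f K b
    using that by (simp add: DG_space_iff)
  have sm: "smooth (f K)" if "f \<in> DG_space \<Omega> T k" "K \<in> T" for f K
    using that by (auto simp: DG_space_iff intro: smooth_P_poly)
  have closed: "(\<lambda>K x. f K x + c *\<^sub>R g K x) \<in> DG_space \<Omega> T k" if "f \<in> DG_space \<Omega> T k" "g \<in> DG_space \<Omega> T k" for f g c
    using that by (simp add: DG_space_iff P_poly_add P_poly_scale)
  show "regular_in_time I f"
    unfolding regular_in_time_def
  proof (intro conjI ballI allI impI)
    show "\<exists>d. loc_modulus I d \<and> (\<forall>s\<in>I. \<forall>t\<in>I. \<forall>K\<in>T. \<forall>x\<in>K. norm (f t K x - f s K x) \<le> d s t)"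
      by (rule field_modulus[where V = "DG_space \<Omega> T k" and k = k, OF I], erule (2) p, erule (1) sm, erule (1) closed, erule fV, rule ac)
    show "continuous_on K (f t K)" if "t \<in> I" "K \<in> T" for t K by (rule smooth_continuous[OF sm[OF fV that(2)]]) (rule that)
    show "\<exists>P. \<forall>t\<in>{a..b}. \<forall>K\<in>T. \<forall>x\<in>K. norm (f t K x) \<le> P" if "a \<in> I" "b \<in> I" for a b
      by (rule field_locally_bounded[where V = "DG_space \<Omega> T k" and k = k, OF I _ _ _ _ _ that], erule (2) p, erule (1) sm, erule (1) closed, erule fV, rule ac)
    show "\<exists>B. \<forall>\<^sub>F s in at t within I. \<forall>K\<in>T. \<forall>x\<in>K. norm (f s K x - f t K x) \<le> B * \<bar>s - t\<bar>"
      if "t \<in> I" "field_has_time_deriv T I f t df" for t df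
      by (rule field_difference_bound[where V = "DG_space \<Omega> T k" and k = k, OF I _ _ _ _ _ that], erule (2) p, erule (1) sm, erule (1) closed, erule fV, rule ac)
  qed
  show "\<exists>g\<in>DG_space \<Omega> T k. \<forall>K\<in>T. \<forall>x\<in>K. df K x = g K x"
    if "t \<in> I" "at t within I \<noteq> bot" "field_has_time_deriv T I f t df" for t df
    by (rule field_derivative_in_space[where V = "DG_space \<Omega> T k" and k = k, OF I _ _ _ _ _ that], erule (2) p, erule (1) sm, erule (1) closed, erule fV, rule ac)
qed

end

section \<open>Conservation laws of the scheme\<close>

text \<open>The last assumption excludes a one-point interval, on which every number is a time derivative.\<close>
locale scheme_solution = mesh \<Omega> T for \<Omega> T +
  fixes c m q :: real and N k :: nat and wt :: "nat \<Rightarrow> real" and F :: "(cell \<times> cell) set"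
    and loc :: "real^3 \<Rightarrow> cell" and I :: "real set"
    and \<rho> :: "real \<Rightarrow> cell \<Rightarrow> real^3 \<Rightarrow> real"
    and M E B :: "real \<Rightarrow> cell \<Rightarrow> real^3 \<Rightarrow> real^3"
    and X U :: "nat \<Rightarrow> real \<Rightarrow> real^3"
  assumes c: "c > 0" and m: "m > 0"
    and faces: "oriented_interior_faces T F"
    and loc: "cell_selection T loc"
    and I: "is_interval I"
    and solution: "scheme_F_solution c m q N wt \<Omega> T F k loc I \<rho> M E B X U"
    and accumulation: "\<And>t. t \<in> I \<Longrightarrow> at t within I \<noteq> bot"
begin

text \<open>The equations of the scheme at a single time.\<close>
definition step where
  "step t w G d\<rho> dM dE dB \<longleftrightarrow>
     is_L2_projection T (RT_space \<Omega> T k) (velocity_arg m c (\<rho> t) (M t)) w \<and>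
     is_L2_projection T (DG_space \<Omega> T (k + 1)) (potential_arg m c (\<rho> t) (M t)) G \<and>
     field_has_time_deriv T I \<rho> t d\<rho> \<and> field_has_time_deriv T I M t dM \<and>
     field_has_time_deriv T I E t dE \<and> field_has_time_deriv T I B t dB \<and>
     density_eq \<Omega> T F k (\<rho> t) (M t) w d\<rho> \<and>
     momentum_eq c m q \<Omega> T F k (\<rho> t) (M t) (E t) (B t) w G dM \<and>
     ampere_eq c m q N wt \<Omega> T k loc (\<rho> t) (B t) w dE (\<lambda>p. X p t) (\<lambda>p. U p t) \<and>
     faraday_eq c \<Omega> T k (E t) dB \<and>
     (\<forall>p\<in>{1..N}.
        (X p has_vector_derivative (1 / (m * lorentz m c (U p t))) *\<^sub>R U p t) (at t within I) \<and>
        (U p has_vector_derivative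
           q *\<^sub>R (E t (loc (X p t)) (X p t) +
                 (1 / (c * m * lorentz m c (U p t))) *\<^sub>R cross3 (U p t) (B t (loc (X p t)) (X p t))))
          (at t within I))"

lemma stepD:
  assumes "step t w G d\<rho> dM dE dB"
  shows "is_L2_projection T (RT_space \<Omega> T k) (velocity_arg m c (\<rho> t) (M t)) w"
    and "is_L2_projection T (DG_space \<Omega> T (k + 1)) (potential_arg m c (\<rho> t) (M t)) G"
    and "field_has_time_deriv T I \<rho> t d\<rho>" and "field_has_time_deriv T I M t dM"
    and "field_has_time_deriv T I E t dE" and "field_has_time_deriv T I B t dB"
    and "density_eq \<Omega> T F k (\<rho> t) (M t) w d\<rho>"
    and "momentum_eq c m q \<Omega> T F k (\<rho> t) (M t) (E t) (B t) w G dM"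
    and "ampere_eq c m q N wt \<Omega> T k loc (\<rho> t) (B t) w dE (\<lambda>p. X p t) (\<lambda>p. U p t)"
    and "faraday_eq c \<Omega> T k (E t) dB"
    and "\<forall>p\<in>{1..N}.
        (X p has_vector_derivative (1 / (m * lorentz m c (U p t))) *\<^sub>R U p t) (at t within I) \<and>
        (U p has_vector_derivative
           q *\<^sub>R (E t (loc (X p t)) (X p t) +
                 (1 / (c * m * lorentz m c (U p t))) *\<^sub>R cross3 (U p t) (B t (loc (X p t)) (X p t))))
          (at t within I)"
  by (insert assms, unfold step_def, (elim conjE, assumption)+)

lemma solutionD:
  shows "\<forall>t\<in>I. \<rho> t \<in> DG_space \<Omega> T (k + 1) \<and> M t \<in> RT_space \<Omega> T k \<and>
            E t \<in> N0_space \<Omega> T k \<and> B t \<in> RT0_space \<Omega> T k \<and>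
            (\<forall>K\<in>T. \<forall>x\<in>K. \<rho> t K x \<noteq> 0) \<and> (\<forall>p\<in>{1..N}. X p t \<in> \<Union>T)"
    and \<rho>_ac: "field_abs_continuous T I \<rho>" and M_ac: "field_abs_continuous T I M"
    and E_ac: "field_abs_continuous T I E" and B_ac: "field_abs_continuous T I B"
    and "\<forall>p\<in>{1..N}. loc_abs_continuous_on I (X p) \<and> loc_abs_continuous_on I (U p)"
    and ae_step: "AE t in lebesgue_on I. \<exists>w G d\<rho> dM dE dB. step t w G d\<rho> dM dE dB"
  by (insert solution, unfold scheme_F_solution_def step_def, (elim conjE, assumption)+)

lemma in_spaces:
  assumes "t \<in> I"
  shows \<rho>_DG: "\<rho> t \<in> DG_space \<Omega> T (k + 1)" and M_RT: "M t \<in> RT_space \<Omega> T k"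
    and E_N0: "E t \<in> N0_space \<Omega> T k" and B_RT0: "B t \<in> RT0_space \<Omega> T k"
    and \<rho>_nonzero': "\<forall>K\<in>T. \<forall>x\<in>K. \<rho> t K x \<noteq> 0" and X_in_mesh': "\<forall>p\<in>{1..N}. X p t \<in> \<Union>T"
  by (insert bspec[OF solutionD(1) assms], (elim conjE, assumption)+)

lemma \<rho>_nonzero: "t \<in> I \<Longrightarrow> K \<in> T \<Longrightarrow> x \<in> K \<Longrightarrow> \<rho> t K x \<noteq> 0"
  by (rule bspec[OF bspec[OF \<rho>_nonzero']])

lemma X_in_mesh: "t \<in> I \<Longrightarrow> p \<in> {1..N} \<Longrightarrow> X p t \<in> \<Union>T"
  by (rule bspec[OF X_in_mesh'])

lemma E_N: "t \<in> I \<Longrightarrow> E t \<in> N_space \<Omega> T k" and B_RT: "t \<in> I \<Longrightarrow> B t \<in> RT_space \<Omega> T k"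
  using E_N0[of t] B_RT0[of t] by (simp_all add: N0_space_def RT0_space_def)

lemma X_ac: "p \<in> {1..N} \<Longrightarrow> loc_abs_continuous_on I (X p)"
  and U_ac: "p \<in> {1..N} \<Longrightarrow> loc_abs_continuous_on I (U p)"
  using solutionD(6) by simp_all

lemma smooth_on_cells:
  assumes "t \<in> I" "K \<in> T"
  shows \<rho>_smooth: "smooth (\<rho> t K)" and M_smooth: "smooth (M t K)"
    and E_smooth: "smooth (E t K)" and B_smooth: "smooth (B t K)"
  using \<rho>_DG[OF assms(1)] assms(2) RT_space_smooth[OF M_RT[OF assms(1)] assms(2)]
    N_space_smooth[OF E_N[OF assms(1)] assms(2)] RT_space_smooth[OF B_RT[OF assms(1)] assms(2)]
  by (auto simp: DG_space_iff intro: smooth_P_poly)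

lemma \<rho>_regular: "regular_in_time I \<rho>"
  by (rule DG_field_regular_in_time[OF I \<rho>_DG \<rho>_ac])

lemma RT_field_regular:
  assumes "\<And>t. t \<in> I \<Longrightarrow> f t \<in> RT_space \<Omega> T k" "field_abs_continuous T I f"
  shows RT_field_regular_in_time: "regular_in_time I f"
    and RT_field_derivative: "\<And>t df. t \<in> I \<Longrightarrow> field_has_time_deriv T I f t df \<Longrightarrow>
      \<exists>g\<in>RT_space \<Omega> T k. \<forall>K\<in>T. \<forall>x\<in>K. df K x = g K x"
proof -
  show "regular_in_time I f"
    by (rule polynomial_field_regular_in_time[where V = "RT_space \<Omega> T k" and d = "k + 1", OF I])
      (erule (1) RT_space_components RT_space_comb | erule assms(1) | rule assms(2))+
  show "\<exists>g\<in>RT_space \<Omega> T k. \<forall>K\<in>T. \<forall>x\<in>K. df K x = g K x" if "t \<in> I" "field_has_time_deriv T I f t df" for t df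
    by (rule polynomial_field_derivative[where V = "RT_space \<Omega> T k" and d = "k + 1", OF I _ _ _ _ that(1) accumulation[OF that(1)] that(2)])
      (erule (1) RT_space_components RT_space_comb | erule assms(1) | rule assms(2))+
qed

lemma M_regular: "regular_in_time I M" and B_regular: "regular_in_time I B"
  by (rule RT_field_regular_in_time, erule M_RT B_RT, rule M_ac B_ac)+

lemma E_regular: "regular_in_time I E"
  using N_space_components[OF E_N]
  by (intro polynomial_field_regular_in_time[OF I, where V = "{f. \<forall>K\<in>T. \<forall>i. (\<lambda>x. f K x $ i) \<in> P_poly (k + 1)}" and d = "k + 1"] E_ac)
    (simp_all add: P_poly_add P_poly_scale)

text \<open>The set \<open>C\<close> makes room for the times at which particles leave a cell.\<close>
lemma conserved:
  assumes ac: "loc_abs_continuous_on I R" and C: "countable C"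
    and deriv: "\<And>t w G d\<rho> dM dE dB. t \<in> I \<Longrightarrow> t \<notin> C \<Longrightarrow> step t w G d\<rho> dM dE dB \<Longrightarrow>
      (R has_vector_derivative (0::real)) (at t within I)"
  shows "R constant_on I"
proof (rule ac_ae_derivative_zero_constant[OF I ac])
  have Im: "I \<in> sets lebesgue" using real_interval_borel_measurable[OF I] by simp
  have "AE t in lebesgue. t \<notin> C"
    by (rule AE_not_in[OF null_sets_completionI[OF countable_imp_null_set_lborel[OF C]]])
  then have "AE t in lebesgue_on I. t \<notin> C" using Im by (simp add: AE_restrict_space_iff, auto)
  moreover have "AE t in lebesgue_on I. \<exists>w G d\<rho> dM dE dB. step t w G d\<rho> dM dE dB"
    by (rule ae_step)
  moreover have "AE t in lebesgue_on I. t \<in> I" by (rule AE_I2) simp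
  ultimately show "AE t in lebesgue_on I. (R has_vector_derivative 0) (at t within I)"
    by eventually_elim (use deriv in blast)
qed

lemma mesh_continuous:
  assumes "t \<in> I" "K \<in> T"
  shows "continuous_on K (\<rho> t K)" "continuous_on K (M t K)" "continuous_on K (E t K)" "continuous_on K (B t K)"
  using smooth_on_cells[OF assms] by (auto intro: smooth_continuous)

subsection \<open>Fluid mass\<close>

theorem fluid_mass: "(\<lambda>t. mesh_integral T (\<rho> t)) constant_on I"
proof (rule conserved[where C = "{}"])
  have g: "continuous_on K (\<lambda>x. 1 :: real)" for K :: cell by simp
  show "loc_abs_continuous_on I (\<lambda>t. mesh_integral T (\<rho> t))"
    using regular_linear_ac[OF I \<rho>_regular, of "\<lambda>K x. 1"] by simp
  fix t w G d\<rho> dM dE dB assume t: "t \<in> I" and s: "step t w G d\<rho> dM dE dB"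
  have "(\<lambda>K x. 1) \<in> DG_space \<Omega> T (k + 1)" by (simp add: DG_space_iff P_poly_const)
  then have "mesh_integral T (\<lambda>K x. d\<rho> K x * 1) = mesh_integral T (\<lambda>K x. \<rho> t K x *\<^sub>R w K x \<bullet> grad (\<lambda>x. 1) x)
      - face_flux (M t) F (\<lambda>n K x. \<rho> t K x *\<^sub>R w K x) (\<lambda>n K1 K2 x. scalar_jump n 1 1)"
    using stepD(7)[OF s] unfolding density_eq_def by (rule bspec[rotated])
  also have "\<dots> = 0" by (simp add: grad_const mesh_integral_zero face_flux_zero scalar_jump_def)
  finally have "mesh_integral T (\<lambda>K x. d\<rho> K x \<bullet> 1) = 0" by simp
  moreover have "field_has_time_deriv T I \<rho> t d\<rho>" by (rule stepD(3)[OF s])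
  ultimately show "((\<lambda>t. mesh_integral T (\<rho> t)) has_vector_derivative 0) (at t within I)"
    using regular_linear_deriv[OF I \<rho>_regular g t, of d\<rho>] by simp
qed simp

subsection \<open>Weak Gauss law\<close>

text \<open>The residual is first freed from the weak divergence, which leaves integrals against the fixed fields
  \<open>grad \<phi>\<close> and \<open>\<phi>\<close> and the values of \<open>\<phi>\<close> at the particles.\<close>
theorem gauss_law:
  assumes \<phi>: "\<phi> \<in> Q0_space \<Omega> T (k + 1)"
  shows "(\<lambda>t. gauss_residual m q N wt \<Omega> T k loc (\<rho> t) (E t) (\<lambda>p. X p t) \<phi>) constant_on I"
proof -
  let ?part = "\<lambda>p t. \<phi> (loc (X p t)) (X p t)"
  let ?R = "\<lambda>t. - 1 * mesh_integral T (\<lambda>K x. E t K x \<bullet> grad (\<phi> K) x)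
     + (- (4 * pi * q / m)) * mesh_integral T (\<lambda>K x. \<rho> t K x \<bullet> \<phi> K x)
     + (- (4 * pi * q)) * (\<Sum>p\<in>{1..N}. wt p * ?part p t)"
  have sm: "smooth (\<phi> K)" if "K \<in> T" for K using Q0_smooth[OF \<phi> that] .
  have cg: "continuous_on K (grad (\<phi> K))" if "K \<in> T" for K using sm[OF that] by (intro smooth_continuous smooth_grad)
  have cf: "continuous_on K (\<phi> K)" if "K \<in> T" for K using sm[OF that] by (rule smooth_continuous)
  have DG: "\<phi> \<in> DG_space \<Omega> T (k + 1)" using \<phi> by (simp add: Q0_space_def Q_space_def DG_space_iff)
  have N0: "(\<lambda>K. grad (\<phi> K)) \<in> N0_space \<Omega> T k" by (rule grad_Q0_in_N0[OF \<phi>])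
  have res: "gauss_residual m q N wt \<Omega> T k loc (\<rho> t) (E t) (\<lambda>p. X p t) \<phi> = ?R t" if t: "t \<in> I" for t
  proof -
    have W: "weak_div \<Omega> T k (E t) \<in> Q0_space \<Omega> T (k + 1)"
      "mesh_integral T (\<lambda>K x. weak_div \<Omega> T k (E t) K x * \<phi> K x) = - mesh_integral T (\<lambda>K x. E t K x \<bullet> grad (\<phi> K) x)"
      using weak_div_defining[where E = "E t" and k = k, OF E_smooth[OF t]] \<phi> by blast+
    have cw: "continuous_on K (weak_div \<Omega> T k (E t) K)" if "K \<in> T" for K using Q0_smooth[OF W(1) that] by (rule smooth_continuous)
    have "mesh_integral T (\<lambda>K x. (weak_div \<Omega> T k (E t) K x - 4 * pi * q * (\<rho> t K x / m)) * \<phi> K x)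
      = mesh_integral T (\<lambda>K x. weak_div \<Omega> T k (E t) K x * \<phi> K x - (4 * pi * q / m) * (\<rho> t K x * \<phi> K x))"
      by (rule mesh_integral_cong) (simp add: algebra_simps)
    also have "\<dots> = mesh_integral T (\<lambda>K x. weak_div \<Omega> T k (E t) K x * \<phi> K x) - mesh_integral T (\<lambda>K x. (4 * pi * q / m) * (\<rho> t K x * \<phi> K x))"
      by (rule mesh_integral_diff; intro continuous_on_const continuous_on_mult cw cf mesh_continuous(1)[OF t])
    finally show ?thesis unfolding gauss_residual_def W(2) mesh_integral_scale by simp
  qed
  have lin_E: "loc_abs_continuous_on I (\<lambda>t. mesh_integral T (\<lambda>K x. E t K x \<bullet> grad (\<phi> K) x))"
    by (rule regular_linear_ac[OF I E_regular cg])
  have lin_\<rho>: "loc_abs_continuous_on I (\<lambda>t. mesh_integral T (\<lambda>K x. \<rho> t K x \<bullet> \<phi> K x))"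
    by (rule regular_linear_ac[OF I \<rho>_regular cf])
  obtain L where L: "L \<ge> 0" "\<And>K K' x y. K \<in> T \<Longrightarrow> x \<in> K \<Longrightarrow> K' \<in> T \<Longrightarrow> y \<in> K' \<Longrightarrow> \<bar>\<phi> K x - \<phi> K' y\<bar> \<le> L * norm (x - y)"
    using Q0_lipschitz[OF \<phi>] by blast
  have at_particle: "loc (X p t) \<in> T" "X p t \<in> loc (X p t)" if "p \<in> {1..N}" "t \<in> I" for p t
    using loc X_in_mesh[OF that(2,1)] unfolding cell_selection_def by blast+
  have part_ac: "loc_abs_continuous_on I (?part p)" if p: "p \<in> {1..N}" for p
  proof (rule loc_ac_lipschitz[OF X_ac[OF p] _ I])
    fix s t assume "s \<in> I" "t \<in> I"
    then show "norm (?part p t - ?part p s) \<le> L * norm (X p t - X p s)"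
      using L(2)[OF at_particle[OF p] at_particle[OF p]] by simp
  qed
  have "?R constant_on I"
  proof (rule conserved[where C = "\<Union>p\<in>{1..N}. \<Union>K\<in>T. right_isolated {s \<in> I. X p s \<in> K}"])
    show "loc_abs_continuous_on I ?R"
      by (intro loc_ac_add loc_ac_scale loc_ac_sum lin_E lin_\<rho> part_ac)
    show "countable (\<Union>p\<in>{1..N}. \<Union>K\<in>T. right_isolated {s \<in> I. X p s \<in> K})"
      by (intro countable_UN countable_right_isolated countable_finite finite_cells finite_atLeastAtMost)
    fix t w G d\<rho> dM dE dB
    assume t: "t \<in> I" and acc: "t \<notin> (\<Union>p\<in>{1..N}. \<Union>K\<in>T. right_isolated {s \<in> I. X p s \<in> K})"
      and s: "step t w G d\<rho> dM dE dB"
    let ?V = "\<lambda>p. (1 / (m * lorentz m c (U p t))) *\<^sub>R U p t"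
    let ?g = "\<lambda>p. grad (\<phi> (loc (X p t))) (X p t)"
    have dE: "((\<lambda>t. mesh_integral T (\<lambda>K x. E t K x \<bullet> grad (\<phi> K) x)) has_vector_derivative mesh_integral T (\<lambda>K x. dE K x \<bullet> grad (\<phi> K) x)) (at t within I)"
      by (rule regular_linear_deriv[OF I E_regular cg t stepD(5)[OF s]])
    have d\<rho>: "((\<lambda>t. mesh_integral T (\<lambda>K x. \<rho> t K x \<bullet> \<phi> K x)) has_vector_derivative mesh_integral T (\<lambda>K x. d\<rho> K x \<bullet> \<phi> K x)) (at t within I)"
      by (rule regular_linear_deriv[OF I \<rho>_regular cf t stepD(3)[OF s]])
    have dX: "(?part p has_vector_derivative ?g p \<bullet> ?V p) (at t within I)" if p: "p \<in> {1..N}" for p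
    proof (rule particle_derivative[OF \<phi> loc X_in_mesh[OF _ p] t])
      show "(X p has_vector_derivative ?V p) (at t within I)" using stepD(11)[OF s] p by blast
      show "t \<notin> right_isolated {s \<in> I. X p s \<in> K}" if "K \<in> T" for K using acc p that by blast
    qed
    have "(?R has_vector_derivative
        - 1 * mesh_integral T (\<lambda>K x. dE K x \<bullet> grad (\<phi> K) x) + (- (4 * pi * q / m)) * mesh_integral T (\<lambda>K x. d\<rho> K x \<bullet> \<phi> K x)
        + (- (4 * pi * q)) * (\<Sum>p\<in>{1..N}. wt p * (?g p \<bullet> ?V p))) (at t within I)"
      by (intro has_vector_derivative_add has_vector_derivative_mult_right has_vector_derivative_sum dE d\<rho> dX)
    moreover have "mesh_integral T (\<lambda>K x. d\<rho> K x \<bullet> \<phi> K x) = mesh_integral T (\<lambda>K x. \<rho> t K x *\<^sub>R w K x \<bullet> grad (\<phi> K) x)"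
    proof -
      have "face_flux (M t) F (\<lambda>n K x. \<rho> t K x *\<^sub>R w K x) (\<lambda>n K1 K2 x. scalar_jump n (\<phi> K1 x) (\<phi> K2 x)) = 0"
      proof (rule face_flux_zero)
        fix K1 K2 x assume "(K1, K2) \<in> F" "x \<in> K1 \<inter> K2"
        then have "\<phi> K1 x = \<phi> K2 x" using faces unfolding oriented_interior_faces_def by (intro Q0_continuous[OF \<phi>]) auto
        then show "scalar_jump (face_normal K1 K2) (\<phi> K1 x) (\<phi> K2 x) = 0" by (simp add: scalar_jump_def)
      qed
      then show ?thesis using bspec[OF stepD(7)[OF s, unfolded density_eq_def] DG] by simp
    qed
    moreover have "mesh_integral T (\<lambda>K x. dE K x \<bullet> grad (\<phi> K) x)
      = - (4 * pi * q / m) * mesh_integral T (\<lambda>K x. \<rho> t K x *\<^sub>R w K x \<bullet> grad (\<phi> K) x)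
        - 4 * pi * q / m * (\<Sum>p\<in>{1..N}. (wt p / lorentz m c (U p t)) *\<^sub>R U p t \<bullet> ?g p)"
    proof -
      from bspec[OF stepD(9)[OF s, unfolded ampere_eq_def] N0]
      have "mesh_integral T (\<lambda>K x. dE K x \<bullet> grad (\<phi> K) x) = c * mesh_integral T (\<lambda>K x. B t K x \<bullet> curl (grad (\<phi> K)) x)
        - 4 * pi * q / m * mesh_integral T (\<lambda>K x. \<rho> t K x *\<^sub>R w K x \<bullet> grad (\<phi> K) x)
        - 4 * pi * q / m * (\<Sum>p\<in>{1..N}. (wt p / lorentz m c (U p t)) *\<^sub>R U p t \<bullet> ?g p)" .
      moreover have "mesh_integral T (\<lambda>K x. B t K x \<bullet> curl (grad (\<phi> K)) x) = mesh_integral T (\<lambda>K x. 0)"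
        by (rule mesh_integral_cong) (simp add: curl_grad sm)
      ultimately show ?thesis by (simp add: mesh_integral_zero)
    qed
    moreover have "(\<Sum>p\<in>{1..N}. (wt p / lorentz m c (U p t)) *\<^sub>R U p t \<bullet> ?g p) = m * (\<Sum>p\<in>{1..N}. wt p * (?g p \<bullet> ?V p))"
      unfolding sum_distrib_left using m by (intro sum.cong refl) (simp add: inner_commute)
    ultimately show "(?R has_vector_derivative 0) (at t within I)" using m by (simp add: algebra_simps)
  qed
  from constant_on_cong[OF this res] show ?thesis .
qed

subsection \<open>Energy\<close>

text \<open>The magnetic force is orthogonal to the momentum.\<close>
lemma particle_energy_deriv:
  assumes t: "t \<in> I" and s: "step t w G d\<rho> dM dE dB" and p: "p \<in> {1..N}"
  shows "((\<lambda>t. wt p * (lorentz m c (U p t) - 1) * m * c\<^sup>2) has_vector_derivative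
     q / m * ((wt p / lorentz m c (U p t)) *\<^sub>R U p t \<bullet> E t (loc (X p t)) (X p t))) (at t within I)"
proof -
  let ?\<gamma> = "lorentz m c (U p t)" and ?E = "E t (loc (X p t)) (X p t)"
  let ?U' = "q *\<^sub>R (?E + (1 / (c * m * ?\<gamma>)) *\<^sub>R cross3 (U p t) (B t (loc (X p t)) (X p t)))"
  have \<gamma>: "?\<gamma> \<noteq> 0" using lorentz_ge_1[of m c "U p t"] by simp
  have "(U p has_vector_derivative ?U') (at t within I)" using stepD(11)[OF s] p by blast
  from lorentz_derivative[OF m c this]
  have "((\<lambda>t. wt p * (lorentz m c (U p t) - 1) * m * c\<^sup>2) has_real_derivative
      wt p * ((U p t \<bullet> ?U') / (m\<^sup>2 * c\<^sup>2 * ?\<gamma>) - 0) * m * c\<^sup>2) (at t within I)"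
    by (intro DERIV_cmult_right DERIV_cmult DERIV_diff DERIV_const)
  also have "U p t \<bullet> ?U' = q * (U p t \<bullet> ?E)"
    by (simp add: inner_add_right dot_cross_self)
  also have "wt p * (q * (U p t \<bullet> ?E) / (m\<^sup>2 * c\<^sup>2 * ?\<gamma>) - 0) * m * c\<^sup>2 = q / m * ((wt p / ?\<gamma>) *\<^sub>R U p t \<bullet> ?E)"
    using m c \<gamma> by (simp add: field_simps power2_eq_square)
  finally show ?thesis unfolding has_real_derivative_iff_has_vector_derivative .
qed

text \<open>The two curl terms cancel, and the currents remain.\<close>
lemma field_energy_exchange:
  assumes t: "t \<in> I" and s: "step t w G d\<rho> dM dE dB"
  shows "mesh_integral T (\<lambda>K x. dE K x \<bullet> E t K x) + mesh_integral T (\<lambda>K x. dB K x \<bullet> B t K x)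
    = - (4 * pi * q / m) * (mesh_integral T (\<lambda>K x. \<rho> t K x *\<^sub>R w K x \<bullet> E t K x)
        + (\<Sum>p\<in>{1..N}. (wt p / lorentz m c (U p t)) *\<^sub>R U p t \<bullet> E t (loc (X p t)) (X p t)))"
  using bspec[OF stepD(9)[OF s, unfolded ampere_eq_def] E_N0[OF t]] bspec[OF stepD(10)[OF s, unfolded faraday_eq_def] B_RT0[OF t]]
  by (simp add: distrib_left)

text \<open>The time derivatives are replaced by members of the discrete spaces, against which \<open>potential_arg\<close> and
  \<open>velocity_arg\<close> have the same integrals as their projections \<open>G\<close> and \<open>w\<close>. With these as test functions,
  the volume and face terms of the density equation occur with opposite sign in the momentum
  equation, and its first and fourth terms vanish by antisymmetry.\<close>
lemma fluid_energy_exchange: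
  assumes t: "t \<in> I" and s: "step t w G d\<rho> dM dE dB"
  shows "mesh_integral T (\<lambda>K x. c\<^sup>2 * (potential_arg m c (\<rho> t) (M t) K x * d\<rho> K x) + velocity_arg m c (\<rho> t) (M t) K x \<bullet> dM K x)
    = q / m * mesh_integral T (\<lambda>K x. \<rho> t K x *\<^sub>R w K x \<bullet> E t K x)"
proof -
  let ?pot = "potential_arg m c (\<rho> t) (M t)" and ?vel = "velocity_arg m c (\<rho> t) (M t)"
  have w: "w \<in> RT_space \<Omega> T k" and G: "G \<in> DG_space \<Omega> T (k + 1)"
    using stepD(1,2)[OF s] unfolding is_L2_projection_def by blast+
  obtain g\<rho> where g\<rho>: "g\<rho> \<in> DG_space \<Omega> T (k + 1)" "\<forall>K\<in>T. \<forall>x\<in>K. d\<rho> K x = g\<rho> K x"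
    using DG_field_derivative[OF I \<rho>_DG \<rho>_ac t accumulation[OF t] stepD(3)[OF s]] by blast
  obtain gM where gM: "gM \<in> RT_space \<Omega> T k" "\<forall>K\<in>T. \<forall>x\<in>K. dM K x = gM K x"
    using RT_field_derivative[OF M_RT M_ac t stepD(4)[OF s]] by blast
  have \<gamma>c: "continuous_on K (\<lambda>x. fluid_gamma m c (\<rho> t K x) (M t K x))" if "K \<in> T" for K
    by (rule continuous_gamma[OF m c I \<rho>_regular M_regular \<rho>_ac \<rho>_nonzero t that])
  have \<gamma>0: "fluid_gamma m c r v \<noteq> 0" for r v using lorentz_ge_1[of m c "(m / r) *\<^sub>R v"] by auto
  have MMc: "continuous_on K (\<lambda>x. M t K x \<bullet> M t K x)" if "K \<in> T" for K
    using mesh_continuous(2)[OF t that] by (intro continuous_on_inner)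
  have potc: "continuous_on K (?pot K)" if K: "K \<in> T" for K
    unfolding potential_arg_def using c \<rho>_nonzero[OF t K] \<gamma>0
    by (intro continuous_on_diff continuous_on_divide continuous_on_mult continuous_on_power continuous_on_const \<gamma>c[OF K] MMc[OF K] mesh_continuous(1)[OF t K] ballI) simp
  have velc: "continuous_on K (?vel K)" if K: "K \<in> T" for K
    unfolding velocity_arg_def using \<rho>_nonzero[OF t K] \<gamma>0
    by (intro continuous_on_scaleR continuous_on_divide continuous_on_mult continuous_on_const \<gamma>c[OF K] mesh_continuous(1,2)[OF t K] ballI) simp
  have g\<rho>c: "continuous_on K (g\<rho> K)" if "K \<in> T" for K using g\<rho>(1) that by (auto simp: DG_space_iff intro: smooth_continuous smooth_P_poly)
  have gMc: "continuous_on K (gM K)" if "K \<in> T" for K using RT_space_smooth[OF gM(1) that] by (rule smooth_continuous)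
  have "mesh_integral T (\<lambda>K x. c\<^sup>2 * (?pot K x * d\<rho> K x) + ?vel K x \<bullet> dM K x)
      = mesh_integral T (\<lambda>K x. c\<^sup>2 * (?pot K x * g\<rho> K x) + ?vel K x \<bullet> gM K x)"
    by (rule mesh_integral_cong) (simp add: g\<rho>(2) gM(2))
  also have "\<dots> = mesh_integral T (\<lambda>K x. c\<^sup>2 * (?pot K x * g\<rho> K x)) + mesh_integral T (\<lambda>K x. ?vel K x \<bullet> gM K x)"
    by (rule mesh_integral_add) (auto intro!: continuous_on_mult continuous_on_inner continuous_on_const potc velc g\<rho>c gMc)
  also have "mesh_integral T (\<lambda>K x. ?vel K x \<bullet> gM K x) = mesh_integral T (\<lambda>K x. w K x \<bullet> gM K x)"
    using stepD(1)[OF s] gM(1) unfolding is_L2_projection_def by simp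
  also have "\<dots> = mesh_integral T (\<lambda>K x. dM K x \<bullet> w K x)"
    by (rule mesh_integral_cong) (simp add: gM(2) inner_commute)
  also have "mesh_integral T (\<lambda>K x. c\<^sup>2 * (?pot K x * g\<rho> K x)) = c\<^sup>2 * mesh_integral T (\<lambda>K x. G K x \<bullet> g\<rho> K x)"
    using stepD(2)[OF s] g\<rho>(1) unfolding is_L2_projection_def mesh_integral_scale by simp
  also have "mesh_integral T (\<lambda>K x. G K x \<bullet> g\<rho> K x) = mesh_integral T (\<lambda>K x. d\<rho> K x * G K x)"
    by (rule mesh_integral_cong) (simp add: g\<rho>(2))
  also have "\<dots> = mesh_integral T (\<lambda>K x. \<rho> t K x *\<^sub>R w K x \<bullet> grad (G K) x)
      - face_flux (M t) F (\<lambda>n K x. \<rho> t K x *\<^sub>R w K x) (\<lambda>n K1 K2 x. scalar_jump n (G K1 x) (G K2 x))"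
    by (rule bspec[OF stepD(7)[OF s, unfolded density_eq_def] G])
  also have "mesh_integral T (\<lambda>K x. dM K x \<bullet> w K x) =
       mesh_integral T (\<lambda>K x. (dir_grad (w K) (w K) x - dir_grad (w K) (w K) x) \<bullet> M t K x)
     - mesh_integral T (\<lambda>K x. \<rho> t K x * (w K x \<bullet> grad (G K) x) * c\<^sup>2)
     + q / m * mesh_integral T (\<lambda>K x. \<rho> t K x * ((E t K x + cross3 (w K x) ((1 / c) *\<^sub>R B t K x)) \<bullet> w K x))
     + face_flux (M t) F (\<lambda>n K x. cross3 n (M t K x))
         (\<lambda>n K1 K2 x. vector_jump (cross3 (w K1 x) (w K1 x)) (cross3 (w K2 x) (w K2 x)))
     + face_flux (M t) F (\<lambda>n K x. \<rho> t K x *\<^sub>R w K x) (\<lambda>n K1 K2 x. c\<^sup>2 *\<^sub>R scalar_jump n (G K1 x) (G K2 x))"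
    by (rule bspec[OF stepD(8)[OF s, unfolded momentum_eq_def] w])
  also have "mesh_integral T (\<lambda>K x. \<rho> t K x * (w K x \<bullet> grad (G K) x) * c\<^sup>2) = c\<^sup>2 * mesh_integral T (\<lambda>K x. \<rho> t K x *\<^sub>R w K x \<bullet> grad (G K) x)"
    unfolding mesh_integral_scale[symmetric] by (rule mesh_integral_cong) simp
  also have "mesh_integral T (\<lambda>K x. \<rho> t K x * ((E t K x + cross3 (w K x) ((1 / c) *\<^sub>R B t K x)) \<bullet> w K x)) = mesh_integral T (\<lambda>K x. \<rho> t K x *\<^sub>R w K x \<bullet> E t K x)"
    by (rule mesh_integral_cong) (simp add: inner_add_left dot_cross_self inner_commute[of "w _ _"])
  finally show ?thesis
    by (simp add: mesh_integral_zero face_flux_zero vector_jump_def face_flux_scale right_diff_distrib)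
qed

theorem energy:
  "(\<lambda>t. total_energy c m N wt T (\<rho> t) (M t) (E t) (B t) (\<lambda>p. U p t)) constant_on I"
proof -
  let ?f = "\<lambda>t. mesh_integral T (\<lambda>K x. \<rho> t K x * (fluid_gamma m c (\<rho> t K x) (M t K x) - 1) * c\<^sup>2)"
  let ?p = "\<lambda>p t. wt p * (lorentz m c (U p t) - 1) * m * c\<^sup>2"
  let ?e = "\<lambda>f t. mesh_integral T (\<lambda>K x. (norm (f t K x))\<^sup>2)"
  let ?R = "\<lambda>t. ?f t + (\<Sum>p\<in>{1..N}. ?p p t) + 1 / (8 * pi) * (?e E t + ?e B t)"
  have eq: "total_energy c m N wt T (\<rho> t) (M t) (E t) (B t) (\<lambda>p. U p t) = ?R t" if t: "t \<in> I" for t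
  proof -
    have "mesh_integral T (\<lambda>K x. (norm (E t K x))\<^sup>2 + (norm (B t K x))\<^sup>2) = ?e E t + ?e B t"
      by (rule mesh_integral_add) (auto intro!: continuous_on_power continuous_on_norm mesh_continuous[OF t])
    then show ?thesis unfolding total_energy_def by simp
  qed
  have p_ac: "loc_abs_continuous_on I (?p p)" if p: "p \<in> {1..N}" for p
  proof (rule loc_ac_lipschitz[OF U_ac[OF p] _ I])
    fix s t
    have "?p p t - ?p p s = (wt p * m * c\<^sup>2) * (lorentz m c (U p t) - lorentz m c (U p s))" by (simp add: algebra_simps)
    then have "norm (?p p t - ?p p s) = \<bar>wt p * m * c\<^sup>2\<bar> * \<bar>lorentz m c (U p t) - lorentz m c (U p s)\<bar>" by (simp add: abs_mult)
    also have "\<dots> \<le> \<bar>wt p * m * c\<^sup>2\<bar> * (1 / (m * c) * norm (U p t - U p s))"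
      by (intro mult_left_mono lorentz_lipschitz[OF m c]) simp
    finally show "norm (?p p t - ?p p s) \<le> (\<bar>wt p * m * c\<^sup>2\<bar> * (1 / (m * c))) * norm (U p t - U p s)" by (simp add: mult.assoc)
  qed
  have "?R constant_on I"
  proof (rule conserved[where C = "{}"])
    show "loc_abs_continuous_on I ?R"
      by (intro loc_ac_add loc_ac_sum loc_ac_scale p_ac regular_square_ac[OF I E_regular] regular_square_ac[OF I B_regular]
        regular_fluid_energy_ac[OF m c I \<rho>_regular M_regular \<rho>_ac \<rho>_nonzero])
    fix t w G d\<rho> dM dE dB assume t: "t \<in> I" and s: "step t w G d\<rho> dM dE dB"
    have "(?R has_vector_derivative
        mesh_integral T (\<lambda>K x. c\<^sup>2 * (potential_arg m c (\<rho> t) (M t) K x * d\<rho> K x) + velocity_arg m c (\<rho> t) (M t) K x \<bullet> dM K x)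
        + (\<Sum>p\<in>{1..N}. q / m * ((wt p / lorentz m c (U p t)) *\<^sub>R U p t \<bullet> E t (loc (X p t)) (X p t)))
        + 1 / (8 * pi) * (2 * mesh_integral T (\<lambda>K x. dE K x \<bullet> E t K x) + 2 * mesh_integral T (\<lambda>K x. dB K x \<bullet> B t K x))) (at t within I)"
      by (intro has_vector_derivative_add has_vector_derivative_mult_right has_vector_derivative_sum particle_energy_deriv[OF t s]
          regular_square_deriv[OF I E_regular t stepD(5)[OF s]] regular_square_deriv[OF I B_regular t stepD(6)[OF s]]
          regular_fluid_energy_deriv[OF m c I \<rho>_regular M_regular \<rho>_ac \<rho>_nonzero t stepD(3,4)[OF s]])
    also have "mesh_integral T (\<lambda>K x. c\<^sup>2 * (potential_arg m c (\<rho> t) (M t) K x * d\<rho> K x) + velocity_arg m c (\<rho> t) (M t) K x \<bullet> dM K x)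
        + (\<Sum>p\<in>{1..N}. q / m * ((wt p / lorentz m c (U p t)) *\<^sub>R U p t \<bullet> E t (loc (X p t)) (X p t)))
        + 1 / (8 * pi) * (2 * mesh_integral T (\<lambda>K x. dE K x \<bullet> E t K x) + 2 * mesh_integral T (\<lambda>K x. dB K x \<bullet> B t K x)) = 0"
      unfolding fluid_energy_exchange[OF t s] sum_distrib_left[symmetric] distrib_left[of 2, symmetric] field_energy_exchange[OF t s]
      using m by (simp add: field_simps)
    finally show "(?R has_vector_derivative 0) (at t within I)" .
  qed simp
  from constant_on_cong[OF this eq] show ?thesis .
qed

subsection \<open>Divergence of the magnetic field\<close>

text \<open>The field \<open>dB + c curl E\<close> is itself admissible in Faraday's law, which says that it is orthogonal to itself.\<close>
lemma magnetic_field_deriv: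
  assumes t: "t \<in> I" and s: "step t w G d\<rho> dM dE dB" and K: "K \<in> T" "x \<in> K"
  shows "dB K x = - c *\<^sub>R curl (E t K) x"
proof -
  obtain g where g: "g \<in> RT0_space \<Omega> T k" "\<forall>K\<in>T. \<forall>x\<in>K. dB K x = g K x"
  proof -
    have comp: "(\<lambda>x. f K x $ i) \<in> P_poly (k + 1)" if "f \<in> RT0_space \<Omega> T k" "K \<in> T" for f K i
      using that by (intro RT_space_components) (auto simp: RT0_space_def)
    have "\<exists>g\<in>RT0_space \<Omega> T k. \<forall>K\<in>T. \<forall>x\<in>K. dB K x = g K x"
      by (rule polynomial_field_derivative[where V = "RT0_space \<Omega> T k" and d = "k + 1", OF I _ _ _ _ t accumulation[OF t] stepD(6)[OF s]])
        (erule (1) comp RT0_space_comb | erule B_RT0 | rule B_ac)+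
    then show ?thesis using that by blast
  qed
  let ?r = "\<lambda>K x. g K x + c *\<^sub>R curl (E t K) x"
  have r: "?r \<in> RT0_space \<Omega> T k" by (rule RT0_space_comb[OF g(1) curl_N0_in_RT0[OF E_N0[OF t]]])
  have rc: "continuous_on K (?r K)" if "K \<in> T" for K
    using r that by (auto simp: RT0_space_def intro: smooth_continuous RT_space_smooth)
  have cc: "continuous_on K (curl (E t K))" if "K \<in> T" for K
    using E_smooth[OF t that] by (intro smooth_continuous smooth_curl)
  have gc: "continuous_on K (g K)" if "K \<in> T" for K
    using g(1) that by (auto simp: RT0_space_def intro: smooth_continuous RT_space_smooth)
  have "mesh_integral T (\<lambda>K x. ?r K x \<bullet> ?r K x)
      = mesh_integral T (\<lambda>K x. g K x \<bullet> ?r K x + c * (?r K x \<bullet> curl (E t K) x))"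
    by (rule mesh_integral_cong) (simp add: inner_add_left inner_add_right inner_commute distrib_left)
  also have "\<dots> = mesh_integral T (\<lambda>K x. g K x \<bullet> ?r K x) + mesh_integral T (\<lambda>K x. c * (?r K x \<bullet> curl (E t K) x))"
    by (rule mesh_integral_add) (auto intro!: continuous_on_mult continuous_on_inner continuous_on_const rc cc gc)
  also have "mesh_integral T (\<lambda>K x. g K x \<bullet> ?r K x) = mesh_integral T (\<lambda>K x. dB K x \<bullet> ?r K x)"
    by (rule mesh_integral_cong) (simp add: g(2))
  also have "\<dots> = - c * mesh_integral T (\<lambda>K x. ?r K x \<bullet> curl (E t K) x)"
    by (rule bspec[OF stepD(10)[OF s, unfolded faraday_eq_def] r])
  finally have "mesh_integral T (\<lambda>K x. ?r K x \<bullet> ?r K x) = 0" by (simp add: mesh_integral_scale)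
  then have "?r K x \<bullet> ?r K x = 0"
    by (intro mesh_integral_eq_0D[where f = "\<lambda>K x. ?r K x \<bullet> ?r K x", OF _ _ _ K] continuous_on_inner rc) auto
  then have "g K x + c *\<^sub>R curl (E t K) x = 0" by simp
  then show ?thesis using g(2) K by (simp add: eq_neg_iff_add_eq_0)
qed

text \<open>Since \<open>B\<close> changes by curls, its integrals against gradients of test functions do not change; a weak
  divergence at one time is thus one at all times.\<close>
theorem magnetic_divergence: "\<exists>g. \<forall>t\<in>I. has_weak_divergence \<Omega> (broken T (B t)) g"
proof (cases "I = {}")
  case False
  then obtain t0 where t0: "t0 \<in> I" by blast
  obtain g where g: "has_weak_divergence \<Omega> (broken T (B t0)) g"
    using B_RT[OF t0] unfolding RT_space_def Hdiv_def by blast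
  have const: "(\<lambda>t. mesh_integral T (\<lambda>K x. B t K x \<bullet> grad \<psi> x)) constant_on I" if \<psi>: "\<psi> \<in> test_functions \<Omega>" for \<psi> :: "real^3 \<Rightarrow> real"
  proof (rule conserved[where C = "{}"])
    have sm: "smooth \<psi>" using \<psi> by (simp add: test_functions_iff)
    have gc: "continuous_on K (grad \<psi>)" for K by (intro smooth_continuous smooth_grad sm)
    have g\<psi>: "grad \<psi> \<in> test_functions \<Omega>" using \<psi> by (simp add: test_functions_iff smooth_grad supported_in_grad)
    show "loc_abs_continuous_on I (\<lambda>t. mesh_integral T (\<lambda>K x. B t K x \<bullet> grad \<psi> x))"
      by (rule regular_linear_ac[OF I B_regular gc])
    fix t w G d\<rho> dM dE dB assume t: "t \<in> I" and s: "step t w G d\<rho> dM dE dB"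
    have "mesh_integral T (\<lambda>K x. dB K x \<bullet> grad \<psi> x) = mesh_integral T (\<lambda>K x. - c * (curl (E t K) x \<bullet> grad \<psi> x))"
      by (rule mesh_integral_cong) (simp add: magnetic_field_deriv[OF t s])
    also have "\<dots> = - c * mesh_integral T (\<lambda>K x. curl (E t K) x \<bullet> grad \<psi> x)" by (rule mesh_integral_scale)
    also have "mesh_integral T (\<lambda>K x. curl (E t K) x \<bullet> grad \<psi> x) = mesh_integral T (\<lambda>K x. E t K x \<bullet> curl (grad \<psi>) x)"
      using E_N[OF t] by (intro Hcurl_mesh[where E = "E t", OF E_smooth[OF t] _ g\<psi>]) (auto simp: N_space_def)
    also have "\<dots> = 0" by (simp add: curl_grad[OF sm] mesh_integral_zero)
    finally have "mesh_integral T (\<lambda>K x. dB K x \<bullet> grad \<psi> x) = 0" by simp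
    then show "((\<lambda>t. mesh_integral T (\<lambda>K x. B t K x \<bullet> grad \<psi> x)) has_vector_derivative 0) (at t within I)"
      using regular_linear_deriv[OF I B_regular gc t stepD(6)[OF s]] by simp
  qed simp
  have "has_weak_divergence \<Omega> (broken T (B t)) g" if t: "t \<in> I" for t
    unfolding has_weak_divergence_def
  proof (intro conjI ballI)
    show "broken T (B t) \<in> L2 \<Omega>" by (rule broken_L2[OF mesh_continuous(4)[OF t]])
    show "g \<in> L2 \<Omega>" using g unfolding has_weak_divergence_def by blast
    fix \<psi> :: "real^3 \<Rightarrow> real" assume \<psi>: "\<psi> \<in> test_functions \<Omega>"
    have gc: "continuous_on UNIV (grad \<psi>)" using \<psi> by (intro smooth_continuous smooth_grad) (simp add: test_functions_iff)
    have I1: "(LINT x|lebesgue_on \<Omega>. broken T (B s) x \<bullet> grad \<psi> x) = mesh_integral T (\<lambda>K x. B s K x \<bullet> grad \<psi> x)" if "s \<in> I" for s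
      by (rule LINT_broken_inner(1)[OF mesh_continuous(4)[OF that] gc])
    have "(LINT x|lebesgue_on \<Omega>. g x * \<psi> x) = - (LINT x|lebesgue_on \<Omega>. broken T (B t0) x \<bullet> grad \<psi> x)"
      using g \<psi> unfolding has_weak_divergence_def by blast
    also have "\<dots> = - (LINT x|lebesgue_on \<Omega>. broken T (B t) x \<bullet> grad \<psi> x)"
      unfolding I1[OF t0] I1[OF t] constant_onD[OF const[OF \<psi>] t0 t] by (rule refl)
    finally show "(LINT x|lebesgue_on \<Omega>. g x * \<psi> x) = - (LINT x|lebesgue_on \<Omega>. broken T (B t) x \<bullet> grad \<psi> x)" .
  qed
  then show ?thesis by blast
qed simp

end

lemma is_interval_isolated_point:
  fixes I :: "real set"
  assumes I: "is_interval I" and t: "t \<in> I" "at t within I = bot"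
  shows "I = {t}"
proof (rule ccontr)
  assume "I \<noteq> {t}"
  then obtain s where s: "s \<in> I" "s \<noteq> t" using t(1) by blast
  have "connected I" using I by (simp add: is_interval_connected_1)
  then have "t islimpt I" using connected_imp_perfect[of I t] s t(1) by blast
  then show False using t(2) by (simp add: trivial_limit_within)
qed

theorem proposition3p2:
  fixes c m q :: real and N k :: nat and wt :: "nat \<Rightarrow> real"
    and \<Omega> :: "(real^3) set" and T :: "cell set" and F :: "(cell \<times> cell) set"
    and loc :: "real^3 \<Rightarrow> cell" and I :: "real set"
    and \<rho> :: "real \<Rightarrow> cell \<Rightarrow> real^3 \<Rightarrow> real"
    and M E B :: "real \<Rightarrow> cell \<Rightarrow> real^3 \<Rightarrow> real^3"
    and X U :: "nat \<Rightarrow> real \<Rightarrow> real^3"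
  assumes "c > 0" and "m > 0" and "q \<noteq> 0"
    and "conforming_mesh \<Omega> T"
    and "oriented_interior_faces T F"
    and "cell_selection T loc"
    and "is_interval I"
    and "scheme_F_solution c m q N wt \<Omega> T F k loc I \<rho> M E B X U"
  shows "(\<lambda>t. mesh_integral T (\<rho> t)) constant_on I
    \<and> (\<lambda>t. \<Sum>p\<in>{1..N}. wt p) constant_on I
    \<and> (\<lambda>t. total_energy c m N wt T (\<rho> t) (M t) (E t) (B t) (\<lambda>p. U p t)) constant_on I
    \<and> (\<forall>\<phi> \<in> Q0_space \<Omega> T (k + 1).
         (\<lambda>t. gauss_residual m q N wt \<Omega> T k loc (\<rho> t) (E t) (\<lambda>p. X p t) \<phi>) constant_on I)
    \<and> (\<exists>g. \<forall>t\<in>I. has_weak_divergence \<Omega> (broken T (B t)) g)"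
proof (cases "\<forall>t\<in>I. at t within I \<noteq> bot")
  case True
  then interpret scheme_solution \<Omega> T c m q N k wt F loc I \<rho> M E B X U
    by (intro scheme_solution.intro mesh.intro scheme_solution_axioms.intro assms) (rule bspec[OF True])
  have "(\<lambda>t. \<Sum>p\<in>{1..N}. wt p) constant_on I" by (auto simp: constant_on_def)
  then show ?thesis by (intro conjI ballI fluid_mass energy gauss_law magnetic_divergence)
next
  case False
  \<comment> \<open>On a one-point interval the equations carry no information, but a weak divergence still exists.\<close>
  then obtain t where t: "t \<in> I" "at t within I = bot" by blast
  then have I: "I = {t}" by (rule is_interval_isolated_point[OF assms(7)])
  have "B t \<in> RT0_space \<Omega> T k" using bspec[OF conjunct1[OF assms(8)[unfolded scheme_F_solution_def]] t(1)] by (elim conjE)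
  then have "\<exists>g. has_weak_divergence \<Omega> (broken T (B t)) g" unfolding RT0_space_def RT_space_def Hdiv_def by blast
  then show ?thesis unfolding I by (auto simp: constant_on_def)
qed

end
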